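(* For $n\in\mathbb Z_{>0}$ and $N\ge3$, there are exactly $L_n(N)$ scalar-equivalence classes of non-even isomonodromic families of one-integer weight $n$ with period monodromy group $C_N$ (the cyclic group of order $N$), where $L_n(N)$ is the number of scalar-equivalence classes of algebraic Lamé equations of weight $n$ with monodromy group the dihedral group $D_N$ (of order $2N$).
   Context: For a lattice $\Lambda\subset\mathbb C$ with invariants $g_2,g_3$, Weierstrass functions $\wp,\zeta,\sigma$ and $E=\mathbb C/\Lambda$, and for $p\in E\setminus E[2]$, $T\in\mathbb C$, the non-even equation is $y''=q^{(1)}_n(z;p,T)y$ with $$q_n^{(1)}=n(n+1)\wp(z)+\tfrac34(\wp(z+p)+\wp(z-p))+T(\zeta(z+p)+\zeta(z-p)-2\zeta(z))-\tfrac{\wp''(p)}{4\wp'(p)}(\zeta(z+p)-\zeta(z-p))+B,$$ $B=T^2+\frac{\wp''(p)}{2\wp'(p)}\zeta(p)-\frac12(2n^2+2n-3)\wp(p)$. A non-even isomonodromic family of weight $n$ is, for a fixed curve $E$ and a fixed $\widetilde B\in\mathbb C$, the set of all these equations with $T^2-n(n+1)\wp(p)=\widetilde B$; all its members have the same period monodromy up to conjugation. The period monodromy group is the group generated by the monodromy matrices along cycles for two generators of $\Lambda$, chosen so that $\sigma(z)/\sqrt{\sigma(z-p)\sigma(z+p)}$ is invariant under continuation. Scalar equivalence of families is the one induced by $(x,y,x_0,y_0,T)\mapsto(\lambda^2x,\lambda^3y,\lambda^2x_0,\lambda^3y_0,\lambda T)$, $\lambda\in\mathbb C^*$, where $(x,y)=(\wp(z),\wp'(z))$,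 $(x_0,y_0)=(\wp(p),\wp'(p))$; thus $(g_2,g_3,\widetilde B)\sim(\lambda^4g_2,\lambda^6g_3,\lambda^2\widetilde B)$. The algebraic Lamé equation of weight $n$ is $(4x^3-g_2x-g_3)\frac{d^2w}{dx^2}+(6x^2-\frac{g_2}2)\frac{dw}{dx}-(n(n+1)x+\widetilde B)w=0$ with $g_2^3-27g_3^2\ne0$, obtained from $w''(z)=(n(n+1)\wp(z)+\widetilde B)w$ by $x=\wp(z)$; scalar equivalence is $(g_2,g_3,\widetilde B)\sim(\lambda^4g_2,\lambda^6g_3,\lambda^2\widetilde B)$, $\lambda\in\mathbb C^*$. *)

theory Defs
  imports
    "HOL-Analysis.Analysis"
    "HOL-Library.Equipollence"
    "HOL-Algebra.Generated_Groups"
    "HOL-Algebra.Elementary_Groups"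
begin

section \<open>Lattices and Weierstrass functions\<close>

definition lattice_basis :: "complex set \<Rightarrow> complex \<Rightarrow> complex \<Rightarrow> bool" where
  "lattice_basis L \<omega>1 \<omega>2 \<longleftrightarrow>
     Im (\<omega>2 / \<omega>1) \<noteq> 0 \<and> L = {of_int a * \<omega>1 + of_int b * \<omega>2 |a b. True}"

definition is_lattice :: "complex set \<Rightarrow> bool" where
  "is_lattice L \<longleftrightarrow> (\<exists>\<omega>1 \<omega>2. lattice_basis L \<omega>1 \<omega>2)"

definition inv_g2 :: "complex set \<Rightarrow> complex" where
  "inv_g2 L = 60 * (\<Sum>\<^sub>\<infinity>\<omega>\<in>L - {0}. 1 / \<omega> ^ 4)"

definition inv_g3 :: "complex set \<Rightarrow> complex" where
  "inv_g3 L = 140 * (\<Sum>\<^sub>\<infinity>\<omega>\<in>L - {0}. 1 / \<omega> ^ 6)"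

definition wp :: "complex set \<Rightarrow> complex \<Rightarrow> complex" where
  "wp L z = 1 / z ^ 2 + (\<Sum>\<^sub>\<infinity>\<omega>\<in>L - {0}. 1 / (z - \<omega>) ^ 2 - 1 / \<omega> ^ 2)"

definition wzeta :: "complex set \<Rightarrow> complex \<Rightarrow> complex" where
  "wzeta L z = 1 / z + (\<Sum>\<^sub>\<infinity>\<omega>\<in>L - {0}. 1 / (z - \<omega>) + 1 / \<omega> + z / \<omega> ^ 2)"

text \<open>The Weierstrass product over the lattice, taken as an unordered limit over finite
  subsets, just as \<^const>\<open>infsum\<close> is for sums.\<close>

definition wsigma :: "complex set \<Rightarrow> complex \<Rightarrow> complex" where
  "wsigma L z = z * Lim (finite_subsets_at_top (L - {0}))
     (\<lambda>X. \<Prod>\<omega>\<in>X. (1 - z / \<omega>) * exp (z / \<omega> + (z / \<omega>) ^ 2 / 2))"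


section \<open>Analytic continuation and monodromy of second order linear equations\<close>

text \<open>Germs at a point are represented by functions, two of which are identified when they
  agree near the point. The family \<open>F t\<close> of germs at \<open>\<gamma> t\<close> is a continuation of \<open>f\<close> to \<open>g\<close>
  along \<open>\<gamma>\<close> if the germs at all nearby parameters come from one and the same function.\<close>

definition continues_along ::
    "(real \<Rightarrow> complex) \<Rightarrow> (complex \<Rightarrow> complex) \<Rightarrow> (complex \<Rightarrow> complex) \<Rightarrow> bool" where
  "continues_along \<gamma> f g \<longleftrightarrow>
     (\<exists>F. F 0 = f \<and> F 1 = g \<and>
       (\<forall>t\<in>{0..1}. F t analytic_on {\<gamma> t} \<and>
          (\<forall>\<^sub>F s in at t within {0..1}. \<forall>\<^sub>F z in nhds (\<gamma> s). F s z = F t z)))"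

text \<open>A path from \<open>z0\<close> to \<open>z0 + \<omega>\<close> with \<open>\<omega>\<close> in the lattice is a cycle on the torus;
  continuing \<open>f\<close> along it and translating back to \<open>z0\<close> yields \<open>h\<close>. Ordinary loops are the
  case \<open>\<omega> = 0\<close>.\<close>

definition continues_to ::
    "(real \<Rightarrow> complex) \<Rightarrow> complex \<Rightarrow> (complex \<Rightarrow> complex) \<Rightarrow> (complex \<Rightarrow> complex) \<Rightarrow> bool" where
  "continues_to \<gamma> \<omega> f h \<longleftrightarrow>
     (\<exists>g. continues_along \<gamma> f g \<and> (\<forall>\<^sub>F z in nhds (pathstart \<gamma>). h z = g (z + \<omega>)))"

definition cycle_in :: "complex set \<Rightarrow> complex \<Rightarrow> complex \<Rightarrow> (real \<Rightarrow> complex) \<Rightarrow> bool" where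
  "cycle_in U z0 \<omega> \<gamma> \<longleftrightarrow>
     path \<gamma> \<and> pathstart \<gamma> = z0 \<and> pathfinish \<gamma> = z0 + \<omega> \<and> path_image \<gamma> \<subseteq> U"

definition fundamental_system ::
    "(complex \<Rightarrow> complex) \<Rightarrow> (complex \<Rightarrow> complex) \<Rightarrow> (complex \<Rightarrow> complex) \<Rightarrow>
     complex \<Rightarrow> (2 \<Rightarrow> complex \<Rightarrow> complex) \<Rightarrow> bool" where
  "fundamental_system a b c z0 y \<longleftrightarrow>
     (\<forall>j. y j analytic_on {z0} \<and>
        (\<forall>\<^sub>F z in nhds z0. a z * (deriv ^^ 2) (y j) z + b z * deriv (y j) z + c z * y j z = 0)) \<and>
     (\<forall>k :: complex ^ 2. (\<forall>\<^sub>F z in nhds z0. (\<Sum>j\<in>UNIV. k $ j * y j z) = 0) \<longrightarrow> k = 0)"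

text \<open>Continuation turns the row vector \<open>(y 1, y 2)\<close> into \<open>(y 1, y 2) M\<close>.\<close>

definition monodromy_matrix ::
    "(real \<Rightarrow> complex) \<Rightarrow> complex \<Rightarrow> (2 \<Rightarrow> complex \<Rightarrow> complex) \<Rightarrow> complex ^ 2 ^ 2 \<Rightarrow> bool" where
  "monodromy_matrix \<gamma> \<omega> y M \<longleftrightarrow>
     (\<forall>j. continues_to \<gamma> \<omega> (y j) (\<lambda>z. \<Sum>i\<in>UNIV. y i z * M $ i $ j))"

definition GL2 :: "(complex ^ 2 ^ 2) monoid" where
  "GL2 = \<lparr>carrier = {A. invertible A}, monoid.mult = (**), one = mat 1\<rparr>"

text \<open>\<open>(a, s)\<close> stands for the symmetry \<open>x \<mapsto> a + x\<close> (for \<open>\<not> s\<close>) or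
  \<open>x \<mapsto> a - x\<close> (for \<open>s\<close>) of the integers modulo \<open>N\<close>.\<close>

definition dihedral_group :: "nat \<Rightarrow> (int \<times> bool) monoid" where
  "dihedral_group N =
     \<lparr>carrier = {0..<int N} \<times> UNIV,
      monoid.mult = (\<lambda>(a, s) (b, t). ((if s then a - b else a + b) mod int N, s \<noteq> t)),
      one = (0, False)\<rparr>"


section \<open>Non-even equations and isomonodromic families\<close>

definition noneven_potential ::
    "nat \<Rightarrow> complex set \<Rightarrow> complex \<Rightarrow> complex \<Rightarrow> complex \<Rightarrow> complex" where
  "noneven_potential n L p T z =
     of_nat (n * (n + 1)) * wp L z
     + 3 / 4 * (wp L (z + p) + wp L (z - p))
     + T * (wzeta L (z + p) + wzeta L (z - p) - 2 * wzeta L z)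
     - (deriv ^^ 2) (wp L) p / (4 * deriv (wp L) p) * (wzeta L (z + p) - wzeta L (z - p))
     + (T ^ 2
        + (deriv ^^ 2) (wp L) p / (2 * deriv (wp L) p) * wzeta L p
        - 1 / 2 * (2 * of_nat n ^ 2 + 2 * of_nat n - 3) * wp L p)"

text \<open>The complement, in the plane, of all singular points of the non-even equation.\<close>

definition noneven_domain :: "complex set \<Rightarrow> complex \<Rightarrow> complex set" where
  "noneven_domain L p = {z. z \<notin> L \<and> z - p \<notin> L \<and> z + p \<notin> L}"

text \<open>Here \<open>r\<close> is a local branch of the square root of \<open>\<sigma>(z - p) \<sigma>(z + p)\<close> at the starting
  point of \<open>\<gamma>\<close>; the condition does not depend on the choice of branch.\<close>

definition sigma_quotient_invariant ::
    "complex set \<Rightarrow> complex \<Rightarrow> (real \<Rightarrow> complex) \<Rightarrow> complex \<Rightarrow> bool" where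
  "sigma_quotient_invariant L p \<gamma> \<omega> \<longleftrightarrow>
     (\<exists>r. r analytic_on {pathstart \<gamma>} \<and>
       (\<forall>\<^sub>F z in nhds (pathstart \<gamma>). r z ^ 2 = wsigma L (z - p) * wsigma L (z + p)) \<and>
       continues_to \<gamma> \<omega> (\<lambda>z. wsigma L z / r z) (\<lambda>z. wsigma L z / r z))"

text \<open>A non-even equation (for given \<open>n\<close>) is given by its lattice, the point \<open>p\<close> (represented in
  the plane) and the parameter \<open>T\<close>.\<close>

type_synonym noneven_equation = "complex set \<times> complex \<times> complex"

text \<open>\<open>H\<close> is the period monodromy group with respect to some base point, fundamental system,
  basis of the lattice and admissible pair of cycles. Other choices give conjugate groups.\<close>

definition is_period_monodromy_group ::
    "nat \<Rightarrow> noneven_equation \<Rightarrow> (complex ^ 2 ^ 2) set \<Rightarrow> bool" where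
  "is_period_monodromy_group n e H \<longleftrightarrow> (case e of (L, p, T) \<Rightarrow>
     (\<exists>z0 y \<omega>1 \<omega>2 \<gamma>1 \<gamma>2 M1 M2.
        z0 \<in> noneven_domain L p \<and>
        fundamental_system (\<lambda>_. 1) (\<lambda>_. 0) (\<lambda>z. - noneven_potential n L p T z) z0 y \<and>
        lattice_basis L \<omega>1 \<omega>2 \<and>
        cycle_in (noneven_domain L p) z0 \<omega>1 \<gamma>1 \<and> sigma_quotient_invariant L p \<gamma>1 \<omega>1 \<and>
        cycle_in (noneven_domain L p) z0 \<omega>2 \<gamma>2 \<and> sigma_quotient_invariant L p \<gamma>2 \<omega>2 \<and>
        monodromy_matrix \<gamma>1 \<omega>1 y M1 \<and> monodromy_matrix \<gamma>2 \<omega>2 y M2 \<and>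
        H = generate GL2 {M1, M2}))"

definition noneven_family :: "nat \<Rightarrow> complex set \<Rightarrow> complex \<Rightarrow> noneven_equation set" where
  "noneven_family n L Bt =
     {(L, p, T) |p T. 2 * p \<notin> L \<and> T ^ 2 - of_nat (n * (n + 1)) * wp L p = Bt}"

definition noneven_families :: "nat \<Rightarrow> noneven_equation set set" where
  "noneven_families n = {noneven_family n L Bt |L Bt. is_lattice L}"

definition has_cyclic_period_monodromy :: "nat \<Rightarrow> nat \<Rightarrow> noneven_equation set \<Rightarrow> bool" where
  "has_cyclic_period_monodromy n N F \<longleftrightarrow>
     (\<forall>e\<in>F. \<exists>H. is_period_monodromy_group n e H \<and>
        GL2\<lparr>carrier := H\<rparr> \<cong> integer_mod_group N)"

text \<open>The algebraic form of a non-even equation: the curve \<open>y\<^sup>2 = 4 x\<^sup>3 - g2 x - g3\<close>, the point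
  \<open>(x0, y0)\<close> on it, and \<open>T\<close>. The map \<open>(x, y) \<mapsto> (\<mu>\<^sup>2 x, \<mu>\<^sup>3 y)\<close> carries the curve with
  invariants \<open>g2, g3\<close> to the one with invariants \<open>\<mu>\<^sup>4 g2, \<mu>\<^sup>6 g3\<close>.\<close>

type_synonym noneven_coords = "complex \<times> complex \<times> complex \<times> complex \<times> complex"

definition noneven_coords :: "noneven_equation \<Rightarrow> noneven_coords" where
  "noneven_coords e = (case e of (L, p, T) \<Rightarrow>
     (inv_g2 L, inv_g3 L, wp L p, deriv (wp L) p, T))"

definition scale_coords :: "complex \<Rightarrow> noneven_coords \<Rightarrow> noneven_coords" where
  "scale_coords \<mu> v = (case v of (g2, g3, x0, y0, T) \<Rightarrow>
     (\<mu> ^ 4 * g2, \<mu> ^ 6 * g3, \<mu> ^ 2 * x0, \<mu> ^ 3 * y0, \<mu> * T))"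

definition family_scalar_equiv :: "nat \<Rightarrow> (noneven_equation set \<times> noneven_equation set) set" where
  "family_scalar_equiv n =
     {(F, F'). F \<in> noneven_families n \<and> F' \<in> noneven_families n \<and>
        (\<exists>\<mu>. \<mu> \<noteq> 0 \<and> noneven_coords ` F' = scale_coords \<mu> ` noneven_coords ` F)}"

definition noneven_classes :: "nat \<Rightarrow> nat \<Rightarrow> noneven_equation set set set" where
  "noneven_classes n N =
     {F \<in> noneven_families n. has_cyclic_period_monodromy n N F} // family_scalar_equiv n"


section \<open>Algebraic Lame equations\<close>

text \<open>For fixed weight \<open>n\<close> the equation is given by the triple of its parameters
  \<open>(g2, g3, Bt)\<close>.\<close>

type_synonym lame_equation = "complex \<times> complex \<times> complex"

definition lame_equations :: "lame_equation set" where
  "lame_equations = {(g2, g3, Bt). g2 ^ 3 - 27 * g3 ^ 2 \<noteq> 0}"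

text \<open>The image of the fundamental group of the Riemann sphere without \<open>\<infinity>\<close> and the three
  roots of \<open>4 x\<^sup>3 - g2 x - g3\<close>, with respect to some base point and fundamental system.\<close>

definition is_lame_monodromy_group ::
    "nat \<Rightarrow> lame_equation \<Rightarrow> (complex ^ 2 ^ 2) set \<Rightarrow> bool" where
  "is_lame_monodromy_group n e H \<longleftrightarrow> (case e of (g2, g3, Bt) \<Rightarrow>
     (let U = {x. 4 * x ^ 3 - g2 * x - g3 \<noteq> 0} in
      \<exists>x0 w. x0 \<in> U \<and>
        fundamental_system (\<lambda>x. 4 * x ^ 3 - g2 * x - g3) (\<lambda>x. 6 * x ^ 2 - g2 / 2)
          (\<lambda>x. - (of_nat (n * (n + 1)) * x + Bt)) x0 w \<and>
        H = {M. \<exists>\<gamma>. cycle_in U x0 0 \<gamma> \<and> monodromy_matrix \<gamma> 0 w M}))"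

definition has_dihedral_monodromy :: "nat \<Rightarrow> nat \<Rightarrow> lame_equation \<Rightarrow> bool" where
  "has_dihedral_monodromy n N e \<longleftrightarrow>
     (\<exists>H. is_lame_monodromy_group n e H \<and> GL2\<lparr>carrier := H\<rparr> \<cong> dihedral_group N)"

definition lame_scalar_equiv :: "(lame_equation \<times> lame_equation) set" where
  "lame_scalar_equiv =
     {((g2, g3, Bt), (g2', g3', Bt')).
        (g2, g3, Bt) \<in> lame_equations \<and> (g2', g3', Bt') \<in> lame_equations \<and>
        (\<exists>\<mu>. \<mu> \<noteq> 0 \<and> g2' = \<mu> ^ 4 * g2 \<and> g3' = \<mu> ^ 6 * g3 \<and> Bt' = \<mu> ^ 2 * Bt)}"

definition lame_classes :: "nat \<Rightarrow> nat \<Rightarrow> lame_equation set set" where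
  "lame_classes n N =
     {e \<in> lame_equations. has_dihedral_monodromy n N e} // lame_scalar_equiv"

definition lame_count :: "nat \<Rightarrow> nat \<Rightarrow> nat" where
  "lame_count n N = card (lame_classes n N)"

end

theory Submission
  imports Defs "HOL-Complex_Analysis.Complex_Analysis"
begin

text \<open>The exponents of \<open>w'' = (n (n + 1) P + B) w\<close> (with the Weierstrass function \<open>P\<close>) at lattice points are integers and its
  potential is even, so its solutions are meromorphic in the plane and translation by the lattice
  acts on them by a commutative group \<open>A\<close> of matrices of determinant 1. If
  \<open>B = T\<^sup>2 - n (n + 1) P(p)\<close> and \<open>s = \<sigma>(z) / \<surd>(\<sigma>(z - p) \<sigma>(z + p))\<close>, then
  \<open>y = s (w' - T w)\<close> maps these solutions isomorphically to those of the non-even equation; on cycles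
  along which \<open>s\<close> is invariant it is equivariant, so that the period monodromy group is \<open>A\<close>, for every
  member of the family. On the other hand \<open>x = P(z)\<close> identifies the monodromy group of the algebraic
  equation with the group generated by \<open>A\<close> and the action \<open>S\<close> of \<open>z \<mapsto> - z\<close>. Since
  \<open>S a S = a\<^sup>-\<^sup>1\<close>, \<open>S\<^sup>2 = 1\<close> and \<open>det S = - 1\<close>, this group is dihedral of order \<open>2 N\<close> if and
  only if \<open>A\<close> is cyclic of order \<open>N\<close>. Finally every nonsingular cubic is uniformized by a lattice, so
  families and algebraic equations have the same parameters up to scaling.\<close>

section \<open>Series of holomorphic functions and lattice sums\<close>

text \<open>The definitions speak of germs continued along paths, for some base point and some
  fundamental system, while the comparison is one of matrices. Solutions defined on the whole
  complement of the lattice bridge the gap: under continuation only the factor s can then change. By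
  the product formula for sigma, s squared times P(z) - P(p) is the constant -1 / sigma(p)^2. Hence
  a cycle is admissible as soon as its image under P - P(p) winds an even number of times around 0;
  an odd number is repaired by a loop around p, where P - P(p) has a simple zero since 2p is no
  lattice point. The same relation shows that the map from w to y multiplies Wronskians by n (n + 1)
  / sigma(p)^2, which is nonzero for n > 0. Single-valuedness rests on a parity argument: the
  exponents -n and n + 1 differ by an odd number, whereas the recursion for an even potential is
  void at odd indices, so that no logarithm appears. For the uniformization, the image of the
  modular invariant is open by the open mapping theorem, and closed because bounded values confine
  reduced periods to a compact set.\<close>

lemma
  fixes f :: "'i \<Rightarrow> complex \<Rightarrow> complex"
  assumes "open S" and hol: "\<And>i. i \<in> I \<Longrightarrow> f i holomorphic_on S"
    and bd: "\<And>x. x \<in> S \<Longrightarrow> \<exists>d>0. \<exists>M. M summable_on I \<and> (\<forall>i\<in>I. \<forall>z\<in>ball x d \<inter> S. norm (f i z) \<le> M i)"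
    and "z \<in> S"
  shows infsum_has_field_derivative:
      "((\<lambda>z. \<Sum>\<^sub>\<infinity>i\<in>I. f i z) has_field_derivative (\<Sum>\<^sub>\<infinity>i\<in>I. deriv (f i) z)) (at z)"
    and summable_on_deriv: "(\<lambda>i. deriv (f i) z) summable_on I"
    and summable_on_locally_bounded: "(\<lambda>i. f i z) summable_on I"
proof -
  obtain d M where d: "d > 0" and M: "M summable_on I"
    and b: "\<And>i w. i \<in> I \<Longrightarrow> w \<in> ball z d \<inter> S \<Longrightarrow> norm (f i w) \<le> M i"
    using bd[OF \<open>z \<in> S\<close>] by blast
  have "open (ball z d \<inter> S)" "z \<in> ball z d \<inter> S"
    using \<open>open S\<close> d \<open>z \<in> S\<close> by auto
  then obtain e where e: "e > 0" "cball z e \<subseteq> ball z d \<inter> S"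
    using open_contains_cball by blast
  have ul: "uniform_limit (cball z e) (\<lambda>X w. \<Sum>i\<in>X. f i w) (\<lambda>w. \<Sum>\<^sub>\<infinity>i\<in>I. f i w) (finite_subsets_at_top I)"
    by (rule Weierstrass_m_test_general[OF _ M]) (use b e in blast)
  have ev: "\<forall>\<^sub>F X in finite_subsets_at_top I. continuous_on (cball z e) (\<lambda>w. \<Sum>i\<in>X. f i w) \<and>
      (\<forall>w\<in>ball z e. ((\<lambda>w. \<Sum>i\<in>X. f i w) has_field_derivative (\<Sum>i\<in>X. deriv (f i) w)) (at w))"
  proof (rule eventually_finite_subsets_at_top_weakI)
    fix X assume X: "finite X" "X \<subseteq> I"
    have "continuous_on (cball z e) (\<lambda>w. \<Sum>i\<in>X. f i w)"
      using X hol e by (intro continuous_on_sum)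
        (meson holomorphic_on_imp_continuous_on holomorphic_on_subset le_inf_iff subsetD)
    moreover have "((\<lambda>w. \<Sum>i\<in>X. f i w) has_field_derivative (\<Sum>i\<in>X. deriv (f i) w)) (at w)" if "w \<in> ball z e" for w
    proof (rule DERIV_sum)
      fix i assume "i \<in> X"
      then show "(f i has_field_derivative deriv (f i) w) (at w)"
        using X hol[of i] that e \<open>open S\<close>
        by (intro holomorphic_derivI[of _ S]) (auto dest!: subsetD)
    qed
    ultimately show "continuous_on (cball z e) (\<lambda>w. \<Sum>i\<in>X. f i w) \<and>
      (\<forall>w\<in>ball z e. ((\<lambda>w. \<Sum>i\<in>X. f i w) has_field_derivative (\<Sum>i\<in>X. deriv (f i) w)) (at w))" by blast
  qed
  \<comment> \<open>The limit theorem applies to the filter of finite subsets, so that convergence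
    of the differentiated partial sums is literally summability.\<close>
  obtain g' where g': "\<And>w. w \<in> ball z e \<Longrightarrow> ((\<lambda>w. \<Sum>\<^sub>\<infinity>i\<in>I. f i w) has_field_derivative (g' w)) (at w) \<and>
       ((\<lambda>X. \<Sum>i\<in>X. deriv (f i) w) \<longlongrightarrow> g' w) (finite_subsets_at_top I)"
    using has_complex_derivative_uniform_limit[OF ev ul _ e(1)] by auto
  have "z \<in> ball z e" using e by auto
  then have hs: "((\<lambda>i. deriv (f i) z) has_sum g' z) I"
    using g' unfolding has_sum_def by blast
  then show "(\<lambda>i. deriv (f i) z) summable_on I"
    by (rule has_sum_imp_summable)
  show "((\<lambda>z. \<Sum>\<^sub>\<infinity>i\<in>I. f i z) has_field_derivative (\<Sum>\<^sub>\<infinity>i\<in>I. deriv (f i) z)) (at z)"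
    using g'[OF \<open>z \<in> ball z e\<close>] infsumI[OF hs] by simp
  have "(\<lambda>i. norm (f i z)) summable_on I"
    by (rule summable_on_comparison_test[OF M]) (use b \<open>z \<in> S\<close> d in auto)
  then show "(\<lambda>i. f i z) summable_on I"
    by (rule abs_summable_summable)
qed

text \<open>The imaginary part controls \<open>b\<close>, and then the triangle inequality controls
  \<open>a\<close>. The constant is explicit because it must later be uniform for
  \<open>\<tau>\<close> near a point and near the cusp.\<close>

lemma abs_coords_le:
  fixes a b :: real and \<tau> :: complex
  assumes "Im \<tau> \<noteq> 0"
  shows "\<bar>a\<bar> + \<bar>b\<bar> \<le> (1 + (1 + norm \<tau>) / \<bar>Im \<tau>\<bar>) * norm (of_real a + of_real b * \<tau>)"
proof -
  let ?w = "of_real a + of_real b * \<tau>"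
  have "\<bar>b\<bar> * \<bar>Im \<tau>\<bar> = \<bar>Im ?w\<bar>" by (simp add: abs_mult)
  also have "\<dots> \<le> norm ?w" by (rule abs_Im_le_cmod)
  finally have b: "\<bar>b\<bar> \<le> norm ?w / \<bar>Im \<tau>\<bar>"
    using assms by (simp add: field_simps)
  have "norm (of_real a :: complex) \<le> norm ?w + norm (of_real b * \<tau>)"
    using norm_triangle_ineq4[of ?w "of_real b * \<tau>"] by simp
  then have "\<bar>a\<bar> \<le> norm ?w + \<bar>b\<bar> * norm \<tau>" by (simp add: norm_mult)
  also have "\<dots> \<le> norm ?w + norm ?w / \<bar>Im \<tau>\<bar> * norm \<tau>"
    using b by (intro add_left_mono mult_right_mono) auto
  finally show ?thesis using b by (simp add: field_simps add_divide_distrib)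
qed

text \<open>The exponent is half of the cube needed in dimension two: up to a constant, a product of
  two such terms majorizes the inverse cube of the sum of the coordinates.\<close>

lemma summable_on_int_powr: "(\<lambda>a::int. (1 + real_of_int \<bar>a\<bar>) powr (-3/2)) summable_on UNIV"
proof -
  have nat: "(\<lambda>k::nat. (1 + real k) powr (-3/2)) summable_on UNIV"
  proof -
    have "summable (\<lambda>k::nat. real k powr (-3/2))" by (simp add: summable_real_powr_iff)
    then have "summable (\<lambda>k::nat. real (Suc k) powr (-3/2))"
      by (subst summable_Suc_iff)
    then show ?thesis by (subst summable_on_UNIV_nonneg_real_iff) (auto simp: add_ac)
  qed
  have r1: "(\<lambda>a::int. (1 + real_of_int \<bar>a\<bar>) powr (-3/2)) summable_on range int"
    by (subst summable_on_reindex) (use nat in \<open>auto simp: o_def inj_def\<close>)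
  have r2: "(\<lambda>a::int. (1 + real_of_int \<bar>a\<bar>) powr (-3/2)) summable_on range (\<lambda>k. - int k)"
    by (subst summable_on_reindex) (use nat in \<open>auto simp: o_def inj_def\<close>)
  have "range int \<union> range (\<lambda>k. - int k) = UNIV"
    by (auto simp: image_iff) (metis int_cases2)
  then show ?thesis using summable_on_union[OF r1 r2] by simp
qed

lemma summable_on_int_pair:
  "(\<lambda>(a,b). 1 / real_of_int (\<bar>a\<bar> + \<bar>b\<bar>) ^ 3) summable_on (UNIV :: (int \<times> int) set)"
proof -
  let ?h = "\<lambda>a::int. (1 + real_of_int \<bar>a\<bar>) powr (-3/2)"
  have "(\<lambda>(a,b). ?h a * ?h b) summable_on (UNIV \<times> UNIV)"
    using summable_on_int_powr
    by (intro summable_on_SigmaI[where g = "\<lambda>a. ?h a * infsum ?h UNIV"])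
      (auto intro!: has_sum_cmult_right summable_on_cmult_left simp: mult.commute[of _ "infsum ?h UNIV"])
  then have s: "(\<lambda>p. 27/8 * (case p of (a,b) \<Rightarrow> ?h a * ?h b)) summable_on UNIV"
    by (intro summable_on_cmult_right) (simp add: case_prod_unfold)
  show ?thesis
  proof (rule summable_on_comparison_test[OF s])
    fix p :: "int \<times> int"
    obtain a b where p: "p = (a, b)" by (cases p)
    define s where "s = real_of_int (\<bar>a\<bar> + \<bar>b\<bar>)"
    show "(case p of (a, b) \<Rightarrow> 1 / real_of_int (\<bar>a\<bar> + \<bar>b\<bar>) ^ 3) \<le> 27/8 * (case p of (a, b) \<Rightarrow> ?h a * ?h b)"
    proof (cases "s = 0")
      case True
      then have "\<bar>a\<bar> + \<bar>b\<bar> = 0" unfolding s_def by (simp only: of_int_eq_0_iff)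
      then have "a = 0" "b = 0" by presburger+
      then show ?thesis by (auto simp: p)
    next
      case False
      then have s1: "s \<ge> 1" unfolding s_def by (smt (verit) of_int_1_le_iff of_int_0 abs_ge_zero)
      define A B where "A = 1 + real_of_int \<bar>a\<bar>" and "B = 1 + real_of_int \<bar>b\<bar>"
      have AB: "A \<ge> 1" "B \<ge> 1" "A + B = 2 + s" by (auto simp: A_def B_def s_def)
      \<comment> \<open>Arithmetic-geometric mean. Then \<open>2 + s \<le> 3 * s\<close> by
        \<open>s1\<close>, which makes the constant \<open>(3/2) ^ 3 = 27/8\<close>. The origin,
        where the term is \<open>1 / 0 = 0\<close>, was set apart before.\<close>
      have "A * B \<le> ((A + B) / 2)\<^sup>2"
        using sum_squares_ge_zero[of "A - B" 0] by (simp add: power2_eq_square field_simps)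
      also have "\<dots> \<le> (3/2 * s)\<^sup>2" using AB s1 by (intro power_mono) auto
      finally have "(A * B) powr (3/2) \<le> ((3/2 * s)\<^sup>2) powr (3/2)"
        using AB by (intro powr_mono2) auto
      also have "\<dots> = (3/2 * s) ^ 3"
        using s1 by (simp add: powr_powr powr_realpow flip: powr_numeral)
      finally have le: "(A * B) powr (3/2) \<le> 27/8 * s ^ 3" by (simp add: power3_eq_cube)
      have pos: "(A * B) powr (3/2) > 0" using AB by auto
      have "1 / s ^ 3 = 27/8 * (1 / (27/8 * s ^ 3))" using s1 by simp
      also have "\<dots> \<le> 27/8 * (1 / (A * B) powr (3/2))"
        using le pos by (intro mult_left_mono divide_left_mono) (auto intro!: mult_pos_pos simp: s1 less_le_trans[OF _ s1])
      also have "1 / (A * B) powr (3/2) = A powr (-3/2) * B powr (-3/2)"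
        using AB by (simp add: powr_mult powr_minus field_simps)
      finally show ?thesis by (simp add: p s_def A_def B_def)
    qed
  qed (auto split: prod.splits)
qed

section \<open>Geometry of a lattice and convergence of lattice sums\<close>

locale lattice =
  fixes L :: "complex set" and \<omega>\<^sub>1 \<omega>\<^sub>2 :: complex
  assumes basis: "lattice_basis L \<omega>\<^sub>1 \<omega>\<^sub>2"
begin

definition lat :: "int \<Rightarrow> int \<Rightarrow> complex" where
  "lat a b = of_int a * \<omega>\<^sub>1 + of_int b * \<omega>\<^sub>2"

lemma Im_ratio: "Im (\<omega>\<^sub>2 / \<omega>\<^sub>1) \<noteq> 0" and w1_nz: "\<omega>\<^sub>1 \<noteq> 0" and w2_nz: "\<omega>\<^sub>2 \<noteq> 0"
  using basis by (auto simp: lattice_basis_def)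

lemma L_eq: "L = range (\<lambda>(a, b). lat a b)"
  using basis by (auto simp: lattice_basis_def lat_def)

lemma lat_in [simp, intro]: "lat a b \<in> L" by (auto simp: L_eq)

lemma L_cases: assumes "w \<in> L" obtains a b where "w = lat a b"
  using assms by (auto simp: L_eq)

lemma zero_in [simp, intro]: "0 \<in> L" using lat_in[of 0 0] by (simp add: lat_def)

lemma w1_in [simp, intro]: "\<omega>\<^sub>1 \<in> L" using lat_in[of 1 0] by (simp add: lat_def)

lemma w2_in [simp, intro]: "\<omega>\<^sub>2 \<in> L" using lat_in[of 0 1] by (simp add: lat_def)

lemma lat_add: "lat a b + lat c d = lat (a + c) (b + d)"
  and lat_minus: "- lat a b = lat (- a) (- b)"
  by (auto simp: lat_def algebra_simps)

lemma add_in [intro]: "x \<in> L \<Longrightarrow> y \<in> L \<Longrightarrow> x + y \<in> L"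
  by (metis L_cases lat_add lat_in)

lemma uminus_in [simp]: "- x \<in> L \<longleftrightarrow> x \<in> L"
  by (metis L_cases lat_minus lat_in minus_minus)

lemma diff_in [intro]: "x \<in> L \<Longrightarrow> y \<in> L \<Longrightarrow> x - y \<in> L"
  using add_in[of x "- y"] by simp

lemma add_in_iff [simp]: "y \<in> L \<Longrightarrow> x + y \<in> L \<longleftrightarrow> x \<in> L"
  and add_in_iff2 [simp]: "y \<in> L \<Longrightarrow> y + x \<in> L \<longleftrightarrow> x \<in> L"
  and diff_in_iff [simp]: "y \<in> L \<Longrightarrow> x - y \<in> L \<longleftrightarrow> x \<in> L"
  and diff_in_iff2 [simp]: "y \<in> L \<Longrightarrow> y - x \<in> L \<longleftrightarrow> x \<in> L"
  by (metis add_in diff_in add_diff_cancel add_diff_cancel_left' diff_add_cancel uminus_in minus_diff_eq)+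

text \<open>The constant of \<open>abs_coords_le\<close> for the ratio of the periods, rescaled by
  \<open>norm \<omega>\<^sub>1\<close>. Being a lower bound for the distance of two lattice points,
  it also serves as radius of balls that contain a single lattice point.\<close>

definition cL :: real where
  "cL = norm \<omega>\<^sub>1 / (1 + (1 + norm (\<omega>\<^sub>2 / \<omega>\<^sub>1)) / \<bar>Im (\<omega>\<^sub>2 / \<omega>\<^sub>1)\<bar>)"

lemma cL_pos: "cL > 0"
  unfolding cL_def using w1_nz by (intro divide_pos_pos add_pos_nonneg) auto

lemma norm_coords_ge:
  "norm (of_real a * \<omega>\<^sub>1 + of_real b * \<omega>\<^sub>2) \<ge> cL * (\<bar>a\<bar> + \<bar>b\<bar>)"
proof -
  let ?t = "\<omega>\<^sub>2 / \<omega>\<^sub>1"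
  let ?K = "1 + (1 + norm ?t) / \<bar>Im ?t\<bar>"
  have K: "?K > 0" by (intro add_pos_nonneg) auto
  have eq: "of_real a * \<omega>\<^sub>1 + of_real b * \<omega>\<^sub>2 = \<omega>\<^sub>1 * (of_real a + of_real b * ?t)"
    using w1_nz by (simp add: field_simps)
  have "cL * (\<bar>a\<bar> + \<bar>b\<bar>) \<le> cL * (?K * norm (of_real a + of_real b * ?t))"
    using abs_coords_le[OF Im_ratio, of a b] cL_pos by (intro mult_left_mono) auto
  also have "\<dots> = norm (of_real a * \<omega>\<^sub>1 + of_real b * \<omega>\<^sub>2)"
    unfolding eq norm_mult cL_def using K by simp
  finally show ?thesis .
qed

lemma norm_lat_ge: "norm (lat a b) \<ge> cL * real_of_int (\<bar>a\<bar> + \<bar>b\<bar>)"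
  using norm_coords_ge[of "of_int a" "of_int b"] by (simp add: lat_def)

lemma coords_unique:
  assumes "of_real a * \<omega>\<^sub>1 + of_real b * \<omega>\<^sub>2 = of_real c * \<omega>\<^sub>1 + of_real d * \<omega>\<^sub>2"
  shows "a = c" "b = d"
proof -
  have "of_real (a - c) * \<omega>\<^sub>1 + of_real (b - d) * \<omega>\<^sub>2 = 0"
    using assms by (simp add: algebra_simps)
  then have "cL * (\<bar>a - c\<bar> + \<bar>b - d\<bar>) \<le> 0" using norm_coords_ge[of "a - c" "b - d"] by simp
  then have "\<bar>a - c\<bar> + \<bar>b - d\<bar> \<le> 0" using cL_pos by (simp add: mult_le_0_iff)
  then show "a = c" "b = d" by auto
qed

lemma lat_eq_iff [simp]: "lat a b = lat c d \<longleftrightarrow> a = c \<and> b = d"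
  using coords_unique[of "of_int a" "of_int b" "of_int c" "of_int d"] by (auto simp: lat_def)

lemma inj_lat: "inj (\<lambda>(a, b). lat a b)"
  by (auto simp: inj_def)

lemma coords_exist: "\<exists>a b. z = of_real a * \<omega>\<^sub>1 + of_real b * \<omega>\<^sub>2"
proof -
  let ?t = "\<omega>\<^sub>2 / \<omega>\<^sub>1"
  define b where "b = Im (z / \<omega>\<^sub>1) / Im ?t"
  define a where "a = Re (z / \<omega>\<^sub>1) - b * Re ?t"
  have "Re (z / \<omega>\<^sub>1) = Re (of_real a + of_real b * ?t)" "Im (z / \<omega>\<^sub>1) = Im (of_real a + of_real b * ?t)"
    unfolding a_def b_def using Im_ratio
    by (simp_all only: plus_complex.sel times_complex.sel Re_complex_of_real Im_complex_of_real) auto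
  then have "z / \<omega>\<^sub>1 = of_real a + of_real b * ?t"
    by (intro complex_eqI)
  then have "z = of_real a * \<omega>\<^sub>1 + of_real b * \<omega>\<^sub>2"
    using w1_nz by (simp add: field_simps)
  then show ?thesis by blast
qed

lemma coords_reduce:
  obtains a b w where "w \<in> L" "z = w + (of_real a * \<omega>\<^sub>1 + of_real b * \<omega>\<^sub>2)" "a \<in> {0..1}" "b \<in> {0..1}"
proof -
  obtain a b where z: "z = of_real a * \<omega>\<^sub>1 + of_real b * \<omega>\<^sub>2" using coords_exist by blast
  show ?thesis
  proof (rule that[of "lat \<lfloor>a\<rfloor> \<lfloor>b\<rfloor>" "frac a" "frac b"])
    show "z = lat \<lfloor>a\<rfloor> \<lfloor>b\<rfloor> + (of_real (frac a) * \<omega>\<^sub>1 + of_real (frac b) * \<omega>\<^sub>2)"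
      by (simp add: z lat_def frac_def algebra_simps)
  qed (auto simp: frac_ge_0 less_imp_le[OF frac_lt_1])
qed

lemma finite_lattice_ball: "finite {w \<in> L. norm w \<le> R}"
proof -
  define m where "m = \<lceil>R / cL\<rceil>"
  have "{w \<in> L. norm w \<le> R} \<subseteq> (\<lambda>(a,b). lat a b) ` ({-m..m} \<times> {-m..m})"
  proof
    fix w assume w: "w \<in> {w \<in> L. norm w \<le> R}"
    then obtain a b where ab: "w = lat a b" by (auto elim: L_cases)
    have "cL * real_of_int (\<bar>a\<bar> + \<bar>b\<bar>) \<le> R" using norm_lat_ge[of a b] w ab by simp
    then have "real_of_int (\<bar>a\<bar> + \<bar>b\<bar>) \<le> R / cL" using cL_pos by (simp add: field_simps)
    also have "\<dots> \<le> of_int m" by (simp add: m_def)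
    finally have "\<bar>a\<bar> + \<bar>b\<bar> \<le> m" by (simp only: of_int_le_iff)
    then show "w \<in> (\<lambda>(a,b). lat a b) ` ({-m..m} \<times> {-m..m})"
      by (auto simp: ab intro!: image_eqI[of _ _ "(a,b)"])
  qed
  then show ?thesis by (rule finite_subset) auto
qed

lemma countable_L: "countable L" by (simp add: L_eq)

lemma cL_le_norm: "w \<in> L \<Longrightarrow> w \<noteq> 0 \<Longrightarrow> cL \<le> norm w"
proof -
  assume w: "w \<in> L" "w \<noteq> 0"
  then obtain a b where ab: "w = lat a b" by (auto elim: L_cases)
  with w have "a \<noteq> 0 \<or> b \<noteq> 0" by (auto simp: lat_def)
  then have "1 \<le> \<bar>a\<bar> + \<bar>b\<bar>" by auto
  then have "cL * 1 \<le> cL * real_of_int (\<bar>a\<bar> + \<bar>b\<bar>)" using cL_pos by (intro mult_left_mono) auto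
  with norm_lat_ge[of a b] ab show ?thesis by simp
qed

lemma lattice_dist: "x \<in> L \<Longrightarrow> y \<in> L \<Longrightarrow> dist x y < cL \<Longrightarrow> x = y"
  using cL_le_norm[of "x - y"] by (auto simp: dist_norm)

lemma closed_subset_L: assumes "X \<subseteq> L" shows "closed X"
proof (rule discrete_imp_closed[of cL])
  show "\<forall>x\<in>X. \<forall>y\<in>X. dist y x < cL \<longrightarrow> y = x" using assms lattice_dist by blast
qed (rule cL_pos)

lemma closed_L: "closed L" by (rule closed_subset_L) simp

lemma open_compl_L: "open (- L)" using closed_L by (simp add: open_Compl)

lemma isolated_L: "w \<in> L \<Longrightarrow> ball w cL \<inter> L = {w}"
  using lattice_dist cL_pos by (auto simp: dist_commute)

lemma connected_open_diff_L: "open S \<Longrightarrow> connected S \<Longrightarrow> connected (S - L)"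
  using connected_open_diff_countable[OF _ _ _ countable_L, of S] by (simp)

lemma connected_compl_L: "connected (- L)"
  using connected_open_diff_L[of UNIV] connected_UNIV by (simp add: Compl_eq_Diff_UNIV)

lemma summable_lattice_cube: "(\<lambda>w. 1 / norm w ^ 3) summable_on L"
proof -
  have "(\<lambda>p. 1 / cL ^ 3 * (case p of (a,b) \<Rightarrow> 1 / real_of_int (\<bar>a\<bar> + \<bar>b\<bar>) ^ 3)) summable_on UNIV"
    by (intro summable_on_cmult_right summable_on_int_pair)
  then have "(\<lambda>p. 1 / norm (case p of (a,b) \<Rightarrow> lat a b) ^ 3) summable_on UNIV"
  proof (rule summable_on_comparison_test)
    fix p :: "int \<times> int"
    obtain a b where p: "p = (a, b)" by (cases p)
    show "1 / norm (case p of (a,b) \<Rightarrow> lat a b) ^ 3 \<le> 1 / cL ^ 3 * (case p of (a,b) \<Rightarrow> 1 / real_of_int (\<bar>a\<bar> + \<bar>b\<bar>) ^ 3)"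
    proof (cases "p = (0, 0)")
      case False
      then have "1 \<le> \<bar>a\<bar> + \<bar>b\<bar>" using p by auto
      then have pos: "cL * real_of_int (\<bar>a\<bar> + \<bar>b\<bar>) > 0" using cL_pos by (intro mult_pos_pos) auto
      have "1 / norm (lat a b) ^ 3 \<le> 1 / (cL * real_of_int (\<bar>a\<bar> + \<bar>b\<bar>)) ^ 3"
        using pos norm_lat_ge[of a b] less_le_trans[OF pos norm_lat_ge[of a b]]
        by (intro divide_left_mono power_mono mult_pos_pos[OF zero_less_power zero_less_power]) auto
      then show ?thesis by (simp add: p power_mult_distrib)
    qed (auto simp: lat_def)
  qed auto
  then show ?thesis
    unfolding L_eq by (subst summable_on_reindex[OF inj_lat]) (simp add: o_def)
qed

text \<open>The majorant hypothesis only has to be checked far away from the origin: the finitely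
  many remaining terms are bounded on compact sets.\<close>

lemma
  fixes f :: "complex \<Rightarrow> complex \<Rightarrow> complex"
  assumes "open S" "I \<subseteq> L" and hol: "\<And>w. w \<in> I \<Longrightarrow> f w holomorphic_on S"
    and bd: "\<And>R. \<exists>K R'. \<forall>w\<in>I. R' \<le> norm w \<longrightarrow> (\<forall>z. norm z \<le> R \<longrightarrow> norm (f w z) \<le> K / norm w ^ 3)"
    and "z \<in> S"
  shows lattice_infsum_has_field_derivative:
      "((\<lambda>z. \<Sum>\<^sub>\<infinity>w\<in>I. f w z) has_field_derivative (\<Sum>\<^sub>\<infinity>w\<in>I. deriv (f w) z)) (at z)"
    and lattice_summable_on_deriv: "(\<lambda>w. deriv (f w) z) summable_on I"
    and lattice_summable_on: "(\<lambda>w. f w z) summable_on I"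
proof -
  have *: "\<exists>d>0. \<exists>M. M summable_on I \<and> (\<forall>w\<in>I. \<forall>z\<in>ball x d \<inter> S. norm (f w z) \<le> M w)" if "x \<in> S" for x
  proof -
    obtain d where d: "d > 0" "cball x d \<subseteq> S"
      using \<open>open S\<close> \<open>x \<in> S\<close> open_contains_cball by blast
    obtain K R' where K: "\<And>w z. w \<in> I \<Longrightarrow> R' \<le> norm w \<Longrightarrow> norm z \<le> norm x + d \<Longrightarrow> norm (f w z) \<le> K / norm w ^ 3"
      using bd[of "norm x + d"] by blast
    have "\<exists>B. \<forall>z\<in>cball x d. norm (f w z) \<le> B" if "w \<in> I" for w
    proof -
      have "compact (f w ` cball x d)"
        using hol[OF that] d by (intro compact_continuous_image)
          (auto intro!: holomorphic_on_imp_continuous_on elim: holomorphic_on_subset)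
      then show ?thesis using compact_imp_bounded by (fastforce simp: bounded_iff)
    qed
    then obtain B where B: "\<And>w z. w \<in> I \<Longrightarrow> z \<in> cball x d \<Longrightarrow> norm (f w z) \<le> B w" by metis
    define F where "F = {w \<in> I. \<not> R' \<le> norm w}"
    have "finite F" using \<open>I \<subseteq> L\<close> by (intro finite_subset[OF _ finite_lattice_ball[of R']]) (auto simp: F_def)
    define M where "M w = (if w \<in> F then B w else K / norm w ^ 3)" for w
    have "M summable_on (F \<union> (I - F))"
    proof (rule summable_on_union)
      show "M summable_on F" using \<open>finite F\<close> by simp
      have "(\<lambda>w. K * (1 / norm w ^ 3)) summable_on (I - F)"
        by (intro summable_on_cmult_right summable_on_subset_banach[OF summable_lattice_cube]) (use \<open>I \<subseteq> L\<close> in auto)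
      then show "M summable_on (I - F)"
        by (rule summable_on_cong[THEN iffD1, rotated]) (auto simp: M_def)
    qed
    moreover have "F \<union> (I - F) = I" by (auto simp: F_def)
    moreover have "norm (f w z) \<le> M w" if "w \<in> I" "z \<in> ball x d \<inter> S" for w z
    proof -
      have "norm z \<le> norm x + d"
        using that(2) norm_triangle_ineq[of x "z - x"] by (auto simp: dist_norm norm_minus_commute)
      then show ?thesis using that K[of w z] B[of w z] by (auto simp: M_def F_def)
    qed
    ultimately show ?thesis using d(1) by (intro exI[of _ d] conjI exI[of _ M]) auto
  qed
  show "((\<lambda>z. \<Sum>\<^sub>\<infinity>w\<in>I. f w z) has_field_derivative (\<Sum>\<^sub>\<infinity>w\<in>I. deriv (f w) z)) (at z)"
    by (rule infsum_has_field_derivative[OF \<open>open S\<close> hol * \<open>z \<in> S\<close>])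
  show "(\<lambda>w. deriv (f w) z) summable_on I"
    by (rule summable_on_deriv[OF \<open>open S\<close> hol * \<open>z \<in> S\<close>])
  show "(\<lambda>w. f w z) summable_on I"
    by (rule summable_on_locally_bounded[OF \<open>open S\<close> hol * \<open>z \<in> S\<close>])
qed

lemma summable_lattice_power: "k \<ge> 3 \<Longrightarrow> (\<lambda>w. 1 / norm w ^ k) summable_on L"
proof -
  assume k: "k \<ge> 3"
  have "(\<lambda>w. 1 / cL ^ (k - 3) * (1 / norm w ^ 3)) summable_on L"
    by (intro summable_on_cmult_right summable_lattice_cube)
  then show ?thesis
  proof (rule summable_on_comparison_test)
    fix w assume "w \<in> L"
    show "1 / norm w ^ k \<le> 1 / cL ^ (k - 3) * (1 / norm w ^ 3)"
    proof (cases "w = 0")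
      case False
      have "norm w ^ k = norm w ^ (k - 3) * norm w ^ 3" using k by (simp flip: power_add)
      moreover have "cL ^ (k - 3) \<le> norm w ^ (k - 3)"
        using cL_le_norm[OF \<open>w \<in> L\<close> False] cL_pos by (intro power_mono) auto
      ultimately show ?thesis using cL_pos False
        by (simp add: divide_simps)
    qed (use k in \<open>auto simp: power_0_left\<close>)
  qed auto
qed

lemma summable_lattice_power_complex: "k \<ge> 3 \<Longrightarrow> (\<lambda>w. 1 / w ^ k) summable_on L"
  by (rule abs_summable_summable) (use summable_lattice_power in \<open>simp add: norm_divide norm_power\<close>)

end

section \<open>Weierstrass functions\<close>

context lattice
begin

text \<open>The term \<open>2 * R\<close> makes \<open>w\<close> dominate \<open>z\<close> by a
  factor 2, and the summand 1 keeps \<open>w\<close> away from 0 even for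
  \<open>R = 0\<close>.\<close>

lemma far_bounds:
  fixes z w :: complex
  assumes "norm z \<le> R" "2 * R + 1 \<le> norm w"
  shows "w \<noteq> 0" "z \<noteq> w" "norm w / 2 \<le> norm (z - w)" "norm w \<ge> 1" "norm z \<le> norm w / 2"
proof -
  have "0 \<le> R" using assms(1) norm_ge_zero order_trans by blast
  then show n: "norm w \<ge> 1" "norm z \<le> norm w / 2" using assms by auto
  then show "w \<noteq> 0" by auto
  have "norm w \<le> norm (z - w) + norm z" using norm_triangle_ineq4[of z "z - w"] by simp
  then show "norm w / 2 \<le> norm (z - w)" using n by simp
  then show "z \<noteq> w" using n by auto
qed

lemma inv_pow_far_bound:
  fixes z w :: complex
  assumes "norm z \<le> R" "2 * R + 1 \<le> norm w"
  shows "1 / norm (z - w) ^ k \<le> 2 ^ k / norm w ^ k"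
proof -
  note b = far_bounds[OF assms]
  have "1 / norm (z - w) ^ k = (1 / norm (z - w)) ^ k" by (simp add: power_divide)
  also have "\<dots> \<le> (2 / norm w) ^ k"
  proof (rule power_mono)
    have "norm w > 0" "norm (z - w) > 0" using b by auto
    then show "1 / norm (z - w) \<le> 2 / norm w" using b by (simp add: field_simps)
  qed auto
  finally show ?thesis by (simp add: power_divide)
qed

definition L0 :: "complex set" where "L0 = L - {0}"

lemma open_compl_L0: "open (- L0)"
  using closed_subset_L[of L0] by (intro open_Compl) (auto simp: L0_def)

lemma L0_sub: "L0 \<subseteq> L" by (auto simp: L0_def)

lemma ball_cL_sub: "ball 0 cL \<subseteq> - L0"
  using isolated_L[of 0] by (auto simp: L0_def)

lemma ball_cL_sub': "ball 0 cL - {0} \<subseteq> - L"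
  using isolated_L[of 0] by auto

definition wpt :: "complex \<Rightarrow> complex \<Rightarrow> complex" where "wpt w z = 1 / (z - w)\<^sup>2 - 1 / w\<^sup>2"
definition zetat :: "complex \<Rightarrow> complex \<Rightarrow> complex" where "zetat w z = 1 / (z - w) + 1 / w + z / w\<^sup>2"

lemma wpt_bound: "\<exists>K R'. \<forall>w\<in>I. R' \<le> norm w \<longrightarrow> (\<forall>z. norm z \<le> R \<longrightarrow> norm (wpt w z) \<le> K / norm w ^ 3)"
proof (rule exI[of _ "10 * \<bar>R\<bar>"], rule exI[of _ "2 * \<bar>R\<bar> + 1"], safe)
  fix w z :: complex assume w: "2 * \<bar>R\<bar> + 1 \<le> norm w" and z: "norm z \<le> R"
  then have z': "norm z \<le> \<bar>R\<bar>" by auto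
  note b = far_bounds[OF z' w]
  \<comment> \<open>Over the common denominator the leading terms cancel. This gains one power of
    \<open>w\<close>, just enough for the summable cube.\<close>
  have "wpt w z = z * (2 * w - z) * (1 / (z - w)\<^sup>2) * (1 / w\<^sup>2)"
    using b by (simp add: wpt_def divide_simps) (simp add: power2_eq_square algebra_simps)
  then have "norm (wpt w z) = norm z * norm (2 * w - z) * (1 / norm (z - w) ^ 2) * (1 / norm w ^ 2)"
    by (simp only: norm_mult norm_divide norm_power norm_one)
  also have "\<dots> \<le> \<bar>R\<bar> * (5/2 * norm w) * (2 ^ 2 / norm w ^ 2) * (1 / norm w ^ 2)"
  proof (intro mult_mono inv_pow_far_bound[OF z' w] z' mult_nonneg_nonneg)
    have "norm (2 * w - z) \<le> 2 * norm w + norm z" using norm_triangle_ineq4[of "2*w" z] by (simp add: norm_mult)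
    then show "norm (2 * w - z) \<le> 5/2 * norm w" using b by auto
  qed auto
  also have "\<dots> = 10 * \<bar>R\<bar> / norm w ^ 3" using b by (simp add: power2_eq_square power3_eq_cube field_simps)
  finally show "norm (wpt w z) \<le> 10 * \<bar>R\<bar> / norm w ^ 3" .
qed

lemma zetat_bound: "\<exists>K R'. \<forall>w\<in>I. R' \<le> norm w \<longrightarrow> (\<forall>z. norm z \<le> R \<longrightarrow> norm (zetat w z) \<le> K / norm w ^ 3)"
proof (rule exI[of _ "2 * \<bar>R\<bar>^2"], rule exI[of _ "2 * \<bar>R\<bar> + 1"], safe)
  fix w z :: complex assume w: "2 * \<bar>R\<bar> + 1 \<le> norm w" and z: "norm z \<le> R"
  then have z': "norm z \<le> \<bar>R\<bar>" by auto
  note b = far_bounds[OF z' w]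
  have "zetat w z = z ^ 2 * (1 / (z - w) ^ 1) * (1 / w\<^sup>2)"
    using b by (simp add: zetat_def divide_simps) (simp add: power2_eq_square algebra_simps)
  then have "norm (zetat w z) = norm z ^ 2 * (1 / norm (z - w) ^ 1) * (1 / norm w ^ 2)"
    by (simp only: norm_mult norm_divide norm_power norm_one)
  also have "\<dots> \<le> \<bar>R\<bar> ^ 2 * (2 ^ 1 / norm w ^ 1) * (1 / norm w ^ 2)"
    by (intro mult_mono inv_pow_far_bound[OF z' w] power_mono z' mult_nonneg_nonneg) auto
  also have "\<dots> = 2 * \<bar>R\<bar> ^ 2 / norm w ^ 3" using b by (simp add: power2_eq_square power3_eq_cube field_simps)
  finally show "norm (zetat w z) \<le> 2 * \<bar>R\<bar> ^ 2 / norm w ^ 3" .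
qed

lemma inv_cube_bound:
  "\<exists>K R'. \<forall>w\<in>I. R' \<le> norm w \<longrightarrow> (\<forall>z::complex. norm z \<le> R \<longrightarrow> norm (- 2 / (z - w) ^ 3) \<le> K / norm w ^ 3)"
proof (rule exI[of _ "16"], rule exI[of _ "2 * \<bar>R\<bar> + 1"], safe)
  fix w z :: complex assume w: "2 * \<bar>R\<bar> + 1 \<le> norm w" and z: "norm z \<le> R"
  then have z': "norm z \<le> \<bar>R\<bar>" by auto
  show "norm (- 2 / (z - w) ^ 3) \<le> 16 / norm w ^ 3"
    using inv_pow_far_bound[OF z' w, of 3] by (simp add: norm_divide norm_power)
qed

lemma wpt_deriv: "z \<noteq> w \<Longrightarrow> (wpt w has_field_derivative - 2 / (z - w) ^ 3) (at z)"
  unfolding wpt_def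
  by (auto intro!: derivative_eq_intros) (simp add: divide_simps power2_eq_square power3_eq_cube power4_eq_xxxx)

lemma zetat_deriv: "z \<noteq> w \<Longrightarrow> (zetat w has_field_derivative - wpt w z) (at z)"
proof -
  assume "z \<noteq> w"
  have "((\<lambda>z. inverse (z - w) + inverse w + z * c) has_field_derivative - (inverse (z - w) * 1 * inverse (z - w)) + c) (at z)" for c
    using \<open>z \<noteq> w\<close> by (auto intro!: derivative_eq_intros)
  from this[of "1 / w\<^sup>2"] show ?thesis
    unfolding zetat_def[abs_def] wpt_def by (simp add: power2_eq_square divide_inverse)
qed

lemma inv_cube_deriv: "z \<noteq> w \<Longrightarrow> ((\<lambda>z. - 2 / (z - w) ^ 3) has_field_derivative 6 / (z - w :: complex) ^ 4) (at z)"
proof -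
  assume "z \<noteq> w"
  then have "((\<lambda>z. - 2 * inverse ((z - w) ^ 3)) has_field_derivative - 2 * (- (inverse ((z - w) ^ 3) * (3 * (z - w) ^ 2 * 1) * inverse ((z - w) ^ 3)))) (at z)"
    by (auto intro!: derivative_eq_intros)
  moreover have "- 2 * (- (inverse ((z - w) ^ 3) * (3 * (z - w) ^ 2 * 1) * inverse ((z - w) ^ 3))) = 6 / (z - w) ^ 4"
    using \<open>z \<noteq> w\<close> by (simp add: divide_simps eval_nat_numeral)
  ultimately show ?thesis by (simp add: divide_inverse)
qed

lemma holomorphic_terms:
  assumes "I \<subseteq> L" "w \<in> I"
  shows "wpt w holomorphic_on - I" "zetat w holomorphic_on - I" "(\<lambda>z. - 2 / (z - w) ^ 3) holomorphic_on - I"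
  unfolding wpt_def zetat_def using assms by (auto intro!: holomorphic_intros)

text \<open>The part of \<open>wp\<close> that is regular at the origin. The sums \<open>wp1\<close>
  and \<open>wp2\<close> below are those of its first two derivatives; they run over the whole
  lattice without correction terms, so that periodicity is a mere reindexing for them, which it is
  not for \<open>wp\<close>.\<close>

definition gwp :: "complex \<Rightarrow> complex" where "gwp z = (\<Sum>\<^sub>\<infinity>w\<in>L0. wpt w z)"
definition wp1 :: "complex \<Rightarrow> complex" where "wp1 z = (\<Sum>\<^sub>\<infinity>w\<in>L. - 2 / (z - w) ^ 3)"
definition wp2 :: "complex \<Rightarrow> complex" where "wp2 z = (\<Sum>\<^sub>\<infinity>w\<in>L. 6 / (z - w) ^ 4)"

lemma wp_eq: "wp L z = 1 / z\<^sup>2 + gwp z"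
  by (simp add: wp_def gwp_def L0_def wpt_def)

lemma wzeta_eq: "wzeta L z = 1 / z + (\<Sum>\<^sub>\<infinity>w\<in>L0. zetat w z)"
  by (simp add: wzeta_def zetat_def L0_def)

lemma deriv_terms:
  "z \<noteq> w \<Longrightarrow> deriv (wpt w) z = - 2 / (z - w) ^ 3"
  "z \<noteq> w \<Longrightarrow> deriv (zetat w) z = - wpt w z"
  "z \<noteq> w \<Longrightarrow> deriv (\<lambda>z. - 2 / (z - w) ^ 3) z = 6 / (z - w) ^ 4"
  using wpt_deriv[THEN DERIV_imp_deriv] zetat_deriv[THEN DERIV_imp_deriv] inv_cube_deriv[THEN DERIV_imp_deriv] by auto

lemma gwp_deriv: 
  assumes "z \<notin> L0"
  shows "(gwp has_field_derivative (\<Sum>\<^sub>\<infinity>w\<in>L0. - 2 / (z - w) ^ 3)) (at z)"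
    and "(\<lambda>w. - 2 / (z - w) ^ 3) summable_on L0"
    and "(\<lambda>w. wpt w z) summable_on L0"
proof -
  note hyps = open_compl_L0 L0_sub holomorphic_terms(1)[OF L0_sub] wpt_bound
  have c: "- 2 / (z - w) ^ 3 = deriv (wpt w) z" if "w \<in> L0" for w
    using that assms by (intro deriv_terms(1)[symmetric]) auto
  have "(\<Sum>\<^sub>\<infinity>w\<in>L0. - 2 / (z - w) ^ 3) = (\<Sum>\<^sub>\<infinity>w\<in>L0. deriv (wpt w) z)"
    by (intro infsum_cong c)
  then show "(gwp has_field_derivative (\<Sum>\<^sub>\<infinity>w\<in>L0. - 2 / (z - w) ^ 3)) (at z)"
    unfolding gwp_def using lattice_infsum_has_field_derivative[OF hyps, of z] assms by simp
  show "(\<lambda>w. - 2 / (z - w) ^ 3) summable_on L0"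
    by (subst summable_on_cong[OF c]) (use lattice_summable_on_deriv[OF hyps, of z] assms in auto)
  show "(\<lambda>w. wpt w z) summable_on L0"
    using lattice_summable_on[OF hyps, of z] assms by simp
qed

lemma L_insert: "L = insert 0 L0" by (auto simp: L0_def)

lemma wp_deriv: assumes "z \<notin> L" shows "(wp L has_field_derivative wp1 z) (at z)"
proof -
  have z: "z \<notin> L0" "z \<noteq> 0" using assms by (auto simp: L0_def)
  have "((\<lambda>z. 1 / z\<^sup>2 + gwp z) has_field_derivative - 2 / z ^ 3 + (\<Sum>\<^sub>\<infinity>w\<in>L0. - 2 / (z - w) ^ 3)) (at z)"
  proof (rule DERIV_add)
    show "((\<lambda>z. 1 / z\<^sup>2) has_field_derivative - 2 / z ^ 3) (at z)"
      using z by (auto intro!: derivative_eq_intros)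
        (simp add: divide_simps power2_eq_square power3_eq_cube power4_eq_xxxx)
  qed (use z gwp_deriv(1) in blast)
  also have "- 2 / z ^ 3 + (\<Sum>\<^sub>\<infinity>w\<in>L0. - 2 / (z - w) ^ 3) = wp1 z"
  proof -
    have "wp1 z = (\<Sum>\<^sub>\<infinity>w\<in>insert 0 L0. - 2 / (z - w) ^ 3)" by (simp add: wp1_def flip: L_insert)
    then show ?thesis by (subst (asm) infsum_insert) (use gwp_deriv(2)[OF z(1)] in \<open>auto simp: L0_def\<close>)
  qed
  finally show ?thesis by (simp add: wp_eq [abs_def])
qed

lemma wp1_deriv: assumes "z \<notin> L" shows "(wp1 has_field_derivative wp2 z) (at z)"
proof -
  note hyps = open_compl_L order_refl holomorphic_terms(3)[OF order_refl] inv_cube_bound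
  have "wp2 z = (\<Sum>\<^sub>\<infinity>w\<in>L. deriv (\<lambda>z. - 2 / (z - w) ^ 3) z)"
    unfolding wp2_def by (rule infsum_cong) (subst deriv_terms(3), use assms in auto)
  then show ?thesis
    unfolding wp1_def[abs_def] using lattice_infsum_has_field_derivative[OF hyps, of z] assms by simp
qed

lemma deriv_wp: "z \<notin> L \<Longrightarrow> deriv (wp L) z = wp1 z"
  by (intro DERIV_imp_deriv wp_deriv)

lemma eventually_notin_L: "z \<notin> L \<Longrightarrow> \<forall>\<^sub>F u in nhds z. u \<notin> L"
  using eventually_nhds_in_open[OF open_compl_L, of z] by simp

lemma deriv2_wp: assumes "z \<notin> L" shows "(deriv ^^ 2) (wp L) z = wp2 z"
proof -
  have "\<forall>\<^sub>F u in nhds z. deriv (wp L) u = wp1 u"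
    using eventually_notin_L[OF assms] by eventually_elim (rule deriv_wp)
  then have "deriv (deriv (wp L)) z = deriv wp1 z" by (intro deriv_cong_ev refl)
  then show ?thesis using DERIV_imp_deriv[OF wp1_deriv[OF assms]] by (simp add: eval_nat_numeral)
qed

lemma wzeta_deriv: assumes "z \<notin> L" shows "(wzeta L has_field_derivative - wp L z) (at z)"
proof -
  have z: "z \<notin> L0" "z \<noteq> 0" using assms by (auto simp: L0_def)
  note hyps = open_compl_L0 L0_sub holomorphic_terms(2)[OF L0_sub] zetat_bound
  have "(\<Sum>\<^sub>\<infinity>w\<in>L0. deriv (zetat w) z) = (\<Sum>\<^sub>\<infinity>w\<in>L0. - wpt w z)"
    by (rule infsum_cong) (subst deriv_terms(2), use z in auto)
  also have "\<dots> = - gwp z" by (simp add: gwp_def infsum_uminus)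
  finally have "((\<lambda>z. \<Sum>\<^sub>\<infinity>w\<in>L0. zetat w z) has_field_derivative - gwp z) (at z)"
    using lattice_infsum_has_field_derivative[OF hyps, of z] z by simp
  then have "((\<lambda>z. 1 / z + (\<Sum>\<^sub>\<infinity>w\<in>L0. zetat w z)) has_field_derivative - wp L z) (at z)"
    using z by (auto intro!: derivative_eq_intros simp: wp_eq power2_eq_square)
  then show ?thesis by (simp add: wzeta_eq[abs_def])
qed

lemma zetat_summable: "z \<notin> L0 \<Longrightarrow> (\<lambda>w. zetat w z) summable_on L0"
  using lattice_summable_on[OF open_compl_L0 L0_sub holomorphic_terms(2)[OF L0_sub] zetat_bound, of z] by simp

lemma bij_uminus_L0: "bij_betw uminus L0 L0"
  by (rule bij_betwI[of _ _ _ uminus]) (auto simp: L0_def)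

lemma bij_add_L: "v \<in> L \<Longrightarrow> bij_betw (\<lambda>w. w + v) L L"
  by (rule bij_betwI[of _ _ _ "\<lambda>w. w - v"]) auto

lemma gwp_even: "gwp (- z) = gwp z"
proof -
  have "gwp (- z) = (\<Sum>\<^sub>\<infinity>w\<in>L0. wpt (- w) (- z))"
    unfolding gwp_def by (rule infsum_reindex_bij_betw[OF bij_uminus_L0, symmetric])
  also have "\<dots> = gwp z" unfolding gwp_def by (rule infsum_cong) (simp add: wpt_def power2_commute)
  finally show ?thesis .
qed

lemma wp_even: "wp L (- z) = wp L z" by (simp add: wp_eq gwp_even)

lemma wzeta_odd: "wzeta L (- z) = - wzeta L z"
proof -
  have "(\<Sum>\<^sub>\<infinity>w\<in>L0. zetat w (- z)) = (\<Sum>\<^sub>\<infinity>w\<in>L0. zetat (- w) (- z))"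
    by (rule infsum_reindex_bij_betw[OF bij_uminus_L0, symmetric])
  also have "\<dots> = (\<Sum>\<^sub>\<infinity>w\<in>L0. - zetat w z)"
  proof (rule infsum_cong)
    fix w show "zetat (- w) (- z) = - zetat w z"
      using divide_minus_right[of 1 "z - w"] by (simp add: zetat_def)
  qed
  finally show ?thesis by (simp add: wzeta_eq infsum_uminus)
qed

lemma wp1_periodic: assumes "v \<in> L" shows "wp1 (z + v) = wp1 z"
proof -
  have "wp1 (z + v) = (\<Sum>\<^sub>\<infinity>w\<in>L. - 2 / (z + v - (w + v)) ^ 3)"
    unfolding wp1_def by (rule infsum_reindex_bij_betw[OF bij_add_L[OF assms], symmetric])
  then show ?thesis by (simp add: wp1_def)
qed

lemma wp2_periodic: assumes "v \<in> L" shows "wp2 (z + v) = wp2 z"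
proof -
  have "wp2 (z + v) = (\<Sum>\<^sub>\<infinity>w\<in>L. 6 / (z + v - (w + v)) ^ 4)"
    unfolding wp2_def by (rule infsum_reindex_bij_betw[OF bij_add_L[OF assms], symmetric])
  then show ?thesis by (simp add: wp2_def)
qed

lemma constant_off_L:
  assumes d: "\<And>z. z \<notin> L \<Longrightarrow> (f has_field_derivative 0) (at z)" and "z \<notin> L" "w \<notin> L"
  shows "f z = f w"
proof -
  obtain c where "\<And>x. x \<in> - L \<Longrightarrow> f x = c"
  proof (rule DERIV_zero_connected_constant[OF connected_compl_L open_compl_L finite.emptyI])
    show "continuous_on (- L) f" 
      by (rule continuous_at_imp_continuous_on) (use d DERIV_isCont in auto)
  qed (use d in auto)
  then show ?thesis using assms by simp
qed

lemma half_notin: "\<omega>\<^sub>1 / 2 \<notin> L" "\<omega>\<^sub>2 / 2 \<notin> L" "(\<omega>\<^sub>1 + \<omega>\<^sub>2) / 2 \<notin> L"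
proof -
  have *: False if half: "lat a b / 2 \<in> L" "odd a \<or> odd b" for a b
  proof -
    obtain c d where "lat a b / 2 = lat c d" using half(1) by (metis L_cases)
    then have "lat a b = 2 * lat c d" by (simp add: field_simps)
    also have "\<dots> = lat (2 * c) (2 * d)" by (simp add: lat_def algebra_simps)
    finally show False using half by auto
  qed
  show "\<omega>\<^sub>1 / 2 \<notin> L" "\<omega>\<^sub>2 / 2 \<notin> L" "(\<omega>\<^sub>1 + \<omega>\<^sub>2) / 2 \<notin> L"
    using *[of 1 0] *[of 0 1] *[of 1 1] by (auto simp: lat_def)
qed

lemma periodicI:
  assumes 1: "\<And>z. z \<notin> L \<Longrightarrow> f (z + \<omega>\<^sub>1) = f z" and 2: "\<And>z. z \<notin> L \<Longrightarrow> f (z + \<omega>\<^sub>2) = f z"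
    and "v \<in> L" "z \<notin> L"
  shows "f (z + v) = f z"
proof -
  have a: "f (z + of_int k * w) = f z" if "\<And>z. z \<notin> L \<Longrightarrow> f (z + w) = f z" "w \<in> L" "\<And>k. of_int k * w \<in> L" "z \<notin> L" for k w z
  proof (induction k rule: int_induct[of _ 0])
    case base then show ?case by simp
  next
    case (step1 i)
    have "f (z + of_int (i + 1) * w) = f (z + of_int i * w + w)" by (simp add: algebra_simps)
    also have "\<dots> = f (z + of_int i * w)" by (rule that(1)) (use that in simp)
    finally show ?case using step1 by simp
  next
    case (step2 i)
    have "f (z + of_int (i - 1) * w) = f (z + of_int (i - 1) * w + w)" by (rule that(1)[symmetric]) (use that in \<open>simp del: of_int_diff\<close>)
    also have "\<dots> = f (z + of_int i * w)" by (simp add: algebra_simps)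
    finally show ?case using step2 by simp
  qed
  obtain a b where v: "v = lat a b" using \<open>v \<in> L\<close> by (rule L_cases)
  have m: "of_int k * \<omega>\<^sub>1 \<in> L" "of_int k * \<omega>\<^sub>2 \<in> L" for k
    using lat_in[of k 0] lat_in[of 0 k] by (simp_all add: lat_def)
  have "f (z + v) = f ((z + of_int a * \<omega>\<^sub>1) + of_int b * \<omega>\<^sub>2)" by (simp add: v lat_def add_ac)
  also have "\<dots> = f (z + of_int a * \<omega>\<^sub>1)" by (rule a[OF 2]) (use m \<open>z \<notin> L\<close> in simp_all)
  also have "\<dots> = f z" by (rule a[OF 1]) (use m \<open>z \<notin> L\<close> in simp_all)
  finally show ?thesis .
qed

lemma DERIV_shift_lattice:
  assumes "\<And>z. z \<notin> L \<Longrightarrow> (f has_field_derivative f' z) (at z)" "z \<notin> L" "v \<in> L"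
  shows "((\<lambda>z. f (z + v)) has_field_derivative f' (z + v)) (at z)"
  using assms(1)[of "z + v"] assms(2,3) by (simp add: DERIV_shift)

text \<open>The difference of \<open>wp\<close> and its translate has derivative 0, and evenness
  shows at \<open>- (v / 2)\<close> that the constant is 0. That point has to avoid the lattice,
  which is why the two basis periods are treated first.\<close>

lemma wp_periodic: assumes "v \<in> L" "z \<notin> L" shows "wp L (z + v) = wp L z"
proof -
  have *: "wp L (z + v) = wp L z" if "v \<in> L" "v / 2 \<notin> L" "z \<notin> L" for v z
  proof -
    have "((\<lambda>z. wp L (z + v) - wp L z) has_field_derivative 0) (at z)" if "z \<notin> L" for z
      using DERIV_diff[OF DERIV_shift_lattice[OF wp_deriv that \<open>v \<in> L\<close>] wp_deriv[OF that]]
      by (simp add: wp1_periodic \<open>v \<in> L\<close>)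
    then have "wp L (z + v) - wp L z = wp L (- (v / 2) + v) - wp L (- (v / 2))"
      by (rule constant_off_L) (use that in \<open>simp_all only: uminus_in not_False_eq_True\<close>)
    also have "- (v / 2) + v = v / 2" by (simp add: field_simps)
    finally show ?thesis by (simp add: wp_even)
  qed
  show ?thesis
    by (rule periodicI[of "wp L"]) (use * half_notin assms in auto)
qed

text \<open>The quasi-periods of zeta. The point \<open>\<omega>\<^sub>1 / 2\<close> is an arbitrary
  one off the lattice.\<close>

definition eta :: "complex \<Rightarrow> complex" where
  "eta v = wzeta L (\<omega>\<^sub>1 / 2 + v) - wzeta L (\<omega>\<^sub>1 / 2)"

lemma wzeta_quasi_periodic: assumes "v \<in> L" "z \<notin> L" shows "wzeta L (z + v) = wzeta L z + eta v"
proof -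
  have "((\<lambda>z. wzeta L (z + v) - wzeta L z) has_field_derivative 0) (at z)" if "z \<notin> L" for z
    using DERIV_diff[OF DERIV_shift_lattice[OF wzeta_deriv that \<open>v \<in> L\<close>] wzeta_deriv[OF that]]
    by (simp add: wp_periodic \<open>v \<in> L\<close> that)
  from constant_off_L[OF this \<open>z \<notin> L\<close> half_notin(1)] show ?thesis by (simp add: eta_def algebra_simps)
qed

end

section \<open>Elliptic functions and the differential equation of wp\<close>

context lattice
begin

text \<open>The hypothesis at the origin says that the singularities are removable.\<close>

lemma elliptic_constant:
  assumes hol: "f holomorphic_on - L" and per: "\<And>z v. z \<notin> L \<Longrightarrow> v \<in> L \<Longrightarrow> f (z + v) = f z"
    and lim: "((\<lambda>z. z * f z) \<longlongrightarrow> 0) (at 0)"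
  obtains c where "\<And>z. z \<notin> L \<Longrightarrow> f z = c"
proof -
  have "f holomorphic_on ball 0 cL - {0}"
    using hol ball_cL_sub' holomorphic_on_subset by blast
  then obtain F where F: "F holomorphic_on ball 0 cL" "\<And>z. z \<in> ball 0 cL - {0} \<Longrightarrow> F z = f z"
    using holomorphic_on_extend_lim[of f "ball 0 cL" 0] lim cL_pos by auto
  \<comment> \<open>Periodicity carries the value \<open>F 0\<close> of the extension to all lattice
    points. The resulting \<open>h\<close> is entire, and it takes all its values on a closed period
    parallelogram.\<close>
  define h where "h z = (if z \<in> L then F 0 else f z)" for z
  have "h analytic_on {z}" for z
  proof (cases "z \<in> L")
    case False
    have "\<forall>\<^sub>F u in nhds z. f u = h u"
      using eventually_notin_L[OF False] by eventually_elim (simp add: h_def)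
    moreover have "f analytic_on {z}" using hol False open_compl_L analytic_at by blast
    ultimately show ?thesis using analytic_at_cong by blast
  next
    case True
    have eq: "h u = F (u - z)" if ball: "u \<in> ball z cL" for u
    proof (cases "u = z")
      case True then show ?thesis using \<open>z \<in> L\<close> by (simp add: h_def)
    next
      case False
      then have u: "u \<notin> L" using isolated_L[OF \<open>z \<in> L\<close>] that by blast
      have "f u = f (u + - z)" by (rule per[symmetric]) (use u \<open>z \<in> L\<close> in auto)
      also have "\<dots> = F (u - z)"
        using F(2)[of "u - z"] False ball by (simp add: dist_norm norm_minus_commute)
      finally show ?thesis using u by (simp add: h_def)
    qed
    have "(\<lambda>u. u - z) ` ball z cL \<subseteq> ball 0 cL" by (auto simp: dist_norm norm_minus_commute)
    moreover have "(\<lambda>u. u - z) holomorphic_on ball z cL" by (intro holomorphic_intros)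
    ultimately have "(F \<circ> (\<lambda>u. u - z)) holomorphic_on ball z cL"
      using F(1) holomorphic_on_compose_gen by blast
    then have "(\<lambda>u. F (u - z)) holomorphic_on ball z cL" by (simp add: o_def)
    then have "h holomorphic_on ball z cL" by (rule holomorphic_transform) (use eq in auto)
    then show ?thesis using cL_pos analytic_at by (metis centre_in_ball open_ball)
  qed
  then have hol_h: "h holomorphic_on UNIV"
    by (meson analytic_imp_holomorphic analytic_on_analytic_at)
  define K where "K = (\<lambda>(a, b). of_real a * \<omega>\<^sub>1 + of_real b * \<omega>\<^sub>2) ` ({0..1} \<times> {0..1::real})"
  have "continuous_on ({0..1} \<times> {0..1::real}) (\<lambda>(a, b). of_real a * \<omega>\<^sub>1 + of_real b * \<omega>\<^sub>2)"
    unfolding case_prod_unfold by (intro continuous_intros)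
  then have "compact K" unfolding K_def
    by (intro compact_continuous_image compact_Times compact_Icc)
  moreover have "continuous_on K h"
    using hol_h holomorphic_on_imp_continuous_on continuous_on_subset by blast
  ultimately have "compact (h ` K)"
    using compact_continuous_image by blast
  moreover have "range h \<subseteq> h ` K"
  proof
    fix y assume "y \<in> range h"
    then obtain z where z: "y = h z" by auto
    obtain a b w where w: "w \<in> L" "z = w + (of_real a * \<omega>\<^sub>1 + of_real b * \<omega>\<^sub>2)" "a \<in> {0..1}" "b \<in> {0..1}"
      by (rule coords_reduce)
    let ?u = "of_real a * \<omega>\<^sub>1 + of_real b * \<omega>\<^sub>2"
    have "h z = h ?u"
      unfolding w(2) h_def using per[of ?u w] w(1) by (simp add: add.commute[of w])
    moreover have "?u \<in> K" using w by (auto simp: K_def intro!: image_eqI[of _ _ "(a,b)"])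
    ultimately show "y \<in> h ` K" using z by auto
  qed
  ultimately have "bounded (range h)" using compact_imp_bounded bounded_subset by blast
  then have "h constant_on UNIV" by (rule Liouville_theorem[OF hol_h])
  then obtain c where "\<And>z. h z = c" unfolding constant_on_def by blast
  then have "f z = c" if "z \<notin> L" for z using that by (metis h_def)
  then show ?thesis by (rule that)
qed

lemma elliptic_constant_lim:
  assumes hol: "f holomorphic_on - L" and per: "\<And>z v. z \<notin> L \<Longrightarrow> v \<in> L \<Longrightarrow> f (z + v) = f z"
    and lim: "(f \<longlongrightarrow> l) (at 0)" and "z \<notin> L"
  shows "f z = l"
proof -
  have "((\<lambda>z. z * f z) \<longlongrightarrow> 0 * l) (at 0)" by (intro tendsto_intros lim)
  then obtain c where c: "\<And>z. z \<notin> L \<Longrightarrow> f z = c" using elliptic_constant[OF hol per] by auto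
  have "\<forall>\<^sub>F z in at 0. z \<in> ball 0 cL - {0}"
    using cL_pos by (intro eventually_at_in_open) auto
  then have "\<forall>\<^sub>F z in at 0. f z = c"
    by eventually_elim (use c ball_cL_sub' in blast)
  then have "(f \<longlongrightarrow> c) (at 0)" by (rule tendsto_eventually)
  then have "l = c" using lim LIM_unique by blast
  then show ?thesis using c \<open>z \<notin> L\<close> by simp
qed

text \<open>The Taylor remainder of \<open>wpt w z\<close> in \<open>z\<close> after degree 4,
  divided by \<open>z ^ 5\<close> and summed over the lattice. This one holomorphic function stands
  for the whole tail of the Laurent series.\<close>

definition gk :: "complex \<Rightarrow> complex" where
  "gk z = (\<Sum>\<^sub>\<infinity>w\<in>L0. (6 * w - 5 * z) / (w ^ 6 * (z - w)\<^sup>2))"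

lemma krem_bound: "\<exists>K R'. \<forall>w\<in>L0. R' \<le> norm w \<longrightarrow> (\<forall>z. norm z \<le> R \<longrightarrow>
   norm ((6 * w - 5 * z) / (w ^ 6 * (z - w)\<^sup>2)) \<le> K / norm w ^ 3)"
proof (rule exI[of _ "34"], rule exI[of _ "2 * \<bar>R\<bar> + 1"], safe)
  fix w z :: complex assume w: "2 * \<bar>R\<bar> + 1 \<le> norm w" and z: "norm z \<le> R"
  then have z': "norm z \<le> \<bar>R\<bar>" by auto
  note b = far_bounds[OF z' w]
  have "norm ((6 * w - 5 * z) / (w ^ 6 * (z - w)\<^sup>2)) = norm (6 * w - 5 * z) * (1 / norm (z - w) ^ 2) * (1 / norm w ^ 6)"
    by (simp add: norm_mult norm_divide norm_power)
  also have "\<dots> \<le> (17/2 * norm w) * (2 ^ 2 / norm w ^ 2) * (1 / norm w ^ 6)"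
  proof (intro mult_mono inv_pow_far_bound[OF z' w] mult_nonneg_nonneg)
    have "norm (6 * w - 5 * z) \<le> 6 * norm w + 5 * norm z" using norm_triangle_ineq4[of "6*w" "5*z"] by (simp add: norm_mult)
    then show "norm (6 * w - 5 * z) \<le> 17/2 * norm w" using b by auto
  qed auto
  also have "\<dots> = 34 / norm w ^ 7" using b by (simp add: field_simps eval_nat_numeral)
  also have "\<dots> \<le> 34 / norm w ^ 3" using b
    by (intro divide_left_mono power_increasing mult_pos_pos zero_less_power) auto
  finally show "norm ((6 * w - 5 * z) / (w ^ 6 * (z - w)\<^sup>2)) \<le> 34 / norm w ^ 3" .
qed

lemma krem_holomorphic: "w \<in> L0 \<Longrightarrow> (\<lambda>z. (6 * w - 5 * z) / (w ^ 6 * (z - w)\<^sup>2)) holomorphic_on - L0"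
  by (auto intro!: holomorphic_intros simp: L0_def)

lemma gk_holomorphic: "gk holomorphic_on - L0"
proof -
  have "\<exists>d. (gk has_field_derivative d) (at z)" if "z \<in> - L0" for z
    unfolding gk_def[abs_def]
    using lattice_infsum_has_field_derivative[OF open_compl_L0 L0_sub krem_holomorphic krem_bound that] by blast
  then show ?thesis using holomorphic_on_open[OF open_compl_L0] by blast
qed

lemma infsum_odd_power: "odd k \<Longrightarrow> (\<Sum>\<^sub>\<infinity>w\<in>L0. 1 / w ^ k) = 0"
proof -
  assume "odd k"
  have "(\<Sum>\<^sub>\<infinity>w\<in>L0. 1 / w ^ k) = (\<Sum>\<^sub>\<infinity>w\<in>L0. 1 / (- w) ^ k)"
    by (rule infsum_reindex_bij_betw[OF bij_uminus_L0, symmetric])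
  also have "\<dots> = (\<Sum>\<^sub>\<infinity>w\<in>L0. - (1 / w ^ k))" using \<open>odd k\<close> by simp
  finally show ?thesis by (simp add: infsum_uminus)
qed

text \<open>The binomial series of \<open>1 / (z - w)\<^sup>2\<close> has the coefficients 2, 3, 4,
  5 here. The odd powers of \<open>w\<close> drop out by symmetry, and the denominators are
  \<open>60 / 3\<close> and \<open>140 / 5\<close>.\<close>

lemma gwp_expand:
  assumes "z \<notin> L0"
  shows "gwp z = inv_g2 L / 20 * z\<^sup>2 + inv_g3 L / 28 * z ^ 4 + z ^ 5 * gk z"
proof -
  have h: "((\<lambda>w. 1 / w ^ k) has_sum (\<Sum>\<^sub>\<infinity>w\<in>L0. 1 / w ^ k)) L0" if "k \<ge> 3" for k
    by (intro has_sum_infsum summable_on_subset_banach[OF summable_lattice_power_complex[OF that] L0_sub])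
  have k: "((\<lambda>w. (6 * w - 5 * z) / (w ^ 6 * (z - w)\<^sup>2)) has_sum gk z) L0"
    unfolding gk_def
    by (intro has_sum_infsum lattice_summable_on[OF open_compl_L0 L0_sub krem_holomorphic krem_bound]) (use assms in auto)
  have "((\<lambda>w. 2 * z * (1 / w ^ 3) + 3 * z\<^sup>2 * (1 / w ^ 4) + 4 * z ^ 3 * (1 / w ^ 5) + 5 * z ^ 4 * (1 / w ^ 6)
      + z ^ 5 * ((6 * w - 5 * z) / (w ^ 6 * (z - w)\<^sup>2))) has_sum
      2 * z * 0 + 3 * z\<^sup>2 * (\<Sum>\<^sub>\<infinity>w\<in>L0. 1 / w ^ 4) + 4 * z ^ 3 * 0 + 5 * z ^ 4 * (\<Sum>\<^sub>\<infinity>w\<in>L0. 1 / w ^ 6) + z ^ 5 * gk z) L0"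
    using h[of 3] h[of 4] h[of 5] h[of 6] k
    by (intro has_sum_add has_sum_cmult_right) (simp_all add: infsum_odd_power)
  also have "?this \<longleftrightarrow> (wpt_sum has_sum 2 * z * 0 + 3 * z\<^sup>2 * (\<Sum>\<^sub>\<infinity>w\<in>L0. 1 / w ^ 4) + 4 * z ^ 3 * 0 + 5 * z ^ 4 * (\<Sum>\<^sub>\<infinity>w\<in>L0. 1 / w ^ 6) + z ^ 5 * gk z) L0"
    if "wpt_sum = (\<lambda>w. wpt w z)" for wpt_sum
  proof (rule has_sum_cong)
    fix w assume "w \<in> L0"
    then have nz: "w \<noteq> 0" "z - w \<noteq> 0" using assms by (auto simp: L0_def)
    define u where "u = z - w"
    have zu: "z = u + w" by (simp add: u_def)
    have "u \<noteq> 0" using nz u_def by simp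
    then show "2 * z * (1 / w ^ 3) + 3 * z\<^sup>2 * (1 / w ^ 4) + 4 * z ^ 3 * (1 / w ^ 5) + 5 * z ^ 4 * (1 / w ^ 6)
      + z ^ 5 * ((6 * w - 5 * z) / (w ^ 6 * (z - w)\<^sup>2)) = wpt_sum w"
      unfolding that wpt_def u_def[symmetric] using \<open>w \<noteq> 0\<close>
      apply (simp add: divide_simps)
      unfolding zu by algebra
  qed
  finally have "gwp z = 2 * z * 0 + 3 * z\<^sup>2 * (\<Sum>\<^sub>\<infinity>w\<in>L0. 1 / w ^ 4) + 4 * z ^ 3 * 0 + 5 * z ^ 4 * (\<Sum>\<^sub>\<infinity>w\<in>L0. 1 / w ^ 6) + z ^ 5 * gk z"
    unfolding gwp_def by (intro infsumI) simp
  then show ?thesis by (simp add: inv_g2_def inv_g3_def L0_def)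
qed

lemma gk_deriv:
  assumes "z \<in> ball 0 cL"
  shows "(gk has_field_derivative deriv gk z) (at z)" "(deriv gk has_field_derivative deriv (deriv gk) z) (at z)"
    "isCont gk z" "isCont (deriv gk) z" "isCont (deriv (deriv gk)) z"
proof -
  have z: "z \<in> - L0" using assms ball_cL_sub by blast
  have h: "deriv gk holomorphic_on - L0" "deriv (deriv gk) holomorphic_on - L0"
    by (intro holomorphic_deriv gk_holomorphic open_compl_L0)+
  show "(gk has_field_derivative deriv gk z) (at z)" "(deriv gk has_field_derivative deriv (deriv gk) z) (at z)"
    by (rule holomorphic_derivI[OF _ open_compl_L0 z], fact gk_holomorphic h)+
  show "isCont gk z" "isCont (deriv gk) z" "isCont (deriv (deriv gk)) z"
    using gk_holomorphic h z open_compl_L0 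
    by (auto intro!: continuous_on_interior[of "- L0"] holomorphic_on_imp_continuous_on simp: interior_open)
qed

context
  fixes \<alpha> \<beta> :: complex
  defines "\<alpha> \<equiv> inv_g2 L / 20" and "\<beta> \<equiv> inv_g3 L / 28"
begin

lemma wp_expand:
  assumes "z \<in> ball 0 cL - {0}"
  shows "wp L z = 1 / z ^ 2 + \<alpha> * z ^ 2 + \<beta> * z ^ 4 + z ^ 5 * gk z"
  using gwp_expand[of z] assms ball_cL_sub by (auto simp: wp_eq \<alpha>_def \<beta>_def)

lemma wp1_expand:
  assumes "z \<in> ball 0 cL - {0}"
  shows "wp1 z = - 2 / z ^ 3 + 2 * \<alpha> * z + 4 * \<beta> * z ^ 3 + 5 * z ^ 4 * gk z + z ^ 5 * deriv gk z"
proof -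
  have "((\<lambda>z. 1 / z ^ 2 + \<alpha> * z ^ 2 + \<beta> * z ^ 4 + z ^ 5 * gk z) has_field_derivative wp1 z) (at z)"
    by (rule has_field_derivative_transform_within_open[OF wp_deriv, of _ "ball 0 cL - {0}"])
      (use assms ball_cL_sub' wp_expand in auto)
  moreover have "((\<lambda>z. 1 / z ^ 2 + \<alpha> * z ^ 2 + \<beta> * z ^ 4 + z ^ 5 * gk z) has_field_derivative
     - 2 / z ^ 3 + 2 * \<alpha> * z + 4 * \<beta> * z ^ 3 + 5 * z ^ 4 * gk z + z ^ 5 * deriv gk z) (at z)"
    using assms by (auto intro!: derivative_eq_intros gk_deriv(1)) (simp add: divide_simps, simp add: eval_nat_numeral)
  ultimately show ?thesis by (rule DERIV_unique)
qed

lemma wp2_expand: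
  assumes "z \<in> ball 0 cL - {0}"
  shows "wp2 z = 6 / z ^ 4 + 2 * \<alpha> + 12 * \<beta> * z ^ 2 + 20 * z ^ 3 * gk z + 10 * z ^ 4 * deriv gk z + z ^ 5 * deriv (deriv gk) z"
proof -
  have "((\<lambda>z. - 2 / z ^ 3 + 2 * \<alpha> * z + 4 * \<beta> * z ^ 3 + 5 * z ^ 4 * gk z + z ^ 5 * deriv gk z) has_field_derivative wp2 z) (at z)"
    by (rule has_field_derivative_transform_within_open[OF wp1_deriv, of _ "ball 0 cL - {0}"])
      (use assms ball_cL_sub' wp1_expand in auto)
  moreover have "((\<lambda>z. - 2 / z ^ 3 + 2 * \<alpha> * z + 4 * \<beta> * z ^ 3 + 5 * z ^ 4 * gk z + z ^ 5 * deriv gk z) has_field_derivative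
     6 / z ^ 4 + 2 * \<alpha> + 12 * \<beta> * z ^ 2 + 20 * z ^ 3 * gk z + 10 * z ^ 4 * deriv gk z + z ^ 5 * deriv (deriv gk) z) (at z)"
  proof -
    have "((\<lambda>z. - 2 / z ^ 3) has_field_derivative 6 / z ^ 4) (at z)"
      using inv_cube_deriv[of z 0] assms by simp
    moreover have "((\<lambda>z. 2 * \<alpha> * z + 4 * \<beta> * z ^ 3 + 5 * z ^ 4 * gk z + z ^ 5 * deriv gk z) has_field_derivative
      2 * \<alpha> + 12 * \<beta> * z ^ 2 + 20 * z ^ 3 * gk z + 10 * z ^ 4 * deriv gk z + z ^ 5 * deriv (deriv gk) z) (at z)"
      using assms by (auto intro!: derivative_eq_intros gk_deriv(1,2) simp: algebra_simps)
    ultimately have "((\<lambda>u. - 2 / u ^ 3 + (2 * \<alpha> * u + 4 * \<beta> * u ^ 3 + 5 * u ^ 4 * gk u + u ^ 5 * deriv gk u)) has_field_derivative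
      6 / z ^ 4 + (2 * \<alpha> + 12 * \<beta> * z ^ 2 + 20 * z ^ 3 * gk z + 10 * z ^ 4 * deriv gk z + z ^ 5 * deriv (deriv gk) z)) (at z)"
      by (rule DERIV_add)
    then show ?thesis by (simp only: add.assoc)
  qed
  ultimately show ?thesis by (rule DERIV_unique)
qed

lemma wp_holomorphic: "wp L holomorphic_on - L" and wp1_holomorphic: "wp1 holomorphic_on - L"
  using wp_deriv wp1_deriv holomorphic_on_open[OF open_compl_L] by auto

lemma wp2_holomorphic: "wp2 holomorphic_on - L"
  using holomorphic_deriv[OF wp1_holomorphic open_compl_L]
  by (rule holomorphic_transform) (simp add: DERIV_imp_deriv[OF wp1_deriv])

lemma tendsto_at_0I:
  fixes f g :: "complex \<Rightarrow> complex"
  assumes "\<And>z. z \<in> ball 0 cL - {0} \<Longrightarrow> f z = g z" "isCont g 0" "g 0 = l"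
  shows "(f \<longlongrightarrow> l) (at 0)"
proof (rule Lim_transform_within_open[of g _ _ _ "ball 0 cL"])
  show "(g \<longlongrightarrow> l) (at 0)" using assms(2,3) by (simp add: isCont_def)
  show "g x = f x" if "x \<in> ball 0 cL" "x \<noteq> 0" for x using assms(1) that by simp
qed (use cL_pos in auto)

text \<open>By the expansions at the origin the poles cancel in \<open>wp2 - 6 * wp ^ 2\<close>. An
  elliptic function without poles is constant, and its limit at 0 is \<open>- 10 * \<alpha>\<close>,
  which is \<open>- inv_g2 L / 2\<close>.\<close>

lemma wp2_eq: assumes "z \<notin> L" shows "wp2 z = 6 * wp L z ^ 2 - inv_g2 L / 2"
proof -
  have "wp2 z - 6 * wp L z ^ 2 = - 10 * \<alpha>"
  proof (rule elliptic_constant_lim[of "\<lambda>z. wp2 z - 6 * wp L z ^ 2", OF _ _ _ assms])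
    show "(\<lambda>z. wp2 z - 6 * wp L z ^ 2) holomorphic_on - L"
      by (intro holomorphic_intros wp2_holomorphic wp_holomorphic)
    show "((\<lambda>z. wp2 z - 6 * (wp L z)\<^sup>2) \<longlongrightarrow> - 10 * \<alpha>) (at 0)"
    proof (rule tendsto_at_0I)
      let ?g = "\<lambda>z. - 10 * \<alpha> + 8 * z ^ 3 * gk z + 10 * z ^ 4 * deriv gk z + z ^ 5 * deriv (deriv gk) z
         - 6 * (\<alpha> * z ^ 2 + \<beta> * z ^ 4 + z ^ 5 * gk z) ^ 2"
      show "isCont ?g 0" using gk_deriv[of 0] cL_pos by (auto intro!: continuous_intros)
      show "?g 0 = - 10 * \<alpha>" by simp
      fix z :: complex assume z: "z \<in> ball 0 cL - {0}"
      \<comment> \<open>With a name for the inverse, the identity becomes polynomial modulo the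
        relation \<open>z * i = 1\<close>.\<close>
      define i where "i = 1 / z"
      have zi: "z * i = 1" "6 / z ^ 4 = 6 * i ^ 4" "1 / z ^ 2 = i ^ 2" using z by (auto simp: i_def power_divide)
      show "wp2 z - 6 * (wp L z)\<^sup>2 = ?g z"
        unfolding wp2_expand[OF z] wp_expand[OF z] zi(2,3) using zi(1) by algebra
    qed
  qed (simp add: wp2_periodic wp_periodic)
  then show ?thesis by (simp add: \<alpha>_def algebra_simps)
qed

text \<open>The same cancellation for poles of order six; \<open>20 * \<alpha>\<close> and
  \<open>28 * \<beta>\<close> are the two invariants.\<close>

lemma wp1_square: assumes "z \<notin> L" shows "wp1 z ^ 2 = 4 * wp L z ^ 3 - inv_g2 L * wp L z - inv_g3 L"
proof -
  have "wp1 z ^ 2 - 4 * wp L z ^ 3 + 20 * \<alpha> * wp L z = - 28 * \<beta>"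
  proof (rule elliptic_constant_lim[of "\<lambda>z. wp1 z ^ 2 - 4 * wp L z ^ 3 + 20 * \<alpha> * wp L z", OF _ _ _ assms])
    show "(\<lambda>z. wp1 z ^ 2 - 4 * wp L z ^ 3 + 20 * \<alpha> * wp L z) holomorphic_on - L"
      by (intro holomorphic_intros wp1_holomorphic wp_holomorphic)
    show "((\<lambda>z. wp1 z ^ 2 - 4 * wp L z ^ 3 + 20 * \<alpha> * wp L z) \<longlongrightarrow> - 28 * \<beta>) (at 0)"
    proof (rule tendsto_at_0I)
      let ?g = "\<lambda>z. - 28 * \<beta> - 32 * z * gk z - 4 * z ^ 2 * deriv gk z
         + (2 * \<alpha> * z + 4 * \<beta> * z ^ 3 + 5 * z ^ 4 * gk z + z ^ 5 * deriv gk z) ^ 2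
         - 12 * z ^ 2 * (\<alpha> + \<beta> * z ^ 2 + z ^ 3 * gk z) ^ 2 - 4 * (\<alpha> * z ^ 2 + \<beta> * z ^ 4 + z ^ 5 * gk z) ^ 3
         + 20 * \<alpha> * (\<alpha> * z ^ 2 + \<beta> * z ^ 4 + z ^ 5 * gk z)"
      show "isCont ?g 0" using gk_deriv[of 0] cL_pos by (auto intro!: continuous_intros)
      show "?g 0 = - 28 * \<beta>" by simp
      fix z :: complex assume z: "z \<in> ball 0 cL - {0}"
      define i where "i = 1 / z"
      have zi: "z * i = 1" "- 2 / z ^ 3 = - 2 * i ^ 3" "1 / z ^ 2 = i ^ 2" using z by (auto simp: i_def power_divide)
      show "wp1 z ^ 2 - 4 * wp L z ^ 3 + 20 * \<alpha> * wp L z = ?g z"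
        unfolding wp1_expand[OF z] wp_expand[OF z] zi(2,3) using zi(1) by algebra
    qed
  qed (simp add: wp1_periodic wp_periodic)
  then show ?thesis by (simp add: \<alpha>_def \<beta>_def algebra_simps)
qed

end

end

subsection \<open>The sigma function\<close>

text \<open>The remainder has the derivative \<open>- z\<^sup>2 / (1 - z)\<close>, whose denominator
  stays at distance \<open>1/2\<close> from 0; the mean value inequality supplies the third
  power.\<close>

lemma Ln_cubic_remainder:
  assumes "norm u \<le> 1 / 2"
  shows "norm (Ln (1 - u) + u + u\<^sup>2 / 2) \<le> 2 * norm u ^ 3"
proof -
  have ne: "1 - z \<notin> \<real>\<^sub>\<le>\<^sub>0" if "z \<in> cball 0 (norm u)" for z :: complex
  proof
    assume "1 - z \<in> \<real>\<^sub>\<le>\<^sub>0"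
    then have "Re (1 - z) \<le> 0" by (auto simp: complex_nonpos_Reals_iff)
    then have "1 \<le> norm z" using abs_Re_le_cmod[of z] by simp
    then show False using that assms by auto
  qed
  have "norm ((\<lambda>z. Ln (1 - z) + z + z\<^sup>2 / 2) u - (\<lambda>z. Ln (1 - z) + z + z\<^sup>2 / 2) 0) \<le> 2 * norm u ^ 2 * norm (u - 0)"
  proof (rule field_differentiable_bound[of "cball 0 (norm u)"])
    fix z :: complex assume z: "z \<in> cball 0 (norm u)"
    have nz: "1 - z \<noteq> 0" using ne[OF z] by auto
    have "((\<lambda>z. Ln (1 - z) + z + z\<^sup>2 / 2) has_field_derivative - 1 / (1 - z) + 1 + z) (at z)"
      using ne[OF z] by (auto intro!: derivative_eq_intros) (simp add: divide_inverse)
    also have "- 1 / (1 - z) + 1 + z = - (z\<^sup>2 / (1 - z))"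
      using nz by (simp add: divide_simps) (simp add: power2_eq_square algebra_simps)
    finally show "((\<lambda>z. Ln (1 - z) + z + z\<^sup>2 / 2) has_field_derivative - (z\<^sup>2 / (1 - z))) (at z within cball 0 (norm u))"
      by (rule has_field_derivative_at_within)
    have "1 - norm z \<le> norm (1 - z)" using norm_triangle_ineq2[of 1 z] by simp
    then have "1 / 2 \<le> norm (1 - z)" using z assms by auto
    then have "norm z ^ 2 / norm (1 - z) \<le> norm u ^ 2 / (1 / 2)"
      using z by (intro frac_le power_mono) auto
    then show "norm (- (z\<^sup>2 / (1 - z))) \<le> 2 * norm u ^ 2" by (simp add: norm_divide norm_power)
  qed auto
  then show ?thesis by (simp add: power2_eq_square power3_eq_cube mult.assoc)
qed

lemma has_field_derivative_prod_log:
  fixes f :: "'i \<Rightarrow> complex \<Rightarrow> complex"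
  assumes "finite F" "\<And>i. i \<in> F \<Longrightarrow> (f i has_field_derivative f i z * l i) (at z)"
  shows "((\<lambda>z. \<Prod>i\<in>F. f i z) has_field_derivative (\<Prod>i\<in>F. f i z) * (\<Sum>i\<in>F. l i)) (at z)"
  using assms
proof (induction F)
  case (insert i F)
  have "((\<lambda>z. f i z * (\<Prod>i\<in>F. f i z)) has_field_derivative
     f i z * l i * (\<Prod>i\<in>F. f i z) + (\<Prod>i\<in>F. f i z) * (\<Sum>i\<in>F. l i) * f i z) (at z)"
    by (rule DERIV_mult) (use insert in auto)
  then show ?case using insert.hyps by (simp add: algebra_simps)
qed auto

context lattice
begin

definition sfac :: "complex \<Rightarrow> complex \<Rightarrow> complex" where
  "sfac w z = (1 - z / w) * exp (z / w + (z / w)\<^sup>2 / 2)"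

definition slog :: "complex \<Rightarrow> complex \<Rightarrow> complex" where
  "slog w z = Ln (1 - z / w) + z / w + (z / w)\<^sup>2 / 2"

text \<open>The product of sigma without its factor \<open>z\<close>: the finitely many factors in
  \<open>F\<close> are kept as they are, and the others are collected through their logarithms. With
  \<open>near_part R\<close> for \<open>F\<close>, the latter have
  \<open>norm (z / w) < 1 / 2\<close> on the ball of radius \<open>R\<close>, where the principal
  logarithm is harmless.\<close>

definition sprod :: "complex set \<Rightarrow> complex \<Rightarrow> complex" where
  "sprod F z = (\<Prod>w\<in>F. sfac w z) * exp (\<Sum>\<^sub>\<infinity>w\<in>L0 - F. slog w z)"

definition near_part :: "real \<Rightarrow> complex set" where "near_part R = {w \<in> L0. norm w \<le> 2 * R}"

lemma near_part: "finite (near_part R)" "near_part R \<subseteq> L0"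
proof -
  show "finite (near_part R)" by (rule finite_subset[OF _ finite_lattice_ball[of "2 * R"]]) (auto simp: near_part_def L0_def)
qed (auto simp: near_part_def)

lemma not_near_part: "w \<in> L0 - near_part R \<Longrightarrow> z \<in> ball 0 R \<Longrightarrow> norm (z / w) < 1 / 2"
proof -
  assume a: "w \<in> L0 - near_part R" "z \<in> ball 0 R"
  then have "2 * norm z < norm w" "norm w > 0" by (auto simp: near_part_def L0_def)
  then show ?thesis by (simp add: norm_divide field_simps)
qed

lemma one_minus_not_nonpos: "norm (u::complex) < 1 / 2 \<Longrightarrow> 1 - u \<notin> \<real>\<^sub>\<le>\<^sub>0" "norm (u::complex) < 1 / 2 \<Longrightarrow> 1 - u \<noteq> 0"
proof -
  assume "norm u < 1 / 2"
  moreover have "Re u \<le> norm u" by (rule complex_Re_le_cmod)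
  ultimately have "Re (1 - u) > 0" by simp
  then show "1 - u \<notin> \<real>\<^sub>\<le>\<^sub>0" "1 - u \<noteq> 0" by (auto simp: complex_nonpos_Reals_iff)
qed

lemma slog_bound: "\<exists>K R'. \<forall>w\<in>I. R' \<le> norm w \<longrightarrow> (\<forall>z. norm z \<le> R \<longrightarrow> norm (slog w z) \<le> K / norm w ^ 3)"
proof (rule exI[of _ "2 * \<bar>R\<bar> ^ 3"], rule exI[of _ "2 * \<bar>R\<bar> + 1"], safe)
  fix w z :: complex assume w: "2 * \<bar>R\<bar> + 1 \<le> norm w" and z: "norm z \<le> R"
  then have z': "norm z \<le> \<bar>R\<bar>" by auto
  note b = far_bounds[OF z' w]
  have "norm (z / w) \<le> 1 / 2" using b by (simp add: norm_divide field_simps)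
  then have "norm (slog w z) \<le> 2 * norm (z / w) ^ 3" unfolding slog_def by (rule Ln_cubic_remainder)
  also have "\<dots> = 2 * norm z ^ 3 / norm w ^ 3" by (simp add: norm_divide power_divide)
  also have "\<dots> \<le> 2 * \<bar>R\<bar> ^ 3 / norm w ^ 3" using z' by (intro divide_right_mono mult_left_mono power_mono) auto
  finally show "norm (slog w z) \<le> 2 * \<bar>R\<bar> ^ 3 / norm w ^ 3" .
qed

lemma slog_deriv:
  assumes "w \<in> L0 - near_part R" "z \<in> ball 0 R"
  shows "(slog w has_field_derivative zetat w z) (at z)"
proof -
  note n = not_near_part[OF assms]
  have w: "w \<noteq> 0" using assms by (auto simp: L0_def)
  have zw: "z \<noteq> w" using n w by auto
  have "((\<lambda>z. Ln (1 - z / w) + z / w + (z / w)\<^sup>2 / 2) has_field_derivative - (1 / w) / (1 - z / w) + 1 / w + z / w * (1 / w)) (at z)"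
    using one_minus_not_nonpos(1)[OF n] w
    by (auto intro!: derivative_eq_intros) (simp add: divide_inverse mult.commute)
  also have "- (1 / w) / (1 - z / w) + 1 / w + z / w * (1 / w) = zetat w z"
  proof -
    have "1 - z / w = - ((z - w) / w)" using w by (simp add: field_simps)
    then have "- (1 / w) / (1 - z / w) = 1 / (z - w)" using w zw by simp
    then show ?thesis by (simp add: zetat_def power2_eq_square)
  qed
  finally show ?thesis by (simp add: slog_def[abs_def])
qed

lemma slog_sum:
  assumes "z \<in> ball 0 R"
  shows "((\<lambda>z. \<Sum>\<^sub>\<infinity>w\<in>L0 - near_part R. slog w z) has_field_derivative (\<Sum>\<^sub>\<infinity>w\<in>L0 - near_part R. zetat w z)) (at z)"
    and "(\<lambda>w. slog w z) summable_on (L0 - near_part R)"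
proof -
  have hol: "slog w holomorphic_on ball 0 R" if "w \<in> L0 - near_part R" for w
    using slog_deriv[OF that] by (meson holomorphic_on_open open_ball)
  have sub: "L0 - near_part R \<subseteq> L" using L0_sub by blast
  note hyps = open_ball[of 0 R] sub hol slog_bound
  have "(\<Sum>\<^sub>\<infinity>w\<in>L0 - near_part R. deriv (slog w) z) = (\<Sum>\<^sub>\<infinity>w\<in>L0 - near_part R. zetat w z)"
    by (intro infsum_cong DERIV_imp_deriv slog_deriv[OF _ assms])
  then show "((\<lambda>z. \<Sum>\<^sub>\<infinity>w\<in>L0 - near_part R. slog w z) has_field_derivative (\<Sum>\<^sub>\<infinity>w\<in>L0 - near_part R. zetat w z)) (at z)"
    using lattice_infsum_has_field_derivative[OF hyps assms] by simp
  show "(\<lambda>w. slog w z) summable_on (L0 - near_part R)"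
    using lattice_summable_on[OF hyps assms] .
qed

lemma sfac_eq_exp: assumes "w \<in> L0 - near_part R" "z \<in> ball 0 R" shows "sfac w z = exp (slog w z)"
  using one_minus_not_nonpos(2)[OF not_near_part[OF assms]] by (simp add: sfac_def slog_def exp_add)

text \<open>As soon as a finite set contains \<open>near_part R\<close>, its partial product equals
  the fixed near part times the exponential of a partial sum of logarithms. Summability of the
  logarithms thus yields existence and value of the limit in the definition.\<close>

lemma wsigma_eq:
  assumes z: "z \<in> ball 0 R"
  shows "wsigma L z = z * sprod (near_part R) z"
proof -
  let ?F = "near_part R"
  define b where "b w = (if w \<in> ?F then 0 else slog w z)" for w
  have "((\<lambda>w. slog w z) has_sum (\<Sum>\<^sub>\<infinity>w\<in>L0 - ?F. slog w z)) (L0 - ?F)"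
    using slog_sum(2)[OF z] by (rule has_sum_infsum)
  then have "(b has_sum (\<Sum>\<^sub>\<infinity>w\<in>L0 - ?F. slog w z)) L0"
    by (rule has_sum_cong_neutral[THEN iffD1, rotated -1]) (auto simp: b_def)
  then have "((\<lambda>X. \<Sum>w\<in>X. b w) \<longlongrightarrow> (\<Sum>\<^sub>\<infinity>w\<in>L0 - ?F. slog w z)) (finite_subsets_at_top L0)"
    by (simp add: has_sum_def)
  then have lim: "((\<lambda>X. (\<Prod>w\<in>?F. sfac w z) * exp (\<Sum>w\<in>X. b w)) \<longlongrightarrow> sprod ?F z) (finite_subsets_at_top L0)"
    unfolding sprod_def by (intro tendsto_intros)
  have "\<forall>\<^sub>F X in finite_subsets_at_top L0. (\<Prod>w\<in>?F. sfac w z) * exp (\<Sum>w\<in>X. b w) = (\<Prod>w\<in>X. sfac w z)"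
    unfolding eventually_finite_subsets_at_top
  proof (intro exI[of _ ?F] conjI allI impI near_part)
    fix X assume X: "finite X \<and> ?F \<subseteq> X \<and> X \<subseteq> L0"
    have "(\<Sum>w\<in>X. b w) = (\<Sum>w\<in>X - ?F. slog w z)"
      using X by (intro sum.mono_neutral_cong_right) (auto simp: b_def)
    then have "exp (\<Sum>w\<in>X. b w) = (\<Prod>w\<in>X - ?F. sfac w z)"
      using X by (simp add: exp_sum) (intro prod.cong refl sfac_eq_exp[OF _ z, symmetric], auto)
    then show "(\<Prod>w\<in>?F. sfac w z) * exp (\<Sum>w\<in>X. b w) = (\<Prod>w\<in>X. sfac w z)"
      using X prod.subset_diff[of ?F X "\<lambda>w. sfac w z"] by (simp add: mult.commute)
  qed
  then have "((\<lambda>X. \<Prod>w\<in>X. sfac w z) \<longlongrightarrow> sprod ?F z) (finite_subsets_at_top L0)"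
    using Lim_transform_eventually[OF lim] by blast
  then have "Lim (finite_subsets_at_top L0) (\<lambda>X. \<Prod>w\<in>X. sfac w z) = sprod ?F z"
    by (intro tendsto_Lim finite_subsets_at_top_neq_bot)
  then show ?thesis by (simp add: wsigma_def sfac_def L0_def)
qed

lemma sfac_deriv:
  assumes "w \<in> L0" "z \<noteq> w"
  shows "(sfac w has_field_derivative sfac w z * zetat w z) (at z)"
proof -
  have w: "w \<noteq> 0" using assms by (auto simp: L0_def)
  have "((\<lambda>z. (1 - z / w) * exp (z / w + (z / w)\<^sup>2 / 2)) has_field_derivative
     - (1 / w) * exp (z / w + (z / w)\<^sup>2 / 2) + (exp (z / w + (z / w)\<^sup>2 / 2) * (1 / w + z / w * (1 / w))) * (1 - z / w)) (at z)"
  proof (intro DERIV_mult DERIV_fun_exp)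
    show "((\<lambda>z. 1 - z / w) has_field_derivative - (1 / w)) (at z)"
      using w by (auto intro!: derivative_eq_intros)
    show "((\<lambda>z. z / w + (z / w)\<^sup>2 / 2) has_field_derivative 1 / w + z / w * (1 / w)) (at z)"
      using w by (auto intro!: derivative_eq_intros)
  qed
  also have "- (1 / w) * exp (z / w + (z / w)\<^sup>2 / 2) + (exp (z / w + (z / w)\<^sup>2 / 2) * (1 / w + z / w * (1 / w))) * (1 - z / w)
    = exp (z / w + (z / w)\<^sup>2 / 2) * (- (1 / w) + (1 / w + z / w * (1 / w)) * (1 - z / w))"
    by algebra
  also have "- (1 / w) + (1 / w + z / w * (1 / w)) * (1 - z / w) = (1 - z / w) * zetat w z"
  proof -
    have "(1 - z / w) * (1 / (z - w)) = - (1 / w)" using w assms by (simp add: divide_simps)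
    then show ?thesis by (simp add: zetat_def power2_eq_square algebra_simps)
  qed
  finally show ?thesis by (simp add: sfac_def[abs_def] mult_ac)
qed

lemma sprod_holomorphic: "sprod (near_part R) holomorphic_on ball 0 R"
proof -
  have "(\<lambda>z. \<Sum>\<^sub>\<infinity>w\<in>L0 - near_part R. slog w z) holomorphic_on ball 0 R"
    using slog_sum(1)[of _ R] by (meson holomorphic_on_open open_ball)
  moreover have "sfac w holomorphic_on ball 0 R" if "w \<in> near_part R" for w
  proof -
    have "w \<noteq> 0" using that near_part(2) by (auto simp: L0_def)
    then show ?thesis unfolding sfac_def by (intro holomorphic_intros) auto
  qed
  ultimately show ?thesis unfolding sprod_def by (intro holomorphic_intros)
qed

lemma sprod_deriv:
  assumes "z \<in> ball 0 R" "z \<notin> L"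
  shows "(sprod (near_part R) has_field_derivative sprod (near_part R) z * (wzeta L z - 1 / z)) (at z)"
proof -
  let ?F = "near_part R"
  have z0: "z \<notin> L0" using assms L0_sub by auto
  have "((\<lambda>z. (\<Prod>w\<in>?F. sfac w z) * exp (\<Sum>\<^sub>\<infinity>w\<in>L0 - ?F. slog w z)) has_field_derivative
     (\<Prod>w\<in>?F. sfac w z) * (\<Sum>w\<in>?F. zetat w z) * exp (\<Sum>\<^sub>\<infinity>w\<in>L0 - ?F. slog w z)
     + exp (\<Sum>\<^sub>\<infinity>w\<in>L0 - ?F. slog w z) * (\<Sum>\<^sub>\<infinity>w\<in>L0 - ?F. zetat w z) * (\<Prod>w\<in>?F. sfac w z)) (at z)"
  proof (rule DERIV_mult)
    show "((\<lambda>z. \<Prod>w\<in>?F. sfac w z) has_field_derivative (\<Prod>w\<in>?F. sfac w z) * (\<Sum>w\<in>?F. zetat w z)) (at z)"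
      using near_part[of R] z0 by (intro has_field_derivative_prod_log sfac_deriv) auto
    show "((\<lambda>z. exp (\<Sum>\<^sub>\<infinity>w\<in>L0 - ?F. slog w z)) has_field_derivative exp (\<Sum>\<^sub>\<infinity>w\<in>L0 - ?F. slog w z) * (\<Sum>\<^sub>\<infinity>w\<in>L0 - ?F. zetat w z)) (at z)"
      by (rule DERIV_fun_exp[OF slog_sum(1)[OF assms(1)]])
  qed
  also have "(\<Prod>w\<in>?F. sfac w z) * (\<Sum>w\<in>?F. zetat w z) * exp (\<Sum>\<^sub>\<infinity>w\<in>L0 - ?F. slog w z)
     + exp (\<Sum>\<^sub>\<infinity>w\<in>L0 - ?F. slog w z) * (\<Sum>\<^sub>\<infinity>w\<in>L0 - ?F. zetat w z) * (\<Prod>w\<in>?F. sfac w z)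
     = sprod ?F z * ((\<Sum>w\<in>?F. zetat w z) + (\<Sum>\<^sub>\<infinity>w\<in>L0 - ?F. zetat w z))"
    by (simp add: sprod_def algebra_simps)
  also have "(\<Sum>w\<in>?F. zetat w z) + (\<Sum>\<^sub>\<infinity>w\<in>L0 - ?F. zetat w z) = (\<Sum>\<^sub>\<infinity>w\<in>L0. zetat w z)"
  proof -
    have "(\<Sum>\<^sub>\<infinity>w\<in>?F \<union> (L0 - ?F). zetat w z) = (\<Sum>\<^sub>\<infinity>w\<in>?F. zetat w z) + (\<Sum>\<^sub>\<infinity>w\<in>L0 - ?F. zetat w z)"
      by (rule infsum_Un_disjoint) (use near_part[of R] summable_on_subset_banach[OF zetat_summable[OF z0]] in auto)
    moreover have "?F \<union> (L0 - ?F) = L0" using near_part(2) by auto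
    ultimately show ?thesis using near_part(1) by simp
  qed
  also have "\<dots> = wzeta L z - 1 / z" by (simp add: wzeta_eq)
  finally show ?thesis by (simp add: sprod_def[abs_def])
qed

lemma sprod_nonzero: 
  assumes "z \<in> ball 0 R" "z \<notin> L0"
  shows "sprod (near_part R) z \<noteq> 0"
proof -
  have "sfac w z \<noteq> 0" if "w \<in> near_part R" for w
  proof -
    have "w \<in> L0" using that near_part(2) by blast
    then have "w \<noteq> 0" "z \<noteq> w" using assms by (auto simp: L0_def)
    then show ?thesis by (simp add: sfac_def)
  qed
  then show ?thesis using near_part(1) by (simp add: sprod_def prod_zero_iff)
qed

lemma wsigma_local: "\<forall>\<^sub>F u in nhds z. wsigma L u = u * sprod (near_part (norm z + 1)) u"
proof -
  have "\<forall>\<^sub>F u in nhds z. u \<in> ball 0 (norm z + 1)" by (intro eventually_nhds_in_open) auto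
  then show ?thesis by eventually_elim (rule wsigma_eq)
qed

lemma wsigma_holomorphic [holomorphic_intros]: "wsigma L holomorphic_on S"
proof -
  have "wsigma L analytic_on {z}" for z
  proof -
    have "(\<lambda>u. u * sprod (near_part (norm z + 1)) u) holomorphic_on ball 0 (norm z + 1)"
      by (intro holomorphic_intros sprod_holomorphic)
    then have "(\<lambda>u. u * sprod (near_part (norm z + 1)) u) analytic_on {z}"
      unfolding analytic_at by (intro exI[of _ "ball 0 (norm z + 1)"]) simp
    then show ?thesis using analytic_at_cong[OF wsigma_local refl] by blast
  qed
  then show ?thesis by (meson analytic_imp_holomorphic analytic_on_analytic_at)
qed

lemma wsigma_deriv:
  assumes "z \<notin> L"
  shows "(wsigma L has_field_derivative wsigma L z * wzeta L z) (at z)"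
proof -
  let ?P = "sprod (near_part (norm z + 1))"
  have b: "z \<in> ball 0 (norm z + 1)" and nz: "z \<noteq> 0" using assms by auto
  have "((\<lambda>u. u * ?P u) has_field_derivative 1 * ?P z + ?P z * (wzeta L z - 1 / z) * z) (at z)"
    by (intro DERIV_mult DERIV_ident sprod_deriv[OF b assms])
  also have "1 * ?P z + ?P z * (wzeta L z - 1 / z) * z = wsigma L z * wzeta L z"
    using nz by (simp add: wsigma_eq[OF b] field_simps)
  finally show ?thesis
    using DERIV_cong_ev[OF refl wsigma_local refl] by blast
qed

lemma wsigma_eq_0_iff: "wsigma L z = 0 \<longleftrightarrow> z \<in> L"
proof -
  let ?F = "near_part (norm z + 1)"
  have b: "z \<in> ball 0 (norm z + 1)" by auto
  have "sprod ?F z = 0" if "z \<in> L0"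
  proof -
    have "z \<in> ?F" using that by (simp add: near_part_def)
    moreover have "sfac z z = 0" using that by (simp add: sfac_def L0_def)
    ultimately have "(\<Prod>w\<in>?F. sfac w z) = 0" using near_part(1) by (auto simp: prod_zero_iff)
    then show ?thesis by (simp add: sprod_def)
  qed
  moreover have "z \<in> L \<longleftrightarrow> z = 0 \<or> z \<in> L0" by (auto simp: L0_def)
  ultimately show ?thesis using sprod_nonzero[OF b] by (auto simp: wsigma_eq[OF b])
qed

text \<open>The quotient of sigma by \<open>z\<close> on a ball that contains no other zero; it
  turns limits at the origin into values.\<close>

definition msig :: "complex \<Rightarrow> complex" where "msig = sprod (near_part cL)"

lemma msig: "msig holomorphic_on ball 0 cL" "msig 0 = 1" "z \<in> ball 0 cL \<Longrightarrow> wsigma L z = z * msig z"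
  "z \<in> ball 0 cL \<Longrightarrow> msig z \<noteq> 0"
proof -
  show "msig holomorphic_on ball 0 cL" unfolding msig_def by (rule sprod_holomorphic)
  show "msig 0 = 1" by (simp add: msig_def sprod_def sfac_def slog_def)
  show "wsigma L z = z * msig z" if "z \<in> ball 0 cL" unfolding msig_def using that by (rule wsigma_eq)
  show "msig z \<noteq> 0" if "z \<in> ball 0 cL"
    unfolding msig_def using that ball_cL_sub by (intro sprod_nonzero) blast+
qed

lemma wsigma_deriv_0: "(wsigma L has_field_derivative 1) (at 0)"
proof -
  have "((\<lambda>z. z * msig z) has_field_derivative 1 * msig 0 + deriv msig 0 * 0) (at 0)"
    using cL_pos by (intro DERIV_mult DERIV_ident holomorphic_derivI[OF msig(1)]) auto
  moreover have "\<forall>\<^sub>F z in nhds 0. z \<in> ball 0 cL" using cL_pos by (intro eventually_nhds_in_open) auto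
  then have ev: "\<forall>\<^sub>F z in nhds 0. wsigma L z = z * msig z" by eventually_elim (rule msig(3))
  ultimately show ?thesis by (subst DERIV_cong_ev[OF refl ev refl]) (simp add: msig(2))
qed

text \<open>Off the lattice the quotient \<open>q\<close> has derivative 0 because zeta is odd, and
  the simple zero of sigma makes its limit at the origin \<open>- 1\<close>.\<close>

lemma wsigma_odd: "wsigma L (- z) = - wsigma L z"
proof (cases "z \<in> L")
  case True
  then show ?thesis using wsigma_eq_0_iff[of z] wsigma_eq_0_iff[of "- z"] by simp
next
  case False
  define q where "q z = wsigma L (- z) / wsigma L z" for z
  have "(q has_field_derivative 0) (at z)" if "z \<notin> L" for z
  proof -
    have nz: "wsigma L z \<noteq> 0" using that wsigma_eq_0_iff by simp
    have "((\<lambda>z. wsigma L (- z)) has_field_derivative (wsigma L (- z) * wzeta L (- z)) * - 1) (at z)"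
      by (rule DERIV_chain2[OF wsigma_deriv]) (use that in \<open>auto intro!: derivative_eq_intros\<close>)
    from DERIV_divide[OF this wsigma_deriv[OF that] nz] show ?thesis
      unfolding q_def[abs_def] by (simp add: wzeta_odd mult_ac)
  qed
  then have const: "q z = q w" if "z \<notin> L" "w \<notin> L" for z w using constant_off_L that by blast
  have "(q \<longlongrightarrow> - 1) (at 0)"
  proof (rule tendsto_at_0I[of q "\<lambda>z. - msig (- z) / msig z"])
    fix z :: complex assume z: "z \<in> ball 0 cL - {0}"
    then have "wsigma L (- z) = - z * msig (- z)" "wsigma L z = z * msig z" by (simp_all add: msig(3))
    then show "q z = - msig (- z) / msig z" using z by (simp add: q_def)
  next
    have c: "isCont msig 0" using msig(1) cL_pos
      by (auto intro!: continuous_on_interior[of "ball 0 cL"] holomorphic_on_imp_continuous_on)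
    show "isCont (\<lambda>z. - msig (- z) / msig z) 0"
      using c by (intro continuous_intros isCont_o2[of 0 uminus msig]) (auto simp: msig(2))
  qed (simp add: msig(2))
  moreover have "\<forall>\<^sub>F u in at 0. u \<in> ball 0 cL - {0}" using cL_pos by (intro eventually_at_in_open) auto
  then have "\<forall>\<^sub>F u in at 0. q u = q z"
    by eventually_elim (use const False ball_cL_sub' in blast)
  then have "(q \<longlongrightarrow> q z) (at 0)" by (rule tendsto_eventually)
  ultimately have "q z = - 1" using LIM_unique by blast
  moreover have "wsigma L z \<noteq> 0" using False wsigma_eq_0_iff by simp
  ultimately show ?thesis by (simp add: q_def field_simps)
qed

end

text \<open>Differences of the three equations express \<open>g2\<close> in two ways and force
  \<open>a + b + c = 0\<close>. The discriminant is then 16 times the square of the product of the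
  differences of the roots.\<close>

lemma cubic_discriminant_nz:
  fixes a b c g2 g3 :: complex
  assumes r: "4 * a ^ 3 - g2 * a - g3 = 0" "4 * b ^ 3 - g2 * b - g3 = 0" "4 * c ^ 3 - g2 * c - g3 = 0"
    and ne: "a \<noteq> b" "a \<noteq> c" "b \<noteq> c"
  shows "g2 ^ 3 - 27 * g3 ^ 2 \<noteq> 0"
proof -
  have "(a - b) * (4 * (a\<^sup>2 + a * b + b\<^sup>2) - g2) = 0" using r(1,2) by algebra
  then have g2: "g2 = 4 * (a\<^sup>2 + a * b + b\<^sup>2)" using ne by simp
  have "(a - c) * (4 * (a\<^sup>2 + a * c + c\<^sup>2) - g2) = 0" using r(1,3) by algebra
  then have "g2 = 4 * (a\<^sup>2 + a * c + c\<^sup>2)" using ne by simp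
  then have "(b - c) * (a + b + c) = 0" using g2 by algebra
  then have "a + b + c = 0" using ne by (simp del: distrib_left)
  then have "c = - a - b" by algebra
  moreover have "g3 = 4 * a ^ 3 - g2 * a" using r(1) by simp
  ultimately have "g2 ^ 3 - 27 * g3 ^ 2 = 16 * ((a - b) * (a - c) * (b - c)) ^ 2"
    using g2 by algebra
  then show ?thesis using ne by simp
qed

lemma DERIV_unique_ev:
  assumes "(f has_field_derivative a) (at z)" "(g has_field_derivative b) (at z)" "\<forall>\<^sub>F x in nhds z. f x = g x"
  shows "a = b"
  using assms DERIV_cong_ev[OF refl assms(3) refl] DERIV_unique by blast

section \<open>Addition formulas obtained from sigma\<close>

context lattice
begin

text \<open>The two sides have the same logarithmic derivative, since zeta changes by
  \<open>eta v\<close>. The factor \<open>C\<close> is left undetermined because it cancels in the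
  quotients formed later.\<close>

lemma wsigma_quasi_periodic:
  assumes v: "v \<in> L"
  obtains C where "\<And>z. wsigma L (z + v) = C * exp (eta v * z) * wsigma L z"
proof -
  define q where "q z = wsigma L (z + v) * exp (- eta v * z) / wsigma L z" for z
  have nz: "wsigma L z \<noteq> 0" if "z \<notin> L" for z using that wsigma_eq_0_iff by simp
  have "(q has_field_derivative 0) (at z)" if "z \<notin> L" for z
  proof -
    have "((\<lambda>z. wsigma L (z + v)) has_field_derivative wsigma L (z + v) * wzeta L (z + v)) (at z)"
      using DERIV_shift_lattice[OF wsigma_deriv that v] .
    moreover have "((\<lambda>z. exp (- eta v * z)) has_field_derivative exp (- eta v * z) * - eta v) (at z)"
      by (auto intro!: derivative_eq_intros)
    ultimately have "((\<lambda>z. wsigma L (z + v) * exp (- eta v * z)) has_field_derivative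
      wsigma L (z + v) * wzeta L (z + v) * exp (- eta v * z) + exp (- eta v * z) * - eta v * wsigma L (z + v)) (at z)"
      by (rule DERIV_mult)
    from DERIV_divide[OF this wsigma_deriv[OF that] nz[OF that]]
    have "(q has_field_derivative ((wsigma L (z + v) * wzeta L (z + v) * exp (- eta v * z) +
      exp (- eta v * z) * - eta v * wsigma L (z + v)) * wsigma L z -
      wsigma L (z + v) * exp (- eta v * z) * (wsigma L z * wzeta L z)) / (wsigma L z * wsigma L z)) (at z)"
      unfolding q_def[abs_def] .
    also have "wzeta L (z + v) = wzeta L z + eta v" using v that by (rule wzeta_quasi_periodic)
    finally show ?thesis by (simp add: algebra_simps)
  qed
  then have const: "q z = q (\<omega>\<^sub>1 / 2)" if "z \<notin> L" for z
    using constant_off_L[of q] that half_notin(1) by blast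
  have "wsigma L (z + v) = q (\<omega>\<^sub>1 / 2) * exp (eta v * z) * wsigma L z" for z
  proof (cases "z \<in> L")
    case True
    then have "z + v \<in> L" using v by auto
    with True have "wsigma L (z + v) = 0" "wsigma L z = 0" using wsigma_eq_0_iff by blast+
    then show ?thesis by simp
  next
    case False
    have "wsigma L (z + v) = q z * exp (eta v * z) * wsigma L z"
      using nz[OF False] by (simp add: q_def exp_minus field_simps)
    then show ?thesis using const[OF False] by simp
  qed
  then show ?thesis by (rule that)
qed

lemma msig_even: "z \<in> ball 0 cL \<Longrightarrow> msig (- z) = msig z"
  using msig(3)[of z] msig(3)[of "- z"] wsigma_odd[of z] by (cases "z = 0") auto

lemma wsigma_field_differentiable: "(wsigma L has_field_derivative deriv (wsigma L) z) (at z)"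
  by (rule holomorphic_derivI[OF wsigma_holomorphic open_UNIV UNIV_I])

text \<open>The quotient below is elliptic with a double pole at the origin, like \<open>wp\<close>; by parity
  there is no simple pole left after subtracting it.\<close>

lemma wsigma_product:
  assumes z: "z \<notin> L" and p: "p \<notin> L"
  shows "wsigma L (z + p) * wsigma L (z - p) = - (wsigma L p)\<^sup>2 * (wsigma L z)\<^sup>2 * (wp L z - wp L p)"
proof -
  define N where "N z = wsigma L (z + p) * wsigma L (z - p)" for z
  define f where "f z = N z / (wsigma L z)\<^sup>2 + (wsigma L p)\<^sup>2 * wp L z" for z
  define u where "u z = N z / (msig z)\<^sup>2" for z
  have nz: "wsigma L z \<noteq> 0" if "z \<notin> L" for z using that wsigma_eq_0_iff by simp
  have shift: "(\<lambda>z. wsigma L (z + c)) holomorphic_on S" for c S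
    using holomorphic_on_compose[of "\<lambda>z. z + c" S "wsigma L"] wsigma_holomorphic holomorphic_on_add[OF holomorphic_on_ident holomorphic_on_const]
    unfolding o_def by blast
  have N: "N holomorphic_on S" for S
    unfolding N_def using shift[of "- p"] by (intro holomorphic_intros shift) simp_all
  have N_even: "N (- z) = N z" for z
  proof -
    have "wsigma L (- z + p) = - wsigma L (z - p)" "wsigma L (- z - p) = - wsigma L (z + p)"
    proof -
      have "- z + p = - (z - p)" "- z - p = - (z + p)" by simp_all
      then show "wsigma L (- z + p) = - wsigma L (z - p)" "wsigma L (- z - p) = - wsigma L (z + p)"
        by (simp_all only: wsigma_odd)
    qed
    then show ?thesis by (simp add: N_def mult.commute)
  qed
  have hol: "f holomorphic_on - L"
    unfolding f_def using nz by (intro holomorphic_intros N wp_holomorphic) auto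
  have per: "f (z + v) = f z" if "z \<notin> L" "v \<in> L" for z v
  proof -
    obtain C where C: "\<And>z. wsigma L (z + v) = C * exp (eta v * z) * wsigma L z"
      using wsigma_quasi_periodic[OF \<open>v \<in> L\<close>] by blast
    have C0: "C \<noteq> 0" using C[of "\<omega>\<^sub>1 / 2"] nz[of "\<omega>\<^sub>1 / 2 + v"] that half_notin(1) by auto
    have "exp (eta v * (z + p)) * exp (eta v * (z - p)) = (exp (eta v * z))\<^sup>2"
      by (simp add: power2_eq_square algebra_simps flip: exp_add)
    then have "N (z + v) = C\<^sup>2 * (exp (eta v * z))\<^sup>2 * N z"
      using C[of "z + p"] C[of "z - p"] by (simp add: N_def algebra_simps power2_eq_square)
    moreover have "(wsigma L (z + v))\<^sup>2 = C\<^sup>2 * (exp (eta v * z))\<^sup>2 * (wsigma L z)\<^sup>2"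
      by (simp add: C power_mult_distrib)
    ultimately show ?thesis using C0 that wp_periodic by (simp add: f_def)
  qed
  have u0: "u 0 = - (wsigma L p)\<^sup>2"
    by (simp add: u_def N_def msig(2) wsigma_odd power2_eq_square)
  have "u holomorphic_on ball 0 cL"
    unfolding u_def by (intro holomorphic_intros N msig(1)) (auto simp: msig(4))
  then obtain d where d: "(u has_field_derivative d) (at 0)"
    using cL_pos by (meson centre_in_ball holomorphic_on_open open_ball)
  have "((\<lambda>z. u (- z)) has_field_derivative d * - 1) (at 0)"
    by (rule DERIV_chain2[of u]) (use d in \<open>auto intro!: derivative_eq_intros\<close>)
  moreover have "\<forall>\<^sub>F z in nhds 0. z \<in> ball 0 cL" using cL_pos by (intro eventually_nhds_in_open) auto
  then have "\<forall>\<^sub>F z in nhds 0. u (- z) = u z"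
    by eventually_elim (simp add: u_def N_even msig_even)
  ultimately have "d * - 1 = d" using DERIV_unique_ev[OF _ d] by blast
  then have "d = 0" by simp
  then have lim1: "((\<lambda>z. (u z - u 0) / z) \<longlongrightarrow> 0) (at 0)" using d by (simp add: has_field_derivative_iff)
  have "isCont gwp 0" using gwp_deriv(1)[of 0] DERIV_isCont by (auto simp: L0_def)
  then have "((\<lambda>z. (wsigma L p)\<^sup>2 * (z * gwp z)) \<longlongrightarrow> (wsigma L p)\<^sup>2 * (0 * gwp 0)) (at 0)"
    by (intro tendsto_intros) (auto simp: isCont_def)
  from tendsto_add[OF lim1 this]
  have "((\<lambda>z. (u z - u 0) / z + (wsigma L p)\<^sup>2 * (z * gwp z)) \<longlongrightarrow> 0) (at 0)" by simp
  moreover have "\<forall>\<^sub>F z in at 0. z \<in> ball 0 cL - {0}" using cL_pos by (intro eventually_at_in_open) auto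
  then have "\<forall>\<^sub>F z in at 0. (u z - u 0) / z + (wsigma L p)\<^sup>2 * (z * gwp z) = z * f z"
  proof eventually_elim
    case (elim z)
    have key: "(U - - S) / z + S * (z * g) = z * (U / z\<^sup>2 + S * (1 / z\<^sup>2 + g))" for U S g
      using elim by (simp add: field_simps power2_eq_square)
    have "wsigma L z = z * msig z" using elim by (intro msig(3)) auto
    then have "N z / (wsigma L z)\<^sup>2 = u z / z\<^sup>2"
      by (simp add: u_def power_mult_distrib divide_divide_eq_left mult.commute)
    then show ?case unfolding f_def u0 wp_eq by (simp only: key)
  qed
  ultimately have "((\<lambda>z. z * f z) \<longlongrightarrow> 0) (at 0)" by (rule Lim_transform_eventually)
  then obtain c where c: "\<And>z. z \<notin> L \<Longrightarrow> f z = c" using elliptic_constant[OF hol per] by auto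
  \<comment> \<open>The constant is read off at \<open>z = p\<close>, where the product of sigmas
    vanishes with \<open>wsigma L 0\<close>.\<close>
  have "f p = (wsigma L p)\<^sup>2 * wp L p" using wsigma_eq_0_iff[of 0] by (simp add: f_def N_def)
  then have "f z = (wsigma L p)\<^sup>2 * wp L p" using c z p by metis
  then show ?thesis using nz[OF z] by (simp add: f_def N_def field_simps)
qed

lemma wp_eq_iff:
  assumes "z \<notin> L" "p \<notin> L"
  shows "wp L z = wp L p \<longleftrightarrow> z + p \<in> L \<or> z - p \<in> L"
  using wsigma_product[OF assms] wsigma_eq_0_iff[of "z + p"] wsigma_eq_0_iff[of "z - p"] assms
    wsigma_eq_0_iff[of p] wsigma_eq_0_iff[of z]
  by (metis mult_eq_0_iff neg_equal_0_iff_equal power_eq_0_iff right_minus_eq)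

text \<open>The derivative of \<open>wsigma_product\<close> at \<open>z = p\<close>: as both
  \<open>wsigma L (z - p)\<close> and \<open>wp L z - wp L p\<close> vanish there, only their
  derivatives contribute. The formula locates the zeros of \<open>wp1\<close> and shows that it is
  odd.\<close>

lemma wp1_eq_wsigma:
  assumes p: "p \<notin> L"
  shows "wp1 p = - wsigma L (2 * p) / wsigma L p ^ 4"
proof -
  have nz: "wsigma L p \<noteq> 0" using p wsigma_eq_0_iff by simp
  have 1: "((\<lambda>z. wsigma L (z + p)) has_field_derivative deriv (wsigma L) (p + p)) (at p)"
    using wsigma_field_differentiable[of "p + p"] DERIV_shift by blast
  have 2: "((\<lambda>z. wsigma L (z - p)) has_field_derivative 1) (at p)"
    using wsigma_deriv_0 DERIV_shift[of "wsigma L" 1 p "- p"] by simp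
  have d1: "((\<lambda>z. wsigma L (z + p) * wsigma L (z - p)) has_field_derivative wsigma L (p + p)) (at p)"
    using DERIV_mult[OF 1 2] wsigma_eq_0_iff[of 0] by simp
  have 3: "((\<lambda>z. - (wsigma L p)\<^sup>2 * (wsigma L z)\<^sup>2) has_field_derivative
      - (wsigma L p)\<^sup>2 * (2 * wsigma L p * (wsigma L p * wzeta L p))) (at p)"
    using wsigma_deriv[OF p] by (auto intro!: derivative_eq_intros)
  have 4: "((\<lambda>z. wp L z - wp L p) has_field_derivative wp1 p) (at p)"
    using wp_deriv[OF p] by (auto intro!: derivative_eq_intros)
  have d2: "((\<lambda>z. - (wsigma L p)\<^sup>2 * (wsigma L z)\<^sup>2 * (wp L z - wp L p)) has_field_derivative - (wsigma L p ^ 4) * wp1 p) (at p)"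
    using DERIV_mult[OF 3 4] by (simp add: power2_eq_square power4_eq_xxxx mult_ac)
  have "\<forall>\<^sub>F u in nhds p. wsigma L (u + p) * wsigma L (u - p) = - (wsigma L p)\<^sup>2 * (wsigma L u)\<^sup>2 * (wp L u - wp L p)"
    using eventually_notin_L[OF p] by eventually_elim (rule wsigma_product[OF _ p])
  then have "wsigma L (p + p) = - (wsigma L p ^ 4) * wp1 p" by (rule DERIV_unique_ev[OF d1 d2])
  then show ?thesis using nz by (simp add: field_simps mult_2)
qed

lemma wp1_eq_0_iff: "p \<notin> L \<Longrightarrow> wp1 p = 0 \<longleftrightarrow> 2 * p \<in> L"
  using wp1_eq_wsigma[of p] wsigma_eq_0_iff[of p] wsigma_eq_0_iff[of "2 * p"] by simp

lemma wp1_odd: "p \<notin> L \<Longrightarrow> wp1 (- p) = - wp1 p"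
  using wp1_eq_wsigma[of p] wp1_eq_wsigma[of "- p"] wsigma_odd[of p] wsigma_odd[of "2 * p"] by simp

text \<open>The logarithmic derivative of \<open>wsigma_product\<close> with respect to
  \<open>z\<close>, cleared of denominators.\<close>

lemma wzeta_sum:
  assumes "z \<notin> L" "p \<notin> L" "z + p \<notin> L" "z - p \<notin> L"
  shows "wzeta L (z + p) + wzeta L (z - p) - 2 * wzeta L z = wp1 z / (wp L z - wp L p)"
proof -
  let ?N = "wsigma L (z + p) * wsigma L (z - p)"
  let ?s = "wsigma L z" and ?t = "wsigma L p" and ?D = "wp L z - wp L p"
  have N: "?N = - ?t\<^sup>2 * ?s\<^sup>2 * ?D" using assms by (intro wsigma_product)
  have nz: "?N \<noteq> 0" using assms wsigma_eq_0_iff by simp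
  have 1: "((\<lambda>z. wsigma L (z + p)) has_field_derivative wsigma L (z + p) * wzeta L (z + p)) (at z)"
    using wsigma_deriv[OF assms(3)] by (simp add: DERIV_shift)
  have 2: "((\<lambda>z. wsigma L (z - p)) has_field_derivative wsigma L (z - p) * wzeta L (z - p)) (at z)"
    using wsigma_deriv[OF assms(4)] DERIV_shift[of "wsigma L" _ z "- p"] by simp
  have d1: "((\<lambda>z. wsigma L (z + p) * wsigma L (z - p)) has_field_derivative ?N * (wzeta L (z + p) + wzeta L (z - p))) (at z)"
    using DERIV_mult[OF 1 2] by (simp add: algebra_simps)
  have 3: "((\<lambda>z. - ?t\<^sup>2 * (wsigma L z)\<^sup>2) has_field_derivative - ?t\<^sup>2 * (2 * ?s * (?s * wzeta L z))) (at z)"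
    using wsigma_deriv[OF assms(1)] by (auto intro!: derivative_eq_intros)
  have 4: "((\<lambda>z. wp L z - wp L p) has_field_derivative wp1 z) (at z)"
    using wp_deriv[OF assms(1)] by (auto intro!: derivative_eq_intros)
  have d2: "((\<lambda>z. - ?t\<^sup>2 * (wsigma L z)\<^sup>2 * (wp L z - wp L p)) has_field_derivative
      - ?t\<^sup>2 * (2 * ?s * (?s * wzeta L z)) * ?D + wp1 z * (- ?t\<^sup>2 * ?s\<^sup>2)) (at z)"
    by (rule DERIV_mult[OF 3 4])
  have "\<forall>\<^sub>F z in nhds z. wsigma L (z + p) * wsigma L (z - p) = - ?t\<^sup>2 * (wsigma L z)\<^sup>2 * (wp L z - wp L p)"
    using eventually_notin_L[OF assms(1)] by eventually_elim (rule wsigma_product[OF _ assms(2)])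
  then have "?N * (wzeta L (z + p) + wzeta L (z - p)) = - ?t\<^sup>2 * (2 * ?s * (?s * wzeta L z)) * ?D + wp1 z * (- ?t\<^sup>2 * ?s\<^sup>2)"
    by (rule DERIV_unique_ev[OF d1 d2])
  then have "- ?t\<^sup>2 * ?s\<^sup>2 * (?D * (wzeta L (z + p) + wzeta L (z - p) - 2 * wzeta L z) - wp1 z) = 0"
    unfolding N by (simp add: algebra_simps power2_eq_square)
  moreover have "- ?t\<^sup>2 * ?s\<^sup>2 \<noteq> 0" "?D \<noteq> 0" using nz N by auto
  ultimately have "?D * (wzeta L (z + p) + wzeta L (z - p) - 2 * wzeta L z) = wp1 z" by simp
  then show ?thesis using \<open>?D \<noteq> 0\<close> by (simp add: field_simps)
qed

text \<open>This is \<open>wzeta_sum\<close> with \<open>z\<close> and \<open>p\<close> exchanged,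
  combined with the oddness of zeta.\<close>

lemma wzeta_diff:
  assumes "z \<notin> L" "p \<notin> L" "z + p \<notin> L" "z - p \<notin> L"
  shows "wzeta L (z + p) - wzeta L (z - p) - 2 * wzeta L p = - wp1 p / (wp L z - wp L p)"
proof -
  have "p - z \<notin> L" using assms(4) uminus_in[of "z - p"] by simp
  then have "wzeta L (p + z) + wzeta L (p - z) - 2 * wzeta L p = wp1 p / (wp L p - wp L z)"
    using assms by (intro wzeta_sum) (auto simp: add.commute)
  moreover have "wzeta L (p - z) = - wzeta L (z - p)" using wzeta_odd[of "z - p"] by simp
  moreover have "wp1 p / (wp L p - wp L z) = - wp1 p / (wp L z - wp L p)"
    by (metis minus_diff_eq minus_divide_divide minus_minus)
  ultimately show ?thesis by (simp add: add.commute)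
qed

text \<open>Otherwise \<open>1 / (wp L z - c)\<close> would be elliptic and holomorphic off the
  lattice with limit 0 at the origin, hence 0 everywhere.\<close>

lemma wp_surj: obtains z where "z \<notin> L" "wp L z = c"
proof (rule ccontr)
  assume "\<not> thesis"
  then have ne: "wp L z \<noteq> c" if "z \<notin> L" for z using that \<open>\<And>z. z \<notin> L \<Longrightarrow> wp L z = c \<Longrightarrow> thesis\<close> by blast
  have "1 / (wp L (\<omega>\<^sub>1 / 2) - c) = 0"
  proof (rule elliptic_constant_lim[of "\<lambda>z. 1 / (wp L z - c)"])
    show "(\<lambda>z. 1 / (wp L z - c)) holomorphic_on - L"
      using ne by (intro holomorphic_intros wp_holomorphic) auto
    have g: "isCont gwp 0" using gwp_deriv(1)[of 0] DERIV_isCont by (auto simp: L0_def)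
    show "((\<lambda>z. 1 / (wp L z - c)) \<longlongrightarrow> 0) (at 0)"
    proof (rule tendsto_at_0I[of _ "\<lambda>z. z\<^sup>2 / (1 + z\<^sup>2 * (gwp z - c))"])
      show "isCont (\<lambda>z. z\<^sup>2 / (1 + z\<^sup>2 * (gwp z - c))) 0" using g by (intro continuous_intros) auto
    next
      fix z :: complex assume z: "z \<in> ball 0 cL - {0}"
      have "wp L z - c = (1 + z\<^sup>2 * (gwp z - c)) / z\<^sup>2" using z by (simp add: wp_eq field_simps)
      then show "1 / (wp L z - c) = z\<^sup>2 / (1 + z\<^sup>2 * (gwp z - c))" by simp
    qed auto
  qed (use half_notin wp_periodic in auto)
  then show False using ne[OF half_notin(1)] by simp
qed

lemma wp_curve_surj:
  assumes "y\<^sup>2 = 4 * x ^ 3 - inv_g2 L * x - inv_g3 L"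
  obtains z where "z \<notin> L" "wp L z = x" "wp1 z = y"
proof -
  obtain z where z: "z \<notin> L" "wp L z = x" by (rule wp_surj)
  have "(wp1 z)\<^sup>2 = y\<^sup>2" using wp1_square[OF z(1)] z(2) assms by simp
  then have "wp1 z = y \<or> wp1 (- z) = y" using wp1_odd[OF z(1)] by (auto simp: power2_eq_iff)
  then show ?thesis using that[of z] that[of "- z"] z wp_even by auto
qed

text \<open>The values at the three half periods are roots of the cubic because \<open>wp1\<close>
  vanishes there, and they are distinct because neither sums nor differences of two of the half
  periods are lattice points.\<close>

lemma discriminant_nz: "inv_g2 L ^ 3 - 27 * inv_g3 L ^ 2 \<noteq> 0"
proof -
  let ?a = "wp L (\<omega>\<^sub>1 / 2)" and ?b = "wp L (\<omega>\<^sub>2 / 2)" and ?c = "wp L ((\<omega>\<^sub>1 + \<omega>\<^sub>2) / 2)"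
  have root: "4 * wp L z ^ 3 - inv_g2 L * wp L z - inv_g3 L = 0" if "z \<notin> L" "2 * z \<in> L" for z
    using wp1_square[OF that(1)] wp1_eq_0_iff[OF that(1)] that(2) by simp
  have r: "4 * ?a ^ 3 - inv_g2 L * ?a - inv_g3 L = 0" "4 * ?b ^ 3 - inv_g2 L * ?b - inv_g3 L = 0"
    "4 * ?c ^ 3 - inv_g2 L * ?c - inv_g3 L = 0"
  proof -
    have "2 * (x / 2) = x" for x :: complex by simp
    from this[of "\<omega>\<^sub>1 + \<omega>\<^sub>2"] have "2 * ((\<omega>\<^sub>1 + \<omega>\<^sub>2) / 2) \<in> L"
      using add_in[OF w1_in w2_in] by argo
    then show "4 * ?a ^ 3 - inv_g2 L * ?a - inv_g3 L = 0" "4 * ?b ^ 3 - inv_g2 L * ?b - inv_g3 L = 0"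
      "4 * ?c ^ 3 - inv_g2 L * ?c - inv_g3 L = 0"
      using root[OF half_notin(1)] root[OF half_notin(2)] root[OF half_notin(3)] by simp_all
  qed
  have *: "(\<omega>\<^sub>1 - \<omega>\<^sub>2) / 2 \<notin> L"
  proof
    assume "(\<omega>\<^sub>1 - \<omega>\<^sub>2) / 2 \<in> L"
    then have "(\<omega>\<^sub>1 - \<omega>\<^sub>2) / 2 + \<omega>\<^sub>2 \<in> L" using add_in w2_in by blast
    moreover have "(x - y) / 2 + y = (x + y) / 2" for x y :: complex by (simp add: field_simps)
    ultimately show False using half_notin(3) by simp
  qed
  have ab: "?a \<noteq> ?b"
    using wp_eq_iff[OF half_notin(1,2)] half_notin(3) * by (simp add: add_divide_distrib diff_divide_distrib)
  have "\<omega>\<^sub>1 / 2 + (\<omega>\<^sub>1 + \<omega>\<^sub>2) / 2 = \<omega>\<^sub>2 / 2 + \<omega>\<^sub>1" "\<omega>\<^sub>1 / 2 - (\<omega>\<^sub>1 + \<omega>\<^sub>2) / 2 = - (\<omega>\<^sub>2 / 2)"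
    "\<omega>\<^sub>2 / 2 + (\<omega>\<^sub>1 + \<omega>\<^sub>2) / 2 = \<omega>\<^sub>1 / 2 + \<omega>\<^sub>2" "\<omega>\<^sub>2 / 2 - (\<omega>\<^sub>1 + \<omega>\<^sub>2) / 2 = - (\<omega>\<^sub>1 / 2)"
    by (simp_all add: field_simps)
  then have ac: "?a \<noteq> ?c" and bc: "?b \<noteq> ?c"
    using wp_eq_iff[OF half_notin(1,3)] wp_eq_iff[OF half_notin(2,3)] half_notin by auto
  show ?thesis by (rule cubic_discriminant_nz[OF r ab ac bc])
qed

end

section \<open>Every nonsingular Weierstrass equation comes from a lattice\<close>

lemma lattice_basis_change:
  assumes "lattice_basis L u v"
  shows lattice_basis_swap: "lattice_basis L v u"
    and lattice_basis_neg: "lattice_basis L u (- v)"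
    and lattice_basis_shear: "lattice_basis L u (v - of_int k * u)"
proof -
  have im: "Im (v / u) \<noteq> 0" and L: "L = {of_int a * u + of_int b * v |a b. True}"
    using assms by (auto simp: lattice_basis_def)
  have nz: "u \<noteq> 0" "v \<noteq> 0" using im by auto
  have "Im (u / v) \<noteq> 0"
  proof
    assume "Im (u / v) = 0"
    then have "u / v \<in> \<real>" by (simp add: complex_is_Real_iff)
    then have "inverse (u / v) \<in> \<real>" by (rule Reals_inverse)
    then show False using im by (simp add: complex_is_Real_iff)
  qed
  moreover have "L = {of_int a * v + of_int b * u |a b. True}"
    unfolding L by (rule Collect_cong) (metis add.commute)
  ultimately show "lattice_basis L v u" by (simp add: lattice_basis_def)
  have "(\<exists>a b. x = of_int a * u + of_int b * v) \<longleftrightarrow> (\<exists>a b. x = of_int a * u + of_int b * - v)" for x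
  proof safe
    fix a b :: int
    show "\<exists>a' b'. complex_of_int a * u + of_int b * v = of_int a' * u + of_int b' * - v"
      by (rule exI[of _ a], rule exI[of _ "- b"]) simp
    show "\<exists>a' b'. complex_of_int a * u + of_int b * - v = of_int a' * u + of_int b' * v"
      by (rule exI[of _ a], rule exI[of _ "- b"]) simp
  qed
  then have "L = {of_int a * u + of_int b * - v |a b. True}" unfolding L by simp
  then show "lattice_basis L u (- v)" using im by (simp add: lattice_basis_def)
  have "(\<exists>a b. x = of_int a * u + of_int b * v) \<longleftrightarrow> (\<exists>a b. x = of_int a * u + of_int b * (v - of_int k * u))" for x
  proof safe
    fix a b :: int
    show "\<exists>a' b'. complex_of_int a * u + of_int b * v = of_int a' * u + of_int b' * (v - of_int k * u)"
      by (rule exI[of _ "a + b * k"], rule exI[of _ b]) (simp add: algebra_simps)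
    show "\<exists>a' b'. complex_of_int a * u + of_int b * (v - of_int k * u) = of_int a' * u + of_int b' * v"
      by (rule exI[of _ "a - b * k"], rule exI[of _ b]) (simp add: algebra_simps)
  qed
  then have "L = {of_int a * u + of_int b * (v - of_int k * u) |a b. True}" unfolding L by simp
  moreover have "Im ((v - of_int k * u) / u) \<noteq> 0" using im nz by (simp add: diff_divide_distrib)
  ultimately show "lattice_basis L u (v - of_int k * u)" by (simp add: lattice_basis_def)
qed

definition std_lattice :: "complex \<Rightarrow> complex set" where
  "std_lattice \<tau> = {of_int a + of_int b * \<tau> |a b. True}"

lemma std_lattice_basis: "Im \<tau> \<noteq> 0 \<Longrightarrow> lattice_basis (std_lattice \<tau>) 1 \<tau>"
  by (simp add: lattice_basis_def std_lattice_def)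

lemma lattice_std: "Im \<tau> \<noteq> 0 \<Longrightarrow> lattice (std_lattice \<tau>) 1 \<tau>"
  by (simp add: lattice_def std_lattice_basis)

lemma
  assumes "c \<noteq> 0"
  shows inv_g2_scale: "inv_g2 ((*) c ` L) = inv_g2 L / c ^ 4"
    and inv_g3_scale: "inv_g3 ((*) c ` L) = inv_g3 L / c ^ 6"
proof -
  have eq: "(*) c ` L - {0} = (*) c ` (L - {0})" using assms by auto
  have inj: "inj_on ((*) c) (L - {0})" using assms by (simp add: inj_on_def)
  have *: "(\<Sum>\<^sub>\<infinity>\<omega>\<in>(*) c ` L - {0}. 1 / \<omega> ^ k) = (\<Sum>\<^sub>\<infinity>\<omega>\<in>L - {0}. 1 / \<omega> ^ k) / c ^ k" for k
  proof -
    have "(\<Sum>\<^sub>\<infinity>\<omega>\<in>(*) c ` L - {0}. 1 / \<omega> ^ k) = (\<Sum>\<^sub>\<infinity>\<omega>\<in>L - {0}. inverse (c ^ k) * (1 / \<omega> ^ k))"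
      unfolding eq infsum_reindex[OF inj] by (intro infsum_cong) (simp add: o_def power_mult_distrib divide_inverse)
    then show ?thesis by (simp add: infsum_cmult_right' divide_inverse)
  qed
  show "inv_g2 ((*) c ` L) = inv_g2 L / c ^ 4" "inv_g3 ((*) c ` L) = inv_g3 L / c ^ 6"
    by (simp_all only: inv_g2_def inv_g3_def * times_divide_eq_right)
qed

lemma lattice_basis_std:
  assumes "lattice_basis L u v"
  shows "L = (*) u ` std_lattice (v / u)"
proof -
  have nz: "u \<noteq> 0" and L: "L = {of_int a * u + of_int b * v |a b. True}" using assms by (auto simp: lattice_basis_def)
  have "of_int a * u + of_int b * v = u * (of_int a + of_int b * (v / u))" for a b
    using nz by (simp add: field_simps)
  then show ?thesis unfolding L std_lattice_def by (auto simp: image_iff)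
qed

lemma is_lattice_scale: assumes "is_lattice L" "c \<noteq> 0" shows "is_lattice ((*) c ` L)"
proof -
  obtain u v where "lattice_basis L u v" using assms by (auto simp: is_lattice_def)
  then have im: "Im (v / u) \<noteq> 0" and L: "L = {of_int a * u + of_int b * v |a b. True}"
    by (auto simp: lattice_basis_def)
  have "c * (of_int a * u + of_int b * v) = of_int a * (c * u) + of_int b * (c * v)" for a b
    by (simp add: algebra_simps)
  then have "(*) c ` L = {of_int a * (c * u) + of_int b * (c * v) |a b. True}"
    unfolding L by (auto simp: image_iff) metis
  then have "lattice_basis ((*) c ` L) (c * u) (c * v)"
    using assms(2) im by (simp add: lattice_basis_def)
  then show ?thesis by (auto simp: is_lattice_def)
qed

section \<open>The modular invariant and reduced periods\<close>

abbreviation "g2t \<tau> \<equiv> inv_g2 (std_lattice \<tau>)"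
abbreviation "g3t \<tau> \<equiv> inv_g3 (std_lattice \<tau>)"

text \<open>Klein's invariant J, that is, the usual j without the factor 1728.\<close>

definition jinv :: "complex \<Rightarrow> complex" where
  "jinv \<tau> = g2t \<tau> ^ 3 / (g2t \<tau> ^ 3 - 27 * g3t \<tau> ^ 2)"

definition jset :: "complex set \<Rightarrow> complex" where
  "jset L = inv_g2 L ^ 3 / (inv_g2 L ^ 3 - 27 * inv_g3 L ^ 2)"

lemma jset_scale: "c \<noteq> 0 \<Longrightarrow> jset ((*) c ` L) = jset L"
proof -
  assume "c \<noteq> 0"
  have "(inv_g2 L / c ^ 4) ^ 3 = inv_g2 L ^ 3 / c ^ 12" "(inv_g3 L / c ^ 6) ^ 2 = inv_g3 L ^ 2 / c ^ 12"
    by (simp_all add: power_divide flip: power_mult)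
  then have "jset ((*) c ` L) = (inv_g2 L ^ 3 / c ^ 12) / ((inv_g2 L ^ 3 - 27 * inv_g3 L ^ 2) / c ^ 12)"
    using \<open>c \<noteq> 0\<close> by (simp add: jset_def inv_g2_scale inv_g3_scale diff_divide_distrib)
  then show ?thesis using \<open>c \<noteq> 0\<close> by (simp add: jset_def)
qed

lemma jset_basis: "lattice_basis L u v \<Longrightarrow> jset L = jinv (v / u)"
proof -
  assume b: "lattice_basis L u v"
  then have "u \<noteq> 0" by (auto simp: lattice_basis_def)
  then have "jset ((*) u ` std_lattice (v / u)) = jset (std_lattice (v / u))" by (rule jset_scale)
  then show "jset L = jinv (v / u)"
    using lattice_basis_std[OF b] by (simp add: jset_def jinv_def)
qed

text \<open>A basis whose first vector is as short as possible.\<close>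

lemma jinv_reduced:
  assumes "Im \<tau> > 0"
  obtains \<tau>' where "Im \<tau>' \<ge> 1 / 2" "\<bar>Re \<tau>'\<bar> \<le> 1 / 2" "jinv \<tau>' = jinv \<tau>"
proof -
  define L where "L = std_lattice \<tau>"
  have b: "lattice_basis L 1 \<tau>" using assms by (simp add: L_def std_lattice_basis)
  interpret lattice L 1 \<tau> by unfold_locales (rule b)
  \<comment> \<open>The bound 1 is the length of the basis vector \<open>1\<close>; it makes
    \<open>S\<close> finite and nonempty.\<close>
  define S where "S = {u \<in> L. norm u \<le> 1 \<and> (\<exists>v. lattice_basis L u v)}"
  have "finite S" unfolding S_def by (rule finite_subset[OF _ finite_lattice_ball[of 1]]) auto
  moreover have "1 \<in> S" unfolding S_def using b w1_in by auto
  ultimately obtain u where u: "u \<in> S" "\<And>x. x \<in> S \<Longrightarrow> norm u \<le> norm x"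
    using arg_min_if_finite[of S norm] by (metis empty_iff not_le)
  have min: "norm u \<le> norm x" if "lattice_basis L x y" for x y
  proof (cases "norm x \<le> 1")
    case True
    have "x \<in> L" using lattice.w1_in[of L x y] that by (simp add: lattice_def)
    then show ?thesis using u(2) True that by (auto simp: S_def)
  next
    case False then show ?thesis using u(1) by (auto simp: S_def)
  qed
  obtain v0 where "lattice_basis L u v0" using u(1) by (auto simp: S_def)
  then obtain v where v: "lattice_basis L u v" "Im (v / u) > 0"
  proof (cases "Im (v0 / u) > 0")
    case False
    then have "Im (- v0 / u) > 0" using \<open>lattice_basis L u v0\<close> by (auto simp: lattice_basis_def)
    then show ?thesis using that lattice_basis_neg[OF \<open>lattice_basis L u v0\<close>] by blast
  qed (use that \<open>lattice_basis L u v0\<close> in blast)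
  \<comment> \<open>Rounding brings the real part of the ratio into \<open>[- 1/2, 1/2]\<close>.
    Minimality of \<open>u\<close>, applied to the swapped basis, gives
    \<open>norm (w / u) \<ge> 1\<close>, and the imaginary part is then bounded below.\<close>
  define k where "k = round (Re (v / u))"
  define w where "w = v - of_int k * u"
  have w: "lattice_basis L u w" unfolding w_def by (rule lattice_basis_shear[OF v(1)])
  have nz: "u \<noteq> 0" using v(2) by auto
  have wu: "w / u = v / u - of_int k" using nz by (simp add: w_def diff_divide_distrib)
  have re: "\<bar>Re (w / u)\<bar> \<le> 1 / 2"
    using of_int_round_abs_le[of "Re (v / u)"] by (simp add: wu k_def abs_minus_commute)
  have im: "Im (w / u) > 0" using v(2) by (simp add: wu)
  have "norm u \<le> norm w" using min[OF lattice_basis_swap[OF w]] .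
  then have "1 \<le> norm (w / u)" using nz by (simp add: norm_divide)
  then have "1 \<le> (norm (w / u))\<^sup>2" by simp
  also have "\<dots> = (Re (w / u))\<^sup>2 + (Im (w / u))\<^sup>2" by (simp add: cmod_power2)
  also have "(Re (w / u))\<^sup>2 \<le> (1 / 2)\<^sup>2" using re by (metis abs_ge_zero power2_abs power_mono)
  finally have "(1 / 2)\<^sup>2 \<le> (Im (w / u))\<^sup>2" by (simp add: power2_eq_square)
  then have "1 / 2 \<le> Im (w / u)" using im by (intro power2_le_imp_le[of "1/2"]) auto
  moreover have "jinv (w / u) = jinv \<tau>" using jset_basis[OF w] jset_basis[OF b] by simp
  ultimately show ?thesis using re that by blast
qed

definition pairs0 :: "(int \<times> int) set" where "pairs0 = UNIV - {(0, 0)}"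

lemma inv_g_std:
  assumes "Im \<tau> \<noteq> 0"
  shows "(\<Sum>\<^sub>\<infinity>\<omega>\<in>std_lattice \<tau> - {0}. 1 / \<omega> ^ k) = (\<Sum>\<^sub>\<infinity>(a,b)\<in>pairs0. 1 / (of_int a + of_int b * \<tau>) ^ k)"
proof -
  interpret lattice "std_lattice \<tau>" 1 \<tau> by (rule lattice_std[OF assms])
  have "bij_betw (\<lambda>(a,b). lat a b) pairs0 (std_lattice \<tau> - {0})"
    unfolding bij_betw_def
  proof
    show "inj_on (\<lambda>(a,b). lat a b) pairs0" using inj_lat by (rule inj_on_subset) auto
    have "lat 0 0 = 0" by (simp add: lat_def)
    then have "lat a b = 0 \<longleftrightarrow> (a, b) = (0, 0)" for a b using lat_eq_iff[of a b 0 0] by auto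
    then show "(\<lambda>(a,b). lat a b) ` pairs0 = std_lattice \<tau> - {0}"
      unfolding pairs0_def by (auto elim!: L_cases simp: image_iff)
  qed
  from infsum_reindex_bij_betw[OF this, of "\<lambda>\<omega>. 1 / \<omega> ^ k"]
  show ?thesis by (simp add: case_prod_unfold lat_def)
qed

section \<open>Holomorphy of the Eisenstein series\<close>

abbreviation "sz \<equiv> (\<lambda>p :: int \<times> int. real_of_int (\<bar>fst p\<bar> + \<bar>snd p\<bar>))"

lemma summable_sz: "(\<lambda>p. 1 / sz p ^ 3) summable_on A"
  by (rule summable_on_subset_banach[of _ UNIV]) (use summable_on_int_pair in \<open>simp_all add: case_prod_unfold\<close>)

lemma sz_ge_1: "p \<in> pairs0 \<Longrightarrow> sz p \<ge> 1"
proof -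
  assume "p \<in> pairs0"
  then have "\<bar>fst p\<bar> + \<bar>snd p\<bar> \<ge> 1" by (cases p) (auto simp: pairs0_def)
  then show ?thesis by (metis of_int_1 of_int_le_iff)
qed

lemma norm_pair_ge:
  assumes "d > 0" "Im \<tau> \<ge> d" "norm \<tau> \<le> B" "K = 1 + (1 + B) / d"
  shows "\<bar>a\<bar> + \<bar>b\<bar> \<le> K * norm (of_real a + of_real b * \<tau>)"
proof -
  have "\<bar>a\<bar> + \<bar>b\<bar> \<le> (1 + (1 + norm \<tau>) / \<bar>Im \<tau>\<bar>) * norm (of_real a + of_real b * \<tau>)"
    using assms by (intro abs_coords_le) auto
  also have "\<dots> \<le> K * norm (of_real a + of_real b * \<tau>)"
  proof (rule mult_right_mono)
    show "1 + (1 + norm \<tau>) / \<bar>Im \<tau>\<bar> \<le> K"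
      unfolding assms(4) using assms(1-3) norm_ge_zero[of \<tau>] by (intro add_left_mono frac_le) linarith+
  qed simp
  finally show ?thesis .
qed

text \<open>As \<open>sz p \<ge> 1\<close>, higher powers are dominated by the cube, so that a
  single summable majorant serves both Eisenstein series.\<close>

lemma pair_power_bound:
  fixes w :: complex
  assumes "p \<in> pairs0" "K > 0" "sz p \<le> K * norm w" "k \<ge> 3"
  shows "norm (1 / w ^ k) \<le> K ^ k * (1 / sz p ^ 3)"
proof -
  have s: "sz p \<ge> 1" by (rule sz_ge_1[OF assms(1)])
  have "sz p / K \<le> norm w" "sz p / K > 0" using assms(2,3) s by (simp_all add: field_simps)
  then have "1 / norm w ^ k \<le> 1 / (sz p / K) ^ k"
    by (intro divide_left_mono power_mono mult_pos_pos zero_less_power) auto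
  also have "\<dots> = K ^ k * (1 / sz p ^ k)" by (simp add: power_divide)
  also have "\<dots> \<le> K ^ k * (1 / sz p ^ 3)"
    using s assms by (intro mult_left_mono divide_left_mono power_increasing mult_pos_pos zero_less_power) auto
  finally show ?thesis by (simp add: norm_divide norm_power)
qed

lemma norm_inverse_power4: "norm (c / w ^ 4 :: complex) = norm c * (1 / norm w * norm (1 / w ^ 3))"
  by (simp add: norm_divide norm_power eval_nat_numeral norm_mult)

lemma eisenstein_holomorphic:
  assumes "k \<ge> 3"
  shows "(\<lambda>\<tau>. \<Sum>\<^sub>\<infinity>(a,b)\<in>pairs0. 1 / (of_int a + of_int b * \<tau>) ^ k) holomorphic_on {\<tau>. Im \<tau> > 0}"
proof -
  let ?H = "{\<tau>. Im \<tau> > 0}"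
  have op: "open ?H" by (rule open_halfspace_Im_gt)
  define f where "f p \<tau> = 1 / (of_int (fst p) + of_int (snd p) * \<tau>) ^ k" for p :: "int \<times> int" and \<tau> :: complex
  have nz: "of_int (fst p) + of_int (snd p) * \<tau> \<noteq> 0" if "p \<in> pairs0" "\<tau> \<in> ?H" for p \<tau>
  proof -
    have "sz p \<le> (1 + (1 + norm \<tau>) / Im \<tau>) * norm (of_real (of_int (fst p)) + of_real (of_int (snd p)) * \<tau>)"
      using norm_pair_ge[of "Im \<tau>" \<tau> "norm \<tau>" _ "of_int (fst p)" "of_int (snd p)"] that by simp
    then show ?thesis using sz_ge_1[OF that(1)] by auto
  qed
  have hol: "f p holomorphic_on ?H" if "p \<in> pairs0" for p
    unfolding f_def using nz[OF that] by (intro holomorphic_intros) auto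
  have bd: "\<exists>d>0. \<exists>M. M summable_on pairs0 \<and> (\<forall>p\<in>pairs0. \<forall>\<tau>\<in>ball x d \<inter> ?H. norm (f p \<tau>) \<le> M p)"
    if x: "x \<in> ?H" for x
  proof -
    \<comment> \<open>Half the height of \<open>x\<close>: on the ball of this radius the imaginary
      part stays at least \<open>d\<close>.\<close>
    define d where "d = Im x / 2"
    define K where "K = 1 + (1 + (norm x + d)) / d"
    have d: "d > 0" using x by (simp add: d_def)
    have K: "K > 0" unfolding K_def using d by (intro add_pos_nonneg divide_nonneg_pos) auto
    have "norm (f p \<tau>) \<le> K ^ k * (1 / sz p ^ 3)" if "p \<in> pairs0" "\<tau> \<in> ball x d \<inter> ?H" for p \<tau>
      unfolding f_def
    proof (rule pair_power_bound[OF that(1) K _ assms])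
      have n: "norm (\<tau> - x) < d" using that by (simp add: dist_norm norm_minus_commute)
      then have "\<bar>Im (\<tau> - x)\<bar> < d" using abs_Im_le_cmod[of "\<tau> - x"] by linarith
      then have "Im \<tau> \<ge> d" by (simp add: d_def abs_if split: if_splits)
      moreover have "norm \<tau> \<le> norm x + d" using n norm_triangle_ineq[of x "\<tau> - x"] by simp
      ultimately show "sz p \<le> K * norm (of_int (fst p) + of_int (snd p) * \<tau>)"
        using norm_pair_ge[OF d _ _ K_def, of \<tau> "of_int (fst p)" "of_int (snd p)"] by simp
    qed
    moreover have "(\<lambda>p. K ^ k * (1 / sz p ^ 3)) summable_on pairs0" by (intro summable_on_cmult_right summable_sz)
    ultimately show ?thesis using d by (intro exI[of _ d] conjI exI[of _ "\<lambda>p. K ^ k * (1 / sz p ^ 3)"]) auto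
  qed
  have "\<exists>D. ((\<lambda>\<tau>. \<Sum>\<^sub>\<infinity>p\<in>pairs0. f p \<tau>) has_field_derivative D) (at \<tau>)" if "\<tau> \<in> ?H" for \<tau>
    using infsum_has_field_derivative[OF op hol bd that] by blast
  then have "(\<lambda>\<tau>. \<Sum>\<^sub>\<infinity>p\<in>pairs0. f p \<tau>) holomorphic_on ?H" using holomorphic_on_open[OF op] by blast
  then show ?thesis by (simp add: f_def case_prod_unfold)
qed

lemma g2t_eq: "Im \<tau> \<noteq> 0 \<Longrightarrow> g2t \<tau> = 60 * (\<Sum>\<^sub>\<infinity>(a,b)\<in>pairs0. 1 / (of_int a + of_int b * \<tau>) ^ 4)"
  and g3t_eq: "Im \<tau> \<noteq> 0 \<Longrightarrow> g3t \<tau> = 140 * (\<Sum>\<^sub>\<infinity>(a,b)\<in>pairs0. 1 / (of_int a + of_int b * \<tau>) ^ 6)"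
  by (simp_all add: inv_g2_def inv_g3_def inv_g_std)

lemma jinv_holomorphic: "jinv holomorphic_on {\<tau>. Im \<tau> > 0}"
proof -
  have g2: "g2t holomorphic_on {\<tau>. Im \<tau> > 0}"
    by (rule holomorphic_transform[OF holomorphic_on_mult[OF holomorphic_on_const eisenstein_holomorphic[of 4]]])
      (auto simp: g2t_eq)
  have g3: "g3t holomorphic_on {\<tau>. Im \<tau> > 0}"
    by (rule holomorphic_transform[OF holomorphic_on_mult[OF holomorphic_on_const eisenstein_holomorphic[of 6]]])
      (auto simp: g3t_eq)
  have "g2t \<tau> ^ 3 - 27 * g3t \<tau> ^ 2 \<noteq> 0" if "\<tau> \<in> {\<tau>. Im \<tau> > 0}" for \<tau>
    by (rule lattice.discriminant_nz[OF lattice_std]) (use that in auto)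
  then show ?thesis unfolding jinv_def by (intro holomorphic_intros g2 g3)
qed

subsection \<open>Behaviour at the cusp\<close>

text \<open>In a vertical strip \<open>(1 + norm \<tau>) / Im \<tau>\<close> stays below 3 for
  \<open>Im \<tau> \<ge> 1\<close>, so the constant of \<open>abs_coords_le\<close> does not
  deteriorate towards the cusp.\<close>

lemma norm_pair_ge_cusp:
  assumes "\<bar>Re \<tau>\<bar> \<le> 1 / 2" "Im \<tau> \<ge> 1"
  shows "\<bar>a\<bar> + \<bar>b\<bar> \<le> 4 * norm (of_real a + of_real b * \<tau>)"
proof -
  have "norm \<tau> \<le> \<bar>Re \<tau>\<bar> + \<bar>Im \<tau>\<bar>" by (rule cmod_le)
  then have "(1 + norm \<tau>) / \<bar>Im \<tau>\<bar> \<le> 3" using assms by (simp add: field_simps)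
  then have "(1 + (1 + norm \<tau>) / \<bar>Im \<tau>\<bar>) * norm (of_real a + of_real b * \<tau>) \<le> 4 * norm (of_real a + of_real b * \<tau>)"
    by (intro mult_right_mono) auto
  then show ?thesis using abs_coords_le[of \<tau> a b] assms by linarith
qed

lemma norm_pair_ge_Im: "\<bar>b\<bar> * \<bar>Im \<tau>\<bar> \<le> norm (of_real a + of_real b * \<tau>)"
  using abs_Im_le_cmod[of "of_real a + of_real b * \<tau>"] by (simp add: abs_mult)

definition S3 :: real where "S3 = (\<Sum>\<^sub>\<infinity>p. 1 / sz p ^ 3)"

lemma S3_nonneg: "S3 \<ge> 0" unfolding S3_def by (intro infsum_nonneg) auto

lemma infsum_le_S3:
  assumes "\<And>p. p \<in> A \<Longrightarrow> norm (f p) \<le> C * (1 / sz p ^ 3)" "C \<ge> 0"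
  shows "norm (\<Sum>\<^sub>\<infinity>p\<in>A. f p :: complex) \<le> C * S3" "f summable_on A"
proof -
  have M: "(\<lambda>p. C * (1 / sz p ^ 3)) summable_on A" by (intro summable_on_cmult_right summable_sz)
  then have ns: "(\<lambda>p. norm (f p)) summable_on A"
    by (rule summable_on_comparison_test) (use assms in auto)
  then show "f summable_on A" by (rule abs_summable_summable)
  have "norm (\<Sum>\<^sub>\<infinity>p\<in>A. f p) \<le> (\<Sum>\<^sub>\<infinity>p\<in>A. C * (1 / sz p ^ 3))"
    by (rule norm_infsum_le[OF has_sum_infsum has_sum_infsum]) (use \<open>f summable_on A\<close> M assms in auto)
  also have "\<dots> \<le> (\<Sum>\<^sub>\<infinity>p. C * (1 / sz p ^ 3))"
  proof (rule infsum_mono_neutral[OF M])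
    show "(\<lambda>p. C * (1 / sz p ^ 3)) summable_on UNIV" by (intro summable_on_cmult_right summable_sz)
  qed (use assms(2) in auto)
  also have "\<dots> = C * S3" unfolding S3_def by (simp add: infsum_cmult_right' del: times_divide_eq_right)
  finally show "norm (\<Sum>\<^sub>\<infinity>p\<in>A. f p) \<le> C * S3" .
qed

text \<open>The contribution of the row \<open>b = 0\<close>, which is twice the Riemann zeta value
  at 4 and the limit of the Eisenstein sum of weight 4 at the cusp.\<close>

definition Z4 :: complex where "Z4 = (\<Sum>\<^sub>\<infinity>p\<in>pairs0 \<inter> {p. snd p = 0}. 1 / of_int (fst p) ^ 4)"

lemma Z4_nz: "Z4 \<noteq> 0"
proof -
  let ?A = "pairs0 \<inter> {p :: int \<times> int. snd p = 0}"
  have s: "(\<lambda>p::int\<times>int. 1 / real_of_int (fst p) ^ 4) summable_on ?A"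
  proof (rule summable_on_comparison_test[OF summable_sz])
    fix p assume p: "p \<in> ?A"
    then have "1 \<le> \<bar>real_of_int (fst p)\<bar>" using sz_ge_1[of p] by auto
    then have "\<bar>real_of_int (fst p)\<bar> ^ 3 \<le> \<bar>real_of_int (fst p)\<bar> ^ 4" by (intro power_increasing) auto
    moreover have "\<bar>real_of_int (fst p)\<bar> ^ 4 = real_of_int (fst p) ^ 4" by (simp add: power_even_abs)
    ultimately show "1 / real_of_int (fst p) ^ 4 \<le> 1 / sz p ^ 3"
      using p \<open>1 \<le> _\<close> by (auto intro!: divide_left_mono mult_pos_pos)
  qed auto
  have "1 \<le> (\<Sum>\<^sub>\<infinity>p\<in>?A. 1 / real_of_int (fst p) ^ 4)"
    using finite_sum_le_infsum[OF s, of "{(1, 0)}"] by (simp add: pairs0_def)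
  moreover have "Z4 = of_real (\<Sum>\<^sub>\<infinity>p\<in>?A. 1 / real_of_int (fst p) ^ 4)"
    unfolding Z4_def by (intro infsumI has_sum_of_real[OF has_sum_infsum[OF s], where ?'a = complex, simplified])
  ultimately show ?thesis by auto
qed

text \<open>The row \<open>b = 0\<close> does not depend on \<open>\<tau>\<close>. In each other
  term one of the four factors is at most \<open>1 / Im \<tau>\<close>, and the remaining three are
  left to the summable majorant; \<open>3840 = 60 * 4 ^ 3\<close>.\<close>

lemma g2t_cusp:
  assumes "\<bar>Re \<tau>\<bar> \<le> 1 / 2" "Im \<tau> \<ge> 1"
  shows "norm (g2t \<tau> - 60 * Z4) \<le> 3840 * S3 / Im \<tau>"
proof -
  let ?A = "pairs0 \<inter> {p :: int \<times> int. snd p = 0}" and ?B = "pairs0 \<inter> {p :: int \<times> int. snd p \<noteq> 0}"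
  define f where "f p = 1 / (of_int (fst p) + of_int (snd p) * \<tau>) ^ 4" for p :: "int \<times> int"
  have ge: "sz p \<le> 4 * norm (of_int (fst p) + of_int (snd p) * \<tau>)" for p :: "int \<times> int"
    using norm_pair_ge_cusp[OF assms, of "of_int (fst p)" "of_int (snd p)"] by simp
  have fb: "norm (f p) \<le> 256 * (1 / sz p ^ 3)" if "p \<in> pairs0" for p
    unfolding f_def using pair_power_bound[OF that _ ge[of p], of 4] by simp
  have sA: "f summable_on ?A" and sB: "f summable_on ?B"
  proof -
    show "f summable_on ?A" by (rule infsum_le_S3(2)[of _ f 256]) (use fb in \<open>blast, simp\<close>)
    show "f summable_on ?B" by (rule infsum_le_S3(2)[of _ f 256]) (use fb in \<open>blast, simp\<close>)
  qed
  have "(\<Sum>\<^sub>\<infinity>p\<in>?A \<union> ?B. f p) = (\<Sum>\<^sub>\<infinity>p\<in>?A. f p) + (\<Sum>\<^sub>\<infinity>p\<in>?B. f p)"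
    by (rule infsum_Un_disjoint[OF sA sB]) auto
  moreover have "?A \<union> ?B = pairs0" by auto
  moreover have "(\<Sum>\<^sub>\<infinity>p\<in>?A. f p) = Z4" unfolding Z4_def by (intro infsum_cong) (auto simp: f_def)
  moreover have "g2t \<tau> = 60 * (\<Sum>\<^sub>\<infinity>p\<in>pairs0. f p)"
    using assms by (simp add: g2t_eq f_def case_prod_unfold)
  ultimately have "g2t \<tau> - 60 * Z4 = 60 * (\<Sum>\<^sub>\<infinity>p\<in>?B. f p)" by (simp add: algebra_simps)
  moreover have "norm (\<Sum>\<^sub>\<infinity>p\<in>?B. f p) \<le> 64 / Im \<tau> * S3"
  proof (rule infsum_le_S3(1))
    fix p assume p: "p \<in> ?B"
    let ?w = "of_int (fst p) + of_int (snd p) * \<tau>"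
    have "1 \<le> \<bar>real_of_int (snd p)\<bar>" using p by (simp add: Ints_nonzero_abs_ge1)
    then have "1 * Im \<tau> \<le> \<bar>real_of_int (snd p)\<bar> * \<bar>Im \<tau>\<bar>" using assms by (intro mult_mono) auto
    also have "\<dots> \<le> norm ?w" using norm_pair_ge_Im[of "of_int (snd p)" \<tau> "of_int (fst p)"] by simp
    finally have y: "Im \<tau> \<le> norm ?w" by simp
    have "norm (f p) = 1 / norm ?w * norm (1 / ?w ^ 3)"
      using norm_inverse_power4[of 1 ?w] by (simp add: f_def)
    also have "\<dots> \<le> 1 / Im \<tau> * (4 ^ 3 * (1 / sz p ^ 3))"
    proof (rule mult_mono)
      show "1 / norm ?w \<le> 1 / Im \<tau>" using y assms by (intro divide_left_mono mult_pos_pos) auto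
      show "norm (1 / ?w ^ 3) \<le> 4 ^ 3 * (1 / sz p ^ 3)" by (rule pair_power_bound[OF _ _ ge[of p]]) (use p in auto)
    qed (use assms in auto)
    finally show "norm (f p) \<le> 64 / Im \<tau> * (1 / sz p ^ 3)" by simp
  qed (use assms in auto)
  ultimately show ?thesis by (simp add: norm_mult)
qed

text \<open>At the half period \<open>\<tau> / 2\<close> the cubic vanishes, while its derivative \<open>2 wp''\<close> there
  becomes small; this forces the discriminant to vanish at the cusp.\<close>

lemma wp2_half_cusp:
  assumes "\<bar>Re \<tau>\<bar> \<le> 1 / 2" "Im \<tau> \<ge> 1"
  shows "norm (lattice.wp2 (std_lattice \<tau>) (\<tau> / 2)) \<le> (6144 * S3 + 96) / Im \<tau>"
proof -
  have y: "Im \<tau> \<ge> 1" by fact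
  interpret lattice "std_lattice \<tau>" 1 \<tau> by (rule lattice_std) (use assms in auto)
  define f where "f p = 6 / (\<tau> / 2 - (of_int (fst p) + of_int (snd p) * \<tau>)) ^ 4" for p :: "int \<times> int"
  \<comment> \<open>The coefficient \<open>1/2 - b\<close> of \<open>\<tau>\<close> is never smaller
    than \<open>1/2\<close> in absolute value. The constant is \<open>6 * 2 * 8 ^ 3\<close>, where 2
    comes from this lower bound and 8 from
    \<open>\<bar>b\<bar> \<le> 2 * \<bar>1/2 - b\<bar>\<close> together with the factor 4 at the
    cusp.\<close>
  have bound: "norm (f p) \<le> (6144 / Im \<tau>) * (1 / sz p ^ 3)" if p: "p \<in> pairs0" for p
  proof -
    let ?a = "- real_of_int (fst p)" and ?b = "1 / 2 - real_of_int (snd p)"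
    let ?w = "of_real ?a + of_real ?b * \<tau>"
    have w: "\<tau> / 2 - (of_int (fst p) + of_int (snd p) * \<tau>) = ?w" by (simp add: algebra_simps)
    have half: "\<bar>?b\<bar> \<ge> 1 / 2" "\<bar>real_of_int (snd p)\<bar> \<le> 2 * \<bar>?b\<bar>"
    proof -
      consider "snd p \<le> 0" | "snd p \<ge> 1" by linarith
      then have "\<bar>?b\<bar> \<ge> 1 / 2 \<and> \<bar>real_of_int (snd p)\<bar> \<le> 2 * \<bar>?b\<bar>"
      proof cases
        case 1
        then have "real_of_int (snd p) \<le> 0" by simp
        then show ?thesis by simp
      next
        case 2
        then have "real_of_int (snd p) \<ge> 1" by simp
        then show ?thesis by (simp add: abs_if)
      qed
      then show "\<bar>?b\<bar> \<ge> 1 / 2" "\<bar>real_of_int (snd p)\<bar> \<le> 2 * \<bar>?b\<bar>" by auto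
    qed
    have "sz p \<le> 8 * norm ?w"
    proof -
      have "sz p = \<bar>?a\<bar> + \<bar>real_of_int (snd p)\<bar>" by simp
      moreover have "0 \<le> \<bar>?a\<bar>" by simp
      ultimately show ?thesis using norm_pair_ge_cusp[OF assms, of ?a ?b] half(2) by linarith
    qed
    then have c: "norm (1 / ?w ^ 3) \<le> 8 ^ 3 * (1 / sz p ^ 3)" by (intro pair_power_bound[OF p]) auto
    have "1 / 2 * Im \<tau> \<le> \<bar>?b\<bar> * \<bar>Im \<tau>\<bar>" using half(1) y by (intro mult_mono) auto
    also have "\<dots> \<le> norm ?w" by (rule norm_pair_ge_Im)
    finally have "1 / norm ?w \<le> 1 / (1 / 2 * Im \<tau>)" using y by (intro divide_left_mono mult_pos_pos) auto
    then have "1 / norm ?w * norm (1 / ?w ^ 3) \<le> 1 / (1 / 2 * Im \<tau>) * (8 ^ 3 * (1 / sz p ^ 3))"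
      using c y by (intro mult_mono) auto
    moreover have "norm (f p) = 6 * (1 / norm ?w * norm (1 / ?w ^ 3))"
      unfolding f_def w norm_inverse_power4 by simp
    ultimately show ?thesis by simp
  qed
  have "wp2 (\<tau> / 2) = (\<Sum>\<^sub>\<infinity>p. f p)"
  proof -
    have "(\<Sum>\<^sub>\<infinity>w\<in>std_lattice \<tau>. 6 / (\<tau> / 2 - w) ^ 4) = (\<Sum>\<^sub>\<infinity>p. 6 / (\<tau> / 2 - (case p of (a,b) \<Rightarrow> lat a b)) ^ 4)"
      by (subst L_eq, subst infsum_reindex[OF inj_lat]) (simp add: o_def)
    then show ?thesis by (simp add: wp2_def f_def lat_def case_prod_unfold)
  qed
  \<comment> \<open>The majorant is useless at the origin, where \<open>sz\<close> is 0; this term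
    is \<open>96 / \<tau> ^ 4\<close> in closed form.\<close>
  also have "\<dots> = f (0, 0) + (\<Sum>\<^sub>\<infinity>p\<in>pairs0. f p)"
  proof -
    have "(\<Sum>\<^sub>\<infinity>p\<in>insert (0,0) pairs0. f p) = f (0,0) + (\<Sum>\<^sub>\<infinity>p\<in>pairs0. f p)"
    proof (rule infsum_insert)
      have "norm (f p) \<le> (6144 / Im \<tau>) * (1 / sz p ^ 3)" if "p \<in> pairs0" for p by (rule bound[OF that])
      then show "f summable_on pairs0" by (rule infsum_le_S3(2)) (use y in auto)
    qed (auto simp: pairs0_def)
    moreover have "insert (0,0) pairs0 = UNIV" by (auto simp: pairs0_def)
    ultimately show ?thesis by simp
  qed
  also have "norm \<dots> \<le> 96 / Im \<tau> + 6144 / Im \<tau> * S3"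
  proof (rule order_trans[OF norm_triangle_ineq add_mono])
    have "Im \<tau> \<le> norm \<tau>" using abs_Im_le_cmod[of \<tau>] by linarith
    moreover have "norm \<tau> ^ 1 \<le> norm \<tau> ^ 4" using y calculation by (intro power_increasing) auto
    ultimately have "96 / norm \<tau> ^ 4 \<le> 96 / Im \<tau>" using y by (intro divide_left_mono mult_pos_pos) auto
    moreover have "norm (f (0,0)) = 96 / norm \<tau> ^ 4" by (simp add: f_def norm_divide norm_power power_divide)
    ultimately show "norm (f (0,0)) \<le> 96 / Im \<tau>" by simp
    show "norm (\<Sum>\<^sub>\<infinity>p\<in>pairs0. f p) \<le> 6144 / Im \<tau> * S3"
      by (rule infsum_le_S3(1)) (use bound y in auto)
  qed
  finally show ?thesis by (simp add: add_divide_distrib)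
qed

text \<open>Here \<open>2 * q\<close> is the derivative of the cubic at its root \<open>e\<close>.
  The factorization turns smallness of \<open>q\<close> into smallness of the discriminant.\<close>

lemma discriminant_wp2:
  fixes e q g2 g3 :: complex
  assumes "4 * e ^ 3 - g2 * e - g3 = 0" "q = 6 * e\<^sup>2 - g2 / 2"
  shows "g2 ^ 3 - 27 * g3 ^ 2 = q\<^sup>2 * (3 * g2 - 2 * q)"
proof -
  have "g2 = 12 * e\<^sup>2 - 2 * q" using assms(2) by simp
  moreover have "g3 = 4 * e ^ 3 - g2 * e" using assms(1) by simp
  ultimately show ?thesis by algebra
qed

text \<open>High up in the strip the discriminant is \<open>O(1 / Im \<tau>)\<close>, whereas the
  numerator \<open>g2t \<tau> ^ 3\<close> stays away from 0; hence \<open>jinv\<close> can only be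
  bounded at bounded height.\<close>

lemma jinv_bounded_imp_Im_bounded:
  obtains Y where "\<And>\<tau>. \<bar>Re \<tau>\<bar> \<le> 1 / 2 \<Longrightarrow> norm (jinv \<tau>) \<le> B \<Longrightarrow> Im \<tau> \<le> Y"
proof -
  \<comment> \<open>Half the absolute value of \<open>60 * Z4\<close>, the limit of
    \<open>g2t\<close> at the cusp.\<close>
  define A where "A = 30 * norm Z4"
  define C1 where "C1 = 3840 * S3"
  define C2 where "C2 = 6144 * S3 + 96"
  define C3 where "C3 = C2 * C2 * (3 * (60 * norm Z4 + C1) + 2 * C2)"
  have A: "A > 0" using Z4_nz by (simp add: A_def)
  have C: "C1 \<ge> 0" "C2 \<ge> 0" "C3 \<ge> 0" using S3_nonneg by (auto simp: C1_def C2_def C3_def)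
  have "Im \<tau> \<le> max 1 (max (C1 / A) (B * C3 / A ^ 3))" if re: "\<bar>Re \<tau>\<bar> \<le> 1 / 2" and j: "norm (jinv \<tau>) \<le> B" for \<tau>
  proof (rule ccontr)
    assume "\<not> ?thesis"
    then have y: "Im \<tau> \<ge> 1" "C1 / A < Im \<tau>" "B * C3 / A ^ 3 < Im \<tau>" by auto
    interpret lattice "std_lattice \<tau>" 1 \<tau> by (rule lattice_std) (use y in auto)
    define q where "q = wp2 (\<tau> / 2)"
    have q: "norm q \<le> C2 / Im \<tau>" using wp2_half_cusp[OF re y(1)] by (simp add: q_def C2_def)
    then have q': "norm q \<le> C2" using y(1) C(2) divide_left_mono[of 1 "Im \<tau>" C2] by simp
    have g: "norm (g2t \<tau> - 60 * Z4) \<le> C1 / Im \<tau>" using g2t_cusp[OF re y(1)] by (simp add: C1_def)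
    have "C1 / Im \<tau> < A" using y A by (simp add: field_simps)
    then have "norm (g2t \<tau> - 60 * Z4) \<le> A" using g by simp
    moreover have "norm (60 * Z4) = 2 * A" by (simp add: A_def norm_mult)
    ultimately have gA: "A \<le> norm (g2t \<tau>)"
      using norm_triangle_ineq2[of "60 * Z4" "g2t \<tau>"] by (simp add: norm_minus_commute)
    have "C1 / Im \<tau> \<le> C1" using y(1) C(1) divide_left_mono[of 1 "Im \<tau>" C1] by simp
    then have gB: "norm (g2t \<tau>) \<le> 60 * norm Z4 + C1"
      using g norm_triangle_ineq2[of "g2t \<tau>" "60 * Z4"] by (simp add: norm_mult)
    have e: "wp1 (\<tau> / 2) = 0" using wp1_eq_0_iff[OF half_notin(2)] by simp
    have "g2t \<tau> ^ 3 - 27 * g3t \<tau> ^ 2 = q\<^sup>2 * (3 * g2t \<tau> - 2 * q)"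
      using wp1_square[OF half_notin(2)] wp2_eq[OF half_notin(2)] e
      by (intro discriminant_wp2[of "wp (std_lattice \<tau>) (\<tau> / 2)"]) (simp_all add: q_def)
    then have "norm (g2t \<tau> ^ 3 - 27 * g3t \<tau> ^ 2) = norm q * (norm q * norm (3 * g2t \<tau> - 2 * q))"
      by (simp add: norm_mult norm_power power2_eq_square)
    also have "\<dots> \<le> C2 / Im \<tau> * (C2 * (3 * (60 * norm Z4 + C1) + 2 * C2))"
    proof (intro mult_mono q q')
      have "norm (3 * g2t \<tau> - 2 * q) \<le> norm (3 * g2t \<tau>) + norm (2 * q)" by (rule norm_triangle_ineq4)
      also have "\<dots> \<le> 3 * (60 * norm Z4 + C1) + 2 * C2" using gB q' by (simp add: norm_mult)
      finally show "norm (3 * g2t \<tau> - 2 * q) \<le> 3 * (60 * norm Z4 + C1) + 2 * C2" .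
    qed (use C y in auto)
    also have "\<dots> = C3 / Im \<tau>" by (simp add: C3_def)
    finally have D: "norm (g2t \<tau> ^ 3 - 27 * g3t \<tau> ^ 2) \<le> C3 / Im \<tau>" .
    have "g2t \<tau> ^ 3 = jinv \<tau> * (g2t \<tau> ^ 3 - 27 * g3t \<tau> ^ 2)"
      using discriminant_nz by (simp add: jinv_def)
    then have "norm (g2t \<tau>) ^ 3 = norm (jinv \<tau>) * norm (g2t \<tau> ^ 3 - 27 * g3t \<tau> ^ 2)"
      by (metis norm_mult norm_power)
    also have "\<dots> \<le> B * (C3 / Im \<tau>)"
      using j D norm_ge_zero[of "jinv \<tau>"] by (intro mult_mono) (linarith | simp)+
    finally have "norm (g2t \<tau>) ^ 3 \<le> B * (C3 / Im \<tau>)" .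
    moreover have "A ^ 3 \<le> norm (g2t \<tau>) ^ 3" using gA A by (intro power_mono) auto
    ultimately have "A ^ 3 \<le> B * (C3 / Im \<tau>)" by simp
    then have "Im \<tau> \<le> B * C3 / A ^ 3" using A y(1) by (simp add: field_simps)
    then show False using y(3) by simp
  qed
  then show ?thesis by (rule that)
qed

subsection \<open>Surjectivity of the modular invariant\<close>

text \<open>The image is open and closed. For closedness, the preimages of a convergent sequence are
  replaced by reduced ones, which lie in a compact box inside the half plane. Constancy is excluded
  because it would bound \<open>jinv\<close> along the whole imaginary axis.\<close>

lemma jinv_surj: obtains \<tau> where "Im \<tau> > 0" "jinv \<tau> = c"
proof -
  let ?H = "{\<tau>. Im \<tau> > 0}"
  have opH: "open ?H" by (rule open_halfspace_Im_gt)
  have conn: "connected ?H" by (rule convex_connected[OF convex_halfspace_Im_gt])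
  have ne: "\<not> jinv constant_on ?H"
  proof
    assume "jinv constant_on ?H"
    then obtain k where k: "\<And>\<tau>. \<tau> \<in> ?H \<Longrightarrow> jinv \<tau> = k" by (auto simp: constant_on_def)
    obtain Y where Y: "\<And>\<tau>. \<bar>Re \<tau>\<bar> \<le> 1 / 2 \<Longrightarrow> norm (jinv \<tau>) \<le> norm k \<Longrightarrow> Im \<tau> \<le> Y"
      by (rule jinv_bounded_imp_Im_bounded[of "norm k"]) blast
    show False using Y[of "Complex 0 (\<bar>Y\<bar> + 1)"] k[of "Complex 0 (\<bar>Y\<bar> + 1)"] by simp
  qed
  have op: "open (jinv ` ?H)"
    by (rule open_mapping_thm[OF jinv_holomorphic opH conn opH order_refl ne])
  have cl: "closed (jinv ` ?H)"
  proof (unfold closed_sequential_limits, intro allI impI, elim conjE)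
    fix x l assume x: "\<forall>n. x n \<in> jinv ` ?H" and lim: "x \<longlonglongrightarrow> l"
    have "\<exists>t. Im t \<ge> 1 / 2 \<and> \<bar>Re t\<bar> \<le> 1 / 2 \<and> jinv t = x n" for n
    proof -
      obtain \<tau> where "Im \<tau> > 0" "x n = jinv \<tau>" using x by blast
      then show ?thesis using jinv_reduced[of \<tau>] by metis
    qed
    then obtain t where t: "\<And>n. Im (t n) \<ge> 1 / 2" "\<And>n. \<bar>Re (t n)\<bar> \<le> 1 / 2" "\<And>n. jinv (t n) = x n" by metis
    have "Bseq x" using lim convergent_imp_Bseq convergentI by blast
    then obtain B where B: "\<And>n. norm (x n) \<le> B" by (auto simp: Bseq_def)
    obtain Y where Y: "\<And>\<tau>. \<bar>Re \<tau>\<bar> \<le> 1 / 2 \<Longrightarrow> norm (jinv \<tau>) \<le> B \<Longrightarrow> Im \<tau> \<le> Y"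
      by (rule jinv_bounded_imp_Im_bounded[of B]) blast
    define K where "K = cbox (Complex (- 1/2) (1/2)) (Complex (1/2) Y)"
    have "compact K" unfolding K_def by (rule compact_cbox)
    moreover have "t n \<in> K" for n
      using t[of n] Y[of "t n"] B[of n] by (auto simp: K_def in_cbox_complex_iff abs_le_iff)
    ultimately obtain s r where s: "s \<in> K" "strict_mono r" "(t \<circ> r) \<longlonglongrightarrow> s"
      unfolding compact_def by meson
    have sH: "s \<in> ?H" using s(1) by (auto simp: K_def in_cbox_complex_iff)
    then have "isCont jinv s"
      using jinv_holomorphic opH holomorphic_on_imp_continuous_on continuous_on_eq_continuous_at by blast
    then have "(\<lambda>n. jinv ((t \<circ> r) n)) \<longlonglongrightarrow> jinv s" using s(3) isCont_tendsto_compose by blast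
    moreover have "(\<lambda>n. jinv ((t \<circ> r) n)) = x \<circ> r" by (auto simp: t(3))
    moreover have "(x \<circ> r) \<longlonglongrightarrow> l" using lim s(2) LIMSEQ_subseq_LIMSEQ by blast
    ultimately have "jinv s = l" using LIMSEQ_unique by metis
    then show "l \<in> jinv ` ?H" using sH by blast
  qed
  have "\<i> \<in> ?H" by simp
  then have "jinv ` ?H \<noteq> {}" by blast
  then have "jinv ` ?H = UNIV" using clopen[THEN iffD1, OF conjI[OF cl op]] by blast
  then have "c \<in> jinv ` ?H" by simp
  then show ?thesis by (elim imageE) (use that in simp)
qed

lemma complex_root_exists:
  assumes "(c::complex) \<noteq> 0" "n > 0"
  obtains m where "m ^ n = c" "m \<noteq> 0"
proof (rule that[of "exp (Ln c / of_nat n)"])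
  show "exp (Ln c / of_nat n) ^ n = c"
    using assms by (simp flip: exp_of_nat_mult)
qed auto

text \<open>Equality of Klein's invariant leaves only a scaling. A fourth root adjusts
  \<open>g2\<close> and determines \<open>g3\<close> up to sign; if \<open>g2 = 0\<close>, a sixth
  root adjusts \<open>g3\<close>. Invariants have negative weight under dilation, so the lattice is
  dilated by \<open>1 / m\<close>.\<close>

theorem lattice_of_invariants:
  fixes g2 g3 :: complex
  assumes "g2 ^ 3 - 27 * g3 ^ 2 \<noteq> 0"
  obtains L where "is_lattice L" "inv_g2 L = g2" "inv_g3 L = g3"
proof -
  obtain \<tau> where t: "Im \<tau> > 0" "jinv \<tau> = g2 ^ 3 / (g2 ^ 3 - 27 * g3 ^ 2)" by (rule jinv_surj)
  let ?G2 = "g2t \<tau>" and ?G3 = "g3t \<tau>"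
  have D: "?G2 ^ 3 - 27 * ?G3 ^ 2 \<noteq> 0"
    by (rule lattice.discriminant_nz[OF lattice_std]) (use t in auto)
  have "?G2 ^ 3 * (g2 ^ 3 - 27 * g3 ^ 2) = g2 ^ 3 * (?G2 ^ 3 - 27 * ?G3 ^ 2)"
    using t(2) D assms by (simp add: jinv_def frac_eq_eq)
  then have eq: "?G2 ^ 3 * g3 ^ 2 = g2 ^ 3 * ?G3 ^ 2" by algebra
  have "\<exists>m. m \<noteq> 0 \<and> g2 = m ^ 4 * ?G2 \<and> g3 = m ^ 6 * ?G3"
  proof (cases "g2 = 0")
    case True
    then have "g3 \<noteq> 0" "?G2 = 0" using assms eq by auto
    then have "?G3 \<noteq> 0" using D by auto
    obtain m where "m ^ 6 = g3 / ?G3" "m \<noteq> 0" by (rule complex_root_exists[of "g3 / ?G3" 6]) (use \<open>g3 \<noteq> 0\<close> \<open>?G3 \<noteq> 0\<close> in auto)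
    then show ?thesis using True \<open>?G2 = 0\<close> \<open>?G3 \<noteq> 0\<close> by (intro exI[of _ m]) auto
  next
    case False
    then have G2: "?G2 \<noteq> 0" using eq D by auto
    obtain m where m: "m ^ 4 = g2 / ?G2" "m \<noteq> 0" by (rule complex_root_exists[of "g2 / ?G2" 4]) (use False G2 in auto)
    have g2: "g2 = m ^ 4 * ?G2" using m G2 by simp
    have "?G2 ^ 3 * (g3 ^ 2 - (m ^ 6 * ?G3) ^ 2) = 0" using eq unfolding g2 by algebra
    then have "g3 ^ 2 = (m ^ 6 * ?G3) ^ 2" using G2 by simp
    then consider "g3 = m ^ 6 * ?G3" | "g3 = - (m ^ 6 * ?G3)" by (auto simp: power2_eq_iff)
    then show ?thesis
    proof cases
      case 1 then show ?thesis using g2 m by blast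
    next
      case 2
      \<comment> \<open>Multiplying the scaling factor by the imaginary unit corrects the sign of
        \<open>g3\<close> without touching \<open>g2\<close>.\<close>
      have i: "(\<i> * m) ^ 4 = m ^ 4" "(\<i> * m) ^ 6 = - (m ^ 6)"
      proof -
        have "\<i> ^ 4 = 1" "\<i> ^ 6 = - 1" by (simp_all add: eval_nat_numeral)
        then show "(\<i> * m) ^ 4 = m ^ 4" "(\<i> * m) ^ 6 = - (m ^ 6)" by (simp_all add: power_mult_distrib)
      qed
      show ?thesis using 2 g2 m by (intro exI[of _ "\<i> * m"]) (simp add: i)
    qed
  qed
  then obtain m where m: "m \<noteq> 0" "g2 = m ^ 4 * ?G2" "g3 = m ^ 6 * ?G3" by blast
  show ?thesis
  proof (rule that)
    show "is_lattice ((*) (1 / m) ` std_lattice \<tau>)"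
      by (rule is_lattice_scale) (use m t std_lattice_basis[of \<tau>] in \<open>auto simp: is_lattice_def\<close>)
    show "inv_g2 ((*) (1 / m) ` std_lattice \<tau>) = g2" "inv_g3 ((*) (1 / m) ` std_lattice \<tau>) = g3"
      using m inv_g2_scale[of "1 / m" "std_lattice \<tau>"] inv_g3_scale[of "1 / m" "std_lattice \<tau>"]
      by (simp_all del: times_divide_eq_left add: power_divide)
  qed
qed

section \<open>Second order linear equations in the complex domain\<close>

text \<open>Quantifying over the first derivative lets an explicit candidate be checked pointwise;
  on open sets \<open>solvesD\<close> identifies it with \<open>deriv f\<close>.\<close>

definition solves :: "(complex \<Rightarrow> complex) \<Rightarrow> complex set \<Rightarrow> (complex \<Rightarrow> complex) \<Rightarrow> bool" where
  "solves q S f \<longleftrightarrow> (\<exists>f'. \<forall>z\<in>S. (f has_field_derivative f' z) (at z) \<and> (f' has_field_derivative q z * f z) (at z))"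

definition wronsk :: "(complex \<Rightarrow> complex) \<Rightarrow> (complex \<Rightarrow> complex) \<Rightarrow> complex \<Rightarrow> complex" where
  "wronsk f g z = f z * deriv g z - deriv f z * g z"

lemma solvesI:
  assumes "\<And>z. z \<in> S \<Longrightarrow> (f has_field_derivative f' z) (at z)"
    "\<And>z. z \<in> S \<Longrightarrow> (f' has_field_derivative q z * f z) (at z)"
  shows "solves q S f"
  using assms unfolding solves_def by blast

lemma solvesD:
  assumes "solves q S f" "open S" "z \<in> S"
  shows "(f has_field_derivative deriv f z) (at z)" "(deriv f has_field_derivative q z * f z) (at z)"
proof -
  obtain f' where f': "\<And>z. z \<in> S \<Longrightarrow> (f has_field_derivative f' z) (at z)"
    "\<And>z. z \<in> S \<Longrightarrow> (f' has_field_derivative q z * f z) (at z)"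
    using assms(1) unfolding solves_def by blast
  have eq: "deriv f z = f' z" if "z \<in> S" for z using f'(1)[OF that] by (rule DERIV_imp_deriv)
  show "(f has_field_derivative deriv f z) (at z)" using f'(1) eq assms by simp
  show "(deriv f has_field_derivative q z * f z) (at z)"
    by (rule has_field_derivative_transform_within_open[OF f'(2)[OF assms(3)] assms(2,3)]) (simp add: eq)
qed

lemma solves_holomorphic: "solves q S f \<Longrightarrow> open S \<Longrightarrow> f holomorphic_on S"
  using solvesD(1) holomorphic_on_open by blast

lemma solves_subset: "solves q S f \<Longrightarrow> T \<subseteq> S \<Longrightarrow> solves q T f"
  unfolding solves_def by blast

lemma solves_cong:
  assumes "solves q S f" "open S" "\<And>z. z \<in> S \<Longrightarrow> f z = g z" "\<And>z. z \<in> S \<Longrightarrow> q z = r z"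
  shows "solves r S g"
proof (rule solvesI)
  fix z assume z: "z \<in> S"
  show "(g has_field_derivative deriv f z) (at z)"
    by (rule has_field_derivative_transform_within_open[OF solvesD(1)[OF assms(1,2) z] assms(2) z]) (use assms in auto)
  show "(deriv f has_field_derivative r z * g z) (at z)"
    using solvesD(2)[OF assms(1,2) z] assms(3,4) z by simp
qed

lemma solves_lincomb:
  assumes "solves q S f" "solves q S g" "open S"
  shows "solves q S (\<lambda>z. a * f z + b * g z)"
    and "z \<in> S \<Longrightarrow> deriv (\<lambda>z. a * f z + b * g z) z = a * deriv f z + b * deriv g z"
proof -
  have d: "((\<lambda>z. a * f z + b * g z) has_field_derivative a * deriv f z + b * deriv g z) (at z)" if "z \<in> S" for z
    using solvesD(1)[OF assms(1,3) that] solvesD(1)[OF assms(2,3) that] by (auto intro!: derivative_eq_intros)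
  then show "z \<in> S \<Longrightarrow> deriv (\<lambda>z. a * f z + b * g z) z = a * deriv f z + b * deriv g z"
    using DERIV_imp_deriv by blast
  show "solves q S (\<lambda>z. a * f z + b * g z)"
  proof (rule solvesI[OF d])
    fix z assume z: "z \<in> S"
    show "((\<lambda>z. a * deriv f z + b * deriv g z) has_field_derivative q z * (a * f z + b * g z)) (at z)"
      using solvesD(2)[OF assms(1,3) z] solvesD(2)[OF assms(2,3) z]
      by (auto intro!: derivative_eq_intros simp: algebra_simps)
  qed
qed

text \<open>The chain rule multiplies the second derivative by the square of
  \<open>\<epsilon>\<close>, which has to be 1. The cases of interest are translations and point
  reflections.\<close>

lemma solves_affine:
  assumes "solves q S f" "open S" "\<epsilon> * \<epsilon> = 1"
    and "\<And>z. z \<in> T \<Longrightarrow> \<epsilon> * z + c \<in> S" "\<And>z. z \<in> T \<Longrightarrow> q (\<epsilon> * z + c) = r z"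
  shows "solves r T (\<lambda>z. f (\<epsilon> * z + c))"
    and "z \<in> T \<Longrightarrow> deriv (\<lambda>z. f (\<epsilon> * z + c)) z = \<epsilon> * deriv f (\<epsilon> * z + c)"
proof -
  have lin: "((\<lambda>z. \<epsilon> * z + c) has_field_derivative \<epsilon>) (at z)" for z
    by (auto intro!: derivative_eq_intros)
  have d: "((\<lambda>z. f (\<epsilon> * z + c)) has_field_derivative \<epsilon> * deriv f (\<epsilon> * z + c)) (at z)" if "z \<in> T" for z
    using DERIV_chain2[OF solvesD(1)[OF assms(1,2) assms(4)[OF that]] lin] by (simp add: mult.commute)
  then show "z \<in> T \<Longrightarrow> deriv (\<lambda>z. f (\<epsilon> * z + c)) z = \<epsilon> * deriv f (\<epsilon> * z + c)"
    using DERIV_imp_deriv by blast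
  show "solves r T (\<lambda>z. f (\<epsilon> * z + c))"
  proof (rule solvesI[OF d])
    fix z assume z: "z \<in> T"
    have "((\<lambda>z. \<epsilon> * deriv f (\<epsilon> * z + c)) has_field_derivative \<epsilon> * (q (\<epsilon> * z + c) * f (\<epsilon> * z + c) * \<epsilon>)) (at z)"
      by (rule DERIV_cmult[OF DERIV_chain2[OF solvesD(2)[OF assms(1,2) assms(4)[OF z]] lin]])
    also have "\<epsilon> * (q (\<epsilon> * z + c) * f (\<epsilon> * z + c) * \<epsilon>) = (\<epsilon> * \<epsilon>) * (q (\<epsilon> * z + c) * f (\<epsilon> * z + c))"
      by (simp only: mult_ac)
    finally show "((\<lambda>z. \<epsilon> * deriv f (\<epsilon> * z + c)) has_field_derivative r z * f (\<epsilon> * z + c)) (at z)"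
      using assms(3) assms(5)[OF z] by simp
  qed
qed

lemma wronsk_deriv:
  assumes "solves q S f" "solves q S g" "open S" "z \<in> S"
  shows "(wronsk f g has_field_derivative 0) (at z)"
proof -
  note f = solvesD[OF assms(1,3,4)] and g = solvesD[OF assms(2,3,4)]
  have "((\<lambda>z. f z * deriv g z - deriv f z * g z) has_field_derivative
     (deriv f z * deriv g z + q z * g z * f z) - (q z * f z * g z + deriv g z * deriv f z)) (at z)"
    by (intro DERIV_diff DERIV_mult f g)
  then show ?thesis by (simp add: wronsk_def[abs_def] algebra_simps)
qed

lemma wronsk_const:
  assumes "solves q S f" "solves q S g" "open S" "connected S" "z \<in> S" "w \<in> S"
  shows "wronsk f g z = wronsk f g w"
proof -
  obtain c where "\<And>x. x \<in> S \<Longrightarrow> wronsk f g x = c"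
  proof (rule DERIV_zero_connected_constant[OF assms(4,3) finite.emptyI])
    show "continuous_on S (wronsk f g)"
      by (rule continuous_at_imp_continuous_on) (use wronsk_deriv[OF assms(1-3)] DERIV_isCont in blast)
  qed (use wronsk_deriv[OF assms(1-3)] in auto)
  then show ?thesis using assms(5,6) by simp
qed

lemma solution_with_data:
  assumes "solves q S f" "solves q S g" "open S" "b \<in> S" "wronsk f g b \<noteq> 0"
  obtains h where "solves q S h" "h b = \<alpha>" "deriv h b = \<beta>"
proof -
  let ?W = "wronsk f g b"
  define c where "c = (\<alpha> * deriv g b - \<beta> * g b) / ?W"
  define d where "d = (\<beta> * f b - \<alpha> * deriv f b) / ?W"
  have "c * f b + d * g b = \<alpha> * ?W / ?W"
    unfolding c_def d_def by (simp add: wronsk_def algebra_simps flip: add_divide_distrib diff_divide_distrib)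
  moreover have "c * deriv f b + d * deriv g b = \<beta> * ?W / ?W"
    unfolding c_def d_def by (simp add: wronsk_def algebra_simps flip: add_divide_distrib diff_divide_distrib)
  ultimately show ?thesis
    using that[OF solves_lincomb(1)[OF assms(1-3), of c d]] solves_lincomb(2)[OF assms(1-4), of c d] assms(5) by simp
qed

text \<open>Cramer's rule with Wronskians, which are constant.\<close>

lemma solution_is_lincomb:
  assumes "solves q S f" "solves q S g" "solves q S h" "open S" "connected S" "b \<in> S" "wronsk f g b \<noteq> 0" "z \<in> S"
  shows "h z = wronsk h g b / wronsk f g b * f z + wronsk f h b / wronsk f g b * g z"
proof -
  have "wronsk h g b * f z + wronsk f h b * g z = wronsk h g z * f z + wronsk f h z * g z"
    using wronsk_const[OF assms(3,2,4,5,6,8)] wronsk_const[OF assms(1,3,4,5,6,8)] by simp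
  also have "\<dots> = wronsk f g z * h z" by (simp add: wronsk_def algebra_simps)
  also have "\<dots> = wronsk f g b * h z" using wronsk_const[OF assms(1,2,4,5,6,8)] by simp
  finally show ?thesis using assms(7) by (simp add: field_simps)
qed

lemma solution_eq_0:
  assumes "solves q S f" "solves q S g" "solves q S h" "open S" "connected S" "b \<in> S" "wronsk f g b \<noteq> 0" "z \<in> S"
    and "h b = 0" "deriv h b = 0"
  shows "h z = 0"
  using solution_is_lincomb[OF assms(1-8)] assms(9,10) by (simp add: wronsk_def)

subsection \<open>Frobenius series\<close>

text \<open>Frobenius recursion for the power series \<open>A\<close> in a solution
  \<open>z powi s * A z\<close>, with \<open>t = 2 * s - 1\<close>: the indicial polynomial at
  \<open>s + k\<close> is \<open>k * (k + t)\<close>. At a resonance \<open>k + t = 0\<close>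
  division by zero yields the coefficient 0, a valid choice exactly when the sum above it
  vanishes.\<close>

fun frob :: "(nat \<Rightarrow> complex) \<Rightarrow> int \<Rightarrow> nat \<Rightarrow> complex" where
  "frob p t k = (if k = 0 then 1 else (\<Sum>j<k. p (k - j) * frob p t j) / (of_nat k * of_int (int k + t)))"

declare frob.simps [simp del]

lemma frob_0: "frob p t 0 = 1" by (subst frob.simps) simp

text \<open>If \<open>k\<close> is odd, then in each product one of the indices \<open>j\<close> and
  \<open>k - j\<close> is odd. The second conjunct is what rules out an obstruction at an odd
  resonance.\<close>

lemma frob_odd:
  assumes "\<And>k. odd k \<Longrightarrow> p k = 0"
  shows "odd k \<Longrightarrow> frob p t k = 0 \<and> (\<Sum>j<k. p (k - j) * frob p t j) = 0"
proof (induction k rule: less_induct)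
  case (less k)
  have "(\<Sum>j<k. p (k - j) * frob p t j) = 0"
  proof (rule sum.neutral, rule ballI)
    fix j assume "j \<in> {..<k}"
    then show "p (k - j) * frob p t j = 0"
      using less assms[of "k - j"] by (cases "odd j") auto
  qed
  moreover from this have "frob p t k = 0" using less.prems odd_pos by (subst frob.simps) auto
  ultimately show ?case by simp
qed

text \<open>Off resonance the integer \<open>k + t\<close> has absolute value at least 1, which
  gives \<open>k * C k \<le> M * (\<Sum>j<k. C j)\<close>. The weights \<open>q ^ k\<close> turn the
  right-hand side into a geometric sum.\<close>

lemma frob_bound:
  assumes r: "r > 0" and M: "\<And>j. norm (p j) * r ^ j \<le> M" and q: "0 < q" "q < 1"
  shows "\<exists>B. \<forall>k. norm (frob p t k) * r ^ k * q ^ k \<le> B"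
proof -
  define C where "C k = norm (frob p t k) * r ^ k" for k
  have C0: "C k \<ge> 0" for k using r by (simp add: C_def)
  have "norm (p 0) \<le> M" using M[of 0] by simp
  then have M0: "M \<ge> 0" using norm_ge_zero order_trans by blast
  have rec: "real k * C k \<le> M * (\<Sum>j<k. C j)" if k: "k > 0" for k
  proof (cases "int k + t = 0")
    case True
    then have "frob p t k = 0" by (subst frob.simps) (use k in simp)
    then show ?thesis using M0 C0 by (simp add: C_def sum_nonneg)
  next
    case False
    have "1 \<le> norm (of_int (int k + t) :: complex)"
      using False unfolding norm_of_int by linarith
    then have "real k * norm (frob p t k) \<le> real k * norm (frob p t k) * norm (of_int (int k + t) :: complex)"
      using mult_left_mono[of 1 _ "real k * norm (frob p t k)"] by simp
    also have "\<dots> = norm (\<Sum>j<k. p (k - j) * frob p t j)"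
    proof -
      have "of_nat k * of_int (int k + t) * frob p t k = (\<Sum>j<k. p (k - j) * frob p t j)"
        using False k by (subst frob.simps) (simp del: of_int_add)
      then have "norm (of_nat k * of_int (int k + t) * frob p t k) = norm (\<Sum>j<k. p (k - j) * frob p t j)" by simp
      then show ?thesis by (simp add: norm_mult mult_ac del: of_int_add)
    qed
    also have "\<dots> \<le> (\<Sum>j<k. norm (p (k - j)) * norm (frob p t j))"
      by (rule order_trans[OF norm_sum]) (simp add: norm_mult)
    finally have "real k * norm (frob p t k) * r ^ k \<le> (\<Sum>j<k. norm (p (k - j)) * norm (frob p t j)) * r ^ k"
      using r by (intro mult_right_mono) auto
    also have "\<dots> = (\<Sum>j<k. (norm (p (k - j)) * r ^ (k - j)) * C j)"
      unfolding sum_distrib_right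
    proof (rule sum.cong[OF refl])
      fix j assume "j \<in> {..<k}"
      then have "r ^ k = r ^ (k - j) * r ^ j" by (simp flip: power_add)
      then show "norm (p (k - j)) * norm (frob p t j) * r ^ k = norm (p (k - j)) * r ^ (k - j) * C j"
        by (simp add: C_def)
    qed
    also have "\<dots> \<le> (\<Sum>j<k. M * C j)" by (intro sum_mono mult_right_mono M C0)
    finally show ?thesis by (simp add: C_def sum_distrib_left mult_ac)
  qed
  \<comment> \<open>From this index on \<open>M / (1 - q) \<le> k\<close>, and the induction step
    closes with the same \<open>B\<close>; the indices before it are absorbed into
    \<open>B\<close>.\<close>
  define k0 where "k0 = nat \<lceil>M / (1 - q)\<rceil>"
  define B where "B = (\<Sum>j\<le>k0. C j * q ^ j)"
  have B0: "B \<ge> 0" unfolding B_def using C0 q by (intro sum_nonneg mult_nonneg_nonneg) auto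
  have "C k * q ^ k \<le> B" for k
  proof (induction k rule: less_induct)
    case (less k)
    show ?case
    proof (cases "k \<le> k0")
      case True
      then show ?thesis unfolding B_def using C0 q
        by (intro member_le_sum[of k "{..k0}" "\<lambda>j. C j * q ^ j"]) auto
    next
      case False
      then have k: "k > 0" by simp
      have "real k * (C k * q ^ k) \<le> M * (\<Sum>j<k. C j) * q ^ k"
        using mult_right_mono[OF rec[OF k], of "q ^ k"] q by (simp add: mult_ac)
      also have "\<dots> = M * (\<Sum>j<k. (C j * q ^ j) * q ^ (k - j))"
        unfolding sum_distrib_right sum_distrib_left
      proof (rule sum.cong[OF refl])
        fix j assume "j \<in> {..<k}"
        then have "q ^ k = q ^ j * q ^ (k - j)" by (simp flip: power_add)
        then show "M * C j * q ^ k = M * (C j * q ^ j * q ^ (k - j))" by simp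
      qed
      also have "\<dots> \<le> M * (\<Sum>j<k. B * q ^ (k - j))"
        using less M0 q by (intro mult_left_mono sum_mono mult_right_mono) auto
      also have "(\<Sum>j<k. B * q ^ (k - j)) = B * (\<Sum>j<k. q ^ Suc j)"
        unfolding sum_distrib_left
        by (rule sum.reindex_bij_witness[of _ "\<lambda>j. k - Suc j" "\<lambda>j. k - Suc j"]) (auto simp: Suc_diff_Suc simp del: power_Suc)
      also have "\<dots> \<le> B * (1 / (1 - q))"
      proof (rule mult_left_mono[OF _ B0])
        have "(\<Sum>j<k. q ^ Suc j) \<le> (\<Sum>j<k. q ^ j)" using q by (intro sum_mono) (simp add: mult_left_le_one_le)
        also have "\<dots> \<le> (\<Sum>j. q ^ j)" using q by (intro sum_le_suminf summable_geometric) auto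
        also have "\<dots> = 1 / (1 - q)" using q by (simp add: suminf_geometric)
        finally show "(\<Sum>j<k. q ^ Suc j) \<le> 1 / (1 - q)" .
      qed
      finally have "real k * (C k * q ^ k) \<le> M * (B * (1 / (1 - q)))" using M0 by (simp add: mult_left_mono)
      also have "\<dots> = M / (1 - q) * B" by simp
      also have "\<dots> \<le> real k * B"
      proof (rule mult_right_mono[OF _ B0])
        have "M / (1 - q) \<le> real k0" unfolding k0_def by linarith
        then show "M / (1 - q) \<le> real k" using False by simp
      qed
      finally show ?thesis using k by simp
    qed
  qed
  then show ?thesis by (auto simp: C_def)
qed

text \<open>The assumption \<open>res\<close> says that resonances are solvable, so that
  \<open>frob\<close> satisfies the recursion at every index. The equation is that of
  \<open>A\<close> after the power of \<open>z\<close> has been divided out.\<close>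

lemma frobenius_series:
  assumes R: "R > 0" and P: "P holomorphic_on ball 0 R"
    and res: "\<And>k. k > 0 \<Longrightarrow> int k + t = 0 \<Longrightarrow>
      (\<Sum>j<k. fps_nth (fps_expansion P 0) (k - j) * frob (fps_nth (fps_expansion P 0)) t j) = 0"
  obtains A where "A holomorphic_on ball 0 R" "A 0 = 1"
    "\<And>z. z \<in> ball 0 R \<Longrightarrow> z\<^sup>2 * deriv (deriv A) z + of_int (t + 1) * z * deriv A z = (P z - P 0) * A z"
proof -
  define PF where "PF = fps_expansion P 0"
  define p where "p = fps_nth PF"
  define F where "F = Abs_fps (frob p t)"
  have hP: "P holomorphic_on eball 0 (ereal R)" using P by simp
  have cP: "fps_conv_radius PF \<ge> R" unfolding PF_def by (rule conv_radius_fps_expansion[OF hP])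
  have bd: "\<exists>M. \<forall>j. norm (p j) * r ^ j \<le> M" if "0 < r" "r < R" for r
  proof -
    have "ereal (norm (of_real r :: complex)) < fps_conv_radius PF"
      using that cP less_le_trans[of "ereal r" "ereal R"] by simp
    then have "summable (\<lambda>j. p j * of_real r ^ j)" unfolding p_def by (rule summable_fps)
    then have "(\<lambda>j. p j * of_real r ^ j) \<longlonglongrightarrow> 0" by (rule summable_LIMSEQ_zero)
    then have "Bseq (\<lambda>j. p j * of_real r ^ j)" by (meson convergentI convergent_imp_Bseq)
    then obtain M where "\<And>j. norm (p j * of_real r ^ j) \<le> M" unfolding Bseq_def by blast
    then show ?thesis using that by (auto simp: norm_mult norm_power)
  qed
  have cF: "fps_conv_radius F \<ge> R"
    unfolding fps_conv_radius_def
  proof (rule conv_radius_geI_ex')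
    fix \<rho> :: real assume rho: "0 < \<rho>" "ereal \<rho> < ereal R"
    \<comment> \<open>Three radii \<open>\<rho> < s < r < R\<close>: boundedness of the terms of
      \<open>P\<close> at \<open>r\<close>, the loss \<open>q = s / r\<close> in
      \<open>frob_bound\<close>, and convergence at \<open>\<rho>\<close> by Abel's lemma.\<close>
    define r where "r = (\<rho> + R) / 2"
    define s where "s = (\<rho> + r) / 2"
    have "0 < \<rho>" "\<rho> < R" using rho by auto
    then have "\<rho> < r" "r < R" unfolding r_def by simp_all
    moreover from this have "\<rho> < s" "s < r" unfolding s_def by simp_all
    ultimately have o: "\<rho> < s" "s < r" "r < R" "0 < r" "0 < s" using \<open>0 < \<rho>\<close> by simp_all
    obtain M where M: "\<And>j. norm (p j) * r ^ j \<le> M" using bd[of r] o by blast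
    obtain B where B: "\<And>k. norm (frob p t k) * r ^ k * (s / r) ^ k \<le> B"
      using frob_bound[OF o(4) M, of "s / r" t] o by auto
    have "norm (frob p t k) * s ^ k \<le> B" for k
      using B[of k] o(4) by (simp add: power_divide)
    then have "summable (\<lambda>k. norm (frob p t k) * \<rho> ^ k)"
      by (rule Abel_lemma[OF less_imp_le[OF rho(1)] o(1)])
    then have "summable (\<lambda>k. norm (frob p t k * of_real \<rho> ^ k))"
      using rho by (simp add: norm_mult norm_power)
    then show "summable (\<lambda>k. fps_nth F k * of_real \<rho> ^ k)"
      unfolding F_def by (simp add: summable_norm_cancel)
  qed
  have rec: "of_nat k * of_int (int k + t) * frob p t k = (\<Sum>j<k. p (k - j) * frob p t j)" if k: "k > 0" for k
  proof (cases "int k + t = 0")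
    case True
    then show ?thesis using res[OF k True] by (simp add: p_def PF_def)
  next
    case False
    then show ?thesis using k by (subst frob.simps) (simp del: of_int_add)
  qed
  define DF DDF where "DF = fps_deriv F" and "DDF = fps_deriv DF"
  have c: "fps_conv_radius DF \<ge> R" "fps_conv_radius DDF \<ge> R"
    unfolding DF_def DDF_def using cF fps_conv_radius_deriv order_trans by metis+
  have fps: "fps_X ^ 2 * DDF + fps_const (of_int (t + 1)) * (fps_X * DF) = (PF - fps_const (fps_nth PF 0)) * F"
  proof (rule fps_ext)
    fix k
    have nn: "fps_nth (fps_X * DF) k = of_nat k * frob p t k"
      by (cases k) (simp_all add: DF_def F_def)
    have nn2: "fps_nth (fps_X ^ 2 * DDF) k = of_nat k * (of_nat k - 1) * frob p t k"
    proof (cases "k < 2")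
      case True
      then have "k = 0 \<or> k = 1" by auto
      then show ?thesis by (auto simp: fps_X_power_mult_nth)
    next
      case False
      then obtain l where "k = Suc (Suc l)" by (metis One_nat_def Suc_1 add_2_eq_Suc le_Suc_ex not_less)
      then show ?thesis by (simp add: fps_X_power_mult_nth DDF_def DF_def F_def algebra_simps)
    qed
    have "fps_nth ((PF - fps_const (fps_nth PF 0)) * F) k = (\<Sum>i\<le>k. (if i = 0 then 0 else p i) * frob p t (k - i))"
      unfolding fps_mult_nth atLeast0AtMost by (intro sum.cong) (auto simp: p_def F_def)
    also have "\<dots> = (\<Sum>j\<le>k. (if k - j = 0 then 0 else p (k - j)) * frob p t j)"
      by (rule sum.reindex_bij_witness[of _ "\<lambda>j. k - j" "\<lambda>j. k - j"]) auto
    also have "\<dots> = (\<Sum>j<k. p (k - j) * frob p t j)"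
      by (rule sum.mono_neutral_cong_right) auto
    also have "\<dots> = of_nat k * of_int (int k + t) * frob p t k"
      using rec[of k] by (cases "k = 0") auto
    finally have rhs: "fps_nth ((PF - fps_const (fps_nth PF 0)) * F) k = of_nat k * of_int (int k + t) * frob p t k" .
    have "fps_nth (fps_X ^ 2 * DDF + fps_const (of_int (t + 1)) * (fps_X * DF)) k
      = of_nat k * (of_nat k - 1) * frob p t k + of_int (t + 1) * (of_nat k * frob p t k)"
      by (simp only: fps_add_nth fps_mult_left_const_nth nn nn2)
    also have "\<dots> = of_nat k * of_int (int k + t) * frob p t k" by (simp add: algebra_simps)
    finally show "fps_nth (fps_X ^ 2 * DDF + fps_const (of_int (t + 1)) * (fps_X * DF)) k
       = fps_nth ((PF - fps_const (fps_nth PF 0)) * F) k" unfolding rhs .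
  qed
  define A where "A = eval_fps F"
  have dA: "(A has_field_derivative eval_fps DF z) (at z)" if "z \<in> ball 0 R" for z
    unfolding A_def DF_def using that cF less_le_trans[of "ereal (norm z)" "ereal R"]
    by (intro has_field_derivative_eval_fps) auto
  have dA2: "(eval_fps DF has_field_derivative eval_fps DDF z) (at z)" if "z \<in> ball 0 R" for z
    unfolding DDF_def using that c(1) less_le_trans[of "ereal (norm z)" "ereal R"]
    by (intro has_field_derivative_eval_fps) auto
  show ?thesis
  proof (rule that[of A])
    show "A holomorphic_on ball 0 R" using dA holomorphic_on_open by blast
    show "A 0 = 1" by (simp add: A_def eval_fps_at_0 F_def frob_0)
    fix z :: complex assume z: "z \<in> ball 0 R"
    have 1: "deriv A z = eval_fps DF z" if "z \<in> ball 0 R" for z using dA[OF that] by (rule DERIV_imp_deriv)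
    have "\<forall>\<^sub>F u in nhds z. u \<in> ball 0 R" using z by (intro eventually_nhds_in_open) auto
    then have "\<forall>\<^sub>F u in nhds z. deriv A u = eval_fps DF u" by eventually_elim (rule 1)
    then have 2: "deriv (deriv A) z = eval_fps DDF z"
      using DERIV_imp_deriv[OF dA2[OF z]] deriv_cong_ev by metis
    have lt: "ereal (norm z) < fps_conv_radius PF" "ereal (norm z) < fps_conv_radius F"
      "ereal (norm z) < fps_conv_radius DF" "ereal (norm z) < fps_conv_radius DDF"
      using z cP cF c less_le_trans[of "ereal (norm z)" "ereal R"] by auto
    have m: "ereal (norm z) < fps_conv_radius (a * b)"
      if "ereal (norm z) < fps_conv_radius a" "ereal (norm z) < fps_conv_radius b" for a b :: "complex fps"
      using that less_le_trans[OF _ fps_conv_radius_mult[of a b]] by auto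
    have e1: "eval_fps (fps_X ^ 2 * DDF + fps_const (of_int (t + 1)) * (fps_X * DF)) z
       = z\<^sup>2 * eval_fps DDF z + of_int (t + 1) * (z * eval_fps DF z)"
      using lt m by (simp add: eval_fps_add eval_fps_mult)
    have "ereal (norm z) < fps_conv_radius (PF - fps_const (fps_nth PF 0))"
      using lt less_le_trans[OF _ fps_conv_radius_diff[of PF "fps_const (fps_nth PF 0)"]] by auto
    then have e2: "eval_fps ((PF - fps_const (fps_nth PF 0)) * F) z = (eval_fps PF z - fps_nth PF 0) * eval_fps F z"
      using lt by (simp add: eval_fps_mult eval_fps_diff)
    have "eval_fps PF z = P z" unfolding PF_def using eval_fps_expansion'[OF hP, of z] z by simp
    moreover have "fps_nth PF 0 = P 0" by (simp add: PF_def fps_expansion_def)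
    ultimately show "z\<^sup>2 * deriv (deriv A) z + of_int (t + 1) * z * deriv A z = (P z - P 0) * A z"
      using e1 e2 fps A_def unfolding 1[OF z] 2 by (simp add: mult.assoc)
  qed
qed

text \<open>The defect \<open>deriv (deriv f) z - q z * f z\<close> is continuous at
  \<open>a\<close> and zero around it.\<close>

lemma solves_removable:
  assumes "open S" "a \<in> S" "f holomorphic_on S" "q holomorphic_on S" "solves q (S - {a}) f"
  shows "solves q S f"
proof (rule solvesI)
  have h: "deriv f holomorphic_on S" "deriv (deriv f) holomorphic_on S"
    by (intro holomorphic_deriv assms)+
  show "(f has_field_derivative deriv f z) (at z)" if "z \<in> S" for z
    by (rule holomorphic_derivI[OF assms(3,1) that])
  have op: "open (S - {a})" using assms(1) by (simp add: open_Diff)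
  have eq: "deriv (deriv f) z = q z * f z" if "z \<in> S - {a}" for z
    using DERIV_imp_deriv[OF solvesD(2)[OF assms(5) op that]] .
  define g where "g z = deriv (deriv f) z - q z * f z" for z
  have "g holomorphic_on S" unfolding g_def by (intro holomorphic_intros h assms)
  then have "isCont g a"
    using assms(1,2) holomorphic_on_imp_continuous_on continuous_on_eq_continuous_at by blast
  then have "(g \<longlongrightarrow> g a) (at a)" by (simp add: isCont_def)
  moreover have "\<forall>\<^sub>F z in at a. z \<in> S - {a}" using assms(1,2) by (rule eventually_at_in_open)
  then have "\<forall>\<^sub>F z in at a. g z = 0" by eventually_elim (simp add: g_def eq)
  then have "(g \<longlongrightarrow> 0) (at a)" by (rule tendsto_eventually)
  ultimately have "g a = 0" using LIM_unique by blast
  then have "deriv (deriv f) z = q z * f z" if "z \<in> S" for z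
    using eq that by (cases "z = a") (auto simp: g_def)
  then show "(deriv f has_field_derivative q z * f z) (at z)" if "z \<in> S" for z
    using holomorphic_derivI[OF h(1) assms(1) that] that by simp
qed

lemma frobenius_solution:
  assumes A: "A holomorphic_on ball 0 R" and s: "of_int (s * (s - 1)) = P 0"
    and eq: "\<And>z. z \<in> ball 0 R \<Longrightarrow> z\<^sup>2 * deriv (deriv A) z + of_int (2 * s) * z * deriv A z = (P z - P 0) * A z"
  shows "solves (\<lambda>z. P z / z\<^sup>2) (ball 0 R - {0}) (\<lambda>z. z powi s * A z)"
    and "z \<in> ball 0 R - {0} \<Longrightarrow> deriv (\<lambda>z. z powi s * A z) z = z powi (s - 1) * (of_int s * A z + z * deriv A z)"
proof -
  have op: "open (ball 0 R :: complex set)" by simp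
  have dA: "(A has_field_derivative deriv A z) (at z)" "(deriv A has_field_derivative deriv (deriv A) z) (at z)" if "z \<in> ball 0 R" for z
    by (rule holomorphic_derivI[OF _ op that] A holomorphic_deriv[OF A op])+
  have pw: "((\<lambda>z. z powi k) has_field_derivative of_int k * z powi (k - 1)) (at z)" if "z \<noteq> 0" for z :: complex and k :: int
    using that by (auto intro!: derivative_eq_intros)
  have shift: "z powi k = z powi (k - 1) * z" if "z \<noteq> 0" for z :: complex and k :: int
    using power_int_add_1[of z "k - 1"] that by simp
  have d1: "((\<lambda>z. z powi s * A z) has_field_derivative z powi (s - 1) * (of_int s * A z + z * deriv A z)) (at z)"
    if "z \<in> ball 0 R - {0}" for z
  proof -
    have z: "z \<in> ball 0 R" "z \<noteq> 0" using that by auto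
    show ?thesis using DERIV_mult[OF pw[OF z(2), of s] dA(1)[OF z(1)]] shift[OF z(2), of s]
      by (simp add: algebra_simps)
  qed
  then show "z \<in> ball 0 R - {0} \<Longrightarrow> deriv (\<lambda>z. z powi s * A z) z = z powi (s - 1) * (of_int s * A z + z * deriv A z)"
    using DERIV_imp_deriv by blast
  show "solves (\<lambda>z. P z / z\<^sup>2) (ball 0 R - {0}) (\<lambda>z. z powi s * A z)"
  proof (rule solvesI[OF d1])
    fix z :: complex assume "z \<in> ball 0 R - {0}"
    then have z: "z \<in> ball 0 R" "z \<noteq> 0" by auto
    define u where "u = z powi (s - 2)"
    have us: "z powi (s - 1) = u * z" "z powi s = u * z * z"
      using shift[OF z(2), of s] shift[OF z(2), of "s - 1"] by (simp_all add: u_def)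
    have "((\<lambda>z. of_int s * A z + z * deriv A z) has_field_derivative
       of_int s * deriv A z + (1 * deriv A z + deriv (deriv A) z * z)) (at z)"
      by (intro DERIV_add DERIV_cmult DERIV_mult DERIV_ident dA z)
    from DERIV_mult[OF pw[OF z(2), of "s - 1"] this]
    have "((\<lambda>z. z powi (s - 1) * (of_int s * A z + z * deriv A z)) has_field_derivative
       of_int (s - 1) * u * (of_int s * A z + z * deriv A z) + (of_int s * deriv A z + (1 * deriv A z + deriv (deriv A) z * z)) * (u * z)) (at z)"
      by (simp add: us(1)) (simp add: u_def)
    also have "of_int (s - 1) * u * (of_int s * A z + z * deriv A z) + (of_int s * deriv A z + (1 * deriv A z + deriv (deriv A) z * z)) * (u * z)
      = u * (of_int (s * (s - 1)) * A z + (z\<^sup>2 * deriv (deriv A) z + of_int (2 * s) * z * deriv A z))"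
      by (simp add: algebra_simps power2_eq_square)
    also have "\<dots> = u * (P z * A z)" unfolding eq[OF z(1)] s by (simp add: algebra_simps)
    also have "\<dots> = P z / z\<^sup>2 * (z powi s * A z)" using z(2) by (simp add: us power2_eq_square)
    finally show "((\<lambda>z. z powi (s - 1) * (of_int s * A z + z * deriv A z)) has_field_derivative
      P z / z\<^sup>2 * (z powi s * A z)) (at z)" .
  qed
qed

lemma fps_expansion_even_odd_coeff:
  assumes P: "P holomorphic_on ball 0 R" "R > 0" and ev: "\<And>z. z \<in> ball 0 R \<Longrightarrow> P (- z) = P z" and "odd k"
  shows "fps_nth (fps_expansion P 0) k = 0"
proof -
  have "(deriv ^^ k) (\<lambda>w. P (- 1 * w + 0)) 0 = (- 1) ^ k * (deriv ^^ k) P (- 1 * 0 + 0)"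
    by (rule higher_deriv_compose_linear'[OF P(1), of "ball 0 R"]) (use P(2) in auto)
  moreover have "\<forall>\<^sub>F w in nhds 0. w \<in> ball 0 R" using P(2) by (intro eventually_nhds_in_open) auto
  then have "\<forall>\<^sub>F w in nhds 0. P (- 1 * w + 0) = P w" by eventually_elim (simp add: ev)
  then have "(deriv ^^ k) (\<lambda>w. P (- 1 * w + 0)) 0 = (deriv ^^ k) P 0" by (intro higher_deriv_cong_ev refl)
  ultimately have "(deriv ^^ k) P 0 = - (deriv ^^ k) P 0" using \<open>odd k\<close> by simp
  then show ?thesis by (simp add: fps_expansion_def)
qed

text \<open>The exponents are \<open>- m\<close> and \<open>m + 1\<close>. Their difference
  \<open>2 * m + 1\<close> is odd, so that by \<open>frob_odd\<close> the only resonance is solvable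
  and both exponents carry solutions without logarithm.\<close>

lemma local_basis_singular:
  fixes m :: nat
  assumes R: "R > 0" and P: "P holomorphic_on ball 0 R" and P0: "P 0 = of_nat (m * (m + 1))"
    and ev: "\<And>z. z \<in> ball 0 R \<Longrightarrow> P (- z) = P z"
  obtains f g where "solves (\<lambda>z. P z / z\<^sup>2) (ball 0 R - {0}) f" "solves (\<lambda>z. P z / z\<^sup>2) (ball 0 R - {0}) g"
    "\<And>z. z \<in> ball 0 R - {0} \<Longrightarrow> wronsk f g z \<noteq> 0"
proof -
  let ?S = "ball 0 R - {0 :: complex}"
  have odd: "odd k \<Longrightarrow> fps_nth (fps_expansion P 0) k = 0" for k
    by (rule fps_expansion_even_odd_coeff[OF P R ev])
  have res: "(\<Sum>j<k. fps_nth (fps_expansion P 0) (k - j) * frob (fps_nth (fps_expansion P 0)) t j) = 0"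
    if "int k + t = 0" "odd t" for k t
  proof -
    have "odd k" using that by presburger
    then show ?thesis using frob_odd[of "fps_nth (fps_expansion P 0)"] odd by blast
  qed
  define s1 s2 where "s1 = - int m" and "s2 = int m + 1"
  obtain A where A: "A holomorphic_on ball 0 R" "A 0 = 1"
    "\<And>z. z \<in> ball 0 R \<Longrightarrow> z\<^sup>2 * deriv (deriv A) z + of_int (2 * s1 - 1 + 1) * z * deriv A z = (P z - P 0) * A z"
    by (rule frobenius_series[OF R P, of "2 * s1 - 1"]) (use res in auto)
  obtain B where B: "B holomorphic_on ball 0 R" "B 0 = 1"
    "\<And>z. z \<in> ball 0 R \<Longrightarrow> z\<^sup>2 * deriv (deriv B) z + of_int (2 * s2 - 1 + 1) * z * deriv B z = (P z - P 0) * B z"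
    by (rule frobenius_series[OF R P, of "2 * s2 - 1"]) (use res in auto)
  have sP: "of_int (s1 * (s1 - 1)) = P 0" "of_int (s2 * (s2 - 1)) = P 0"
    by (simp_all add: s1_def s2_def P0 algebra_simps)
  define f g where "f z = z powi s1 * A z" and "g z = z powi s2 * B z" for z
  have f: "solves (\<lambda>z. P z / z\<^sup>2) ?S f" "\<And>z. z \<in> ?S \<Longrightarrow> deriv f z = z powi (s1 - 1) * (of_int s1 * A z + z * deriv A z)"
    unfolding f_def[abs_def] using frobenius_solution[where A = A and R = R and s = s1 and P = P, OF A(1) sP(1)] A(3) by simp_all
  have g: "solves (\<lambda>z. P z / z\<^sup>2) ?S g" "\<And>z. z \<in> ?S \<Longrightarrow> deriv g z = z powi (s2 - 1) * (of_int s2 * B z + z * deriv B z)"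
    unfolding g_def[abs_def] using frobenius_solution[where A = B and R = R and s = s2 and P = P, OF B(1) sP(2)] B(3) by simp_all
  \<comment> \<open>The Wronskian after cancellation of the powers of \<open>z\<close>; it is
    continuous at 0, with the difference of the exponents as value.\<close>
  define W where "W z = of_nat (2 * m + 1) * A z * B z + z * (A z * deriv B z - deriv A z * B z)" for z
  have W: "wronsk f g z = W z" if "z \<in> ?S" for z
  proof -
    have z: "z \<noteq> 0" using that by simp
    have "z powi - k * z powi k = 1" for k using z by (simp add: power_int_minus)
    from this[of "int m"] this[of "int m + 1"]
    have 1: "z powi s1 * z powi (s2 - 1) = 1" "z powi (s1 - 1) * z powi s2 = 1"
      by (simp_all add: s1_def s2_def)
    have "wronsk f g z = (z powi s1 * z powi (s2 - 1)) * (A z * (of_int s2 * B z + z * deriv B z))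
       - (z powi (s1 - 1) * z powi s2) * ((of_int s1 * A z + z * deriv A z) * B z)"
      unfolding wronsk_def f(2)[OF that] g(2)[OF that] f_def g_def by (simp add: algebra_simps)
    also have "\<dots> = W z" unfolding 1 unfolding W_def s1_def s2_def by (simp add: algebra_simps)
    finally show ?thesis .
  qed
  have op: "open ?S" and conn: "connected ?S"
    using connected_punctured_ball[of "0::complex" R] by (auto simp: open_Diff)
  show ?thesis
  proof (rule that[OF f(1) g(1)])
    fix z assume z: "z \<in> ?S"
    have "isCont W 0"
    proof -
      have "W holomorphic_on ball 0 R" unfolding W_def
        by (intro holomorphic_intros A(1) B(1) holomorphic_deriv open_ball)
      then show ?thesis using R holomorphic_on_imp_continuous_on continuous_on_eq_continuous_at
        by (metis centre_in_ball open_ball)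
    qed
    then have "(W \<longlongrightarrow> W 0) (at 0)" by (simp add: isCont_def)
    moreover have "\<forall>\<^sub>F u in at 0. u \<in> ?S" using R by (intro eventually_at_in_open) auto
    then have "\<forall>\<^sub>F u in at 0. W u = W z"
    proof eventually_elim
      case (elim u)
      then show ?case using wronsk_const[OF f(1) g(1) op conn elim z] W z by simp
    qed
    then have "(W \<longlongrightarrow> W z) (at 0)" by (rule tendsto_eventually)
    ultimately have "W z = W 0" using LIM_unique by blast
    also have "W 0 = of_nat (2 * m + 1)" by (simp add: W_def A B)
    also have "\<dots> \<noteq> 0" unfolding of_nat_eq_0_iff by simp
    finally show "wronsk f g z \<noteq> 0" using W z by simp
  qed
qed

text \<open>An ordinary point is treated as a singular one with exponents 0 and 1. The resonance at
  index 1 is solvable because \<open>z\<^sup>2 * q z\<close> has no linear term.\<close>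

lemma local_basis_regular:
  assumes R: "R > 0" and q: "q holomorphic_on ball 0 R"
  obtains f g where "solves q (ball 0 R) f" "solves q (ball 0 R) g" "\<And>z. z \<in> ball 0 R \<Longrightarrow> wronsk f g z \<noteq> 0"
proof -
  define P where "P z = z\<^sup>2 * q z" for z
  have P: "P holomorphic_on ball 0 R" unfolding P_def by (intro holomorphic_intros q)
  have "(P has_field_derivative 2 * 0 * q 0 + deriv q 0 * 0\<^sup>2) (at 0)"
    unfolding P_def[abs_def]
    by (rule DERIV_mult) (use R holomorphic_derivI[OF q open_ball, of 0] in \<open>auto intro!: derivative_eq_intros\<close>)
  then have p1: "fps_nth (fps_expansion P 0) (Suc 0) = 0"
    by (simp add: fps_expansion_def DERIV_imp_deriv)
  have res: "(\<Sum>j<k. fps_nth (fps_expansion P 0) (k - j) * frob (fps_nth (fps_expansion P 0)) (- 1) j) = 0"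
    if "int k + - 1 = 0" for k
  proof -
    have "k = 1" using that by simp
    then show ?thesis by (simp add: p1)
  qed
  obtain A where A: "A holomorphic_on ball 0 R" "A 0 = 1"
    "\<And>z. z \<in> ball 0 R \<Longrightarrow> z\<^sup>2 * deriv (deriv A) z + of_int (- 1 + 1) * z * deriv A z = (P z - P 0) * A z"
    by (rule frobenius_series[OF R P, of "- 1"]) (use res in auto)
  obtain B where B: "B holomorphic_on ball 0 R" "B 0 = 1"
    "\<And>z. z \<in> ball 0 R \<Longrightarrow> z\<^sup>2 * deriv (deriv B) z + of_int (1 + 1) * z * deriv B z = (P z - P 0) * B z"
    by (rule frobenius_series[OF R P, of 1]) auto
  have P0: "P 0 = 0" by (simp add: P_def)
  have f: "solves q (ball 0 R) A"
  proof (rule solves_removable[OF open_ball _ A(1) q])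
    show "solves q (ball 0 R - {0}) A"
      by (rule solves_cong[OF frobenius_solution(1)[where A = A and R = R and s = 0 and P = P, OF A(1)]])
        (use A(3) in \<open>auto simp: P0 P_def open_Diff\<close>)
  qed (use R in simp)
  have g: "solves q (ball 0 R) (\<lambda>z. z * B z)"
  proof (rule solves_removable[OF open_ball _ _ q])
    show "(\<lambda>z. z * B z) holomorphic_on ball 0 R" by (intro holomorphic_intros B(1))
    show "solves q (ball 0 R - {0}) (\<lambda>z. z * B z)"
      by (rule solves_cong[OF frobenius_solution(1)[where A = B and R = R and s = 1 and P = P, OF B(1)]])
        (use B(3) in \<open>auto simp: P0 P_def open_Diff\<close>)
  qed (use R in simp)
  have "((\<lambda>z. z * B z) has_field_derivative 1 * B 0 + deriv B 0 * 0) (at 0)"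
    using R by (intro DERIV_mult DERIV_ident holomorphic_derivI[OF B(1)]) auto
  then have "wronsk A (\<lambda>z. z * B z) 0 = 1" by (simp add: wronsk_def A B DERIV_imp_deriv)
  moreover have "wronsk A (\<lambda>z. z * B z) z = wronsk A (\<lambda>z. z * B z) 0" if "z \<in> ball 0 R" for z
    by (rule wronsk_const[OF f g]) (use that R in auto)
  ultimately show ?thesis using that[OF f g] by simp
qed

section \<open>Global solutions of the Lame equation\<close>

locale lame = lattice +
  fixes n :: nat and Bt :: complex
begin

definition Q :: "complex \<Rightarrow> complex" where "Q z = of_nat (n * (n + 1)) * wp L z + Bt"

text \<open>Absence of monodromy around the lattice points of \<open>U\<close>. Arbitrary initial
  data are part of the notion so that solutions on overlapping sets can be matched.\<close>

definition good :: "complex set \<Rightarrow> bool" where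
  "good U \<longleftrightarrow> open U \<and> (\<forall>b\<in>U - L. \<forall>\<alpha> \<beta>. \<exists>f. solves Q (U - L) f \<and> f b = \<alpha> \<and> deriv f b = \<beta>)"

lemma Q_holomorphic: "Q holomorphic_on - L"
  unfolding Q_def by (intro holomorphic_intros wp_holomorphic)

lemma Q_periodic: "v \<in> L \<Longrightarrow> z \<notin> L \<Longrightarrow> Q (z + v) = Q z"
  by (simp add: Q_def wp_periodic)

lemma Q_even: "Q (- z) = Q z"
  by (simp add: Q_def wp_even)

lemma good_subset: "good V \<Longrightarrow> U \<subseteq> V \<Longrightarrow> open U \<Longrightarrow> good U"
  unfolding good_def using solves_subset[of Q "V - L" _ "U - L"] by (meson Diff_iff Diff_mono order_refl subsetD)

lemma good_basisI:
  assumes "open U" "solves Q (U - L) f" "solves Q (U - L) g" "\<And>z. z \<in> U - L \<Longrightarrow> wronsk f g z \<noteq> 0"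
  shows "good U"
  unfolding good_def
proof (intro conjI ballI allI)
  fix b \<alpha> \<beta> assume b: "b \<in> U - L"
  have "open (U - L)" using assms(1) closed_L by (rule open_Diff)
  then show "\<exists>f. solves Q (U - L) f \<and> f b = \<alpha> \<and> deriv f b = \<beta>"
    using solution_with_data[OF assms(2,3) _ b assms(4)[OF b]] by metis
qed fact

text \<open>Translation moves \<open>\<omega>\<close> to 0, where \<open>z\<^sup>2 * Q z\<close>
  extends to an even holomorphic function with value \<open>n * (n + 1)\<close>; then
  \<open>local_basis_singular\<close> applies.\<close>

lemma good_singular: assumes "\<omega> \<in> L" shows "good (ball \<omega> cL)"
proof -
  define P where "P z = of_nat (n * (n + 1)) * (1 + z\<^sup>2 * gwp z) + Bt * z\<^sup>2" for z
  have g: "gwp holomorphic_on ball 0 cL"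
    using gwp_deriv(1) ball_cL_sub holomorphic_on_open[OF open_ball] by blast
  have P: "P holomorphic_on ball 0 cL" unfolding P_def by (intro holomorphic_intros g)
  have P0: "P 0 = of_nat (n * (n + 1))" by (simp add: P_def)
  have ev: "P (- z) = P z" for z by (simp add: P_def gwp_even)
  have QP: "Q z = P z / z\<^sup>2" if "z \<noteq> 0" for z
    using that by (simp add: Q_def P_def wp_eq field_simps)
  obtain f g where fg: "solves (\<lambda>z. P z / z\<^sup>2) (ball 0 cL - {0}) f" "solves (\<lambda>z. P z / z\<^sup>2) (ball 0 cL - {0}) g"
    "\<And>z. z \<in> ball 0 cL - {0} \<Longrightarrow> wronsk f g z \<noteq> 0"
    by (rule local_basis_singular[OF cL_pos P P0 ev]) blast
  let ?T = "ball \<omega> cL - L"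
  have op: "open (ball 0 cL - {0::complex})" by (rule open_delete[OF open_ball])
  have T: "1 * z + - \<omega> \<in> ball 0 cL - {0}" if "z \<in> ?T" for z
    using that assms by (auto simp: dist_norm norm_minus_commute)
  have q: "P (1 * z + - \<omega>) / (1 * z + - \<omega>)\<^sup>2 = Q z" if "z \<in> ?T" for z
  proof -
    have "Q (z + - \<omega>) = Q z" using assms that by (intro Q_periodic) auto
    then show ?thesis using QP[of "z - \<omega>"] T[OF that] by simp
  qed
  have F1: "solves Q (?T) (\<lambda>z. f (1 * z + - \<omega>))"
    by (rule solves_affine(1)[OF fg(1) op]) (use T q in simp_all)
  have G1: "solves Q (?T) (\<lambda>z. g (1 * z + - \<omega>))"
    by (rule solves_affine(1)[OF fg(2) op]) (use T q in simp_all)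
  show ?thesis
  proof (rule good_basisI[OF open_ball F1 G1])
    fix z assume z: "z \<in> ?T"
    have "deriv (\<lambda>z. f (1 * z + - \<omega>)) z = 1 * deriv f (1 * z + - \<omega>)"
      by (rule solves_affine(2)[OF fg(1) op _ _ _ z]) (use T q in simp_all)
    moreover have "deriv (\<lambda>z. g (1 * z + - \<omega>)) z = 1 * deriv g (1 * z + - \<omega>)"
      by (rule solves_affine(2)[OF fg(2) op _ _ _ z]) (use T q in simp_all)
    ultimately have "wronsk (\<lambda>z. f (1 * z + - \<omega>)) (\<lambda>z. g (1 * z + - \<omega>)) z = wronsk f g (1 * z + - \<omega>)"
      unfolding wronsk_def by simp
    then show "wronsk (\<lambda>z. f (1 * z + - \<omega>)) (\<lambda>z. g (1 * z + - \<omega>)) z \<noteq> 0" using fg(3) T[OF z] by simp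
  qed
qed

lemma good_regular: assumes "r > 0" "ball a r \<inter> L = {}" shows "good (ball a r)"
proof -
  have T: "1 * z + - a \<in> ball 0 r" if "z \<in> ball a r - L" for z
    using that by (auto simp: dist_norm norm_minus_commute)
  have im: "(\<lambda>z. z + a) ` ball 0 r \<subseteq> - L"
  proof
    fix y assume "y \<in> (\<lambda>z. z + a) ` ball 0 r"
    then have "y \<in> ball a r" by (auto simp: dist_norm)
    then show "y \<in> - L" using assms(2) by auto
  qed
  have "(\<lambda>z. z + a) holomorphic_on ball 0 r" by (intro holomorphic_intros)
  then have "(Q \<circ> (\<lambda>z. z + a)) holomorphic_on ball 0 r"
    using holomorphic_on_compose_gen[OF _ Q_holomorphic im] by blast
  then have "(\<lambda>z. Q (z + a)) holomorphic_on ball 0 r" by (simp add: o_def)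
  then obtain f g where fg: "solves (\<lambda>z. Q (z + a)) (ball 0 r) f" "solves (\<lambda>z. Q (z + a)) (ball 0 r) g"
    "\<And>z. z \<in> ball 0 r \<Longrightarrow> wronsk f g z \<noteq> 0"
    by (rule local_basis_regular[OF assms(1)]) blast
  have q: "Q (1 * z + - a + a) = Q z" if "z \<in> ball a r - L" for z by simp
  have F1: "solves Q (ball a r - L) (\<lambda>z. f (1 * z + - a))"
    by (rule solves_affine(1)[OF fg(1) open_ball]) (use T q in simp_all)
  have G1: "solves Q (ball a r - L) (\<lambda>z. g (1 * z + - a))"
    by (rule solves_affine(1)[OF fg(2) open_ball]) (use T q in simp_all)
  show ?thesis
  proof (rule good_basisI[OF open_ball F1 G1])
    fix z assume z: "z \<in> ball a r - L"
    have "deriv (\<lambda>z. f (1 * z + - a)) z = 1 * deriv f (1 * z + - a)"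
      by (rule solves_affine(2)[OF fg(1) open_ball _ _ _ z]) (use T q in simp_all)
    moreover have "deriv (\<lambda>z. g (1 * z + - a)) z = 1 * deriv g (1 * z + - a)"
      by (rule solves_affine(2)[OF fg(2) open_ball _ _ _ z]) (use T q in simp_all)
    ultimately have "wronsk (\<lambda>z. f (1 * z + - a)) (\<lambda>z. g (1 * z + - a)) z = wronsk f g (1 * z + - a)"
      unfolding wronsk_def by simp
    then show "wronsk (\<lambda>z. f (1 * z + - a)) (\<lambda>z. g (1 * z + - a)) z \<noteq> 0" using fg(3) T[OF z] by simp
  qed
qed

text \<open>A ball of this radius that contains a lattice point lies in the ball of twice the radius
  around that point.\<close>

lemma good_small: "good (ball a (cL / 2))"
proof (cases "ball a (cL / 2) \<inter> L = {}")
  case True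
  then show ?thesis using cL_pos by (intro good_regular) auto
next
  case False
  then obtain w where w: "w \<in> L" "dist a w < cL / 2" by auto
  have "ball a (cL / 2) \<subseteq> ball w cL"
  proof
    fix x assume "x \<in> ball a (cL / 2)"
    then have "dist w x < cL" using w(2) dist_triangle[of w x a] by (simp add: dist_commute)
    then show "x \<in> ball w cL" by simp
  qed
  then show ?thesis using good_subset[OF good_singular[OF w(1)]] by simp
qed

text \<open>Locally a solution is determined by its data at one point; identity propagates along
  connected sets.\<close>

lemma solution_unique:
  assumes "open U" "connected U" "solves Q (U - L) f" "solves Q (U - L) g"
    and b: "b \<in> U - L" "f b = g b" "deriv f b = deriv g b" and z: "z \<in> U - L"
  shows "f z = g z"
proof -
  have op: "open (U - L)" using assms(1) closed_L by (rule open_Diff)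
  have conn: "connected (U - L)" using assms(1,2) by (rule connected_open_diff_L)
  define h where "h z = 1 * f z + (- 1) * g z" for z
  have h: "solves Q (U - L) h" "deriv h b = 0" "h b = 0"
    unfolding h_def[abs_def] using solves_lincomb(1)[OF assms(3,4) op, of 1 "- 1"]
      solves_lincomb(2)[OF assms(3,4) op b(1), of 1 "- 1"] b(2,3) by simp_all
  obtain e where e: "e > 0" "ball b e \<subseteq> U - L" using op b(1) open_contains_ball by blast
  have gd: "good (ball b e)" using e by (intro good_regular) auto
  have bL: "ball b e - L = ball b e" using e by auto
  obtain u where u: "solves Q (ball b e) u" "u b = 1" "deriv u b = 0"
    using gd e(1) unfolding good_def bL by (metis centre_in_ball)
  obtain v where v: "solves Q (ball b e) v" "v b = 0" "deriv v b = 1"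
    using gd e(1) unfolding good_def bL by (metis centre_in_ball)
  have 0: "h z = 0" if "z \<in> ball b e" for z
  proof (rule solution_eq_0[OF u(1) v(1) solves_subset[OF h(1) e(2)]])
    show "wronsk u v b \<noteq> 0" using u v by (simp add: wronsk_def)
  qed (use that e h in auto)
  have "h z = 0"
  proof (rule analytic_continuation[OF solves_holomorphic[OF h(1) op] op conn e(2) b(1) _ 0 z])
    show "b islimpt ball b e" using e(1) by (simp add: islimpt_ball)
  qed auto
  then show ?thesis by (simp add: h_def)
qed

text \<open>The data are transported from one set to the other through a common point, which can be
  chosen off the countable lattice. Connectedness of the intersection makes the two solutions agree
  on all of it.\<close>

lemma good_union:
  assumes "good U" "good V" "connected U" "connected V" "connected (U \<inter> V)" "U \<inter> V \<noteq> {}"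
  shows "good (U \<union> V)"
proof -
  have main: "\<exists>f. solves Q (U \<union> V - L) f \<and> f b = \<alpha> \<and> deriv f b = \<beta>"
    if UV: "good U" "good V" "connected (U \<inter> V)" "U \<inter> V \<noteq> {}" and b: "b \<in> U - L" for U V b \<alpha> \<beta>
  proof -
    have op: "open U" "open V" using UV by (auto simp: good_def)
    then have op': "open (U - L)" "open (V - L)" "open (U \<inter> V)" using closed_L by (auto intro: open_Diff)
    obtain c where c: "c \<in> U \<inter> V" "c \<notin> L"
    proof -
      have "\<not> U \<inter> V \<subseteq> L"
      proof
        assume sub: "U \<inter> V \<subseteq> L"
        obtain x e where "e > 0" "ball x e \<subseteq> U \<inter> V"
          using op'(3) UV(4) open_contains_ball by blast
        then show False
          using uncountable_ball[of e x] countable_subset[OF _ countable_L, of "ball x e"] sub by blast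
      qed
      then show ?thesis using that by blast
    qed
    obtain f where f: "solves Q (U - L) f" "f b = \<alpha>" "deriv f b = \<beta>" using UV(1) b unfolding good_def by metis
    have "c \<in> V - L" using c by auto
    then obtain g where g: "solves Q (V - L) g" "g c = f c" "deriv g c = deriv f c"
      using UV(2) unfolding good_def by metis
    have eq: "f z = g z" if "z \<in> U \<inter> V - L" for z
      by (rule solution_unique[OF op'(3) UV(3) solves_subset[OF f(1)] solves_subset[OF g(1)], of c]) (use g c that in auto)
    define h where "h z = (if z \<in> U then f z else g z)" for z
    have hU: "solves Q (U - L) h" by (rule solves_cong[OF f(1) op'(1)]) (auto simp: h_def)
    have hV: "solves Q (V - L) h" by (rule solves_cong[OF g(1) op'(2)]) (use eq in \<open>auto simp: h_def\<close>)
    have "solves Q (U \<union> V - L) h"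
      using solvesD[OF hU op'(1)] solvesD[OF hV op'(2)] by (intro solvesI[of _ h "deriv h"]) auto
    moreover have "h b = \<alpha>" using f b by (simp add: h_def)
    moreover have "deriv h b = \<beta>"
    proof -
      have "\<forall>\<^sub>F z in nhds b. z \<in> U - L" using op'(1) b by (rule eventually_nhds_in_open)
      then have "\<forall>\<^sub>F z in nhds b. h z = f z" by eventually_elim (simp add: h_def)
      then have "deriv h b = deriv f b" by (rule deriv_cong_ev) simp
      then show ?thesis using f(3) by simp
    qed
    ultimately show ?thesis by blast
  qed
  have "open (U \<union> V)" using assms(1,2) by (auto simp: good_def)
  moreover have "\<exists>f. solves Q (U \<union> V - L) f \<and> f b = \<alpha> \<and> deriv f b = \<beta>" if "b \<in> U \<union> V - L" for b \<alpha> \<beta>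
    using main[OF assms(1,2,5,6), of b] main[OF assms(2,1), of b] assms(5,6) that
    by (auto simp: Int_commute Un_commute)
  ultimately show ?thesis by (simp add: good_def)
qed

section \<open>Gluing over overlapping rectangles\<close>

definition rect :: "real \<Rightarrow> real \<Rightarrow> real \<Rightarrow> real \<Rightarrow> complex set" where
  "rect a b c d = {z. a < Re z \<and> Re z < b \<and> c < Im z \<and> Im z < d}"

lemma rect: "open (rect a b c d)" "connected (rect a b c d)"
proof -
  have eq: "rect a b c d = box (Complex a c) (Complex b d)"
    by (auto simp: rect_def in_box_complex_iff)
  show "open (rect a b c d)" "connected (rect a b c d)"
    unfolding eq by (auto intro: open_box convex_connected convex_box)
qed

lemma rect_Int: "rect a b c d \<inter> rect a' b' c' d' = rect (max a a') (min b b') (max c c') (min d d')"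
  by (auto simp: rect_def)

lemma good_rect_small:
  assumes h: "0 < h" "4 * h < cL"
  shows "good (rect a (a + h) c (c + h))"
proof (rule good_subset[OF good_small[of "Complex a c"]])
  show "rect a (a + h) c (c + h) \<subseteq> ball (Complex a c) (cL / 2)"
  proof
    fix z assume z: "z \<in> rect a (a + h) c (c + h)"
    have "norm (z - Complex a c) \<le> \<bar>Re (z - Complex a c)\<bar> + \<bar>Im (z - Complex a c)\<bar>" by (rule cmod_le)
    also have "\<dots> < h + h" using z by (intro add_strict_mono) (auto simp: rect_def)
    finally show "z \<in> ball (Complex a c) (cL / 2)" using h by (simp add: dist_norm norm_minus_commute)
  qed
qed (rule rect)

text \<open>Squares of side \<open>2 * h\<close>, each shifted by \<open>h\<close>: a new square
  meets the row in a rectangle, so \<open>good_union\<close> applies. The bound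
  \<open>8 * h < cL\<close> is that of \<open>good_rect_small\<close> for side
  \<open>2 * h\<close>.\<close>

lemma good_rect_row:
  assumes h: "0 < h" "8 * h < cL"
  shows "good (rect a (a + (real k + 2) * h) c (c + 2 * h))"
proof (induction k)
  case 0
  then show ?case using good_rect_small[of "2 * h" a c] h by simp
next
  case (Suc k)
  let ?U = "rect a (a + (real k + 2) * h) c (c + 2 * h)"
  let ?V = "rect (a + (real k + 1) * h) (a + (real k + 1) * h + 2 * h) c (c + 2 * h)"
  have V: "good ?V" using good_rect_small[of "2 * h"] h by simp
  have kh: "real k * h \<ge> 0" using h by simp
  have "good (?U \<union> ?V)"
  proof (rule good_union[OF Suc V rect(2) rect(2)])
    show "connected (?U \<inter> ?V)" unfolding rect_Int by (rule rect)
    have "Complex (a + (real k + 3 / 2) * h) (c + h) \<in> ?U \<inter> ?V"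
      using h kh unfolding rect_def distrib_right by (simp; linarith)
    then show "?U \<inter> ?V \<noteq> {}" by blast
  qed
  moreover have "?U \<union> ?V = rect a (a + (real (Suc k) + 2) * h) c (c + 2 * h)"
  proof -
    define K where "K = real k * h"
    have e: "(real k + 2) * h = K + 2 * h" "(real k + 1) * h = K + h" "(real (Suc k) + 2) * h = K + 3 * h"
      by (simp_all add: K_def algebra_simps)
    show ?thesis using h(1) kh unfolding e K_def[symmetric] rect_def by auto
  qed
  ultimately show ?case by simp
qed

lemma good_rect:
  assumes h: "0 < h" "8 * h < cL"
  shows "good (rect a (a + (real k + 2) * h) c (c + (real l + 2) * h))"
proof (induction l)
  case 0
  then show ?case using good_rect_row[OF h, of a k c] by simp
next
  case (Suc l)
  let ?b = "a + (real k + 2) * h"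
  let ?U = "rect a ?b c (c + (real l + 2) * h)"
  let ?V = "rect a ?b (c + (real l + 1) * h) (c + (real l + 1) * h + 2 * h)"
  have V: "good ?V" by (rule good_rect_row[OF h])
  have kh: "real k * h \<ge> 0" "real l * h \<ge> 0" using h by simp_all
  have "good (?U \<union> ?V)"
  proof (rule good_union[OF Suc V rect(2) rect(2)])
    show "connected (?U \<inter> ?V)" unfolding rect_Int by (rule rect)
    have "Complex (a + h) (c + (real l + 3 / 2) * h) \<in> ?U \<inter> ?V"
      using h kh unfolding rect_def distrib_right by (simp; linarith)
    then show "?U \<inter> ?V \<noteq> {}" by blast
  qed
  moreover have "?U \<union> ?V = rect a ?b c (c + (real (Suc l) + 2) * h)"
  proof -
    define K where "K = real l * h"
    have e: "(real l + 2) * h = K + 2 * h" "(real l + 1) * h = K + h" "(real (Suc l) + 2) * h = K + 3 * h"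
      by (simp_all add: K_def algebra_simps)
    show ?thesis using h(1) kh(2) unfolding e K_def[symmetric] rect_def by auto
  qed
  ultimately show ?case by simp
qed

lemma good_ball: "good (ball 0 X)"
proof -
  define h where "h = cL / 16"
  have h: "0 < h" "8 * h < cL" using cL_pos by (auto simp: h_def)
  obtain k :: nat where k: "2 * \<bar>X\<bar> / h < real k" using reals_Archimedean2 by blast
  then have k': "2 * \<bar>X\<bar> < (real k + 2) * h" using h by (simp add: field_simps)
  show ?thesis
  proof (rule good_subset[OF good_rect[OF h, of "- \<bar>X\<bar>" k "- \<bar>X\<bar>" k] _ open_ball])
    show "ball 0 X \<subseteq> rect (- \<bar>X\<bar>) (- \<bar>X\<bar> + (real k + 2) * h) (- \<bar>X\<bar>) (- \<bar>X\<bar> + (real k + 2) * h)"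
    proof
      fix z :: complex assume "z \<in> ball 0 X"
      then have "\<bar>Re z\<bar> < \<bar>X\<bar>" "\<bar>Im z\<bar> < \<bar>X\<bar>" using abs_Re_le_cmod[of z] abs_Im_le_cmod[of z] by auto
      then show "z \<in> rect (- \<bar>X\<bar>) (- \<bar>X\<bar> + (real k + 2) * h) (- \<bar>X\<bar>) (- \<bar>X\<bar> + (real k + 2) * h)"
        using k' unfolding rect_def by (simp add: abs_less_iff)
    qed
  qed
qed

text \<open>Solutions with the same data at \<open>b\<close> on growing balls agree by uniqueness.
  The value at \<open>z\<close> is taken from the first of these balls that contains
  \<open>z\<close>.\<close>

theorem lame_solution_exists:
  assumes b: "b \<notin> L"
  obtains f where "solves Q (- L) f" "f b = \<alpha>" "deriv f b = \<beta>"
proof -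
  define r where "r k = norm b + 1 + real k" for k :: nat
  have bk: "b \<in> ball 0 (r k) - L" for k using b by (simp add: r_def)
  have "\<exists>f. solves Q (ball 0 (r k) - L) f \<and> f b = \<alpha> \<and> deriv f b = \<beta>" for k
    using good_ball[of "r k"] bk[of k] unfolding good_def by blast
  then obtain F where F: "\<And>k. solves Q (ball 0 (r k) - L) (F k)" "\<And>k. F k b = \<alpha>" "\<And>k. deriv (F k) b = \<beta>" by metis
  have op: "open (ball 0 (r k) - L)" for k using closed_L by (simp add: open_Diff)
  have mono: "ball 0 (r k) \<subseteq> ball 0 (r l)" if "k \<le> l" for k l using that by (intro subset_ball) (simp add: r_def)
  have eq: "F k z = F l z" if "k \<le> l" "z \<in> ball 0 (r k) - L" for k l z
    by (rule solution_unique[OF open_ball connected_ball F(1) solves_subset[OF F(1)] bk])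
      (use F(2,3) mono[OF that(1)] that in auto)
  define N where "N z = (LEAST k. z \<in> ball 0 (r k))" for z :: complex
  have N: "z \<in> ball 0 (r (N z))" for z
    unfolding N_def
  proof (rule LeastI_ex)
    obtain k :: nat where "norm z < real k" using reals_Archimedean2 by blast
    then show "\<exists>k. z \<in> ball 0 (r k)" by (intro exI[of _ k]) (use norm_ge_zero[of b] in \<open>simp add: r_def; linarith\<close>)
  qed
  define f where "f z = F (N z) z" for z
  have fk: "f z = F k z" if "z \<in> ball 0 (r k) - L" for z k
  proof -
    have "N z \<le> k" unfolding N_def using that by (intro Least_le) auto
    then show ?thesis unfolding f_def using eq N that by blast
  qed
  have sk: "solves Q (ball 0 (r k) - L) f" for k by (rule solves_cong[OF F(1) op]) (use fk in auto)
  have "solves Q (- L) f"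
  proof (rule solvesI[of _ f "deriv f"])
    fix z assume "z \<in> - L"
    then have z: "z \<in> ball 0 (r (N z)) - L" using N by blast
    show "(f has_field_derivative deriv f z) (at z)" "(deriv f has_field_derivative Q z * f z) (at z)"
      using solvesD[OF sk op z] by auto
  qed
  moreover have "f b = \<alpha>" using fk[OF bk[of 0]] F(2) by simp
  moreover have "deriv f b = \<beta>"
  proof -
    have "\<forall>\<^sub>F z in nhds b. z \<in> ball 0 (r 0) - L" using op bk by (rule eventually_nhds_in_open)
    then have "\<forall>\<^sub>F z in nhds b. f z = F 0 z" by eventually_elim (rule fk)
    then have "deriv f b = deriv (F 0) b" by (rule deriv_cong_ev) simp
    then show ?thesis using F(3) by simp
  qed
  ultimately show ?thesis by (rule that)
qed

end

section \<open>Analytic continuation along paths\<close>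

lemma path_tendsto:
  assumes "path \<gamma>" "t \<in> {0..1}"
  shows "(\<gamma> \<longlongrightarrow> \<gamma> t) (at t within {0..1})"
  using assms unfolding path_def continuous_on_def by blast

lemma path_eventually:
  assumes "path \<gamma>" "t \<in> {0..1}" "\<forall>\<^sub>F u in nhds (\<gamma> t). P u"
  shows "\<forall>\<^sub>F s in at t within {0..1}. P (\<gamma> s)"
  using assms(3) path_tendsto[OF assms(1,2)] by (rule eventually_compose_filterlim)

lemma eventually_nhds_nhds:
  assumes "\<forall>\<^sub>F u in nhds x. P u"
  shows "\<forall>\<^sub>F v in nhds x. \<forall>\<^sub>F u in nhds v. P u"
  using assms by (simp add: eventually_eventually)

lemma germ_identity:
  assumes f: "f holomorphic_on ball c r" "g holomorphic_on ball c r" and u: "u \<in> ball c r"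
    and eq: "\<forall>\<^sub>F z in nhds u. f z = g z" and w: "w \<in> ball c r"
  shows "f w = g w"
proof -
  obtain e where e: "e > 0" "\<And>z. dist z u < e \<Longrightarrow> f z = g z"
    using eq unfolding eventually_nhds_metric by blast
  obtain d where d: "d > 0" "ball u d \<subseteq> ball c r" using openE[OF open_ball u] by blast
  let ?U = "ball u (min d e)"
  have "f w - g w = 0"
  proof (rule analytic_continuation[of "\<lambda>z. f z - g z" "ball c r" ?U u])
    show "(\<lambda>z. f z - g z) holomorphic_on ball c r" by (intro holomorphic_intros f)
    show "u islimpt ?U" using d e by (simp add: islimpt_ball)
    show "?U \<subseteq> ball c r" using d by auto
    show "f z - g z = 0" if "z \<in> ?U" for z using e(2)[of z] that by (simp add: dist_commute)
  qed (use u w in auto)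
  then show ?thesis by simp
qed

text \<open>Agreement of the two germs at a parameter is a locally constant property on the
  interval, by the identity theorem on a common ball of convergence.\<close>

lemma continues_along_unique:
  assumes \<gamma>: "path \<gamma>" and f: "continues_along \<gamma> f g" and f': "continues_along \<gamma> f' g'"
    and eq: "\<forall>\<^sub>F z in nhds (\<gamma> 0). f z = f' z"
  shows "\<forall>\<^sub>F z in nhds (\<gamma> 1). g z = g' z"
proof -
  obtain F where F: "F 0 = f" "F 1 = g" "\<And>t. t \<in> {0..1} \<Longrightarrow> F t analytic_on {\<gamma> t}"
    "\<And>t. t \<in> {0..1} \<Longrightarrow> \<forall>\<^sub>F s in at t within {0..1}. \<forall>\<^sub>F z in nhds (\<gamma> s). F s z = F t z"
    using f unfolding continues_along_def by blast
  obtain G where G: "G 0 = f'" "G 1 = g'" "\<And>t. t \<in> {0..1} \<Longrightarrow> G t analytic_on {\<gamma> t}"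
    "\<And>t. t \<in> {0..1} \<Longrightarrow> \<forall>\<^sub>F s in at t within {0..1}. \<forall>\<^sub>F z in nhds (\<gamma> s). G s z = G t z"
    using f' unfolding continues_along_def by blast
  define P where "P t \<longleftrightarrow> (\<forall>\<^sub>F z in nhds (\<gamma> t). F t z = G t z)" for t
  have "P 0 = P 1"
  proof (rule connected_local_const[of "{0..1::real}"])
    show "\<forall>t\<in>{0..1}. \<forall>\<^sub>F s in at t within {0..1}. P t = P s"
    proof
      fix t :: real assume t: "t \<in> {0..1}"
      obtain r1 where r1: "r1 > 0" "F t holomorphic_on ball (\<gamma> t) r1" using F(3)[OF t] unfolding analytic_on_def by blast
      obtain r2 where r2: "r2 > 0" "G t holomorphic_on ball (\<gamma> t) r2" using G(3)[OF t] unfolding analytic_on_def by blast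
      define r where "r = min r1 r2"
      have r: "r > 0" "F t holomorphic_on ball (\<gamma> t) r" "G t holomorphic_on ball (\<gamma> t) r"
        using r1 r2 by (auto simp: r_def intro: holomorphic_on_subset)
      have "\<forall>\<^sub>F u in nhds (\<gamma> t). u \<in> ball (\<gamma> t) r" using r by (intro eventually_nhds_in_open) auto
      then have "\<forall>\<^sub>F s in at t within {0..1}. \<gamma> s \<in> ball (\<gamma> t) r" by (rule path_eventually[OF \<gamma> t])
      with F(4)[OF t] G(4)[OF t] show "\<forall>\<^sub>F s in at t within {0..1}. P t = P s"
      proof eventually_elim
        case (elim s)
        have all: "(\<forall>\<^sub>F z in nhds v. F t z = G t z) \<longleftrightarrow> (\<forall>w\<in>ball (\<gamma> t) r. F t w = G t w)" if v: "v \<in> ball (\<gamma> t) r" for v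
        proof
          assume "\<forall>\<^sub>F z in nhds v. F t z = G t z"
          then show "\<forall>w\<in>ball (\<gamma> t) r. F t w = G t w" using germ_identity[OF r(2,3) v] by blast
        next
          assume a: "\<forall>w\<in>ball (\<gamma> t) r. F t w = G t w"
          have "\<forall>\<^sub>F z in nhds v. z \<in> ball (\<gamma> t) r" using v by (intro eventually_nhds_in_open) auto
          then show "\<forall>\<^sub>F z in nhds v. F t z = G t z" by eventually_elim (use a in blast)
        qed
        have "P s \<longleftrightarrow> (\<forall>\<^sub>F z in nhds (\<gamma> s). F t z = G t z)"
        proof
          assume "P s"
          then show "\<forall>\<^sub>F z in nhds (\<gamma> s). F t z = G t z" using elim(1,2) unfolding P_def by eventually_elim simp
        next
          assume "\<forall>\<^sub>F z in nhds (\<gamma> s). F t z = G t z"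
          then show "P s" using elim(1,2) unfolding P_def by eventually_elim simp
        qed
        also have "\<dots> \<longleftrightarrow> P t" unfolding P_def using all[of "\<gamma> s"] all[of "\<gamma> t"] elim(3) r(1) by simp
        finally show ?case by simp
      qed
    qed
  qed auto
  moreover have "P 0" using eq F(1) G(1) by (simp add: P_def)
  ultimately show ?thesis using F(2) G(2) by (simp add: P_def)
qed

text \<open>The definition fixes the end functions themselves and not only their germs; exchanging
  them at the parameters 0 and 1 leaves all germs unchanged.\<close>

lemma continues_along_cong:
  assumes \<gamma>: "path \<gamma>" and f: "continues_along \<gamma> f g"
    and eq: "\<forall>\<^sub>F z in nhds (\<gamma> 0). f z = f' z" "\<forall>\<^sub>F z in nhds (\<gamma> 1). g z = g' z"
  shows "continues_along \<gamma> f' g'"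
proof -
  obtain F where F: "F 0 = f" "F 1 = g" "\<And>t. t \<in> {0..1} \<Longrightarrow> F t analytic_on {\<gamma> t}"
    "\<And>t. t \<in> {0..1} \<Longrightarrow> \<forall>\<^sub>F s in at t within {0..1}. \<forall>\<^sub>F z in nhds (\<gamma> s). F s z = F t z"
    using f unfolding continues_along_def by blast
  define G where "G t = (if t = 0 then f' else if t = 1 then g' else F t)" for t :: real
  have FG: "\<forall>\<^sub>F z in nhds (\<gamma> t). F t z = G t z" for t
    using eq F(1,2) by (auto simp: G_def)
  show ?thesis unfolding continues_along_def
  proof (intro exI[of _ G] conjI ballI)
    fix t :: real assume t: "t \<in> {0..1}"
    show "G t analytic_on {\<gamma> t}" using analytic_at_cong[OF FG refl] F(3)[OF t] by blast
    have "\<forall>\<^sub>F s in at t within {0..1}. \<forall>\<^sub>F z in nhds (\<gamma> s). F t z = G t z"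
      by (rule path_eventually[OF \<gamma> t eventually_nhds_nhds[OF FG]])
    with F(4)[OF t] show "\<forall>\<^sub>F s in at t within {0..1}. \<forall>\<^sub>F z in nhds (\<gamma> s). G s z = G t z"
    proof eventually_elim
      case (elim s)
      then show ?case using FG[of s] by eventually_elim simp
    qed
  qed (auto simp: G_def)
qed

lemma continues_along_global:
  assumes "path \<gamma>" "open S" "path_image \<gamma> \<subseteq> S" "f holomorphic_on S"
  shows "continues_along \<gamma> f f"
  unfolding continues_along_def
proof (intro exI[of _ "\<lambda>_. f"] conjI ballI)
  fix t :: real assume "t \<in> {0..1}"
  then have "\<gamma> t \<in> S" using assms(3) by (auto simp: path_image_def)
  then show "f analytic_on {\<gamma> t}" using assms(2,4) analytic_at by blast
qed auto

lemma continues_along_mult: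
  assumes "continues_along \<gamma> f g" "continues_along \<gamma> f' g'"
  shows "continues_along \<gamma> (\<lambda>z. f z * f' z) (\<lambda>z. g z * g' z)"
proof -
  obtain F where F: "F 0 = f" "F 1 = g" "\<And>t. t \<in> {0..1} \<Longrightarrow> F t analytic_on {\<gamma> t}"
    "\<And>t. t \<in> {0..1} \<Longrightarrow> \<forall>\<^sub>F s in at t within {0..1}. \<forall>\<^sub>F z in nhds (\<gamma> s). F s z = F t z"
    using assms(1) unfolding continues_along_def by blast
  obtain G where G: "G 0 = f'" "G 1 = g'" "\<And>t. t \<in> {0..1} \<Longrightarrow> G t analytic_on {\<gamma> t}"
    "\<And>t. t \<in> {0..1} \<Longrightarrow> \<forall>\<^sub>F s in at t within {0..1}. \<forall>\<^sub>F z in nhds (\<gamma> s). G s z = G t z"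
    using assms(2) unfolding continues_along_def by blast
  show ?thesis unfolding continues_along_def
  proof (intro exI[of _ "\<lambda>t z. F t z * G t z"] conjI ballI)
    fix t :: real assume t: "t \<in> {0..1}"
    show "(\<lambda>z. F t z * G t z) analytic_on {\<gamma> t}" by (intro analytic_intros F G t)
    show "\<forall>\<^sub>F s in at t within {0..1}. \<forall>\<^sub>F z in nhds (\<gamma> s). F s z * G s z = F t z * G t z"
      using F(4)[OF t] G(4)[OF t]
    proof eventually_elim
      case (elim s)
      then show ?case by eventually_elim simp
    qed
  qed (use F G in auto)
qed

lemma continues_along_const:
  "continues_along \<gamma> (\<lambda>_. c) (\<lambda>_. c)"
  unfolding continues_along_def by (intro exI[of _ "\<lambda>_ _. c"]) auto

lemma eventually_nhds_shift: "(\<forall>\<^sub>F z in nhds (a + c :: complex). P z) \<longleftrightarrow> (\<forall>\<^sub>F z in nhds a. P (z + c))"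
proof -
  have *: "\<forall>\<^sub>F z in nhds a. P (z + c)" if "\<forall>\<^sub>F z in nhds (a + c). P z" for a c :: complex and P
    by (rule eventually_compose_filterlim[OF that]) (intro tendsto_add tendsto_const filterlim_ident)
  show ?thesis
  proof
    assume "\<forall>\<^sub>F z in nhds a. P (z + c)"
    then have "\<forall>\<^sub>F z in nhds (a + c + - c). P (z + c)" by simp
    from *[OF this] show "\<forall>\<^sub>F z in nhds (a + c). P z" by simp
  qed (rule *)
qed

text \<open>Uniqueness of continuation makes the two combinations equal as germs, and linear
  independence of the fundamental system separates their coefficients.\<close>

lemma monodromy_matrix_unique:
  assumes \<gamma>: "path \<gamma>" "pathfinish \<gamma> = pathstart \<gamma> + \<omega>"
    and fs: "fundamental_system a b c (pathstart \<gamma>) y"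
    and M: "monodromy_matrix \<gamma> \<omega> y M" and M': "monodromy_matrix \<gamma> \<omega> y M'"
  shows "M = M'"
proof -
  have ind: "k = 0" if "\<forall>\<^sub>F z in nhds (pathstart \<gamma>). (\<Sum>j\<in>UNIV. k $ j * y j z) = 0" for k :: "complex ^ 2"
    using fs that unfolding fundamental_system_def by blast
  have "M $ i $ j = M' $ i $ j" for i j
  proof -
    obtain g where g: "continues_along \<gamma> (y j) g"
      "\<forall>\<^sub>F z in nhds (pathstart \<gamma>). (\<Sum>i\<in>UNIV. y i z * M $ i $ j) = g (z + \<omega>)"
      using M unfolding monodromy_matrix_def continues_to_def by blast
    obtain g' where g': "continues_along \<gamma> (y j) g'"
      "\<forall>\<^sub>F z in nhds (pathstart \<gamma>). (\<Sum>i\<in>UNIV. y i z * M' $ i $ j) = g' (z + \<omega>)"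
      using M' unfolding monodromy_matrix_def continues_to_def by blast
    have "\<forall>\<^sub>F z in nhds (\<gamma> 1). g z = g' z"
      by (rule continues_along_unique[OF \<gamma>(1) g(1) g'(1)]) simp
    then have "\<forall>\<^sub>F z in nhds (pathstart \<gamma>). g (z + \<omega>) = g' (z + \<omega>)"
      using \<gamma>(2) by (simp add: pathfinish_def eventually_nhds_shift)
    with g(2) g'(2) have "\<forall>\<^sub>F z in nhds (pathstart \<gamma>). (\<Sum>i\<in>UNIV. (\<chi> i. M $ i $ j - M' $ i $ j) $ i * y i z) = 0"
      by eventually_elim (simp add: sum_subtractf algebra_simps)
    then have "(\<chi> i. M $ i $ j - M' $ i $ j) = 0" by (rule ind)
    then have "(\<chi> i. M $ i $ j - M' $ i $ j) $ i = 0" by simp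
    then show ?thesis by simp
  qed
  then show ?thesis by (simp add: vec_eq_iff)
qed

text \<open>Along a path on which \<open>exp (l t) = h (\<gamma> t)\<close>, the germs of \<open>h powr \<alpha>\<close> are continued by means
  of the principal logarithm of \<open>h z / h (\<gamma> t)\<close>.\<close>

lemma power_germ_continues:
  fixes \<alpha> :: complex
  assumes \<gamma>: "path \<gamma>" and S: "open S" "path_image \<gamma> \<subseteq> S" and h: "h holomorphic_on S"
    and l: "path l" "\<And>t. t \<in> {0..1} \<Longrightarrow> h (\<gamma> t) = exp (l t)"
  defines "G \<equiv> \<lambda>t z. exp (\<alpha> * (l t + Ln (h z / h (\<gamma> t))))"
  shows "continues_along \<gamma> (G 0) (G 1)"
  unfolding continues_along_def
proof (intro exI[of _ G] conjI ballI refl)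
  fix t :: real assume t: "t \<in> {0..1}"
  have \<gamma>S: "\<gamma> s \<in> S" if "s \<in> {0..1}" for s using S(2) that by (auto simp: path_image_def)
  have nz: "h (\<gamma> s) \<noteq> 0" if "s \<in> {0..1}" for s using l(2)[OF that] by simp
  have han: "h analytic_on {\<gamma> s}" if "s \<in> {0..1}" for s using h S(1) \<gamma>S[OF that] analytic_at by blast
  have one: "h (\<gamma> t) / h (\<gamma> t) \<notin> \<real>\<^sub>\<le>\<^sub>0" using nz[OF t] by simp
  have "(\<lambda>z. h z / h (\<gamma> t)) analytic_on {\<gamma> t}" by (intro analytic_intros han t) (use nz[OF t] in auto)
  then have "(Ln \<circ> (\<lambda>z. h z / h (\<gamma> t))) analytic_on {\<gamma> t}"
    by (rule analytic_on_compose) (use one in \<open>auto intro!: analytic_intros\<close>)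
  then obtain u where u: "u = (\<lambda>z. Ln (h z / h (\<gamma> t)))" "u analytic_on {\<gamma> t}" by (simp add: o_def)
  have "(\<lambda>z. exp (\<alpha> * (l t + u z))) analytic_on {\<gamma> t}" by (intro analytic_intros u(2))
  then show "G t analytic_on {\<gamma> t}" by (simp add: G_def u(1))
  have nhd: "\<forall>\<^sub>F z in nhds (\<gamma> s). 0 < Re (h z / h (\<gamma> s))" if s: "s \<in> {0..1}" for s
  proof -
    have "isCont h (\<gamma> s)" using han[OF s] by (rule analytic_at_imp_isCont)
    then have "(h \<longlongrightarrow> h (\<gamma> s)) (nhds (\<gamma> s))" by (simp only: isCont_def tendsto_at_iff_tendsto_nhds)
    then have "((\<lambda>z. Re (h z / h (\<gamma> s))) \<longlongrightarrow> Re (h (\<gamma> s) / h (\<gamma> s))) (nhds (\<gamma> s))"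
      by (intro tendsto_intros nz s)
    then show ?thesis by (rule order_tendstoD) (use nz[OF s] in simp)
  qed
  have "((\<lambda>s. Im (l s - l t)) \<longlongrightarrow> Im (l t - l t)) (at t within {0..1})"
    by (intro tendsto_intros path_tendsto[OF l(1) t])
  then have "((\<lambda>s. \<bar>Im (l s - l t)\<bar>) \<longlongrightarrow> 0) (at t within {0..1})"
    using tendsto_rabs[of "\<lambda>s. Im (l s - l t)" "Im (l t - l t)"] by simp
  then have "\<forall>\<^sub>F s in at t within {0..1}. \<bar>Im (l s - l t)\<bar> < pi / 2"
    by (rule order_tendstoD(2)) simp
  moreover have "\<forall>\<^sub>F s in at t within {0..1}. s \<in> {0..1}" by (simp add: eventually_at_filter)
  ultimately show "\<forall>\<^sub>F s in at t within {0..1}. \<forall>\<^sub>F z in nhds (\<gamma> s). G s z = G t z"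
  proof eventually_elim
    case (elim s)
    have b: "h (\<gamma> s) / h (\<gamma> t) = exp (l s - l t)" using l(2) elim t by (simp add: exp_diff)
    have Lb: "Ln (h (\<gamma> s) / h (\<gamma> t)) = l s - l t"
      unfolding b by (rule Ln_exp; use elim(1) pi_gt_zero in linarith)
    show ?case using nhd[OF elim(2)]
    proof eventually_elim
      case (elim z)
      let ?a = "h z / h (\<gamma> s)"
      have a0: "?a \<noteq> 0" using elim by auto
      have Ia: "\<bar>Im (Ln ?a)\<bar> < pi / 2" using elim Re_Ln_pos_lt[OF a0] by simp
      \<comment> \<open>Both factors have arguments of absolute value below \<open>pi / 2\<close>,
        so the principal logarithm is additive on this product.\<close>
      have "h z / h (\<gamma> t) = ?a * (h (\<gamma> s) / h (\<gamma> t))" using nz[OF \<open>s \<in> {0..1}\<close>] by simp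
      also have "Ln \<dots> = Ln ?a + Ln (h (\<gamma> s) / h (\<gamma> t))"
      proof (rule Ln_times_simple)
        show "?a \<noteq> 0" by fact
        show "h (\<gamma> s) / h (\<gamma> t) \<noteq> 0" using nz t \<open>s \<in> {0..1}\<close> by simp
        show "- pi < Im (Ln ?a) + Im (Ln (h (\<gamma> s) / h (\<gamma> t)))"
          "Im (Ln ?a) + Im (Ln (h (\<gamma> s) / h (\<gamma> t))) \<le> pi"
          using Ia \<open>\<bar>Im (l s - l t)\<bar> < pi / 2\<close> unfolding Lb by linarith+
      qed
      finally show ?case unfolding G_def Lb by (simp add: add.commute)
    qed
  qed
qed

section \<open>Cycles on which the sigma quotient is invariant\<close>

context lattice
begin

definition hp :: "complex \<Rightarrow> complex \<Rightarrow> complex" where "hp p z = wp L z - wp L p"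

lemma domain_iff: "z \<in> noneven_domain L p \<longleftrightarrow> z \<notin> L \<and> z - p \<notin> L \<and> z + p \<notin> L"
  by (simp add: noneven_domain_def)

lemma domain_eq: "noneven_domain L p = - (L \<union> (\<lambda>w. w + p) ` L \<union> (\<lambda>w. w - p) ` L)"
  by (auto simp: noneven_domain_def image_iff) (metis diff_add_cancel, metis add_diff_cancel)

lemma open_translate_L: "open {z. z + c \<notin> L}"
proof -
  have "{z. z + c \<notin> L} = (\<lambda>z. z + c) -` (- L)" by auto
  moreover have "open ((\<lambda>z. z + c) -` (- L))"
    by (intro open_vimage open_compl_L continuous_intros)
  ultimately show ?thesis by simp
qed

lemma open_domain: "open (noneven_domain L p)"
proof -
  have "noneven_domain L p = - L \<inter> {z. z + p \<notin> L} \<inter> {z. z + - p \<notin> L}" by (auto simp: noneven_domain_def)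
  then show ?thesis using open_compl_L open_translate_L[of p] open_translate_L[of "- p"] by (simp add: open_Int)
qed

lemma path_connected_domain: "path_connected (noneven_domain L p)"
  unfolding domain_eq by (rule path_connected_complement_countable) (use countable_L in auto)

lemma domain_nonempty: "\<exists>z0. z0 \<in> noneven_domain L p"
proof (rule ccontr)
  assume "\<not> ?thesis"
  then have "UNIV = L \<union> (\<lambda>w. w + p) ` L \<union> (\<lambda>w. w - p) ` L" using domain_eq by blast
  then have "countable (UNIV :: complex set)" using countable_L by (metis countable_Un countable_image)
  then have "countable (ball 0 1 :: complex set)" by (rule countable_subset[OF subset_UNIV])
  then show False using uncountable_ball[of 1 "0::complex"] by simp
qed

lemma domain_shift: "\<omega> \<in> L \<Longrightarrow> z \<in> noneven_domain L p \<Longrightarrow> z + \<omega> \<in> noneven_domain L p"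
  using add_in_iff[of \<omega> "z - p"] add_in_iff[of \<omega> "z + p"] by (auto simp: domain_iff algebra_simps)

lemma hp_holomorphic: "hp p holomorphic_on - L"
  unfolding hp_def by (intro holomorphic_intros wp_holomorphic)

lemma hp_nz: "p \<notin> L \<Longrightarrow> z \<in> noneven_domain L p \<Longrightarrow> hp p z \<noteq> 0"
  using wp_eq_iff[of z p] by (auto simp: hp_def domain_iff)

lemma hp_periodic: "\<omega> \<in> L \<Longrightarrow> z \<notin> L \<Longrightarrow> hp p (z + \<omega>) = hp p z"
  by (simp add: hp_def wp_periodic)

lemma wsigma_quotient_square:
  assumes "p \<notin> L" "z \<in> noneven_domain L p" "r\<^sup>2 = wsigma L (z - p) * wsigma L (z + p)"
  shows "(wsigma L z / r)\<^sup>2 * hp p z = - 1 / (wsigma L p)\<^sup>2"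
proof -
  have z: "z \<notin> L" "z - p \<notin> L" "z + p \<notin> L" using assms(2) by (auto simp: domain_iff)
  have nz: "wsigma L z \<noteq> 0" "wsigma L p \<noteq> 0" "hp p z \<noteq> 0" using z(1) assms(1) wsigma_eq_0_iff hp_nz[OF assms(1,2)] by auto
  have "r\<^sup>2 = - (wsigma L p)\<^sup>2 * (wsigma L z)\<^sup>2 * hp p z"
    using wsigma_product[OF z(1) assms(1)] assms(3) by (simp add: hp_def mult.commute)
  then show ?thesis using nz by (simp add: power_divide)
qed

text \<open>Up to a constant the sigma quotient is \<open>hp p\<close> to the power
  \<open>- 1/2\<close>. Along a continuous logarithm \<open>l\<close> of \<open>hp p\<close>,
  winding number \<open>2 * m\<close> changes \<open>l / 2\<close> by a multiple of the period of
  \<open>exp\<close>.\<close>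

lemma sigma_quotient_invariant_even_winding:
  assumes p: "p \<notin> L" and \<omega>: "\<omega> \<in> L"
    and cyc: "cycle_in (noneven_domain L p) z0 \<omega> \<gamma>"
    and wn: "winding_number (hp p \<circ> \<gamma>) 0 = of_int (2 * m)"
  shows "sigma_quotient_invariant L p \<gamma> \<omega>"
proof -
  have \<gamma>: "path \<gamma>" "\<gamma> 0 = z0" "\<gamma> 1 = z0 + \<omega>" "path_image \<gamma> \<subseteq> noneven_domain L p"
    using cyc by (auto simp: cycle_in_def pathstart_def pathfinish_def)
  have DL: "noneven_domain L p \<subseteq> - L" by (auto simp: noneven_domain_def)
  have z0: "z0 \<in> noneven_domain L p" using \<gamma> pathstart_in_path_image[of \<gamma>] by (auto simp: pathstart_def)
  have hol: "hp p holomorphic_on noneven_domain L p" using hp_holomorphic DL holomorphic_on_subset by blast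
  have path: "path (hp p \<circ> \<gamma>)"
    by (rule path_continuous_image[OF \<gamma>(1)])
      (use hol \<gamma>(4) holomorphic_on_imp_continuous_on continuous_on_subset in blast)
  have "0 \<notin> path_image (hp p \<circ> \<gamma>)"
    using hp_nz[OF p] \<gamma>(4) by (fastforce simp: path_image_def)
  then obtain l where l: "path l" "pathfinish l - pathstart l = 2 * of_real pi * \<i> * winding_number (hp p \<circ> \<gamma>) 0"
    "\<And>t. t \<in> {0..1} \<Longrightarrow> (hp p \<circ> \<gamma>) t = 0 + exp (l t)"
    using winding_number_as_continuous_log[OF path] by blast
  have lt: "hp p (\<gamma> t) = exp (l t)" if "t \<in> {0..1}" for t using l(3)[OF that] by simp
  define E where "E t z = exp (- (1 / 2) * (l t + Ln (hp p z / hp p (\<gamma> t))))" for t z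
  have contE: "continues_along \<gamma> (E 0) (E 1)"
    unfolding E_def by (rule power_germ_continues[OF \<gamma>(1) open_domain \<gamma>(4) hol l(1) lt])
  \<comment> \<open>The square of \<open>c\<close> is the constant of
    \<open>wsigma_quotient_square\<close>.\<close>
  define c where "c = \<i> / wsigma L p"
  define s where "s t z = c * E t z" for t z
  have cont: "continues_along \<gamma> (s 0) (s 1)"
    unfolding s_def[abs_def] by (rule continues_along_mult[OF continues_along_const contE])
  have sp: "wsigma L p \<noteq> 0" using p wsigma_eq_0_iff by simp
  have snz: "s t z \<noteq> 0" for t z using sp by (simp add: s_def E_def c_def)
  define r where "r z = wsigma L z / s 0 z" for z
  have ev: "\<forall>\<^sub>F z in nhds z0. z \<in> noneven_domain L p" using open_domain z0 by (rule eventually_nhds_in_open)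
  have s0: "s 0 analytic_on {z0}" using cont \<gamma>(2) unfolding continues_along_def by force
  have "wsigma L analytic_on {z0}" using wsigma_holomorphic[of UNIV] analytic_at by blast
  then have ran: "r analytic_on {z0}" unfolding r_def by (intro analytic_intros s0) (use snz in auto)
  have sq: "(s 0 z)\<^sup>2 * hp p z = - 1 / (wsigma L p)\<^sup>2" if z: "z \<in> noneven_domain L p" for z
  proof -
    have nz: "hp p z \<noteq> 0" "hp p z0 \<noteq> 0" using hp_nz[OF p] z z0 by auto
    have half: "2 * (- (1 / 2) * x) = - x" for x :: complex by simp
    have "(E 0 z)\<^sup>2 = exp (2 * (- (1 / 2) * (l 0 + Ln (hp p z / hp p z0))))"
      unfolding E_def \<gamma>(2) by (simp only: exp_double)
    then have "(E 0 z)\<^sup>2 = exp (- (l 0 + Ln (hp p z / hp p z0)))"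
      unfolding half .
    also have "\<dots> = 1 / (exp (l 0) * (hp p z / hp p z0))"
    proof -
      have "exp (Ln (hp p z / hp p z0)) = hp p z / hp p z0" using nz by (intro exp_Ln) simp
      then show ?thesis by (simp only: exp_minus exp_add) (simp add: divide_inverse)
    qed
    also have "\<dots> = 1 / hp p z" using lt[of 0] nz by (simp add: \<gamma>(2))
    finally have "(E 0 z)\<^sup>2 = 1 / hp p z" .
    then show ?thesis using nz by (simp add: s_def c_def power_mult_distrib power_divide)
  qed
  have r2: "(r z)\<^sup>2 = wsigma L (z - p) * wsigma L (z + p)" if z: "z \<in> noneven_domain L p" for z
  proof -
    have zz: "z \<notin> L" using z by (simp add: domain_iff)
    have nz: "hp p z \<noteq> 0" using hp_nz[OF p z] .
    have "(s 0 z)\<^sup>2 = - 1 / ((wsigma L p)\<^sup>2 * hp p z)" using sq[OF z] nz sp by (simp add: field_simps)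
    then have "(r z)\<^sup>2 = - ((wsigma L p)\<^sup>2 * hp p z) * (wsigma L z)\<^sup>2"
      by (simp add: r_def power_divide)
    also have "\<dots> = wsigma L (z - p) * wsigma L (z + p)"
      using wsigma_product[OF zz p] by (simp add: hp_def mult_ac)
    finally show ?thesis .
  qed
  have quot: "wsigma L z / r z = s 0 z" if z: "z \<in> noneven_domain L p" for z
    using wsigma_eq_0_iff[of z] z snz[of 0 z] by (simp add: r_def domain_iff)
  have end_: "s 1 (z + \<omega>) = s 0 z" if z: "z \<in> noneven_domain L p" for z
  proof -
    have zz: "z \<notin> L" "z0 \<notin> L" using z z0 by (auto simp: domain_iff)
    have "l 1 = l 0 + 2 * of_int m * (2 * of_real pi * \<i>)"
      using l(2) wn by (simp add: pathfinish_def pathstart_def algebra_simps)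
    then have e1: "- (1 / 2) * (l 1 + x) = - (1 / 2) * (l 0 + x) + - (of_int m * (2 * of_real pi * \<i>))" for x
      by (simp add: algebra_simps)
    have "exp (- (of_int m * (2 * of_real pi * \<i>))) = 1"
      using exp_integer_2pi[of "of_int (- m)"] by (simp add: mult_ac)
    then have "exp (- (1 / 2) * (l 1 + x)) = exp (- (1 / 2) * (l 0 + x))" for x
      unfolding e1 exp_add by simp
    then have "E 1 (z + \<omega>) = E 0 z"
      using hp_periodic[OF \<omega> zz(1)] hp_periodic[OF \<omega> zz(2)] by (simp only: E_def \<gamma>(2,3))
    then show ?thesis by (simp add: s_def)
  qed
  show ?thesis unfolding sigma_quotient_invariant_def
  proof (intro exI[of _ r] conjI)
    show "r analytic_on {pathstart \<gamma>}" using ran \<gamma>(2) by (simp add: pathstart_def)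
    show "\<forall>\<^sub>F z in nhds (pathstart \<gamma>). (r z)\<^sup>2 = wsigma L (z - p) * wsigma L (z + p)"
      unfolding pathstart_def \<gamma>(2) using ev by eventually_elim (rule r2)
    show "continues_to \<gamma> \<omega> (\<lambda>z. wsigma L z / r z) (\<lambda>z. wsigma L z / r z)"
      unfolding continues_to_def
    proof (intro exI[of _ "s 1"] conjI)
      show "continues_along \<gamma> (\<lambda>z. wsigma L z / r z) (s 1)"
      proof (rule continues_along_cong[OF \<gamma>(1) cont])
        show "\<forall>\<^sub>F z in nhds (\<gamma> 0). s 0 z = wsigma L z / r z"
          unfolding \<gamma>(2) using ev by eventually_elim (simp add: quot)
      qed simp
      show "\<forall>\<^sub>F z in nhds (pathstart \<gamma>). wsigma L z / r z = s 1 (z + \<omega>)"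
        unfolding pathstart_def \<gamma>(2) using ev by eventually_elim (simp add: quot end_)
    qed
  qed
qed

text \<open>A loop whose image under \<open>hp p\<close>, a local coordinate at \<open>p\<close>, is a small circle.\<close>

lemma loop_winding_1:
  assumes p: "p \<notin> L" "2 * p \<notin> L" and z0: "z0 \<in> noneven_domain L p"
  obtains \<gamma> where "path \<gamma>" "pathstart \<gamma> = z0" "pathfinish \<gamma> = z0" "path_image \<gamma> \<subseteq> noneven_domain L p"
    "winding_number (hp p \<circ> \<gamma>) 0 = 1"
proof -
  let ?D = "noneven_domain L p"
  define S where "S = - L \<inter> {z. z + p \<notin> L} \<inter> {z. z + - p \<in> - L0}"
  have "open {z. z + - p \<in> - L0}"
  proof -
    have "{z. z + - p \<in> - L0} = (\<lambda>z. z + - p) -` (- L0)" by auto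
    moreover have "open ((\<lambda>z. z + - p) -` (- L0))"
      by (intro open_vimage open_compl_L0 continuous_intros)
    ultimately show ?thesis by simp
  qed
  then have opS: "open S" unfolding S_def using open_compl_L open_translate_L by (intro open_Int) auto
  have SD: "S - {p} \<subseteq> ?D" by (auto simp: S_def noneven_domain_def L0_def)
  have SL: "S \<subseteq> - L" by (auto simp: S_def)
  have pS: "p \<in> S" using p by (simp add: S_def L0_def flip: mult_2)
  have h: "hp p holomorphic_on S" using hp_holomorphic SL holomorphic_on_subset by blast
  have "(hp p has_field_derivative wp1 p) (at p)"
    unfolding hp_def[abs_def] using wp_deriv[OF p(1)] by (auto intro!: derivative_eq_intros)
  then have "deriv (hp p) p \<noteq> 0" using wp1_eq_0_iff[OF p(1)] p(2) DERIV_imp_deriv by metis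
  then obtain e where e: "e > 0" "ball p e \<subseteq> S" "open (hp p ` ball p e)" "inj_on (hp p) (ball p e)"
    using has_complex_derivative_locally_invertible[OF h pS opS] by blast
  have hB: "hp p holomorphic_on ball p e" using h e(2) holomorphic_on_subset by blast
  obtain g where g: "g holomorphic_on (hp p ` ball p e)" "\<And>z. z \<in> ball p e \<Longrightarrow> g (hp p z) = z"
    using holomorphic_has_inverse[OF hB open_ball e(4)] by metis
  have hpp: "hp p p = 0" by (simp add: hp_def)
  then have "0 \<in> hp p ` ball p e" using e(1) by (metis centre_in_ball imageI)
  then obtain d where d: "d > 0" "cball 0 d \<subseteq> hp p ` ball p e" using e(3) open_contains_cball by blast
  define c where "c = circlepath (0::complex) d"
  have cim: "path_image c = sphere 0 d" using d by (simp add: c_def)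
  then have csub: "path_image c \<subseteq> hp p ` ball p e" using d(2) by auto
  have gc: "g w \<in> ball p e" "hp p (g w) = w" if "w \<in> hp p ` ball p e" for w
    using that g(2) by auto
  have pc: "path c" by (simp add: c_def)
  have pgc: "path (g \<circ> c)"
    by (rule path_continuous_image[OF pc]) (use g(1) csub holomorphic_on_imp_continuous_on continuous_on_subset in blast)
  have gcD: "path_image (g \<circ> c) \<subseteq> ?D"
  proof
    fix x assume "x \<in> path_image (g \<circ> c)"
    then obtain w where w: "w \<in> path_image c" "x = g w" by (auto simp: path_image_def)
    then have "w \<in> hp p ` ball p e" "w \<noteq> 0" using csub cim d by auto
    then have "x \<in> ball p e" "x \<noteq> p" using gc[of w] w hpp by auto
    then show "x \<in> ?D" using e(2) SD by blast
  qed
  have loop: "pathfinish c = pathstart c" by (simp add: c_def)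
  have ends: "pathfinish (g \<circ> c) = pathstart (g \<circ> c)" using loop by (simp add: pathstart_def pathfinish_def)
  have "pathstart (g \<circ> c) \<in> ?D" using gcD pathstart_in_path_image by blast
  then obtain \<delta> where \<delta>: "path \<delta>" "path_image \<delta> \<subseteq> ?D" "pathstart \<delta> = z0" "pathfinish \<delta> = pathstart (g \<circ> c)"
    using path_connected_domain z0 unfolding path_connected_def by blast
  have img: "path (hp p \<circ> \<eta>) \<and> 0 \<notin> path_image (hp p \<circ> \<eta>)" if "path \<eta>" "path_image \<eta> \<subseteq> ?D" for \<eta>
  proof
    have "hp p holomorphic_on ?D" using hp_holomorphic holomorphic_on_subset by (metis ComplI domain_iff subsetI)
    then show "path (hp p \<circ> \<eta>)"
      using path_continuous_image[OF that(1)] that(2) holomorphic_on_imp_continuous_on continuous_on_subset by blast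
    show "0 \<notin> path_image (hp p \<circ> \<eta>)" using hp_nz[OF p(1)] that(2) by (fastforce simp: path_image_def)
  qed
  have "winding_number (hp p \<circ> (g \<circ> c)) 0 = winding_number c 0"
  proof (rule winding_number_cong)
    fix t :: real assume "0 \<le> t" "t \<le> 1"
    then have "c t \<in> path_image c" by (auto simp: path_image_def)
    then show "(hp p \<circ> (g \<circ> c)) t = c t" using csub gc(2) by auto
  qed
  also have "\<dots> = 1" using d by (simp add: c_def winding_number_circlepath_centre)
  finally have wc: "winding_number (hp p \<circ> (g \<circ> c)) 0 = 1" .
  \<comment> \<open>The small loop is joined to \<open>z0\<close> along \<open>\<delta>\<close>; the
    contributions of \<open>\<delta>\<close> and its reverse to the winding number cancel.\<close>
  let ?\<gamma> = "\<delta> +++ ((g \<circ> c) +++ reversepath \<delta>)"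
  note i1 = img[OF \<delta>(1,2)] and i2 = img[OF pgc gcD]
  have e1: "pathfinish (hp p \<circ> (g \<circ> c)) = pathstart (reversepath (hp p \<circ> \<delta>))"
    using ends \<delta>(4) by (simp add: pathstart_compose pathfinish_compose)
  have "winding_number (hp p \<circ> ?\<gamma>) 0 = winding_number (hp p \<circ> \<delta>) 0 + (winding_number (hp p \<circ> (g \<circ> c)) 0 + winding_number (reversepath (hp p \<circ> \<delta>)) 0)"
    unfolding path_compose_join path_compose_reversepath
    using i1 i2 e1 \<delta>(4)
    by (subst winding_number_join; (subst winding_number_join)?)
      (auto simp: path_image_join pathstart_compose pathfinish_compose)
  also have "\<dots> = 1" using wc i1 by (simp add: winding_number_reversepath)
  finally have "winding_number (hp p \<circ> ?\<gamma>) 0 = 1" .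
  moreover have "path ?\<gamma>" using \<delta> pgc ends by simp
  moreover have "path_image ?\<gamma> \<subseteq> ?D" using \<delta> pgc ends gcD by (simp add: path_image_join)
  ultimately show ?thesis using that[of ?\<gamma>] \<delta> by simp
qed

text \<open>By periodicity \<open>hp p\<close> maps any path from \<open>z0\<close> to
  \<open>z0 + \<omega>\<close> to a closed one, with an integral winding number. If that is odd, the
  loop of winding number 1 is run through first.\<close>

lemma invariant_cycle_exists:
  assumes p: "p \<notin> L" "2 * p \<notin> L" and z0: "z0 \<in> noneven_domain L p" and \<omega>: "\<omega> \<in> L"
  obtains \<gamma> where "cycle_in (noneven_domain L p) z0 \<omega> \<gamma>" "sigma_quotient_invariant L p \<gamma> \<omega>"
proof -
  let ?D = "noneven_domain L p"
  obtain \<gamma> where \<gamma>: "path \<gamma>" "path_image \<gamma> \<subseteq> ?D" "pathstart \<gamma> = z0" "pathfinish \<gamma> = z0 + \<omega>"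
    using path_connected_domain z0 domain_shift[OF \<omega> z0] unfolding path_connected_def by blast
  have holD: "hp p holomorphic_on ?D" using hp_holomorphic holomorphic_on_subset by (metis ComplI domain_iff subsetI)
  have img: "path (hp p \<circ> \<eta>)" "0 \<notin> path_image (hp p \<circ> \<eta>)" if "path \<eta>" "path_image \<eta> \<subseteq> ?D" for \<eta>
  proof -
    show "path (hp p \<circ> \<eta>)"
      using path_continuous_image[OF that(1)] that(2) holD holomorphic_on_imp_continuous_on continuous_on_subset by blast
    show "0 \<notin> path_image (hp p \<circ> \<eta>)" using hp_nz[OF p(1)] that(2) by (fastforce simp: path_image_def)
  qed
  have "z0 \<notin> L" using z0 by (simp add: domain_iff)
  then have "pathfinish (hp p \<circ> \<gamma>) = pathstart (hp p \<circ> \<gamma>)"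
    using hp_periodic[OF \<omega>] \<gamma>(3,4) by (simp add: pathstart_compose pathfinish_compose)
  then have "winding_number (hp p \<circ> \<gamma>) 0 \<in> \<int>" by (intro integer_winding_number img \<gamma>(1,2))
  then obtain k where k: "winding_number (hp p \<circ> \<gamma>) 0 = of_int k" by (auto elim: Ints_cases)
  show ?thesis
  proof (cases "even k")
    case True
    then obtain m where "k = 2 * m" by (elim evenE)
    then show ?thesis
      using that[of \<gamma>] sigma_quotient_invariant_even_winding[OF p(1) \<omega>, of z0 \<gamma> m] k \<gamma> by (simp add: cycle_in_def)
  next
    case False
    then obtain m where m: "k + 1 = 2 * m" by (metis evenE even_plus_one_iff)
    obtain \<delta> where \<delta>: "path \<delta>" "pathstart \<delta> = z0" "pathfinish \<delta> = z0" "path_image \<delta> \<subseteq> ?D"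
      "winding_number (hp p \<circ> \<delta>) 0 = 1"
      by (rule loop_winding_1[OF p z0])
    have "winding_number (hp p \<circ> (\<delta> +++ \<gamma>)) 0 = winding_number (hp p \<circ> \<delta>) 0 + winding_number (hp p \<circ> \<gamma>) 0"
      unfolding path_compose_join
      by (rule winding_number_join) (use img \<delta> \<gamma> in \<open>auto simp: pathstart_compose pathfinish_compose\<close>)
    also have "\<dots> = of_int (2 * m)" unfolding k \<delta>(5) m[symmetric] by simp
    finally have wn: "winding_number (hp p \<circ> (\<delta> +++ \<gamma>)) 0 = of_int (2 * m)" .
    have cyc: "cycle_in ?D z0 \<omega> (\<delta> +++ \<gamma>)" using \<delta> \<gamma> by (simp add: cycle_in_def path_image_join)
    show ?thesis by (rule that[OF cyc sigma_quotient_invariant_even_winding[OF p(1) \<omega> cyc wn]])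
  qed
qed

end

section \<open>Fundamental systems and transformation matrices\<close>

no_notation fps_nth (infixl \<open>$\<close> 75)

lemma fundamental_system_solves:
  assumes fs: "fundamental_system (\<lambda>_. 1) (\<lambda>_. 0) (\<lambda>z. - q z) z0 y"
  obtains r where "r > 0" "\<And>j. solves q (ball z0 r) (y j)"
proof -
  have "\<exists>r>0. solves q (ball z0 r) (y j)" for j
  proof -
    have an: "y j analytic_on {z0}" and ev: "\<forall>\<^sub>F z in nhds z0. 1 * (deriv ^^ 2) (y j) z + 0 * deriv (y j) z + - q z * y j z = 0"
      using fs unfolding fundamental_system_def by blast+
    obtain r1 where r1: "r1 > 0" "y j holomorphic_on ball z0 r1" using an unfolding analytic_on_def by blast
    obtain r2 where r2: "r2 > 0" "\<And>z. dist z z0 < r2 \<Longrightarrow> 1 * (deriv ^^ 2) (y j) z + 0 * deriv (y j) z + - q z * y j z = 0"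
      using ev unfolding eventually_nhds_metric by blast
    have h: "y j holomorphic_on ball z0 (min r1 r2)" using r1(2) by (rule holomorphic_on_subset) auto
    have "solves q (ball z0 (min r1 r2)) (y j)"
    proof (rule solvesI)
      fix z assume z: "z \<in> ball z0 (min r1 r2)"
      show "(y j has_field_derivative deriv (y j) z) (at z)" by (rule holomorphic_derivI[OF h open_ball z])
      have "deriv (deriv (y j)) z = q z * y j z" using r2(2)[of z] z by (simp add: eval_nat_numeral dist_commute)
      then show "(deriv (y j) has_field_derivative q z * y j z) (at z)"
        using holomorphic_derivI[OF holomorphic_deriv[OF h open_ball] open_ball z] by simp
    qed
    then show ?thesis using r1(1) r2(1) by (intro exI[of _ "min r1 r2"]) auto
  qed
  then obtain r where r: "\<And>j. r j > 0" "\<And>j. solves q (ball z0 (r j)) (y j)" by metis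
  show ?thesis
  proof (rule that[of "min (r 1) (r 2)"])
    show "0 < min (r 1) (r 2)" using r(1) by simp
    fix j :: 2
    have "ball z0 (min (r 1) (r 2)) \<subseteq> ball z0 (r j)" using exhaust_2[of j] by auto
    then show "solves q (ball z0 (min (r 1) (r 2))) (y j)" using solves_subset[OF r(2)] by blast
  qed
qed

lemma fundamental_systemI:
  assumes S: "open S" "z0 \<in> S" and y: "\<And>j. solves q S (y j)" and W: "wronsk (y 1) (y 2) z0 \<noteq> 0"
  shows "fundamental_system (\<lambda>_. 1) (\<lambda>_. 0) (\<lambda>z. - q z) z0 y"
  unfolding fundamental_system_def
proof (intro conjI allI impI)
  have ev: "\<forall>\<^sub>F z in nhds z0. z \<in> S" using S by (rule eventually_nhds_in_open)
  fix j
  show "y j analytic_on {z0}" using solves_holomorphic[OF y S(1)] S analytic_at by blast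
  show "\<forall>\<^sub>F z in nhds z0. 1 * (deriv ^^ 2) (y j) z + 0 * deriv (y j) z + - q z * y j z = 0"
    using ev
  proof eventually_elim
    case (elim z)
    show ?case using DERIV_imp_deriv[OF solvesD(2)[OF y S(1) elim]] by (simp add: eval_nat_numeral)
  qed
next
  fix k :: "complex ^ 2" assume k: "\<forall>\<^sub>F z in nhds z0. (\<Sum>j\<in>UNIV. k $ j * y j z) = 0"
  then have k': "\<forall>\<^sub>F z in nhds z0. k $ 1 * y 1 z + k $ 2 * y 2 z = 0" by (simp add: sum_2)
  have 0: "k $ 1 * y 1 z0 + k $ 2 * y 2 z0 = 0" using eventually_nhds_x_imp_x[OF k'] .
  have "deriv (\<lambda>z. k $ 1 * y 1 z + k $ 2 * y 2 z) z0 = deriv (\<lambda>_. 0) z0" by (rule deriv_cong_ev[OF k' refl])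
  then have 1: "k $ 1 * deriv (y 1) z0 + k $ 2 * deriv (y 2) z0 = 0"
    using solves_lincomb(2)[OF y y S, of "k $ 1" 1 "k $ 2" 2] by simp
  have "k $ 1 * wronsk (y 1) (y 2) z0 = 0" "k $ 2 * wronsk (y 1) (y 2) z0 = 0"
    unfolding wronsk_def using 0 1 by algebra+
  then have "k $ 1 = 0" "k $ 2 = 0" using W by auto
  then show "k = 0" by (simp add: vec_eq_iff forall_2)
qed

section \<open>Global bases of solutions and the matrices acting on them\<close>

context lame
begin

definition lame_basis :: "(2 \<Rightarrow> complex \<Rightarrow> complex) \<Rightarrow> bool" where
  "lame_basis W \<longleftrightarrow> (\<forall>j. solves Q (- L) (W j)) \<and> (\<forall>z\<in>- L. wronsk (W 1) (W 2) z \<noteq> 0)"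

lemma lame_basisD:
  assumes "lame_basis W"
  shows "solves Q (- L) (W j)" "z \<notin> L \<Longrightarrow> wronsk (W 1) (W 2) z \<noteq> 0"
  using assms by (auto simp: lame_basis_def)

lemma lame_basisI:
  assumes "\<And>j. solves Q (- L) (W j)" "b \<notin> L" "wronsk (W 1) (W 2) b \<noteq> 0"
  shows "lame_basis W"
proof -
  have "wronsk (W 1) (W 2) z = wronsk (W 1) (W 2) b" if "z \<in> - L" for z
    by (rule wronsk_const[OF assms(1,1) open_compl_L connected_compl_L that]) (use assms(2) in simp)
  then have "wronsk (W 1) (W 2) z \<noteq> 0" if "z \<in> - L" for z using that assms(3) by metis
  then show ?thesis using assms(1) unfolding lame_basis_def by blast
qed

lemma lame_basis_exists: "\<exists>W. lame_basis W"
proof -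
  obtain f where f: "solves Q (- L) f" "f (\<omega>\<^sub>1 / 2) = 1" "deriv f (\<omega>\<^sub>1 / 2) = 0"
    by (rule lame_solution_exists[OF half_notin(1)])
  obtain g where g: "solves Q (- L) g" "g (\<omega>\<^sub>1 / 2) = 0" "deriv g (\<omega>\<^sub>1 / 2) = 1"
    by (rule lame_solution_exists[OF half_notin(1)])
  have "lame_basis (\<lambda>j. if j = 1 then f else g)"
    by (rule lame_basisI[OF _ half_notin(1)]) (use f g in \<open>auto simp: wronsk_def\<close>)
  then show ?thesis by blast
qed

lemma global_solution_unique:
  assumes "solves Q (- L) f" "solves Q (- L) g" "b \<notin> L" "f b = g b" "deriv f b = deriv g b" "z \<notin> L"
  shows "f z = g z"
  using solution_unique[OF open_UNIV connected_UNIV, of f g b z] assms by (simp add: Compl_eq_Diff_UNIV)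

lemma global_solution_coords:
  assumes W: "lame_basis W" and f: "solves Q (- L) f"
  obtains c where "\<And>z. z \<notin> L \<Longrightarrow> f z = W 1 z * c 1 + W 2 z * c (2::2)"
proof -
  let ?b = "\<omega>\<^sub>1 / 2"
  define c where "c j = (if j = 1 then wronsk f (W 2) ?b else wronsk (W 1) f ?b) / wronsk (W 1) (W 2) ?b" for j :: 2
  have "f z = W 1 z * c 1 + W 2 z * c 2" if "z \<notin> L" for z
    using solution_is_lincomb[OF lame_basisD(1)[OF W] lame_basisD(1)[OF W] f open_compl_L connected_compl_L, of ?b 1 2 z]
      lame_basisD(2)[OF W half_notin(1)] half_notin(1) that by (simp add: c_def mult.commute)
  then show ?thesis by (rule that)
qed

lemma lame_basis_independent:
  assumes W: "lame_basis W" and "z0 \<notin> L" and eq: "\<forall>\<^sub>F z in nhds z0. W 1 z * a + W 2 z * b = 0"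
  shows "a = 0" "b = 0"
proof -
  have fs: "fundamental_system (\<lambda>_. 1) (\<lambda>_. 0) (\<lambda>z. - Q z) z0 W"
    by (rule fundamental_systemI[OF open_compl_L]) (use assms lame_basisD[OF W] in auto)
  define k :: "complex ^ 2" where "k = (\<chi> j. if j = 1 then a else b)"
  have "\<forall>\<^sub>F z in nhds z0. (\<Sum>j\<in>UNIV. k $ j * W j z) = 0"
    using eq by eventually_elim (simp add: sum_2 k_def mult.commute)
  then have "k = 0" using fs unfolding fundamental_system_def by blast
  then have "k $ 1 = 0" "k $ 2 = 0" by simp_all
  then show "a = 0" "b = 0" by (simp_all add: k_def)
qed

text \<open>\<open>act W \<epsilon> \<omega> M\<close>: the substitution \<open>z \<mapsto> \<epsilon> z + \<omega>\<close> turns the row \<open>W\<close> into \<open>W M\<close>.\<close>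

definition act :: "(2 \<Rightarrow> complex \<Rightarrow> complex) \<Rightarrow> complex \<Rightarrow> complex \<Rightarrow> complex ^ 2 ^ 2 \<Rightarrow> bool" where
  "act W \<epsilon> \<omega> M \<longleftrightarrow> (\<forall>z. z \<notin> L \<longrightarrow> (\<forall>j. W j (\<epsilon> * z + \<omega>) = (\<Sum>i\<in>UNIV. W i z * M $ i $ j)))"

lemma affine_notin:
  assumes "\<epsilon> = 1 \<or> \<epsilon> = - 1" "\<omega> \<in> L"
  shows "\<epsilon> * z + \<omega> \<in> L \<longleftrightarrow> z \<in> L"
  using assms by auto

lemma Q_affine:
  assumes "\<epsilon> = 1 \<or> \<epsilon> = - 1" "\<omega> \<in> L" "z \<notin> L"
  shows "Q (\<epsilon> * z + \<omega>) = Q z"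
  using assms Q_periodic[of \<omega> z] Q_periodic[of \<omega> "- z"] Q_even[of z] by auto

lemma solves_affine_L:
  assumes "solves Q (- L) f" "\<epsilon> = 1 \<or> \<epsilon> = - 1" "\<omega> \<in> L"
  shows "solves Q (- L) (\<lambda>z. f (\<epsilon> * z + \<omega>))"
    and "z \<notin> L \<Longrightarrow> deriv (\<lambda>z. f (\<epsilon> * z + \<omega>)) z = \<epsilon> * deriv f (\<epsilon> * z + \<omega>)"
proof -
  have e: "\<epsilon> * \<epsilon> = 1" using assms(2) by auto
  have m: "\<epsilon> * z + \<omega> \<in> - L" if "z \<in> - L" for z using affine_notin[OF assms(2,3)] that by simp
  have q: "Q (\<epsilon> * z + \<omega>) = Q z" if "z \<in> - L" for z using Q_affine[OF assms(2,3)] that by simp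
  show "solves Q (- L) (\<lambda>z. f (\<epsilon> * z + \<omega>))"
    by (rule solves_affine(1)[OF assms(1) open_compl_L e m q])
  show "z \<notin> L \<Longrightarrow> deriv (\<lambda>z. f (\<epsilon> * z + \<omega>)) z = \<epsilon> * deriv f (\<epsilon> * z + \<omega>)"
    using solves_affine(2)[where T = "- L" and q = Q and r = Q, OF assms(1) open_compl_L e] m q by simp
qed

lemma act_exists:
  assumes W: "lame_basis W" and "\<epsilon> = 1 \<or> \<epsilon> = - 1" "\<omega> \<in> L"
  shows "\<exists>M. act W \<epsilon> \<omega> M"
proof -
  have "\<exists>c :: 2 \<Rightarrow> complex. \<forall>z. z \<notin> L \<longrightarrow> W j (\<epsilon> * z + \<omega>) = W 1 z * c 1 + W 2 z * c 2" for j
    using global_solution_coords[OF W solves_affine_L(1)[OF lame_basisD(1)[OF W] assms(2,3)]] by metis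
  then obtain c :: "2 \<Rightarrow> 2 \<Rightarrow> complex" where c: "\<And>j z. z \<notin> L \<Longrightarrow> W j (\<epsilon> * z + \<omega>) = W 1 z * c j 1 + W 2 z * c j 2" by metis
  then show ?thesis by (intro exI[of _ "\<chi> i j. c j i"]) (simp add: act_def sum_2)
qed

lemma act_unique:
  assumes W: "lame_basis W" and M: "act W \<epsilon> \<omega> M" "act W \<epsilon> \<omega> N"
  shows "M = N"
proof -
  let ?b = "\<omega>\<^sub>1 / 2"
  have "M $ i $ j = N $ i $ j" for i j
  proof -
    have "\<forall>\<^sub>F z in nhds ?b. z \<notin> L" using eventually_notin_L[OF half_notin(1)] .
    then have "\<forall>\<^sub>F z in nhds ?b. W 1 z * (M $ 1 $ j - N $ 1 $ j) + W 2 z * (M $ 2 $ j - N $ 2 $ j) = 0"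
    proof eventually_elim
      case (elim z)
      then have "W j (\<epsilon> * z + \<omega>) = (\<Sum>i\<in>UNIV. W i z * M $ i $ j)" "W j (\<epsilon> * z + \<omega>) = (\<Sum>i\<in>UNIV. W i z * N $ i $ j)"
        using M unfolding act_def by blast+
      then have "(\<Sum>i\<in>UNIV. W i z * M $ i $ j) = (\<Sum>i\<in>UNIV. W i z * N $ i $ j)" by (rule trans[OF sym])
      then show ?case unfolding sum_2 by algebra
    qed
    note ev = this
    have "M $ 1 $ j = N $ 1 $ j" "M $ 2 $ j = N $ 2 $ j"
      using lame_basis_independent(1)[OF W half_notin(1) ev] lame_basis_independent(2)[OF W half_notin(1) ev] by simp_all
    then show ?thesis using exhaust_2[of i] by auto
  qed
  then show ?thesis by (simp add: vec_eq_iff)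
qed

text \<open>Matrices multiply the row from the right, so the matrix of the inner substitution stands
  on the left.\<close>

lemma act_comp:
  assumes "act W \<epsilon> \<omega> M" "act W \<epsilon>' \<omega>' M'" "\<epsilon>' = 1 \<or> \<epsilon>' = - 1" "\<omega>' \<in> L"
  shows "act W (\<epsilon> * \<epsilon>') (\<epsilon> * \<omega>' + \<omega>) (M' ** M)"
  unfolding act_def
proof (intro allI impI)
  fix z j assume z: "z \<notin> L"
  have z': "\<epsilon>' * z + \<omega>' \<notin> L" using affine_notin[OF assms(3,4)] z by simp
  have "W j (\<epsilon> * \<epsilon>' * z + (\<epsilon> * \<omega>' + \<omega>)) = W j (\<epsilon> * (\<epsilon>' * z + \<omega>') + \<omega>)" by (simp add: algebra_simps)
  also have "\<dots> = (\<Sum>i\<in>UNIV. W i (\<epsilon>' * z + \<omega>') * M $ i $ j)" using assms(1) z' unfolding act_def by blast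
  also have "\<dots> = (\<Sum>i\<in>UNIV. (\<Sum>k\<in>UNIV. W k z * M' $ k $ i) * M $ i $ j)" using assms(2) z unfolding act_def by simp
  also have "\<dots> = (\<Sum>k\<in>UNIV. W k z * (M' ** M) $ k $ j)"
    by (simp add: matrix_matrix_mult_def sum_2 algebra_simps)
  finally show "W j (\<epsilon> * \<epsilon>' * z + (\<epsilon> * \<omega>' + \<omega>)) = (\<Sum>k\<in>UNIV. W k z * (M' ** M) $ k $ j)" .
qed

lemma act_id: "act W 1 0 (mat 1)"
proof -
  have "(\<Sum>i\<in>UNIV. W i z * (mat 1 :: complex ^ 2 ^ 2) $ i $ j) = W j z" for z j
    using exhaust_2[of j] by (auto simp: sum_2 mat_def)
  then show ?thesis by (simp add: act_def)
qed

lemma act_invertible: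
  assumes W: "lame_basis W" and M: "act W \<epsilon> \<omega> M" and e: "\<epsilon> = 1 \<or> \<epsilon> = - 1" "\<omega> \<in> L"
  shows "\<exists>N. act W \<epsilon> (- \<epsilon> * \<omega>) N \<and> M ** N = mat 1 \<and> N ** M = mat 1"
proof -
  have eL: "- \<epsilon> * \<omega> \<in> L" using e by auto
  obtain N where N: "act W \<epsilon> (- \<epsilon> * \<omega>) N" using act_exists[OF W e(1) eL] by blast
  have ee: "\<epsilon> * \<epsilon> = 1" using e by auto
  have "act W 1 0 (N ** M)" using act_comp[OF M N e(1) eL] ee by (simp add: mult.assoc[symmetric])
  then have 1: "N ** M = mat 1" using act_unique[OF W _ act_id] by blast
  have "act W 1 0 (M ** N)" using act_comp[OF N M e] ee by simp
  then have 2: "M ** N = mat 1" using act_unique[OF W _ act_id] by blast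
  show ?thesis using N 1 2 by blast
qed

text \<open>The Wronskian is constant off the lattice, and the substitution multiplies it by
  \<open>det M\<close> on the one hand and, by the chain rule, by \<open>\<epsilon>\<close> on the
  other.\<close>

lemma act_det:
  assumes W: "lame_basis W" and M: "act W \<epsilon> \<omega> M" and e: "\<epsilon> = 1 \<or> \<epsilon> = - 1" "\<omega> \<in> L"
  shows "det M = \<epsilon>"
proof -
  let ?b = "\<omega>\<^sub>1 / 2"
  have b: "?b \<in> - L" "?b \<notin> L" using half_notin(1) by auto
  have b': "\<epsilon> * ?b + \<omega> \<in> - L" using affine_notin[OF e, of ?b] b by blast
  note s = lame_basisD(1)[OF W]
  define f where "f j z = W j (\<epsilon> * z + \<omega>)" for j z
  have f: "f j z = M $ 1 $ j * W 1 z + M $ 2 $ j * W 2 z" if "z \<in> - L" for j z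
  proof -
    have "f j z = (\<Sum>i\<in>UNIV. W i z * M $ i $ j)" using M that unfolding act_def f_def by blast
    then show ?thesis by (simp only: sum_2 mult.commute)
  qed
  have df: "deriv (f j) ?b = M $ 1 $ j * deriv (W 1) ?b + M $ 2 $ j * deriv (W 2) ?b" for j
  proof -
    have "\<forall>\<^sub>F z in nhds ?b. z \<in> - L" using open_compl_L b(1) by (rule eventually_nhds_in_open)
    then have "\<forall>\<^sub>F z in nhds ?b. f j z = M $ 1 $ j * W 1 z + M $ 2 $ j * W 2 z" by eventually_elim (rule f)
    then have "deriv (f j) ?b = deriv (\<lambda>z. M $ 1 $ j * W 1 z + M $ 2 $ j * W 2 z) ?b" by (rule deriv_cong_ev) simp
    then show ?thesis using solves_lincomb(2)[OF s s open_compl_L b(1)] by simp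
  qed
  have "wronsk (f 1) (f 2) ?b = det M * wronsk (W 1) (W 2) ?b"
    unfolding wronsk_def df f[OF b(1)] det_2 by (simp add: algebra_simps)
  moreover have "wronsk (f 1) (f 2) ?b = \<epsilon> * wronsk (W 1) (W 2) (\<epsilon> * ?b + \<omega>)"
    unfolding wronsk_def f_def[abs_def] solves_affine_L(2)[OF s e b(2)] by (simp add: algebra_simps)
  moreover have "wronsk (W 1) (W 2) (\<epsilon> * ?b + \<omega>) = wronsk (W 1) (W 2) ?b"
    by (rule wronsk_const[OF s s open_compl_L connected_compl_L b' b(1)])
  ultimately show ?thesis using lame_basisD(2)[OF W b(2)] by simp
qed

text \<open>The extensions exist by prescribing the data at \<open>z0\<close>. If their Wronskian
  vanished, a kernel vector would give a combination with zero data, hence the zero solution,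
  against the independence of the germs.\<close>

lemma local_to_global:
  assumes z0: "z0 \<notin> L" and r: "r > 0" and v: "\<And>j. solves Q (ball z0 r - L) (v j)"
    and ind: "\<And>k :: complex ^ 2. (\<forall>\<^sub>F z in nhds z0. (\<Sum>j\<in>UNIV. k $ j * v j z) = 0) \<Longrightarrow> k = 0"
  obtains W where "lame_basis W" "\<And>j. \<forall>\<^sub>F z in nhds z0. W j z = v j z"
proof -
  have "\<exists>f. solves Q (- L) f \<and> f z0 = v j z0 \<and> deriv f z0 = deriv (v j) z0" for j
    using lame_solution_exists[OF z0] by metis
  then obtain W where W: "\<And>j. solves Q (- L) (W j)" "\<And>j. W j z0 = v j z0" "\<And>j. deriv (W j) z0 = deriv (v j) z0" by metis
  have "open (ball z0 r - L)" "z0 \<in> ball z0 r - L" using closed_L z0 r by auto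
  then have nb: "\<forall>\<^sub>F z in nhds z0. z \<in> ball z0 r - L" by (rule eventually_nhds_in_open)
  have eq: "\<forall>\<^sub>F z in nhds z0. W j z = v j z" for j
    using nb
  proof eventually_elim
    case (elim z)
    show ?case
      by (rule solution_unique[OF open_ball connected_ball solves_subset[OF W(1)] v, of z0]) (use elim z0 r W in auto)
  qed
  have wz: "wronsk (W 1) (W 2) z0 \<noteq> 0"
  proof
    assume w0: "wronsk (W 1) (W 2) z0 = 0"
    have "\<exists>k :: complex ^ 2. k \<noteq> 0 \<and> k $ 1 * W 1 z0 + k $ 2 * W 2 z0 = 0 \<and> k $ 1 * deriv (W 1) z0 + k $ 2 * deriv (W 2) z0 = 0"
    proof (cases "W 1 z0 = 0 \<and> W 2 z0 = 0 \<and> deriv (W 1) z0 = 0 \<and> deriv (W 2) z0 = 0")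
      case True
      define k0 :: "complex ^ 2" where "k0 = (\<chi> j. 1)"
      have "k0 $ 1 = 1" by (simp add: k0_def)
      then have "k0 \<noteq> 0" by auto
      then show ?thesis using True by (intro exI[of _ k0]) simp
    next
      case False
      \<comment> \<open>Each vector is orthogonal to one row of the Wronskian matrix by construction
        and to the other one by \<open>w0\<close>; they vanish together only if the matrix
        does.\<close>
      define k1 k2 :: "complex ^ 2" where "k1 = (\<chi> j. if j = 1 then W 2 z0 else - W 1 z0)"
        and "k2 = (\<chi> j. if j = 1 then deriv (W 2) z0 else - deriv (W 1) z0)"
      have "k1 \<noteq> 0 \<or> k2 \<noteq> 0"
      proof (rule ccontr)
        assume "\<not> ?thesis"
        then have "k1 $ 1 = 0" "k1 $ 2 = 0" "k2 $ 1 = 0" "k2 $ 2 = 0" by simp_all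
        then show False using False by (simp add: k1_def k2_def)
      qed
      moreover have "k $ 1 * W 1 z0 + k $ 2 * W 2 z0 = 0 \<and> k $ 1 * deriv (W 1) z0 + k $ 2 * deriv (W 2) z0 = 0" if "k = k1 \<or> k = k2" for k
        using that w0 by (auto simp: k1_def k2_def wronsk_def algebra_simps)
      ultimately show ?thesis by blast
    qed
    then obtain k :: "complex ^ 2" where k: "k \<noteq> 0" "k $ 1 * W 1 z0 + k $ 2 * W 2 z0 = 0" "k $ 1 * deriv (W 1) z0 + k $ 2 * deriv (W 2) z0 = 0" by blast
    have s0: "solves Q (- L) (\<lambda>_. 0)" by (rule solvesI[of _ _ "\<lambda>_. 0"]) auto
    have zero: "k $ 1 * W 1 z + k $ 2 * W 2 z = 0" if "z \<notin> L" for z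
      by (rule global_solution_unique[OF solves_lincomb(1)[OF W(1) W(1) open_compl_L] s0 z0 _ _ that])
        (use k solves_lincomb(2)[OF W(1) W(1) open_compl_L] z0 in auto)
    have "\<forall>\<^sub>F z in nhds z0. (\<Sum>j\<in>UNIV. k $ j * v j z) = 0"
      using eventually_notin_L[OF z0] eq[of 1] eq[of 2]
    proof eventually_elim
      case (elim z)
      show ?case using zero[OF elim(1)] unfolding elim(2,3) sum_2 .
    qed
    then show False using ind k(1) by blast
  qed
  show ?thesis by (rule that[OF lame_basisI[OF W(1) z0 wz] eq])
qed

end

section \<open>The gauge transformation to the non-even equation\<close>

context lattice
begin

text \<open>The derivative of \<open>wzeta_sum\<close> with respect to \<open>z\<close>.\<close>

lemma wp_sum:
  assumes "z \<in> noneven_domain L p" "p \<notin> L"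
  shows "wp L (z + p) + wp L (z - p) = 2 * wp L z - (wp2 z / hp p z - (wp1 z / hp p z)\<^sup>2)"
proof -
  have z: "z \<notin> L" "z - p \<notin> L" "z + p \<notin> L" using assms by (auto simp: domain_iff)
  have nz: "hp p z \<noteq> 0" using hp_nz[OF assms(2,1)] .
  have 1: "((\<lambda>z. wzeta L (z + p)) has_field_derivative - wp L (z + p)) (at z)"
    using wzeta_deriv[OF z(3)] by (simp add: DERIV_shift)
  have 2: "((\<lambda>z. wzeta L (z - p)) has_field_derivative - wp L (z - p)) (at z)"
    using wzeta_deriv[OF z(2)] DERIV_shift[of "wzeta L" _ z "- p"] by simp
  have d1: "((\<lambda>z. wzeta L (z + p) + wzeta L (z - p) - 2 * wzeta L z) has_field_derivative
     - wp L (z + p) + - wp L (z - p) - 2 * - wp L z) (at z)"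
    by (intro DERIV_diff DERIV_add DERIV_cmult 1 2 wzeta_deriv z)
  have "(hp p has_field_derivative wp1 z) (at z)"
    unfolding hp_def[abs_def] using wp_deriv[OF z(1)] by (auto intro!: derivative_eq_intros)
  then have d2: "((\<lambda>z. wp1 z / hp p z) has_field_derivative (wp2 z * hp p z - wp1 z * wp1 z) / (hp p z * hp p z)) (at z)"
    by (intro DERIV_divide wp1_deriv z nz)
  have "\<forall>\<^sub>F u in nhds z. u \<in> noneven_domain L p" using open_domain assms(1) by (rule eventually_nhds_in_open)
  then have "\<forall>\<^sub>F u in nhds z. wzeta L (u + p) + wzeta L (u - p) - 2 * wzeta L u = wp1 u / hp p u"
    by eventually_elim (use wzeta_sum assms(2) in \<open>simp add: hp_def domain_iff\<close>)
  from DERIV_unique_ev[OF d1 d2 this]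
  have "- wp L (z + p) + - wp L (z - p) - 2 * - wp L z = (wp2 z * hp p z - wp1 z * wp1 z) / (hp p z * hp p z)" .
  also have "\<dots> = wp2 z / hp p z - (wp1 z / hp p z)\<^sup>2"
    using nz by (simp add: diff_divide_distrib power2_eq_square)
  finally show ?thesis by (simp add: algebra_simps)
qed

text \<open>The addition formulas leave \<open>wp1\<close>, \<open>wp2\<close> and
  \<open>hp p\<close> at the single argument \<open>z\<close>. This is the shape in which the
  potential arises from the gauge transformation.\<close>

lemma noneven_potential_eq:
  assumes z: "z \<in> noneven_domain L p" and p: "p \<notin> L" "2 * p \<notin> L"
  shows "noneven_potential n L p T z =
    3 / 4 * (wp1 z / hp p z)\<^sup>2 - 1 / 2 * (wp2 z / hp p z) + T * (wp1 z / hp p z) + T\<^sup>2 + of_nat (n * (n + 1)) * hp p z"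
proof -
  have zz: "z \<notin> L" "z - p \<notin> L" "z + p \<notin> L" using z by (auto simp: domain_iff)
  have nz: "hp p z \<noteq> 0" using hp_nz[OF p(1) z] .
  have w1: "wp1 p \<noteq> 0" using wp1_eq_0_iff[OF p(1)] p(2) by simp
  define E D X c where "E = wp1 z / hp p z" and "D = hp p z" and "X = wp L z" and "c = wp L p"
  have D: "D = X - c" by (simp add: D_def X_def c_def hp_def)
  have D0: "D \<noteq> 0" using nz by (simp add: D_def)
  define N :: complex where "N = of_nat (n * (n + 1))"
  have NN: "2 * of_nat n ^ 2 + 2 * of_nat n - 3 = 2 * N - (3 :: complex)"
    by (simp add: N_def power2_eq_square algebra_simps)
  have s1: "wzeta L (z + p) + wzeta L (z - p) - 2 * wzeta L z = E"
    using wzeta_sum[OF zz(1) p(1) zz(3,2)] by (simp add: E_def hp_def)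
  have s2: "wzeta L (z + p) - wzeta L (z - p) = 2 * wzeta L p - wp1 p / D"
    using wzeta_diff[OF zz(1) p(1) zz(3,2)] by (simp add: D_def hp_def algebra_simps)
  have s3: "wp L (z + p) + wp L (z - p) = 2 * X - (wp2 z / D - E\<^sup>2)"
    using wp_sum[OF z p(1)] by (simp add: E_def D_def X_def)
  have "wp2 p / (4 * wp1 p) * (2 * wzeta L p - wp1 p / D) = wp2 p / (2 * wp1 p) * wzeta L p - wp2 p / D / 4"
    using w1 D0 by (simp add: field_simps)
  then have s4: "wp2 p / (4 * wp1 p) * (wzeta L (z + p) - wzeta L (z - p)) = wp2 p / (2 * wp1 p) * wzeta L p - wp2 p / D / 4"
    using s2 by simp
  \<comment> \<open>By the differential equation this difference is divisible by \<open>D\<close>,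
    which removes the contribution of \<open>wp2 p\<close>.\<close>
  have "wp2 z - wp2 p = 6 * (X + c) * D"
    unfolding wp2_eq[OF zz(1)] wp2_eq[OF p(1)] X_def[symmetric] c_def[symmetric] D by (simp add: power2_eq_square algebra_simps)
  then have s5: "wp2 z / D - wp2 p / D = 6 * (X + c)"
    using D0 by (simp flip: diff_divide_distrib)
  have "noneven_potential n L p T z = N * X + 3 / 4 * (2 * X - (wp2 z / D - E\<^sup>2)) + T * E
     - (wp2 p / (2 * wp1 p) * wzeta L p - wp2 p / D / 4) + (T\<^sup>2 + wp2 p / (2 * wp1 p) * wzeta L p - 1 / 2 * (2 * N - 3) * c)"
    unfolding noneven_potential_def deriv_wp[OF p(1)] deriv2_wp[OF p(1)] s1 s3 s4 NN N_def[symmetric] X_def[symmetric] c_def[symmetric] by simp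
  also have "\<dots> = 3 / 4 * E\<^sup>2 - 1 / 2 * (wp2 z / D) + T * E + T\<^sup>2 + N * D - 1 / 4 * ((wp2 z / D - wp2 p / D) - 6 * (X + c))"
  proof -
    have key: "N * (D + c) + 3 / 4 * (2 * (D + c) - (a - E\<^sup>2)) + T * E - (u - b / 4) + (T\<^sup>2 + u - 1 / 2 * (2 * N - 3) * c)
      = 3 / 4 * E\<^sup>2 - 1 / 2 * a + T * E + T\<^sup>2 + N * D - 1 / 4 * ((a - b) - 6 * ((D + c) + c))" for a b u D c N E T :: complex
      by (simp add: field_simps)
    have X: "X = D + c" using D by simp
    show ?thesis unfolding X by (rule key)
  qed
  also have "\<dots> = 3 / 4 * E\<^sup>2 - 1 / 2 * (wp2 z / D) + T * E + T\<^sup>2 + N * D" unfolding s5 by simp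
  finally show ?thesis by (simp add: E_def D_def N_def)
qed

end

context lame
begin

text \<open>With \<open>u = w' - T w\<close> the factor \<open>s\<close> removes the first derivative from the equation of \<open>u\<close>.\<close>

definition gauge :: "complex \<Rightarrow> (complex \<Rightarrow> complex) \<Rightarrow> (complex \<Rightarrow> complex) \<Rightarrow> complex \<Rightarrow> complex" where
  "gauge T s w z = s z * (deriv w z - T * w z)"

context
  fixes p T \<kappa> :: complex and S :: "complex set" and s :: "complex \<Rightarrow> complex"
  assumes p: "p \<notin> L" "2 * p \<notin> L" and Bt: "T\<^sup>2 - of_nat (n * (n + 1)) * wp L p = Bt"
    and S: "open S" "S \<subseteq> noneven_domain L p" and s: "s holomorphic_on S"
    and \<kappa>: "\<kappa> \<noteq> 0" and s2: "\<And>z. z \<in> S \<Longrightarrow> (s z)\<^sup>2 * hp p z = \<kappa>"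
begin

text \<open>Differentiation of the relation \<open>s2\<close> determines the logarithmic derivative
  of \<open>s\<close>, whichever branch of the square root \<open>s\<close> is.\<close>

lemma gauge_factor_deriv:
  assumes z: "z \<in> S"
  shows "(s has_field_derivative - (1 / 2) * (wp1 z / hp p z) * s z) (at z)"
proof -
  have zL: "z \<notin> L" using z S(2) by (auto simp: domain_iff)
  have hnz: "hp p z \<noteq> 0" using hp_nz[OF p(1)] z S(2) by blast
  have snz: "s z \<noteq> 0" using s2[OF z] \<kappa> by auto
  have ds: "(s has_field_derivative deriv s z) (at z)" by (rule holomorphic_derivI[OF s S(1) z])
  have dh: "(hp p has_field_derivative wp1 z) (at z)"
    unfolding hp_def[abs_def] using wp_deriv[OF zL] by (auto intro!: derivative_eq_intros)
  have "((\<lambda>z. (s z * s z) * hp p z) has_field_derivative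
      (deriv s z * s z + deriv s z * s z) * hp p z + wp1 z * (s z * s z)) (at z)"
    by (intro DERIV_mult ds dh)
  moreover have "((\<lambda>z. \<kappa>) has_field_derivative 0) (at z)" by simp
  moreover have "\<forall>\<^sub>F u in nhds z. u \<in> S" using S(1) z by (rule eventually_nhds_in_open)
  then have "\<forall>\<^sub>F u in nhds z. (s u * s u) * hp p u = \<kappa>" by eventually_elim (use s2 in \<open>simp add: power2_eq_square\<close>)
  ultimately have "(deriv s z * s z + deriv s z * s z) * hp p z + wp1 z * (s z * s z) = 0"
    by (rule DERIV_unique_ev)
  then have "s z * (2 * deriv s z * hp p z + wp1 z * s z) = 0" by (simp add: algebra_simps)
  then have "2 * deriv s z * hp p z + wp1 z * s z = 0" using snz by simp
  then have "deriv s z = - (1 / 2) * (wp1 z / hp p z) * s z"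
    using hnz by (simp add: field_simps eq_neg_iff_add_eq_0)
  then show ?thesis using ds by simp
qed

text \<open>By \<open>Bt\<close> the potential is
  \<open>Q z = T\<^sup>2 + n * (n + 1) * hp p z\<close>, so that \<open>u = w' - T * w\<close>
  satisfies \<open>u' = - T * u + n * (n + 1) * hp p z * w\<close>. One further differentiation
  expresses the second derivative through \<open>u\<close> alone, the terms with \<open>w\<close>
  cancelling.\<close>

lemma gauge_solves:
  assumes w: "solves Q (- L) w"
  shows "solves (noneven_potential n L p T) S (gauge T s w)"
    and "z \<in> S \<Longrightarrow> deriv (gauge T s w) z =
      s z * ((- (1 / 2) * (wp1 z / hp p z) - T) * (deriv w z - T * w z) + of_nat (n * (n + 1)) * hp p z * w z)"
proof -
  define N :: complex where "N = of_nat (n * (n + 1))"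
  define a where "a z = - (1 / 2) * (wp1 z / hp p z) - T" for z
  define y' where "y' z = s z * (a z * (deriv w z - T * w z) + N * hp p z * w z)" for z
  have SL: "z \<in> - L" if "z \<in> S" for z using that S(2) by (auto simp: domain_iff)
  have QT: "Q z = T\<^sup>2 + N * hp p z" for z
    using Bt by (simp add: Q_def N_def hp_def algebra_simps)
  have dw: "(w has_field_derivative deriv w z) (at z)" "(deriv w has_field_derivative Q z * w z) (at z)" if "z \<in> S" for z
    using solvesD[OF w open_compl_L SL[OF that]] by auto
  have d1: "(gauge T s w has_field_derivative y' z) (at z)" if z: "z \<in> S" for z
  proof -
    have "((\<lambda>z. s z * (deriv w z - T * w z)) has_field_derivative
      - (1 / 2) * (wp1 z / hp p z) * s z * (deriv w z - T * w z) + (Q z * w z - T * deriv w z) * s z) (at z)"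
      by (intro DERIV_mult DERIV_diff DERIV_cmult gauge_factor_deriv dw z)
    also have "- (1 / 2) * (wp1 z / hp p z) * s z * (deriv w z - T * w z) + (Q z * w z - T * deriv w z) * s z = y' z"
      unfolding y'_def a_def QT by algebra
    finally show ?thesis by (simp add: gauge_def[abs_def])
  qed
  then show "z \<in> S \<Longrightarrow> deriv (gauge T s w) z =
      s z * ((- (1 / 2) * (wp1 z / hp p z) - T) * (deriv w z - T * w z) + of_nat (n * (n + 1)) * hp p z * w z)"
    using DERIV_imp_deriv[OF d1, of z] by (simp only: y'_def a_def N_def)
  show "solves (noneven_potential n L p T) S (gauge T s w)"
  proof (rule solvesI[OF d1])
    fix z assume z: "z \<in> S"
    have zL: "z \<notin> L" using SL[OF z] by simp
    have zD: "z \<in> noneven_domain L p" using z S(2) by blast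
    have nz: "hp p z \<noteq> 0" using hp_nz[OF p(1) zD] .
    define E F where "E = wp1 z / hp p z" and "F = wp2 z / hp p z"
    have dh: "(hp p has_field_derivative wp1 z) (at z)"
      unfolding hp_def[abs_def] using wp_deriv[OF zL] by (auto intro!: derivative_eq_intros)
    have "((\<lambda>z. - (1 / 2) * (wp1 z / hp p z) - T) has_field_derivative
       - (1 / 2) * ((wp2 z * hp p z - wp1 z * wp1 z) / (hp p z * hp p z)) - 0) (at z)"
      by (intro DERIV_diff DERIV_cmult DERIV_divide DERIV_const wp1_deriv zL dh nz)
    also have "- (1 / 2) * ((wp2 z * hp p z - wp1 z * wp1 z) / (hp p z * hp p z)) - 0 = - (1 / 2) * (F - E\<^sup>2)"
      using nz by (simp add: E_def F_def diff_divide_distrib power2_eq_square)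
    finally have da: "(a has_field_derivative - (1 / 2) * (F - E\<^sup>2)) (at z)" by (simp add: a_def[abs_def])
    have "(y' has_field_derivative
       - (1 / 2) * (wp1 z / hp p z) * s z * (a z * (deriv w z - T * w z) + N * hp p z * w z) +
       ((- (1 / 2) * (F - E\<^sup>2) * (deriv w z - T * w z) + (Q z * w z - T * deriv w z) * a z) +
        (N * wp1 z * w z + deriv w z * (N * hp p z))) * s z) (at z)"
      unfolding y'_def[abs_def]
      by (intro DERIV_mult DERIV_add DERIV_diff DERIV_cmult gauge_factor_deriv da dw dh z)
    also have "- (1 / 2) * (wp1 z / hp p z) * s z * (a z * (deriv w z - T * w z) + N * hp p z * w z) +
       ((- (1 / 2) * (F - E\<^sup>2) * (deriv w z - T * w z) + (Q z * w z - T * deriv w z) * a z) +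
        (N * wp1 z * w z + deriv w z * (N * hp p z))) * s z
       = (3 / 4 * E\<^sup>2 - 1 / 2 * F + T * E + T\<^sup>2 + N * hp p z) * (s z * (deriv w z - T * w z))"
    proof -
      have E: "wp1 z = E * hp p z" using nz by (simp add: E_def)
      show ?thesis unfolding a_def E_def[symmetric] QT unfolding E by (simp add: field_simps power2_eq_square)
    qed
    also have "\<dots> = noneven_potential n L p T z * gauge T s w z"
      unfolding noneven_potential_eq[OF zD p] gauge_def by (simp add: E_def F_def N_def)
    finally show "(y' has_field_derivative noneven_potential n L p T z * gauge T s w z) (at z)" .
  qed
qed

text \<open>For \<open>n > 0\<close> the factor is nonzero, and the gauge transformation carries
  bases of solutions to bases.\<close>

lemma gauge_wronsk:
  assumes w: "solves Q (- L) w" "solves Q (- L) v" and z: "z \<in> S"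
  shows "wronsk (gauge T s w) (gauge T s v) z = - of_nat (n * (n + 1)) * \<kappa> * wronsk w v z"
proof -
  have "wronsk (gauge T s w) (gauge T s v) z = - of_nat (n * (n + 1)) * ((s z)\<^sup>2 * hp p z) * wronsk w v z"
    unfolding wronsk_def gauge_solves(2)[OF w(1) z] gauge_solves(2)[OF w(2) z] gauge_def by algebra
  then show ?thesis unfolding s2[OF z] .
qed

end

end

section \<open>Cyclic and dihedral groups\<close>

lemma iso_bij_inverse:
  assumes f: "bij_betw f (carrier D) (carrier G)"
    and hom: "\<And>x y. x \<in> carrier D \<Longrightarrow> y \<in> carrier D \<Longrightarrow> x \<otimes>\<^bsub>D\<^esub> y \<in> carrier D \<and> f (x \<otimes>\<^bsub>D\<^esub> y) = f x \<otimes>\<^bsub>G\<^esub> f y"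
  shows "G \<cong> D"
proof -
  let ?g = "inv_into (carrier D) f"
  have bij: "bij_betw ?g (carrier G) (carrier D)" using f by (rule bij_betw_inv_into)
  have "?g (x \<otimes>\<^bsub>G\<^esub> y) = ?g x \<otimes>\<^bsub>D\<^esub> ?g y" if "x \<in> carrier G" "y \<in> carrier G" for x y
  proof -
    have g: "?g x \<in> carrier D" "?g y \<in> carrier D" "f (?g x) = x" "f (?g y) = y"
      using bij f that by (auto simp: bij_betw_apply bij_betw_inv_into_right)
    then have "f (?g x \<otimes>\<^bsub>D\<^esub> ?g y) = x \<otimes>\<^bsub>G\<^esub> y" "?g x \<otimes>\<^bsub>D\<^esub> ?g y \<in> carrier D" using hom by auto
    then show ?thesis using f by (metis bij_betw_inv_into_left)
  qed
  then have "?g \<in> iso G D" using bij by (auto simp: iso_def hom_def bij_betw_apply)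
  then show ?thesis unfolding is_iso_def by blast
qed

text \<open>For \<open>N \<ge> 3\<close> a rotation of order \<open>N\<close> is no involution, and hence lies in \<open>A\<close>.\<close>

lemma dihedral_criterion:
  fixes G (structure)
  assumes "group G" and A: "subgroup A G" and comm: "\<And>a b. a \<in> A \<Longrightarrow> b \<in> A \<Longrightarrow> a \<otimes> b = b \<otimes> a"
    and s: "s \<in> carrier G" "s \<notin> A" "s \<otimes> s = \<one>" and sa: "\<And>a. a \<in> A \<Longrightarrow> s \<otimes> a = inv a \<otimes> s"
    and cov: "carrier G = A \<union> (\<lambda>a. a \<otimes> s) ` A" and N: "N \<ge> 3"
  shows "G\<lparr>carrier := A\<rparr> \<cong> integer_mod_group N \<longleftrightarrow> G \<cong> dihedral_group N"
proof -
  interpret group G by fact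
  have Ac: "a \<in> carrier G" if "a \<in> A" for a using subgroup.mem_carrier[OF A that] .
  have Ainv: "inv a \<in> A" if "a \<in> A" for a using subgroup.m_inv_closed[OF A that] .
  have Amult: "a \<otimes> b \<in> A" if "a \<in> A" "b \<in> A" for a b using subgroup.m_closed[OF A that] .
  have refl2: "(a \<otimes> s) \<otimes> (b \<otimes> s) = a \<otimes> inv b" if "a \<in> A" "b \<in> A" for a b
  proof -
    have "(a \<otimes> s) \<otimes> (b \<otimes> s) = a \<otimes> ((s \<otimes> b) \<otimes> s)" using Ac that s(1) by (simp add: m_assoc)
    also have "\<dots> = a \<otimes> (inv b \<otimes> (s \<otimes> s))" using Ac that s(1) by (simp add: sa m_assoc)
    finally show ?thesis using Ac that s by simp
  qed
  have Nc: "carrier (integer_mod_group N) = {0..<int N}" using N by (simp add: integer_mod_group_def)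
  have Nm: "x \<otimes>\<^bsub>integer_mod_group N\<^esub> y = (x + y) mod int N" for x y
    using N by (simp add: integer_mod_group_def)
  have Dc: "carrier (dihedral_group N) = {0..<int N} \<times> UNIV" by (simp add: dihedral_group_def)
  have Dm: "(a, t) \<otimes>\<^bsub>dihedral_group N\<^esub> (b, u) = ((if t then a - b else a + b) mod int N, t \<noteq> u)" for a b t u
    by (simp add: dihedral_group_def)
  have Npos: "int N > 0" using N by simp
  show ?thesis
  proof
    assume "G\<lparr>carrier := A\<rparr> \<cong> integer_mod_group N"
    then have "integer_mod_group N \<cong> G\<lparr>carrier := A\<rparr>"
      using group.iso_sym[OF subgroup_imp_group[OF A]] by blast
    then obtain \<phi> where \<phi>: "\<phi> \<in> iso (integer_mod_group N) (G\<lparr>carrier := A\<rparr>)" unfolding is_iso_def by blast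
    have \<phi>A: "\<phi> k \<in> A" if "0 \<le> k" "k < int N" for k
      using \<phi> that Nc by (auto simp: iso_def hom_def)
    have \<phi>m: "\<phi> ((k + l) mod int N) = \<phi> k \<otimes> \<phi> l" if "0 \<le> k" "k < int N" "0 \<le> l" "l < int N" for k l
      using \<phi> that Nc Nm by (auto simp: iso_def hom_def)
    have \<phi>inj: "inj_on \<phi> {0..<int N}" and \<phi>surj: "\<phi> ` {0..<int N} = A"
      using \<phi> Nc by (auto simp: iso_def bij_betw_def)
    define f where "f x = \<phi> (fst x) \<otimes> (if snd x then s else \<one>)" for x
    have \<phi>d: "\<phi> ((k - l) mod int N) = \<phi> k \<otimes> inv \<phi> l" if "0 \<le> k" "k < int N" "0 \<le> l" "l < int N" for k l
    proof -
      have "0 \<le> (k - l) mod int N" "(k - l) mod int N < int N" using Npos by auto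
      from \<phi>m[OF this that(3,4)] have "\<phi> ((k - l) mod int N) \<otimes> \<phi> l = \<phi> k"
        using that by (simp add: mod_add_left_eq)
      moreover have "\<phi> ((k - l) mod int N) \<in> carrier G" "\<phi> l \<in> carrier G" "\<phi> k \<in> carrier G"
        using Npos that by (auto intro!: Ac \<phi>A)
      ultimately show ?thesis using inv_solve_right by metis
    qed
    show "G \<cong> dihedral_group N"
    proof (rule iso_bij_inverse[where f = f])
      have inj: "x = y" if x: "x \<in> carrier (dihedral_group N)" "y \<in> carrier (dihedral_group N)" and eq: "f x = f y" for x y
      proof -
        obtain k t l u where kl: "x = (k, t)" "y = (l, u)" by (metis surj_pair)
        have r: "0 \<le> k" "k < int N" "0 \<le> l" "l < int N" using x kl Dc by auto
        note in' = \<phi>A[OF r(1,2)] \<phi>A[OF r(3,4)]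
        note in_c = Ac[OF in'(1)] Ac[OF in'(2)]
        have mem: "s \<in> A" if "a \<in> A" "b \<in> A" "a \<otimes> s = b" for a b
        proof -
          have "s = inv a \<otimes> b" using that Ac s(1) by (metis inv_solve_left)
          then show ?thesis using Ainv[OF that(1)] Amult that(2) by simp
        qed
        have "\<not> (t \<noteq> u)" using eq mem[OF in'] mem[OF in'(2,1)] s(2) in_c unfolding f_def kl by (auto split: if_splits)
        then have "\<phi> k = \<phi> l" using eq in_c s(1) unfolding f_def kl by (auto split: if_splits)
        then have "k = l" using \<phi>inj r by (auto dest: inj_onD)
        then show ?thesis using kl \<open>\<not> (t \<noteq> u)\<close> by simp
      qed
      moreover have "f ` carrier (dihedral_group N) = carrier G"
      proof
        show "f ` carrier (dihedral_group N) \<subseteq> carrier G" using \<phi>A Ac s(1) by (auto simp: f_def Dc)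
        show "carrier G \<subseteq> f ` carrier (dihedral_group N)"
        proof
          fix g assume "g \<in> carrier G"
          then obtain a t where a: "a \<in> A" "g = a \<otimes> (if t then s else \<one>)"
          proof -
            consider "g \<in> A" | a where "a \<in> A" "g = a \<otimes> s" using \<open>g \<in> carrier G\<close> cov by blast
            then show thesis
            proof cases
              case 1
              then show thesis using that[of g False] Ac by simp
            next
              case 2
              then show thesis using that[of a True] by simp
            qed
          qed
          then obtain k where "k \<in> {0..<int N}" "a = \<phi> k" using \<phi>surj by blast
          then show "g \<in> f ` carrier (dihedral_group N)"
            using a by (intro image_eqI[of _ _ "(k, t)"]) (auto simp: f_def Dc)
        qed
      qed
      ultimately show "bij_betw f (carrier (dihedral_group N)) (carrier G)"
        unfolding bij_betw_def inj_on_def by blast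
      fix x y assume xy: "x \<in> carrier (dihedral_group N)" "y \<in> carrier (dihedral_group N)"
      obtain k t l u where kl: "x = (k, t)" "y = (l, u)" by (metis surj_pair)
      have r: "0 \<le> k" "k < int N" "0 \<le> l" "l < int N" using xy kl Dc by auto
      note in' = \<phi>A[OF r(1,2)] \<phi>A[OF r(3,4)]
      note c = Ac[OF in'(1)] Ac[OF in'(2)] Ac[OF Ainv[OF in'(2)]]
      have "f (x \<otimes>\<^bsub>dihedral_group N\<^esub> y) = f x \<otimes> f y"
      proof (cases t)
        case True
        have "f x \<otimes> f y = \<phi> k \<otimes> inv (\<phi> l) \<otimes> (if u then \<one> else s)"
        proof (cases u)
          case True
          then show ?thesis using \<open>t\<close> refl2[OF in'] c by (simp add: f_def kl)
        next
          case False
          then show ?thesis using \<open>t\<close> c s(1) sa[OF in'(2)] by (simp add: f_def kl m_assoc)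
        qed
        moreover have "f (x \<otimes>\<^bsub>dihedral_group N\<^esub> y) = \<phi> k \<otimes> inv (\<phi> l) \<otimes> (if u then \<one> else s)"
          using True \<phi>d[OF r] by (simp add: kl Dm f_def)
        ultimately show ?thesis by simp
      next
        case False
        then show ?thesis using \<phi>m[OF r] c s(1) by (simp add: kl Dm f_def m_assoc)
      qed
      then show "x \<otimes>\<^bsub>dihedral_group N\<^esub> y \<in> carrier (dihedral_group N) \<and> f (x \<otimes>\<^bsub>dihedral_group N\<^esub> y) = f x \<otimes> f y"
        using Npos by (simp add: kl Dm Dc)
    qed
  next
    assume "G \<cong> dihedral_group N"
    then obtain \<phi> where \<phi>: "\<phi> \<in> iso G (dihedral_group N)" unfolding is_iso_def by blast
    have \<phi>m: "\<phi> (x \<otimes> y) = \<phi> x \<otimes>\<^bsub>dihedral_group N\<^esub> \<phi> y" if "x \<in> carrier G" "y \<in> carrier G" for x y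
      using \<phi> that by (auto simp: iso_def hom_def)
    have \<phi>inj: "x = y" if "x \<in> carrier G" "y \<in> carrier G" "\<phi> x = \<phi> y" for x y
      using \<phi> that by (auto simp: iso_def bij_betw_def dest: inj_onD)
    have \<phi>surj: "\<exists>x\<in>carrier G. \<phi> x = (k, t)" if "0 \<le> k" "k < int N" for k t
    proof -
      have "(k, t) \<in> \<phi> ` carrier G" using \<phi> that Dc by (auto simp: iso_def bij_betw_def)
      then show ?thesis by (metis imageE)
    qed
    obtain r where r: "r \<in> carrier G" "\<phi> r = (1, False)" using \<phi>surj[of 1 False] N by auto
    have rA: "r \<in> A"
    proof (rule ccontr)
      assume "r \<notin> A"
      then obtain a where a: "a \<in> A" "r = a \<otimes> s" using r(1) cov by blast
      then have "r \<otimes> r = \<one>" using refl2[of a a] Ac by simp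
      then have "r \<otimes> r \<otimes> r = r" using r(1) by simp
      then have "((1 + 1) mod int N + 1) mod int N = 1" using \<phi>m[of "r \<otimes> r" r] \<phi>m[OF r(1,1)] r by (simp add: Dm)
      then show False using N by (cases "N = 3") auto
    qed
    \<comment> \<open>Induction on the exponent: \<open>(int k, False)\<close> corresponds to the
      power \<open>k\<close> of the rotation \<open>r\<close>.\<close>
    have kA: "x \<in> A" if "x \<in> carrier G" "\<phi> x = (int k, False)" "k < N" for x k
      using that
    proof (induction k arbitrary: x)
      case 0
      then have "\<phi> (x \<otimes> x) = \<phi> x" using \<phi>m[of x x] by (simp add: Dm)
      then have "x \<otimes> x = x" using \<phi>inj 0 by blast
      then have "x = \<one>" using 0 by (simp add: r_cancel_one)
      then show ?case using subgroup.one_closed[OF A] by simp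
    next
      case (Suc k)
      obtain y where y: "y \<in> carrier G" "\<phi> y = (int k, False)" using \<phi>surj[of "int k" False] Suc by auto
      have "\<phi> (y \<otimes> r) = \<phi> x" using \<phi>m[OF y(1) r(1)] y r Suc by (simp add: Dm add.commute)
      then have "x = y \<otimes> r" using \<phi>inj Suc y r by (metis m_closed)
      moreover have "y \<in> A" using Suc.IH[OF y] Suc.prems by simp
      ultimately show ?case using Amult rA by simp
    qed
    \<comment> \<open>Elements of \<open>A\<close> commute with \<open>r\<close>, whereas a
      reflection would do so only if \<open>N\<close> divided 2.\<close>
    have AF: "\<exists>k. \<phi> x = (k, False) \<and> 0 \<le> k \<and> k < int N" if x: "x \<in> A" for x
    proof -
      obtain k t where k: "\<phi> x = (k, t)" by (metis surj_pair)
      have "\<phi> x \<in> carrier (dihedral_group N)" using \<phi> Ac[OF x] by (auto simp: iso_def hom_def)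
      then have kN: "0 \<le> k" "k < int N" using k Dc by auto
      have "\<not> t"
      proof
        assume t
        have "\<phi> x \<otimes>\<^bsub>dihedral_group N\<^esub> \<phi> r = \<phi> r \<otimes>\<^bsub>dihedral_group N\<^esub> \<phi> x"
          using \<phi>m[OF Ac[OF x] r(1)] \<phi>m[OF r(1) Ac[OF x]] comm[OF x rA] by simp
        then have "(k - 1) mod int N = (1 + k) mod int N" using \<open>t\<close> k r by (simp add: Dm)
        then have "int N dvd (k - 1) - (1 + k)" using mod_eq_dvd_iff by blast
        then have "int N dvd 2" by simp
        then show False using N zdvd_imp_le[of "int N" 2] by simp
      qed
      then show ?thesis using k kN by simp
    qed
    have "fst \<circ> \<phi> \<in> iso (G\<lparr>carrier := A\<rparr>) (integer_mod_group N)"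
      unfolding iso_def hom_def bij_betw_def
    proof (intro CollectI conjI funcsetI ballI)
      fix x assume "x \<in> carrier (G\<lparr>carrier := A\<rparr>)"
      then show "(fst \<circ> \<phi>) x \<in> carrier (integer_mod_group N)" using AF[of x] Nc by auto
    next
      fix x y assume "x \<in> carrier (G\<lparr>carrier := A\<rparr>)" "y \<in> carrier (G\<lparr>carrier := A\<rparr>)"
      then show "(fst \<circ> \<phi>) (x \<otimes>\<^bsub>G\<lparr>carrier := A\<rparr>\<^esub> y) = (fst \<circ> \<phi>) x \<otimes>\<^bsub>integer_mod_group N\<^esub> (fst \<circ> \<phi>) y"
        using AF[of x] AF[of y] \<phi>m[of x y] Ac by (auto simp: Nm Dm)
    next
      show "inj_on (fst \<circ> \<phi>) (carrier (G\<lparr>carrier := A\<rparr>))"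
      proof (rule inj_onI)
        fix x y assume xy: "x \<in> carrier (G\<lparr>carrier := A\<rparr>)" "y \<in> carrier (G\<lparr>carrier := A\<rparr>)" "(fst \<circ> \<phi>) x = (fst \<circ> \<phi>) y"
        then have "\<phi> x = \<phi> y" using AF[of x] AF[of y] by auto
        then show "x = y" using \<phi>inj Ac xy by simp
      qed
      show "(fst \<circ> \<phi>) ` carrier (G\<lparr>carrier := A\<rparr>) = carrier (integer_mod_group N)"
      proof
        show "(fst \<circ> \<phi>) ` carrier (G\<lparr>carrier := A\<rparr>) \<subseteq> carrier (integer_mod_group N)" using AF Nc by fastforce
        show "carrier (integer_mod_group N) \<subseteq> (fst \<circ> \<phi>) ` carrier (G\<lparr>carrier := A\<rparr>)"
        proof
          fix k assume "k \<in> carrier (integer_mod_group N)"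
          then have k: "0 \<le> k" "k < int N" using Nc by auto
          obtain x where x: "x \<in> carrier G" "\<phi> x = (k, False)" using \<phi>surj[OF k] by blast
          have "x \<in> A" using kA[of x "nat k"] x k by simp
          then show "k \<in> (fst \<circ> \<phi>) ` carrier (G\<lparr>carrier := A\<rparr>)" using x(2) by (intro image_eqI[of _ _ x]) auto
        qed
      qed
    qed
    then show "G\<lparr>carrier := A\<rparr> \<cong> integer_mod_group N" unfolding is_iso_def by blast
  qed
qed

section \<open>The groups of a Lame equation\<close>

lemma GL2_simps: "x \<otimes>\<^bsub>GL2\<^esub> y = x ** y" "\<one>\<^bsub>GL2\<^esub> = mat 1" "x \<in> carrier GL2 \<longleftrightarrow> invertible x"
  by (simp_all add: GL2_def)

lemma group_GL2: "group GL2"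
proof (rule groupI)
  fix x assume "x \<in> carrier GL2"
  then obtain y where "x ** y = mat 1" "y ** x = mat 1" unfolding GL2_simps invertible_def by blast
  then show "\<exists>y\<in>carrier GL2. y \<otimes>\<^bsub>GL2\<^esub> x = \<one>\<^bsub>GL2\<^esub>"
    by (intro bexI[of _ y]) (auto simp: GL2_simps invertible_def)
next
  have "invertible (mat 1 :: complex ^ 2 ^ 2)" unfolding invertible_def by (rule exI[of _ "mat 1"]) simp
  then show "\<one>\<^bsub>GL2\<^esub> \<in> carrier GL2" by (simp add: GL2_simps)
qed (simp_all add: GL2_simps invertible_mult matrix_mul_assoc)

lemma inv_GL2: "M ** N = mat 1 \<Longrightarrow> N ** M = mat 1 \<Longrightarrow> inv\<^bsub>GL2\<^esub> M = N"
  by (rule group.inv_equality[OF group_GL2]) (auto simp: GL2_simps invertible_def)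

lemma row_mult:
  fixes a b :: "2 \<Rightarrow> complex" and M N :: "complex ^ 2 ^ 2"
  assumes "\<And>j. b j = (\<Sum>i\<in>UNIV. a i * M $ i $ j)"
  shows "(\<Sum>i\<in>UNIV. b i * N $ i $ j) = (\<Sum>i\<in>UNIV. a i * (M ** N) $ i $ j)"
  unfolding assms by (simp add: matrix_matrix_mult_def sum_2 algebra_simps)

context lame
begin

text \<open>The group \<open>A\<close> of the overview; \<open>full_group\<close> is its extension
  by the matrix of the reflection at the origin.\<close>

definition trans_group :: "(2 \<Rightarrow> complex \<Rightarrow> complex) \<Rightarrow> (complex ^ 2 ^ 2) set" where
  "trans_group W = {M. \<exists>\<omega>\<in>L. act W 1 \<omega> M}"

definition full_group :: "(2 \<Rightarrow> complex \<Rightarrow> complex) \<Rightarrow> (complex ^ 2 ^ 2) set" where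
  "full_group W = {M. \<exists>\<epsilon> \<omega>. (\<epsilon> = 1 \<or> \<epsilon> = - 1) \<and> \<omega> \<in> L \<and> act W \<epsilon> \<omega> M}"

lemma subgroup_trans_group:
  assumes W: "lame_basis W"
  shows "subgroup (trans_group W) GL2"
proof
  show "trans_group W \<subseteq> carrier GL2"
    using act_invertible[OF W] by (fastforce simp: trans_group_def GL2_simps invertible_def)
  show "\<one>\<^bsub>GL2\<^esub> \<in> trans_group W" using act_id zero_in by (auto simp: trans_group_def GL2_simps)
next
  fix x y assume "x \<in> trans_group W" "y \<in> trans_group W"
  then obtain a b where ab: "a \<in> L" "b \<in> L" "act W 1 a x" "act W 1 b y" by (auto simp: trans_group_def)
  have "act W (1 * 1) (1 * a + b) (x ** y)" by (rule act_comp[OF ab(4,3)]) (use ab in auto)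
  then show "x \<otimes>\<^bsub>GL2\<^esub> y \<in> trans_group W" using add_in[OF ab(1,2)] by (auto simp: trans_group_def GL2_simps)
next
  fix x assume "x \<in> trans_group W"
  then obtain a where a: "a \<in> L" "act W 1 a x" by (auto simp: trans_group_def)
  then obtain y where y: "act W 1 (- 1 * a) y" "x ** y = mat 1" "y ** x = mat 1" using act_invertible[OF W a(2) _ a(1)] by blast
  then show "inv\<^bsub>GL2\<^esub> x \<in> trans_group W" using a(1) inv_GL2[OF y(2,3)] by (auto simp: trans_group_def)
qed

lemma trans_group_comm:
  assumes W: "lame_basis W" and x: "x \<in> trans_group W" "y \<in> trans_group W"
  shows "x ** y = y ** x"
proof -
  obtain a b where ab: "a \<in> L" "b \<in> L" "act W 1 a x" "act W 1 b y" using x by (auto simp: trans_group_def)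
  have "act W (1 * 1) (1 * a + b) (x ** y)" by (rule act_comp[OF ab(4,3)]) (use ab in auto)
  moreover have "act W (1 * 1) (1 * b + a) (y ** x)" by (rule act_comp[OF ab(3,4)]) (use ab in auto)
  ultimately show ?thesis using act_unique[OF W] by (simp add: add.commute)
qed

lemma subgroup_full_group:
  assumes W: "lame_basis W"
  shows "subgroup (full_group W) GL2"
proof
  show "full_group W \<subseteq> carrier GL2"
    using act_invertible[OF W] by (fastforce simp: full_group_def GL2_simps invertible_def)
  show "\<one>\<^bsub>GL2\<^esub> \<in> full_group W" using act_id zero_in by (auto simp: full_group_def GL2_simps)
next
  fix x y assume "x \<in> full_group W" "y \<in> full_group W"
  then obtain d e a b where ab: "a \<in> L" "b \<in> L" "act W d a x" "act W e b y" "d = 1 \<or> d = - 1" "e = 1 \<or> e = - 1"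
    unfolding full_group_def by blast
  have "act W (e * d) (e * a + b) (x ** y)" by (rule act_comp[OF ab(4,3)]) (use ab in auto)
  moreover have "e * d = 1 \<or> e * d = - 1" "e * a + b \<in> L" using ab by auto
  ultimately show "x \<otimes>\<^bsub>GL2\<^esub> y \<in> full_group W" unfolding full_group_def GL2_simps by blast
next
  fix x assume "x \<in> full_group W"
  then obtain e a where a: "a \<in> L" "act W e a x" "e = 1 \<or> e = - 1" by (auto simp: full_group_def)
  then obtain y where y: "act W e (- e * a) y" "x ** y = mat 1" "y ** x = mat 1" using act_invertible[OF W a(2,3,1)] by blast
  have "- e * a \<in> L" using a by auto
  then show "inv\<^bsub>GL2\<^esub> x \<in> full_group W" using a(3) y(1) unfolding inv_GL2[OF y(2,3)] full_group_def by blast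
qed

theorem cyclic_iff_dihedral:
  assumes W: "lame_basis W" and N: "N \<ge> 3"
  shows "GL2\<lparr>carrier := trans_group W\<rparr> \<cong> integer_mod_group N \<longleftrightarrow> GL2\<lparr>carrier := full_group W\<rparr> \<cong> dihedral_group N"
proof -
  obtain S where S: "act W (- 1) 0 S" using act_exists[OF W, of "- 1" 0] zero_in by auto
  have SS: "S ** S = mat 1"
  proof -
    have "act W (- 1 * - 1) (- 1 * 0 + 0) (S ** S)" by (rule act_comp[OF S S]) (use zero_in in auto)
    then show ?thesis using act_unique[OF W _ act_id] by simp
  qed
  have Sfull: "S \<in> full_group W" unfolding full_group_def using S zero_in by blast
  have "det S = - 1" using act_det[OF W S] zero_in by simp
  moreover have "det M = 1" if "M \<in> trans_group W" for M using that act_det[OF W] by (auto simp: trans_group_def)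
  ultimately have SA: "S \<notin> trans_group W" by fastforce
  have sub: "trans_group W \<subseteq> full_group W" by (auto simp: trans_group_def full_group_def)
  let ?G = "GL2\<lparr>carrier := full_group W\<rparr>"
  have G: "group ?G" by (rule group.subgroup_imp_group[OF group_GL2 subgroup_full_group[OF W]])
  have A: "subgroup (trans_group W) ?G"
    by (rule group.subgroup_incl[OF group_GL2 subgroup_trans_group[OF W] subgroup_full_group[OF W] sub])
  have inv: "inv\<^bsub>?G\<^esub> M = inv\<^bsub>GL2\<^esub> M" if "M \<in> full_group W" for M
    using group.m_inv_consistent[OF group_GL2 subgroup_full_group[OF W] that] .
  have conj: "S ** M = inv\<^bsub>GL2\<^esub> M ** S" if M: "M \<in> trans_group W" for M
  proof -
    obtain a where a: "a \<in> L" "act W 1 a M" using M by (auto simp: trans_group_def)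
    obtain N where N: "act W 1 (- 1 * a) N" "M ** N = mat 1" "N ** M = mat 1" using act_invertible[OF W a(2) _ a(1)] by blast
    have "act W (1 * - 1) (1 * 0 + a) (S ** M)" by (rule act_comp[OF a(2) S]) (use zero_in in auto)
    moreover have "act W (- 1 * 1) (- 1 * (- 1 * a) + 0) (N ** S)" by (rule act_comp[OF S N(1)]) (use a in auto)
    ultimately show ?thesis using act_unique[OF W] inv_GL2[OF N(2,3)] by simp
  qed
  have cov: "full_group W = trans_group W \<union> (\<lambda>a. a ** S) ` trans_group W"
  proof
    show "trans_group W \<union> (\<lambda>a. a ** S) ` trans_group W \<subseteq> full_group W"
      using sub subgroup.m_closed[OF subgroup_full_group[OF W] _ Sfull] by (auto simp: GL2_simps)
    show "full_group W \<subseteq> trans_group W \<union> (\<lambda>a. a ** S) ` trans_group W"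
    proof
      fix M assume "M \<in> full_group W"
      then obtain e a where a: "e = 1 \<or> e = - 1" "a \<in> L" "act W e a M" by (auto simp: full_group_def)
      show "M \<in> trans_group W \<union> (\<lambda>a. a ** S) ` trans_group W"
      proof (cases "e = 1")
        case True
        then show ?thesis using a by (auto simp: trans_group_def)
      next
        case False
        then have e: "e = - 1" using a(1) by blast
        \<comment> \<open>Composition with the reflection gives a translation \<open>S ** M\<close>.
          Since \<open>S\<close> inverts translations under conjugation, \<open>M\<close> is the
          inverse of that translation times \<open>S\<close>.\<close>
        have "act W (e * - 1) (e * 0 + a) (S ** M)" by (rule act_comp[OF a(3) S]) (use zero_in in auto)
        then have "S ** M \<in> trans_group W" using a(2) e by (auto simp: trans_group_def)
        then have "inv\<^bsub>GL2\<^esub> (S ** M) \<in> trans_group W" using subgroup.m_inv_closed[OF subgroup_trans_group[OF W]] by blast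
        moreover have "S ** (S ** M) = inv\<^bsub>GL2\<^esub> (S ** M) ** S" by (rule conj) fact
        then have "M = inv\<^bsub>GL2\<^esub> (S ** M) ** S" by (simp add: matrix_mul_assoc SS)
        ultimately show ?thesis by blast
      qed
    qed
  qed
  have "?G\<lparr>carrier := trans_group W\<rparr> \<cong> integer_mod_group N \<longleftrightarrow> ?G \<cong> dihedral_group N"
    by (rule dihedral_criterion[OF G A, where s = S])
      (use trans_group_comm[OF W] Sfull SA SS conj cov inv sub N in \<open>auto simp: GL2_simps\<close>)
  then show ?thesis by simp
qed

text \<open>Two bases differ by a constant invertible matrix, and conjugation with it keeps the
  translation behind each matrix. Groups that come with different bases thus become
  comparable.\<close>

lemma trans_group_iso:
  assumes W: "lame_basis W" and W': "lame_basis W'"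
  shows "GL2\<lparr>carrier := trans_group W\<rparr> \<cong> GL2\<lparr>carrier := trans_group W'\<rparr>"
proof -
  have coords: "\<exists>C :: complex ^ 2 ^ 2. \<forall>z. z \<notin> L \<longrightarrow> (\<forall>j. V' j z = (\<Sum>i\<in>UNIV. V i z * C $ i $ j))"
    if V: "lame_basis V" "lame_basis V'" for V V'
  proof -
    have "\<exists>c :: 2 \<Rightarrow> complex. \<forall>z. z \<notin> L \<longrightarrow> V' j z = V 1 z * c 1 + V 2 z * c 2" for j
      using global_solution_coords[OF V(1) lame_basisD(1)[OF V(2)]] by metis
    then obtain c :: "2 \<Rightarrow> 2 \<Rightarrow> complex" where "\<And>j z. z \<notin> L \<Longrightarrow> V' j z = V 1 z * c j 1 + V 2 z * c j 2" by metis
    then show ?thesis by (intro exI[of _ "\<chi> i j. c j i"]) (simp add: sum_2)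
  qed
  obtain C where C: "\<And>z j. z \<notin> L \<Longrightarrow> W' j z = (\<Sum>i\<in>UNIV. W i z * C $ i $ j)" using coords[OF W W'] by blast
  obtain D where D: "\<And>z j. z \<notin> L \<Longrightarrow> W j z = (\<Sum>i\<in>UNIV. W' i z * D $ i $ j)" using coords[OF W' W] by blast
  have change: "act V' 1 \<omega> (F ** M ** E)"
    if E: "\<And>z j. z \<notin> L \<Longrightarrow> V' j z = (\<Sum>i\<in>UNIV. V i z * E $ i $ j)"
      and F: "\<And>z j. z \<notin> L \<Longrightarrow> V j z = (\<Sum>i\<in>UNIV. V' i z * F $ i $ j)"
      and M: "act V 1 \<omega> M" and \<omega>: "\<omega> \<in> L" for V V' E F M \<omega>
    unfolding act_def
  proof (intro allI impI)
    fix z j assume z: "z \<notin> L"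
    have z': "1 * z + \<omega> \<notin> L" using z \<omega> by simp
    have "V' j (1 * z + \<omega>) = (\<Sum>i\<in>UNIV. V i (1 * z + \<omega>) * E $ i $ j)" by (rule E[OF z'])
    also have "\<dots> = (\<Sum>i\<in>UNIV. V i z * (M ** E) $ i $ j)"
      by (rule row_mult) (use M z in \<open>simp add: act_def\<close>)
    also have "\<dots> = (\<Sum>i\<in>UNIV. V' i z * (F ** (M ** E)) $ i $ j)" by (rule row_mult) (rule F[OF z])
    finally show "V' j (1 * z + \<omega>) = (\<Sum>i\<in>UNIV. V' i z * (F ** M ** E) $ i $ j)" by (simp add: matrix_mul_assoc)
  qed
  \<comment> \<open>For the trivial translation the conjugate of \<open>mat 1\<close> is
    \<open>D ** C\<close>; the matrix of a translation being unique, it is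
    \<open>mat 1\<close>.\<close>
  have DC: "D ** C = mat 1" using change[of W' W C D, OF C D act_id zero_in] act_unique[OF W' _ act_id] by simp
  have CD: "C ** D = mat 1" using change[of W W' D C, OF D C act_id zero_in] act_unique[OF W _ act_id] by simp
  let ?f = "\<lambda>M. D ** M ** C" and ?g = "\<lambda>M. C ** M ** D"
  have gf: "?g (?f M) = M" for M
  proof -
    have "?g (?f M) = (C ** D) ** M ** (C ** D)" by (simp add: matrix_mul_assoc)
    then show ?thesis by (simp add: CD)
  qed
  have fg: "?f (?g M) = M" for M
  proof -
    have "?f (?g M) = (D ** C) ** M ** (D ** C)" by (simp add: matrix_mul_assoc)
    then show ?thesis by (simp add: DC)
  qed
  have fm: "?f (M ** N) = ?f M ** ?f N" for M N
  proof -
    have "?f M ** ?f N = D ** M ** (C ** D) ** N ** C" by (simp add: matrix_mul_assoc)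
    then show ?thesis by (simp add: CD matrix_mul_assoc)
  qed
  have f: "?f M \<in> trans_group W'" if "M \<in> trans_group W" for M
    using that change[of W' W C D, OF C D] unfolding trans_group_def by blast
  have g: "?g M \<in> trans_group W" if "M \<in> trans_group W'" for M
    using that change[of W W' D C, OF D C] unfolding trans_group_def by blast
  have "bij_betw ?f (trans_group W) (trans_group W')"
    by (rule bij_betwI[of _ _ _ ?g]) (use f g gf fg in auto)
  then have "?f \<in> iso (GL2\<lparr>carrier := trans_group W\<rparr>) (GL2\<lparr>carrier := trans_group W'\<rparr>)"
    using f fm by (auto simp: iso_def hom_def GL2_simps)
  then show ?thesis unfolding is_iso_def by blast
qed

text \<open>The periods whose matrices lie in the generated group form a subgroup of the lattice
  that contains \<open>u\<close> and \<open>v\<close>. The basis is arbitrary because the period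
  monodromy group allows any.\<close>

lemma generate_trans_group:
  assumes W: "lame_basis W" and b: "lattice_basis L u v" and M: "act W 1 u M1" "act W 1 v M2"
  shows "generate GL2 {M1, M2} = trans_group W"
proof
  have uv: "u \<in> L" "v \<in> L"
  proof -
    have "u = of_int 1 * u + of_int 0 * v" "v = of_int 0 * u + of_int 1 * v" by simp_all
    then show "u \<in> L" "v \<in> L" using b unfolding lattice_basis_def by blast+
  qed
  show "generate GL2 {M1, M2} \<subseteq> trans_group W"
    by (rule group.generate_subgroup_incl[OF group_GL2 _ subgroup_trans_group[OF W]])
      (use M uv in \<open>auto simp: trans_group_def\<close>)
  have sub: "{M1, M2} \<subseteq> carrier GL2"
    using M uv subgroup.subset[OF subgroup_trans_group[OF W]] by (auto simp: trans_group_def)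
  define P where "P \<omega> \<longleftrightarrow> \<omega> \<in> L \<and> (\<exists>M\<in>generate GL2 {M1, M2}. act W 1 \<omega> M)" for \<omega>
  have P0: "P 0" unfolding P_def using act_id zero_in generate.one[of GL2] by (auto simp: GL2_simps)
  have Pu: "P u" "P v" unfolding P_def using uv M by (auto intro: generate.incl)
  have Pa: "P (x + y)" if "P x" "P y" for x y
  proof -
    obtain M N where MN: "M \<in> generate GL2 {M1, M2}" "N \<in> generate GL2 {M1, M2}" "act W 1 x M" "act W 1 y N" "x \<in> L" "y \<in> L"
      using \<open>P x\<close> \<open>P y\<close> unfolding P_def by blast
    have "act W (1 * 1) (1 * x + y) (M ** N)" by (rule act_comp[OF MN(4,3)]) (use MN in auto)
    moreover have "M ** N \<in> generate GL2 {M1, M2}" using generate.eng[OF MN(1,2)] by (simp add: GL2_simps)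
    ultimately show ?thesis unfolding P_def using add_in[OF MN(5,6)] by auto
  qed
  have Pm: "P (- x)" if Px: "P x" for x
  proof -
    obtain M where MN: "M \<in> generate GL2 {M1, M2}" "act W 1 x M" "x \<in> L"
      using Px unfolding P_def by blast
    obtain N where N: "act W 1 (- 1 * x) N" "M ** N = mat 1" "N ** M = mat 1" using act_invertible[OF W MN(2) _ MN(3)] by blast
    have "N \<in> generate GL2 {M1, M2}"
      using group.generate_m_inv_closed[OF group_GL2 sub MN(1)] inv_GL2[OF N(2,3)] by simp
    then show ?thesis unfolding P_def using N(1) MN(3) by auto
  qed
  have Pn: "P (of_nat m * x)" if "P x" for m x
    by (induction m) (use P0 Pa that in \<open>auto simp: algebra_simps\<close>)
  have Pi: "P (of_int m * x)" if "P x" for m x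
  proof (cases "m \<ge> 0")
    case True
    then show ?thesis using Pn[OF that, of "nat m"] by (simp add: of_nat_nat)
  next
    case False
    then show ?thesis using Pm[OF Pn[OF that, of "nat (- m)"]] by (simp add: of_nat_nat)
  qed
  show "trans_group W \<subseteq> generate GL2 {M1, M2}"
  proof
    fix M assume "M \<in> trans_group W"
    then obtain \<omega> where \<omega>: "\<omega> \<in> L" "act W 1 \<omega> M" by (auto simp: trans_group_def)
    then obtain a c where "\<omega> = of_int a * u + of_int c * v" using b unfolding lattice_basis_def by blast
    then have "P \<omega>" using Pa Pi Pu by simp
    then obtain N where "N \<in> generate GL2 {M1, M2}" "act W 1 \<omega> N" unfolding P_def by blast
    then show "M \<in> generate GL2 {M1, M2}" using act_unique[OF W \<omega>(2)] by blast
  qed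
qed

end

section \<open>The period monodromy group\<close>

lemma monodromy_matrix_cong:
  assumes \<gamma>: "path \<gamma>" and M: "monodromy_matrix \<gamma> \<omega> y M"
    and eq: "\<And>j. \<forall>\<^sub>F z in nhds (pathstart \<gamma>). y j z = y' j z"
  shows "monodromy_matrix \<gamma> \<omega> y' M"
  unfolding monodromy_matrix_def
proof
  fix j
  obtain g where g: "continues_along \<gamma> (y j) g"
    "\<forall>\<^sub>F z in nhds (pathstart \<gamma>). (\<Sum>i\<in>UNIV. y i z * M $ i $ j) = g (z + \<omega>)"
    using M unfolding monodromy_matrix_def continues_to_def by blast
  have "continues_along \<gamma> (y' j) g"
    by (rule continues_along_cong[OF \<gamma> g(1)]) (use eq[of j] in \<open>simp_all add: pathstart_def\<close>)
  moreover have "\<forall>\<^sub>F z in nhds (pathstart \<gamma>). (\<Sum>i\<in>UNIV. y' i z * M $ i $ j) = g (z + \<omega>)"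
    using g(2) eq[of 1] eq[of 2] by eventually_elim (simp add: sum_2)
  ultimately show "continues_to \<gamma> \<omega> (y' j) (\<lambda>z. \<Sum>i\<in>UNIV. y' i z * M $ i $ j)"
    unfolding continues_to_def by blast
qed

text \<open>Two branches of a square root differ by a sign near a point where they do not vanish:
  with \<open>c\<close> the quotient of the values, \<open>f + c * g\<close> is nonzero there, so
  the other factor of the difference of squares must vanish.\<close>

lemma equal_squares_germ:
  fixes f g :: "complex \<Rightarrow> complex"
  assumes f: "f analytic_on {z0}" and g: "g analytic_on {z0}" and nz: "g z0 \<noteq> 0"
    and eq: "\<forall>\<^sub>F z in nhds z0. (f z)\<^sup>2 = (g z)\<^sup>2"
  obtains c where "c = 1 \<or> c = - 1" "\<forall>\<^sub>F z in nhds z0. f z = c * g z"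
proof -
  define c where "c = f z0 / g z0"
  have "(f z0)\<^sup>2 = (g z0)\<^sup>2" using eventually_nhds_x_imp_x[OF eq] .
  then have "c\<^sup>2 = 1" using nz by (simp add: c_def power_divide)
  then have c: "c = 1 \<or> c = - 1" by (simp add: power2_eq_1_iff)
  have c0: "f z0 - c * g z0 = 0" using nz by (simp add: c_def)
  have "isCont f z0" "isCont g z0" using f g analytic_at_imp_isCont by auto
  then have "((\<lambda>z. f z + c * g z) \<longlongrightarrow> f z0 + c * g z0) (nhds z0)"
    by (auto intro!: tendsto_intros simp: isCont_def tendsto_at_iff_tendsto_nhds)
  moreover have "f z0 + c * g z0 \<noteq> 0" using c0 nz c by auto
  ultimately have "\<forall>\<^sub>F z in nhds z0. f z + c * g z \<noteq> 0" by (rule tendsto_imp_eventually_ne)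
  with eq have "\<forall>\<^sub>F z in nhds z0. f z = c * g z"
  proof eventually_elim
    case (elim z)
    have "(f z + c * g z) * (f z - c * g z) = 0"
      using elim(1) c by (auto simp: power2_eq_square algebra_simps)
    then show ?case using elim(2) by simp
  qed
  then show ?thesis using that c by blast
qed

context lattice
begin

text \<open>Invariance is given for some branch \<open>r\<close> only. The gauge factor has the same
  square as the corresponding quotient, hence equals it up to sign as a germ and continues in the
  same way.\<close>

lemma invariant_factor:
  assumes p: "p \<notin> L" and \<gamma>: "path \<gamma>" "pathstart \<gamma> \<in> noneven_domain L p"
    and inv: "sigma_quotient_invariant L p \<gamma> \<omega>"
    and s: "s analytic_on {pathstart \<gamma>}" "\<forall>\<^sub>F z in nhds (pathstart \<gamma>). (s z)\<^sup>2 * hp p z = - 1 / (wsigma L p)\<^sup>2"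
  shows "continues_to \<gamma> \<omega> s s"
proof -
  let ?z0 = "pathstart \<gamma>"
  obtain r g where r: "r analytic_on {?z0}" "\<forall>\<^sub>F z in nhds ?z0. r z ^ 2 = wsigma L (z - p) * wsigma L (z + p)"
    and g: "continues_along \<gamma> (\<lambda>z. wsigma L z / r z) g" "\<forall>\<^sub>F z in nhds ?z0. wsigma L z / r z = g (z + \<omega>)"
    using inv unfolding sigma_quotient_invariant_def continues_to_def by blast
  have z0: "?z0 \<notin> L" "?z0 - p \<notin> L" "?z0 + p \<notin> L" using \<gamma>(2) by (auto simp: domain_iff)
  have "wsigma L (?z0 - p) * wsigma L (?z0 + p) \<noteq> 0" using z0(2,3) by (simp add: wsigma_eq_0_iff)
  then have "(r ?z0)\<^sup>2 \<noteq> 0" unfolding eventually_nhds_x_imp_x[OF r(2)] .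
  then have rz: "r ?z0 \<noteq> 0" by simp
  have "wsigma L analytic_on {?z0}" by (rule holomorphic_on_imp_analytic_at[OF wsigma_holomorphic open_UNIV UNIV_I])
  then have an: "(\<lambda>z. wsigma L z / r z) analytic_on {?z0}" by (rule analytic_on_divide[OF _ r(1)]) (use rz in simp)
  have nz: "wsigma L ?z0 / r ?z0 \<noteq> 0" using rz z0(1) by (simp add: wsigma_eq_0_iff)
  have "\<forall>\<^sub>F z in nhds ?z0. z \<in> noneven_domain L p" using open_domain \<gamma>(2) by (rule eventually_nhds_in_open)
  with s(2) r(2) have "\<forall>\<^sub>F z in nhds ?z0. (s z)\<^sup>2 = (wsigma L z / r z)\<^sup>2"
  proof eventually_elim
    case (elim z)
    have "(s z)\<^sup>2 * hp p z = (wsigma L z / r z)\<^sup>2 * hp p z"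
      using wsigma_quotient_square[OF p elim(3,2)] elim(1) by simp
    then show ?case using hp_nz[OF p elim(3)] by simp
  qed
  then obtain c where c: "\<forall>\<^sub>F z in nhds ?z0. s z = c * (wsigma L z / r z)" 
    by (rule equal_squares_germ[OF s(1) an nz])
  have "continues_along \<gamma> (\<lambda>z. c * (wsigma L z / r z)) (\<lambda>z. c * g z)"
    by (rule continues_along_mult[OF continues_along_const g(1)])
  then have "continues_along \<gamma> s (\<lambda>z. c * g z)"
    by (rule continues_along_cong[OF \<gamma>(1)])
      (use c in \<open>auto simp: pathstart_def elim: eventually_mono\<close>)
  moreover have "\<forall>\<^sub>F z in nhds ?z0. s z = c * g (z + \<omega>)"
    using c g(2) by eventually_elim simp
  ultimately show ?thesis unfolding continues_to_def by blast
qed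

lemma gauge_factor_exists:
  assumes p: "p \<notin> L" and B: "ball z0 r \<subseteq> noneven_domain L p"
  obtains s where "s holomorphic_on ball z0 r" "\<And>z. z \<in> ball z0 r \<Longrightarrow> (s z)\<^sup>2 * hp p z = - 1 / (wsigma L p)\<^sup>2"
proof -
  have L: "ball z0 r \<subseteq> - L" using B by (auto simp: domain_iff)
  have nz: "hp p z \<noteq> 0" if "z \<in> ball z0 r" for z using hp_nz[OF p] B that by blast
  have "(\<lambda>z. - 1 / (wsigma L p)\<^sup>2 / hp p z) holomorphic_on ball z0 r"
    by (intro holomorphic_intros holomorphic_on_subset[OF hp_holomorphic L] nz)
  moreover have "- 1 / (wsigma L p)\<^sup>2 / hp p z \<noteq> 0" if "z \<in> ball z0 r" for z
    using nz[OF that] p wsigma_eq_0_iff by auto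
  ultimately obtain s where s: "s holomorphic_on ball z0 r" "\<And>z. z \<in> ball z0 r \<Longrightarrow> - 1 / (wsigma L p)\<^sup>2 / hp p z = (s z)\<^sup>2"
    using contractible_imp_holomorphic_sqrt[of "\<lambda>z. - 1 / (wsigma L p)\<^sup>2 / hp p z" "ball z0 r"]
      convex_imp_contractible[OF convex_ball] by metis
  show ?thesis
  proof (rule that[OF s(1)])
    fix z assume z: "z \<in> ball z0 r"
    show "(s z)\<^sup>2 * hp p z = - 1 / (wsigma L p)\<^sup>2" using s(2)[OF z, symmetric] nz[OF z] by simp
  qed
qed

end

context lame
begin

lemma act_deriv:
  assumes W: "lame_basis W" and M: "act W 1 \<omega> M" and \<omega>: "\<omega> \<in> L" and z: "z \<notin> L"
  shows "deriv (W j) (z + \<omega>) = (\<Sum>i\<in>UNIV. deriv (W i) z * M $ i $ j)"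
proof -
  note s = lame_basisD(1)[OF W]
  have "\<forall>\<^sub>F u in nhds z. W j (1 * u + \<omega>) = M $ 1 $ j * W 1 u + M $ 2 $ j * W 2 u"
    using eventually_notin_L[OF z] by eventually_elim (use M in \<open>simp add: act_def sum_2 mult.commute\<close>)
  then have "deriv (\<lambda>u. W j (1 * u + \<omega>)) z = deriv (\<lambda>u. M $ 1 $ j * W 1 u + M $ 2 $ j * W 2 u) z"
    by (rule deriv_cong_ev) simp
  moreover have "deriv (\<lambda>u. W j (1 * u + \<omega>)) z = 1 * deriv (W j) (1 * z + \<omega>)"
    by (rule solves_affine_L(2)[OF s _ \<omega> z]) simp
  moreover have "deriv (\<lambda>u. M $ 1 $ j * W 1 u + M $ 2 $ j * W 2 u) z = M $ 1 $ j * deriv (W 1) z + M $ 2 $ j * deriv (W 2) z"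
    by (rule solves_lincomb(2)[OF s s open_compl_L]) (use z in simp)
  ultimately show ?thesis by (simp add: sum_2 mult.commute)
qed

text \<open>The factor \<open>w' - T * w\<close> is holomorphic off the whole lattice and continues
  to itself; its translate is given by \<open>M\<close>, while \<open>s\<close> returns to its
  initial germ.\<close>

lemma gauge_monodromy:
  assumes W: "lame_basis W" and \<omega>: "\<omega> \<in> L" and cyc: "cycle_in (noneven_domain L p) z0 \<omega> \<gamma>"
    and s: "continues_to \<gamma> \<omega> s s" and M: "act W 1 \<omega> M"
  shows "monodromy_matrix \<gamma> \<omega> (\<lambda>j. gauge T s (W j)) M"
  unfolding monodromy_matrix_def
proof
  fix j
  have \<gamma>: "path \<gamma>" "pathstart \<gamma> = z0" "path_image \<gamma> \<subseteq> - L"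
    using cyc by (auto simp: cycle_in_def domain_iff)
  have z0: "z0 \<notin> L" using \<gamma>(2,3) pathstart_in_path_image by blast
  note hol = solves_holomorphic[OF lame_basisD(1)[OF W] open_compl_L]
  obtain g where g: "continues_along \<gamma> s g" "\<forall>\<^sub>F z in nhds z0. s z = g (z + \<omega>)"
    using s \<gamma>(2) unfolding continues_to_def by blast
  define G where "G j z = deriv (W j) z - T * W j z" for j z
  have "G j holomorphic_on - L" unfolding G_def[abs_def]
    by (intro holomorphic_intros hol holomorphic_deriv open_compl_L)
  then have "continues_along \<gamma> (G j) (G j)" by (rule continues_along_global[OF \<gamma>(1) open_compl_L \<gamma>(3)])
  from continues_along_mult[OF g(1) this]
  have "continues_along \<gamma> (gauge T s (W j)) (\<lambda>z. g z * G j z)" by (simp add: gauge_def[abs_def] G_def)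
  moreover have "\<forall>\<^sub>F z in nhds z0. (\<Sum>i\<in>UNIV. gauge T s (W i) z * M $ i $ j) = g (z + \<omega>) * G j (z + \<omega>)"
    using g(2) eventually_notin_L[OF z0]
  proof eventually_elim
    case (elim z)
    have "W j (z + \<omega>) = (\<Sum>i\<in>UNIV. W i z * M $ i $ j)" using M elim(2) by (simp add: act_def)
    then have "G j (z + \<omega>) = (\<Sum>i\<in>UNIV. G i z * M $ i $ j)"
      unfolding G_def act_deriv[OF W M \<omega> elim(2)] by (simp add: sum_2 algebra_simps)
    then have "s z * G j (z + \<omega>) = (\<Sum>i\<in>UNIV. gauge T s (W i) z * M $ i $ j)"
      by (simp only: gauge_def G_def sum_2) (simp add: algebra_simps)
    then show ?case unfolding elim(1) by (rule sym)
  qed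
  ultimately show "continues_to \<gamma> \<omega> (gauge T s (W j)) (\<lambda>z. \<Sum>i\<in>UNIV. gauge T s (W i) z * M $ i $ j)"
    unfolding continues_to_def \<gamma>(2) by blast
qed

context
  fixes p T :: complex
  assumes p: "p \<notin> L" "2 * p \<notin> L" and Bt: "T\<^sup>2 - of_nat (n * (n + 1)) * wp L p = Bt" and n: "n > 0"
begin

lemma \<kappa>_nz: "- 1 / (wsigma L p)\<^sup>2 \<noteq> 0" using p(1) wsigma_eq_0_iff by auto

text \<open>The gauge images of a global basis form a fundamental system whose matrices along
  admissible cycles are those of the two translations. Existence is needed for every single member
  of a family.\<close>

theorem period_monodromy_group_exists:
  "\<exists>W H. lame_basis W \<and> H = trans_group W \<and> is_period_monodromy_group n (L, p, T) H"
proof -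
  obtain W where W: "lame_basis W" using lame_basis_exists by blast
  obtain z0 where z0: "z0 \<in> noneven_domain L p" using domain_nonempty by blast
  obtain r where r: "r > 0" "ball z0 r \<subseteq> noneven_domain L p" using open_domain z0 open_contains_ball by metis
  obtain s where s: "s holomorphic_on ball z0 r" "\<And>z. z \<in> ball z0 r \<Longrightarrow> (s z)\<^sup>2 * hp p z = - 1 / (wsigma L p)\<^sup>2"
    by (rule gauge_factor_exists[OF p(1) r(2)]) blast
  have z0b: "z0 \<in> ball z0 r" using r by simp
  have s': "s analytic_on {z0}" using s(1) z0b analytic_at by blast
  have "\<forall>\<^sub>F z in nhds z0. z \<in> ball z0 r" using z0b by (intro eventually_nhds_in_open) auto
  then have s2: "\<forall>\<^sub>F z in nhds z0. (s z)\<^sup>2 * hp p z = - 1 / (wsigma L p)\<^sup>2"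
    by eventually_elim (rule s(2))
  note ctx = p Bt open_ball r(2) s(1) \<kappa>_nz s(2)
  let ?y = "\<lambda>j. gauge T s (W j)"
  have fs: "fundamental_system (\<lambda>_. 1) (\<lambda>_. 0) (\<lambda>z. - noneven_potential n L p T z) z0 ?y"
  proof (rule fundamental_systemI[OF open_ball z0b])
    show "solves (noneven_potential n L p T) (ball z0 r) (?y j)" for j
      by (rule gauge_solves(1)[OF ctx lame_basisD(1)[OF W]])
    have "wronsk (W 1) (W 2) z0 \<noteq> 0" using lame_basisD(2)[OF W] z0 by (simp add: domain_iff)
    moreover have "(of_nat (n * (n + 1)) :: complex) \<noteq> 0" using n by (simp only: of_nat_eq_0_iff) simp
    moreover have "wronsk (?y 1) (?y 2) z0 = - of_nat (n * (n + 1)) * (- 1 / (wsigma L p)\<^sup>2) * wronsk (W 1) (W 2) z0"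
      by (rule gauge_wronsk[OF ctx lame_basisD(1)[OF W] lame_basisD(1)[OF W] z0b])
    ultimately show "wronsk (?y 1) (?y 2) z0 \<noteq> 0"
      using \<kappa>_nz by (simp only: mult_eq_0_iff neg_equal_0_iff_equal) simp
  qed
  obtain \<gamma>1 where 1: "cycle_in (noneven_domain L p) z0 \<omega>\<^sub>1 \<gamma>1" "sigma_quotient_invariant L p \<gamma>1 \<omega>\<^sub>1"
    by (rule invariant_cycle_exists[OF p z0 w1_in])
  obtain \<gamma>2 where 2: "cycle_in (noneven_domain L p) z0 \<omega>\<^sub>2 \<gamma>2" "sigma_quotient_invariant L p \<gamma>2 \<omega>\<^sub>2"
    by (rule invariant_cycle_exists[OF p z0 w2_in])
  have st: "path \<gamma>1" "pathstart \<gamma>1 = z0" "path \<gamma>2" "pathstart \<gamma>2 = z0" using 1 2 by (auto simp: cycle_in_def)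
  have c: "continues_to \<gamma>1 \<omega>\<^sub>1 s s" "continues_to \<gamma>2 \<omega>\<^sub>2 s s"
    by (rule invariant_factor[OF p(1) _ _ 1(2)], use st z0 s' s2 in simp_all)
      (rule invariant_factor[OF p(1) _ _ 2(2)], use st z0 s' s2 in simp_all)
  obtain M1 M2 where M: "act W 1 \<omega>\<^sub>1 M1" "act W 1 \<omega>\<^sub>2 M2" using act_exists[OF W, of 1] w1_in w2_in by blast
  have "monodromy_matrix \<gamma>1 \<omega>\<^sub>1 ?y M1" by (rule gauge_monodromy[OF W w1_in 1(1) c(1) M(1)])
  moreover have "monodromy_matrix \<gamma>2 \<omega>\<^sub>2 ?y M2" by (rule gauge_monodromy[OF W w2_in 2(1) c(2) M(2)])
  ultimately have "is_period_monodromy_group n (L, p, T) (generate GL2 {M1, M2})"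
    unfolding is_period_monodromy_group_def prod.case
    using z0 fs basis 1 2 by blast
  then show ?thesis using W generate_trans_group[OF W basis M] by auto
qed

text \<open>The choices behind \<open>H\<close> are arbitrary, so the given fundamental system has
  to be recognized as a gauge image: locally the images of a global basis span all solutions, and
  the coordinates in this span define global solutions of the Lame equation.\<close>

theorem period_monodromy_group_trans:
  assumes H: "is_period_monodromy_group n (L, p, T) H"
  shows "\<exists>W. lame_basis W \<and> H = trans_group W"
proof -
  let ?q = "noneven_potential n L p T"
  obtain z0 y u v \<gamma>1 \<gamma>2 M1 M2 where z0: "z0 \<in> noneven_domain L p"
    and fs: "fundamental_system (\<lambda>_. 1) (\<lambda>_. 0) (\<lambda>z. - ?q z) z0 y"
    and uv: "lattice_basis L u v"
    and 1: "cycle_in (noneven_domain L p) z0 u \<gamma>1" "sigma_quotient_invariant L p \<gamma>1 u" "monodromy_matrix \<gamma>1 u y M1"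
    and 2: "cycle_in (noneven_domain L p) z0 v \<gamma>2" "sigma_quotient_invariant L p \<gamma>2 v" "monodromy_matrix \<gamma>2 v y M2"
    and HM: "H = generate GL2 {M1, M2}"
    using H unfolding is_period_monodromy_group_def prod.case by blast
  have uL: "u \<in> L" "v \<in> L"
  proof -
    have "u = of_int 1 * u + of_int 0 * v" "v = of_int 0 * u + of_int 1 * v" by simp_all
    then show "u \<in> L" "v \<in> L" using uv unfolding lattice_basis_def by blast+
  qed
  obtain r1 where r1: "r1 > 0" "\<And>j. solves ?q (ball z0 r1) (y j)" using fundamental_system_solves[OF fs] by blast
  obtain r2 where r2: "r2 > 0" "ball z0 r2 \<subseteq> noneven_domain L p" using open_domain z0 open_contains_ball by metis
  define r where "r = min r1 r2"
  have r: "r > 0" "ball z0 r \<subseteq> noneven_domain L p" "ball z0 r \<subseteq> ball z0 r1" using r1 r2 unfolding r_def by auto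
  have zL: "z0 \<notin> L" using z0 by (simp add: domain_iff)
  have BL: "ball z0 r \<subseteq> - L" using r(2) by (auto simp: domain_iff)
  have y: "solves ?q (ball z0 r) (y j)" for j by (rule solves_subset[OF r1(2) r(3)])
  obtain s where s: "s holomorphic_on ball z0 r" "\<And>z. z \<in> ball z0 r \<Longrightarrow> (s z)\<^sup>2 * hp p z = - 1 / (wsigma L p)\<^sup>2"
    by (rule gauge_factor_exists[OF p(1) r(2)]) blast
  have z0b: "z0 \<in> ball z0 r" using r by simp
  have s': "s analytic_on {z0}" using s(1) z0b analytic_at by blast
  have nb: "\<forall>\<^sub>F z in nhds z0. z \<in> ball z0 r" using z0b by (intro eventually_nhds_in_open) auto
  then have s2: "\<forall>\<^sub>F z in nhds z0. (s z)\<^sup>2 * hp p z = - 1 / (wsigma L p)\<^sup>2"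
    by eventually_elim (rule s(2))
  note ctx = p Bt open_ball r(2) s(1) \<kappa>_nz s(2)
  obtain V where V: "lame_basis V" using lame_basis_exists by blast
  note Vs = lame_basisD(1)[OF V]
  let ?y = "\<lambda>j. gauge T s (V j)"
  have ys: "solves ?q (ball z0 r) (?y j)" for j by (rule gauge_solves(1)[OF ctx Vs])
  have yw: "wronsk (?y 1) (?y 2) z0 \<noteq> 0"
  proof -
    have "wronsk (V 1) (V 2) z0 \<noteq> 0" using lame_basisD(2)[OF V] zL by simp
    moreover have "(of_nat (n * (n + 1)) :: complex) \<noteq> 0" using n by (simp only: of_nat_eq_0_iff) simp
    moreover have "wronsk (?y 1) (?y 2) z0 = - of_nat (n * (n + 1)) * (- 1 / (wsigma L p)\<^sup>2) * wronsk (V 1) (V 2) z0"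
      by (rule gauge_wronsk[OF ctx Vs Vs z0b])
    ultimately show ?thesis
      using \<kappa>_nz by (simp only: mult_eq_0_iff neg_equal_0_iff_equal) simp
  qed
  \<comment> \<open>Cramer coordinates of \<open>y j\<close> with respect to the gauge images of
    \<open>V\<close>; the same coefficients combine \<open>V\<close> to the preimage
    \<open>w j\<close>.\<close>
  define a where "a j = wronsk (y j) (?y 2) z0 / wronsk (?y 1) (?y 2) z0" for j
  define b where "b j = wronsk (?y 1) (y j) z0 / wronsk (?y 1) (?y 2) z0" for j
  have ya: "y j z = a j * ?y 1 z + b j * ?y 2 z" if "z \<in> ball z0 r" for j z
    unfolding a_def b_def by (rule solution_is_lincomb[OF ys ys y open_ball connected_ball z0b yw that])
  define w where "w j z = a j * V 1 z + b j * V 2 z" for j z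
  have w: "solves Q (- L) (w j)" for j unfolding w_def[abs_def] by (rule solves_lincomb(1)[OF Vs Vs open_compl_L])
  have dw: "deriv (w j) z = a j * deriv (V 1) z + b j * deriv (V 2) z" if "z \<in> - L" for j z
    unfolding w_def[abs_def] by (rule solves_lincomb(2)[OF Vs Vs open_compl_L that])
  have yw': "y j z = gauge T s (w j) z" if "z \<in> ball z0 r" for j z
    using BL that unfolding ya[OF that] gauge_def dw[OF subsetD[OF BL that]] by (simp add: w_def algebra_simps)
  \<comment> \<open>A linear relation between the \<open>w j\<close> near \<open>z0\<close> holds
    for their derivatives too, hence for the gauge images \<open>y j\<close>.\<close>
  have ind: "k = 0" if k: "\<forall>\<^sub>F z in nhds z0. (\<Sum>j\<in>UNIV. k $ j * w j z) = 0" for k :: "complex ^ 2"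
  proof -
    have "\<forall>\<^sub>F z in nhds z0. (\<Sum>j\<in>UNIV. k $ j * y j z) = 0"
      using nb eventually_nhds_nhds[OF k]
    proof eventually_elim
      case (elim z)
      have zL: "z \<in> - L" using elim(1) BL by blast
      have e: "\<forall>\<^sub>F u in nhds z. k $ 1 * w 1 u + k $ 2 * w 2 u = 0" using elim(2) by (simp add: sum_2)
      have 0: "k $ 1 * w 1 z + k $ 2 * w 2 z = 0" using eventually_nhds_x_imp_x[OF e] .
      have "deriv (\<lambda>u. k $ 1 * w 1 u + k $ 2 * w 2 u) z = deriv (\<lambda>_. 0) z" by (rule deriv_cong_ev[OF e refl])
      then have 1: "k $ 1 * deriv (w 1) z + k $ 2 * deriv (w 2) z = 0"
        using solves_lincomb(2)[OF w w open_compl_L zL] by simp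
      have "k $ 1 * gauge T s (w 1) z + k $ 2 * gauge T s (w 2) z = 0"
        unfolding gauge_def using 0 1 by algebra
      then show ?case using yw'[OF elim(1)] by (simp add: sum_2)
    qed
    then show ?thesis using fs unfolding fundamental_system_def by blast
  qed
  obtain W where W: "lame_basis W" "\<And>j. \<forall>\<^sub>F z in nhds z0. W j z = w j z"
    by (rule local_to_global[OF zL r(1) solves_subset[OF w] ind]) auto
  have gy: "\<forall>\<^sub>F z in nhds z0. gauge T s (W j) z = y j z" for j
    using nb eventually_nhds_nhds[OF W(2)[of j]]
  proof eventually_elim
    case (elim z)
    have "deriv (W j) z = deriv (w j) z" by (rule deriv_cong_ev[OF elim(2) refl])
    moreover have "W j z = w j z" using eventually_nhds_x_imp_x[OF elim(2)] .
    ultimately show ?case using yw'[OF elim(1)] by (simp add: gauge_def)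
  qed
  have key: "act W 1 \<omega> M" if \<omega>: "\<omega> \<in> L" and cyc: "cycle_in (noneven_domain L p) z0 \<omega> \<gamma>"
    and inv: "sigma_quotient_invariant L p \<gamma> \<omega>" and M: "monodromy_matrix \<gamma> \<omega> y M" for \<omega> \<gamma> M
  proof -
    have st: "path \<gamma>" "pathstart \<gamma> = z0" "pathfinish \<gamma> = pathstart \<gamma> + \<omega>" using cyc by (auto simp: cycle_in_def)
    have c: "continues_to \<gamma> \<omega> s s"
      by (rule invariant_factor[OF p(1) _ _ inv]) (use st z0 s' s2 in simp_all)
    obtain N where N: "act W 1 \<omega> N" using act_exists[OF W(1), of 1] \<omega> by blast
    have "monodromy_matrix \<gamma> \<omega> y N"
      by (rule monodromy_matrix_cong[OF st(1) gauge_monodromy[OF W(1) \<omega> cyc c N]]) (use gy st(2) in simp)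
    then have "M = N" using monodromy_matrix_unique[OF st(1,3) _ M, of "\<lambda>_. 1" "\<lambda>_. 0"] fs st(2) by auto
    then show ?thesis using N by simp
  qed
  have "H = trans_group W"
    unfolding HM by (rule generate_trans_group[OF W(1) uv key[OF uL(1) 1] key[OF uL(2) 2]])
  then show ?thesis using W(1) by blast
qed

end

end

section \<open>The algebraic Lame equation\<close>

context lattice
begin

text \<open>This excludes the poles of \<open>wp\<close> together with the zeros of its derivative,
  leaving the points over which it is a covering.\<close>

definition unramified :: "complex set" where "unramified = {z. 2 * z \<notin> L}"

lemma unramified_notin: "z \<in> unramified \<Longrightarrow> z \<notin> L"
  using add_in[of z z] by (auto simp: unramified_def)

lemma unramified_affine:
  assumes "\<epsilon> = 1 \<or> \<epsilon> = - 1" "\<omega> \<in> L" "z \<in> unramified"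
  shows "\<epsilon> * z + \<omega> \<in> unramified"
proof -
  have "2 * \<omega> \<in> L" using add_in[OF assms(2,2)] by simp
  then have "\<epsilon> * (2 * z) + 2 * \<omega> \<in> L \<longleftrightarrow> 2 * z \<in> L" using assms(1) by auto
  moreover have "2 * (\<epsilon> * z + \<omega>) = \<epsilon> * (2 * z) + 2 * \<omega>" by (simp add: algebra_simps)
  ultimately show ?thesis using assms(3) unfolding unramified_def mem_Collect_eq by metis
qed

lemma open_unramified: "open unramified"
proof -
  have "unramified = (\<lambda>z. 2 * z) -` (- L)" by (auto simp: unramified_def)
  moreover have "open ((\<lambda>z::complex. 2 * z) -` (- L))" by (intro open_vimage open_compl_L continuous_intros)
  ultimately show ?thesis by simp
qed

lemma path_connected_unramified: "path_connected unramified"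
proof -
  have "unramified = - ((\<lambda>w. w / 2) ` L)"
  proof -
    have "z \<in> (\<lambda>w. w / 2) ` L \<longleftrightarrow> 2 * z \<in> L" for z
    proof
      assume "2 * z \<in> L"
      then show "z \<in> (\<lambda>w. w / 2) ` L" by (intro image_eqI[of _ _ "2 * z"]) auto
    qed auto
    then show ?thesis by (auto simp: unramified_def)
  qed
  then show ?thesis using countable_L by (simp add: path_connected_complement_countable)
qed

lemma wp_affine:
  assumes "\<epsilon> = 1 \<or> \<epsilon> = - 1" "\<omega> \<in> L" "z \<notin> L"
  shows "wp L (\<epsilon> * z + \<omega>) = wp L z"
  using assms wp_periodic[of \<omega> z] wp_periodic[of \<omega> "- z"] by (auto simp: wp_even)

lemma wp_eq_affine:
  assumes "z \<notin> L" "w \<notin> L" "wp L w = wp L z"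
  obtains \<epsilon> \<omega> where "\<epsilon> = 1 \<or> \<epsilon> = - 1" "\<omega> \<in> L" "w = \<epsilon> * z + \<omega>"
proof -
  have "w + z \<in> L \<or> w - z \<in> L" using wp_eq_iff[OF assms(2,1)] assms(3) by blast
  then show ?thesis using that[of "- 1" "w + z"] that[of 1 "w - z"] by auto
qed

definition branch_points_free :: "complex set" where
  "branch_points_free = {x. 4 * x ^ 3 - inv_g2 L * x - inv_g3 L \<noteq> 0}"

lemma wp_image_unramified: "wp L ` unramified = branch_points_free"
proof
  show "wp L ` unramified \<subseteq> branch_points_free"
  proof
    fix x assume "x \<in> wp L ` unramified"
    then obtain z where z: "z \<in> unramified" "x = wp L z" by blast
    have "wp1 z \<noteq> 0" using wp1_eq_0_iff[OF unramified_notin[OF z(1)]] z(1) by (simp add: unramified_def)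
    then have "wp1 z ^ 2 \<noteq> 0" by simp
    then show "x \<in> branch_points_free" unfolding wp1_square[OF unramified_notin[OF z(1)]] branch_points_free_def z(2) by simp
  qed
  show "branch_points_free \<subseteq> wp L ` unramified"
  proof
    fix x assume x: "x \<in> branch_points_free"
    obtain z where z: "z \<notin> L" "wp L z = x" by (rule wp_surj)
    have "wp1 z ^ 2 \<noteq> 0" unfolding wp1_square[OF z(1)] z(2) using x by (simp add: branch_points_free_def)
    then have "2 * z \<notin> L" using wp1_eq_0_iff[OF z(1)] by auto
    then show "x \<in> wp L ` unramified" using z(2) by (auto simp: unramified_def)
  qed
qed

lemma wp_continuous: "S \<inter> L = {} \<Longrightarrow> continuous_on S (wp L)"
  by (rule continuous_on_subset[OF holomorphic_on_imp_continuous_on[OF wp_holomorphic]]) auto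

text \<open>If \<open>u + v\<close> were a lattice point, then the midpoint of \<open>u\<close> and \<open>v\<close> would be ramified.\<close>

lemma wp_inj_ball:
  assumes "ball z r \<subseteq> unramified" "r \<le> cL / 2"
  shows "inj_on (wp L) (ball z r)"
proof (rule inj_onI)
  fix u v assume uv: "u \<in> ball z r" "v \<in> ball z r" "wp L u = wp L v"
  have L: "u \<notin> L" "v \<notin> L" using uv assms(1) unramified_notin by blast+
  have "(1 / 2) *\<^sub>R u + (1 / 2) *\<^sub>R v \<in> ball z r"
    by (rule convexD[OF convex_ball uv(1,2)]) auto
  moreover have "2 * ((1 / 2) *\<^sub>R u + (1 / 2) *\<^sub>R v) = u + v" by (simp add: scaleR_conv_of_real algebra_simps)
  ultimately have "u + v \<notin> L" using assms(1) unfolding unramified_def by fastforce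
  then have d: "u - v \<in> L" using wp_eq_iff[OF L] uv(3) by blast
  have "dist u v \<le> dist z u + dist z v" by (metis dist_commute dist_triangle2)
  then have "dist u v < cL" using uv(1,2) assms(2) by simp
  then have "u - v \<in> ball 0 cL \<inter> L" using d by (simp add: dist_norm norm_minus_commute)
  then show "u = v" using isolated_L[of 0] by simp
qed

lemma good_ball_exists:
  assumes "z \<in> unramified"
  shows "\<exists>r>0. r \<le> cL / 2 \<and> ball z r \<subseteq> unramified"
proof -
  obtain r where "r > 0" "ball z r \<subseteq> unramified" using open_unramified assms open_contains_ball by metis
  then show ?thesis using cL_pos by (intro exI[of _ "min r (cL / 2)"]) auto
qed

text \<open>A radius chosen once for each point, so that the local inverse of \<open>wp\<close> used
  below depends on the point only.\<close>

definition rad :: "complex \<Rightarrow> real" where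
  "rad z = (SOME r. r > 0 \<and> r \<le> cL / 2 \<and> ball z r \<subseteq> unramified)"

lemma rad:
  assumes "z \<in> unramified"
  shows "rad z > 0" "rad z \<le> cL / 2" "ball z (rad z) \<subseteq> unramified" "inj_on (wp L) (ball z (rad z))"
proof -
  have "rad z > 0 \<and> rad z \<le> cL / 2 \<and> ball z (rad z) \<subseteq> unramified"
    unfolding rad_def by (rule someI_ex) (use good_ball_exists[OF assms] in blast)
  then show "rad z > 0" "rad z \<le> cL / 2" "ball z (rad z) \<subseteq> unramified" by auto
  then show "inj_on (wp L) (ball z (rad z))" by (intro wp_inj_ball)
qed

lemma ball_affine:
  fixes z \<omega> \<epsilon> :: complex
  assumes e: "\<epsilon> = 1 \<or> \<epsilon> = - 1"
  shows "ball (\<epsilon> * z + \<omega>) r = (\<lambda>u. \<epsilon> * u + \<omega>) ` ball z r"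
proof -
  have d: "dist (\<epsilon> * a + \<omega>) (\<epsilon> * b + \<omega>) = dist a b" for a b
    using e by (auto simp: dist_norm norm_minus_commute)
  have "w \<in> (\<lambda>u. \<epsilon> * u + \<omega>) ` ball z r" if "w \<in> ball (\<epsilon> * z + \<omega>) r" for w
  proof (rule image_eqI)
    show w: "w = \<epsilon> * (\<epsilon> * (w - \<omega>)) + \<omega>" using e by auto
    show "\<epsilon> * (w - \<omega>) \<in> ball z r" using that d[of z "\<epsilon> * (w - \<omega>)"] w by simp
  qed
  then show ?thesis using d by auto
qed

text \<open>The sheets over the image of a small ball are the images of the ball under the maps
  \<open>\<epsilon> * u + \<omega>\<close>. If two of them meet, then injectivity on the ball yields
  one \<open>u\<close> with two such expressions; different signs would put \<open>2 * u\<close>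
  into the lattice, so the two sheets coincide.\<close>

lemma wp_covering: "covering_space unramified (wp L) branch_points_free"
  unfolding covering_space_def
proof (intro conjI ballI)
  show "continuous_on unramified (wp L)" by (rule wp_continuous) (use unramified_notin in auto)
  show "wp L ` unramified = branch_points_free" by (rule wp_image_unramified)
  fix x assume "x \<in> branch_points_free"
  then obtain z where z: "z \<in> unramified" "x = wp L z" using wp_image_unramified by blast
  obtain r where r: "r > 0" "r \<le> cL / 2" "ball z r \<subseteq> unramified" using good_ball_exists[OF z(1)] by blast
  let ?B = "ball z r" and ?T = "wp L ` ball z r"
  define v where "v = {ball (\<epsilon> * z + \<omega>) r |\<epsilon> \<omega>. (\<epsilon> = 1 \<or> \<epsilon> = - 1) \<and> \<omega> \<in> L}"
  have inj: "inj_on (wp L) ?B" by (rule wp_inj_ball[OF r(3,2)])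
  have BL: "u \<notin> L" if "u \<in> ?B" for u using that r(3) unramified_notin by blast
  have vsub: "ball (\<epsilon> * z + \<omega>) r \<subseteq> unramified" "wp L ` ball (\<epsilon> * z + \<omega>) r = ?T"
    if e: "\<epsilon> = 1 \<or> \<epsilon> = - 1" "\<omega> \<in> L" for \<epsilon> \<omega>
  proof -
    show "ball (\<epsilon> * z + \<omega>) r \<subseteq> unramified"
      unfolding ball_affine[OF e(1)] using unramified_affine[OF e] r(3) by blast
    show "wp L ` ball (\<epsilon> * z + \<omega>) r = ?T"
      unfolding ball_affine[OF e(1)] image_image by (rule image_cong[OF refl]) (rule wp_affine[OF e BL])
  qed
  have opT: "open ?T"
    by (rule invariance_of_domain[OF wp_continuous open_ball inj]) (use BL in auto)
  show "\<exists>T. x \<in> T \<and> openin (top_of_set branch_points_free) T \<and>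
      (\<exists>v. \<Union> v = unramified \<inter> wp L -` T \<and> (\<forall>u\<in>v. openin (top_of_set unramified) u) \<and>
        pairwise disjnt v \<and> (\<forall>u\<in>v. \<exists>q. homeomorphism u T (wp L) q))"
  proof (intro exI[of _ ?T] exI[of _ v] conjI ballI)
    show "x \<in> ?T" using z r(1) by auto
    have "?T \<subseteq> branch_points_free" using r(3) wp_image_unramified by blast
    then show "openin (top_of_set branch_points_free) ?T" using opT by (simp add: open_subset)
    show "\<Union> v = unramified \<inter> wp L -` ?T"
    proof
      show "\<Union> v \<subseteq> unramified \<inter> wp L -` ?T"
      proof
        fix w assume "w \<in> \<Union> v"
        then obtain \<epsilon> \<omega> where w: "\<epsilon> = 1 \<or> \<epsilon> = - 1" "\<omega> \<in> L" "w \<in> ball (\<epsilon> * z + \<omega>) r" unfolding v_def by blast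
        show "w \<in> unramified \<inter> wp L -` ?T" using vsub[OF w(1,2)] w(3) by blast
      qed
      show "unramified \<inter> wp L -` ?T \<subseteq> \<Union> v"
      proof
        fix w assume w: "w \<in> unramified \<inter> wp L -` ?T"
        then obtain u where u: "u \<in> ?B" "wp L w = wp L u" by blast
        obtain \<epsilon> \<omega> where e: "\<epsilon> = 1 \<or> \<epsilon> = - 1" "\<omega> \<in> L" "w = \<epsilon> * u + \<omega>"
          using wp_eq_affine[OF BL[OF u(1)] _ u(2)] w unramified_notin by blast
        then have "w \<in> ball (\<epsilon> * z + \<omega>) r" using u(1) ball_affine[OF e(1)] by blast
        then show "w \<in> \<Union> v" using e(1,2) unfolding v_def by blast
      qed
    qed
    show "openin (top_of_set unramified) A" if A: "A \<in> v" for A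
    proof -
      obtain \<epsilon> \<omega> where w: "\<epsilon> = 1 \<or> \<epsilon> = - 1" "\<omega> \<in> L" "A = ball (\<epsilon> * z + \<omega>) r" using A unfolding v_def by blast
      show ?thesis using vsub(1)[OF w(1,2)] w(3) by (simp add: open_subset)
    qed
    show "pairwise disjnt v"
    proof (rule pairwiseI)
      fix A A' assume A: "A \<in> v" "A' \<in> v" "A \<noteq> A'"
      obtain \<epsilon> \<omega> where w: "\<epsilon> = 1 \<or> \<epsilon> = - 1" "\<omega> \<in> L" "A = ball (\<epsilon> * z + \<omega>) r" using A(1) unfolding v_def by blast
      obtain \<epsilon>' \<omega>' where w': "\<epsilon>' = 1 \<or> \<epsilon>' = - 1" "\<omega>' \<in> L" "A' = ball (\<epsilon>' * z + \<omega>') r" using A(2) unfolding v_def by blast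
      show "disjnt A A'"
      proof (rule ccontr)
        assume "\<not> disjnt A A'"
        then obtain b where "b \<in> A" "b \<in> A'" unfolding disjnt_iff by blast
        then obtain u u' where u: "u \<in> ?B" "b = \<epsilon> * u + \<omega>" "u' \<in> ?B" "b = \<epsilon>' * u' + \<omega>'"
          using w(3) w'(3) ball_affine[OF w(1)] ball_affine[OF w'(1)] by blast
        have "wp L u = wp L u'" using wp_affine[OF w(1,2) BL[OF u(1)]] wp_affine[OF w'(1,2) BL[OF u(3)]] u(2,4) by simp
        then have uu: "u = u'" using inj u(1,3) by (auto dest: inj_onD)
        have "2 * u \<notin> L" using u(1) r(3) by (auto simp: unramified_def)
        moreover have "\<epsilon> * u + \<omega> = \<epsilon>' * u + \<omega>'" using u(2,4) uu by simp
        moreover have "\<omega> - \<omega>' \<in> L" "\<omega>' - \<omega> \<in> L" using add_in[of \<omega> "- \<omega>'"] add_in[of \<omega>' "- \<omega>"] w(2) w'(2) by auto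
        ultimately have a: "2 * u \<notin> L" "\<epsilon> * u + \<omega> = \<epsilon>' * u + \<omega>'" "\<omega> - \<omega>' \<in> L" "\<omega>' - \<omega> \<in> L" by blast+
        have "\<epsilon> = \<epsilon>'"
        proof (rule ccontr)
          assume "\<epsilon> \<noteq> \<epsilon>'"
          then have "\<epsilon>' = - \<epsilon>" using w(1) w'(1) by auto
          then have "\<epsilon> * (2 * u) = \<omega>' - \<omega>" using a(2) by (simp add: algebra_simps)
          then have "2 * u = \<omega>' - \<omega> \<or> 2 * u = - (\<omega>' - \<omega>)" using w(1) by (metis minus_minus mult_1 mult_minus1)
          then show False using a(1,3,4) by (metis minus_diff_eq)
        qed
        then have "A = A'" using a(2) w(3) w'(3) by simp
        then show False using A(3) by simp
      qed
    qed
    fix A assume "A \<in> v"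
    then obtain \<epsilon> \<omega> where w: "\<epsilon> = 1 \<or> \<epsilon> = - 1" "\<omega> \<in> L" "A = ball (\<epsilon> * z + \<omega>) r" unfolding v_def by blast
    have "inj_on (wp L) A" unfolding w(3) by (rule wp_inj_ball[OF vsub(1)[OF w(1,2)] r(2)])
    moreover have "continuous_on A (wp L)" by (rule wp_continuous) (use vsub(1)[OF w(1,2)] w(3) unramified_notin in blast)
    moreover have "open A" using w(3) by simp
    ultimately obtain g where "homeomorphism A (wp L ` A) (wp L) g" using invariance_of_domain_homeomorphism[of A "wp L"] by auto
    then show "\<exists>q. homeomorphism A ?T (wp L) q" using vsub(2)[OF w(1,2)] w(3) by auto
  qed
qed

text \<open>At an unramified point \<open>wp\<close> is continuous and open, so germs upstairs and
  downstairs determine each other.\<close>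

lemma eventually_wp:
  assumes z: "z \<in> unramified"
  shows "(\<forall>\<^sub>F x in nhds (wp L z). R x) \<longleftrightarrow> (\<forall>\<^sub>F u in nhds z. R (wp L u))"
proof
  assume R: "\<forall>\<^sub>F x in nhds (wp L z). R x"
  have "isCont (wp L) z" using wp_deriv[OF unramified_notin[OF z]] DERIV_isCont by blast
  then have "filterlim (wp L) (nhds (wp L z)) (nhds z)" by (simp add: isCont_def tendsto_at_iff_tendsto_nhds)
  then show "\<forall>\<^sub>F u in nhds z. R (wp L u)" by (rule eventually_compose_filterlim[OF R])
next
  assume "\<forall>\<^sub>F u in nhds z. R (wp L u)"
  then obtain S where S: "open S" "z \<in> S" "\<And>u. u \<in> S \<Longrightarrow> R (wp L u)" unfolding eventually_nhds by blast
  let ?V = "S \<inter> ball z (rad z)"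
  have "?V \<inter> L = {}" using rad(3)[OF z] unramified_notin by blast
  then have "open (wp L ` ?V)"
    by (intro invariance_of_domain wp_continuous open_Int S(1) open_ball inj_on_subset[OF rad(4)[OF z]]) auto
  moreover have "wp L z \<in> wp L ` ?V" using S(2) rad(1)[OF z] by simp
  ultimately show "\<forall>\<^sub>F x in nhds (wp L z). R x" unfolding eventually_nhds using S(3) by (intro exI[of _ "wp L ` ?V"]) auto
qed

text \<open>The germ of \<open>f\<close> at \<open>z\<close>, read in the coordinate
  \<open>wp\<close> through its inverse on the ball of radius \<open>rad z\<close>.\<close>

definition push :: "(complex \<Rightarrow> complex) \<Rightarrow> complex \<Rightarrow> complex \<Rightarrow> complex" where
  "push f z x = f (inv_into (ball z (rad z)) (wp L) x)"

lemma push_wp: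
  assumes z: "z \<in> unramified" and u: "u \<in> ball z (rad z)"
  shows "push f z (wp L u) = f u"
  unfolding push_def using inv_into_f_f[OF rad(4)[OF z] u] by simp

lemma push_analytic:
  assumes z: "z \<in> unramified" and f: "f holomorphic_on - L"
  shows "push f z analytic_on {wp L z}"
proof -
  let ?B = "ball z (rad z)"
  have BL: "?B \<subseteq> - L" using rad(3)[OF z] unramified_notin by blast
  have hol: "wp L holomorphic_on ?B" by (rule holomorphic_on_subset[OF wp_holomorphic BL])
  obtain g where g: "g holomorphic_on wp L ` ?B" "\<And>u. u \<in> ?B \<Longrightarrow> g (wp L u) = u"
    using holomorphic_has_inverse[OF hol open_ball rad(4)[OF z]] by metis
  have "f holomorphic_on g ` wp L ` ?B" by (rule holomorphic_on_subset[OF f]) (use g(2) BL in auto)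
  then have "f \<circ> g holomorphic_on wp L ` ?B" by (rule holomorphic_on_compose[OF g(1)])
  then have "push f z holomorphic_on wp L ` ?B"
    by (rule holomorphic_transform) (use g(2) push_wp[OF z] in auto)
  moreover have "open (wp L ` ?B)"
    by (rule invariance_of_domain[OF wp_continuous open_ball rad(4)[OF z]]) (use BL in auto)
  moreover have "wp L z \<in> wp L ` ?B" using rad(1)[OF z] by simp
  ultimately show ?thesis using analytic_at by blast
qed

lemma push_eventually:
  assumes z: "z \<in> unramified"
  shows "\<forall>\<^sub>F u in nhds z. push f z (wp L u) = f u"
proof -
  have "\<forall>\<^sub>F u in nhds z. u \<in> ball z (rad z)" using rad(1)[OF z] by (intro eventually_nhds_in_open) auto
  then show ?thesis by eventually_elim (rule push_wp[OF z])
qed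

text \<open>For nearby parameters both local inverses of \<open>wp\<close> send
  \<open>wp L u\<close> back to the same \<open>u\<close>, so the pushed germs agree.\<close>

lemma push_continues:
  assumes \<eta>: "path \<eta>" "path_image \<eta> \<subseteq> unramified" and f: "f holomorphic_on - L"
  shows "continues_along (wp L \<circ> \<eta>) (push f (\<eta> 0)) (push f (\<eta> 1))"
  unfolding continues_along_def
proof (intro exI[of _ "\<lambda>t. push f (\<eta> t)"] conjI ballI refl)
  have X: "\<eta> t \<in> unramified" if "t \<in> {0..1}" for t using \<eta>(2) that by (auto simp: path_image_def)
  fix t :: real assume t: "t \<in> {0..1}"
  show "push f (\<eta> t) analytic_on {(wp L \<circ> \<eta>) t}" using push_analytic[OF X[OF t] f] by simp
  have "\<forall>\<^sub>F u in nhds (\<eta> t). u \<in> ball (\<eta> t) (rad (\<eta> t))"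
    using rad(1)[OF X[OF t]] by (intro eventually_nhds_in_open) auto
  then have "\<forall>\<^sub>F s in at t within {0..1}. \<eta> s \<in> ball (\<eta> t) (rad (\<eta> t))" by (rule path_eventually[OF \<eta>(1) t])
  moreover have "\<forall>\<^sub>F s in at t within {0..1}. s \<in> {0..1}" by (simp add: eventually_at_filter)
  ultimately show "\<forall>\<^sub>F s in at t within {0..1}. \<forall>\<^sub>F x in nhds ((wp L \<circ> \<eta>) s). push f (\<eta> s) x = push f (\<eta> t) x"
  proof eventually_elim
    case (elim s)
    have "\<forall>\<^sub>F u in nhds (\<eta> s). u \<in> ball (\<eta> t) (rad (\<eta> t))" using elim(1) by (intro eventually_nhds_in_open) auto
    with push_eventually[OF X[OF elim(2)], of f]
    have "\<forall>\<^sub>F u in nhds (\<eta> s). push f (\<eta> s) (wp L u) = push f (\<eta> t) (wp L u)"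
    proof eventually_elim
      case (elim u)
      show ?case unfolding elim(1) by (rule push_wp[OF X[OF t] elim(2), symmetric])
    qed
    then show ?case using eventually_wp[OF X[OF elim(2)]] by simp
  qed
qed

text \<open>The chain rule produces the coefficients \<open>(wp1 u)\<^sup>2\<close> and
  \<open>wp2 u\<close>. By the differential equations of \<open>wp\<close> these are the cubic and
  half its derivative, the coefficients of the algebraic equation.\<close>

lemma pull_deriv:
  assumes z: "z \<in> unramified" and \<phi>: "\<phi> analytic_on {wp L z}"
  shows "\<forall>\<^sub>F u in nhds z. ((\<lambda>u. \<phi> (wp L u)) has_field_derivative deriv \<phi> (wp L u) * wp1 u) (at u) \<and>
    ((\<lambda>u. deriv \<phi> (wp L u) * wp1 u) has_field_derivative
      (4 * wp L u ^ 3 - inv_g2 L * wp L u - inv_g3 L) * (deriv ^^ 2) \<phi> (wp L u)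
      + (6 * wp L u ^ 2 - inv_g2 L / 2) * deriv \<phi> (wp L u)) (at u)"
proof -
  obtain S where S: "open S" "wp L z \<in> S" "\<phi> holomorphic_on S" using \<phi> analytic_at by blast
  have "\<forall>\<^sub>F x in nhds (wp L z). x \<in> S" using S by (intro eventually_nhds_in_open)
  then have "\<forall>\<^sub>F u in nhds z. wp L u \<in> S" using eventually_wp[OF z] by simp
  moreover have "\<forall>\<^sub>F u in nhds z. u \<notin> L" by (rule eventually_notin_L[OF unramified_notin[OF z]])
  ultimately show ?thesis
  proof eventually_elim
    case (elim u)
    have d1: "(\<phi> has_field_derivative deriv \<phi> (wp L u)) (at (wp L u))"
      by (rule holomorphic_derivI[OF S(3,1) elim(1)])
    have d2: "(deriv \<phi> has_field_derivative (deriv ^^ 2) \<phi> (wp L u)) (at (wp L u))"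
      using holomorphic_derivI[OF holomorphic_deriv[OF S(3,1)] S(1) elim(1)] by (simp add: eval_nat_numeral)
    have "((\<lambda>u. deriv \<phi> (wp L u)) has_field_derivative (deriv ^^ 2) \<phi> (wp L u) * wp1 u) (at u)"
      by (rule DERIV_chain2[where f = "deriv \<phi>" and g = "wp L", OF d2 wp_deriv[OF elim(2)]])
    from DERIV_mult[OF this wp1_deriv[OF elim(2)]]
    have "((\<lambda>u. deriv \<phi> (wp L u) * wp1 u) has_field_derivative
      (deriv ^^ 2) \<phi> (wp L u) * wp1 u * wp1 u + wp2 u * deriv \<phi> (wp L u)) (at u)" .
    also have "(deriv ^^ 2) \<phi> (wp L u) * wp1 u * wp1 u + wp2 u * deriv \<phi> (wp L u)
      = (wp1 u)\<^sup>2 * (deriv ^^ 2) \<phi> (wp L u) + wp2 u * deriv \<phi> (wp L u)" by (simp add: power2_eq_square)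
    finally show ?case
      unfolding wp1_square[OF elim(2)] wp2_eq[OF elim(2)] using DERIV_chain2[where f = \<phi> and g = "wp L", OF d1 wp_deriv[OF elim(2)]] by blast
  qed
qed

end

section \<open>Monodromy of the algebraic equation\<close>

context lame
begin

abbreviation lame_system :: "complex \<Rightarrow> (2 \<Rightarrow> complex \<Rightarrow> complex) \<Rightarrow> bool" where
  "lame_system \<equiv> fundamental_system (\<lambda>x. 4 * x ^ 3 - inv_g2 L * x - inv_g3 L) (\<lambda>x. 6 * x ^ 2 - inv_g2 L / 2)
     (\<lambda>x. - (of_nat (n * (n + 1)) * x + Bt))"

text \<open>A loop lifts to a path from \<open>z0\<close> to a point with the same value of
  \<open>wp\<close>, that is, to some \<open>\<epsilon> * z0 + \<omega>\<close>. As the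
  \<open>W j\<close> are single-valued upstairs, continuation amounts to substituting this affine
  map. Conversely every such endpoint is reached because \<open>unramified\<close> is path
  connected.\<close>

lemma lame_monodromy_set:
  assumes W: "lame_basis W" and z0: "z0 \<in> unramified" and w: "lame_system (wp L z0) w"
    and eq: "\<And>j. \<forall>\<^sub>F u in nhds z0. w j (wp L u) = W j u"
  shows "{M. \<exists>\<gamma>. cycle_in branch_points_free (wp L z0) 0 \<gamma> \<and> monodromy_matrix \<gamma> 0 w M} = full_group W"
proof -
  note hol = solves_holomorphic[OF lame_basisD(1)[OF W] open_compl_L]
  have z0L: "z0 \<notin> L" by (rule unramified_notin[OF z0])
  have key: "monodromy_matrix \<gamma> 0 w M"
    if \<gamma>: "path \<gamma>" and \<eta>: "path \<eta>" "path_image \<eta> \<subseteq> unramified" "\<eta> 0 = z0" "\<eta> 1 = \<epsilon> * z0 + \<omega>"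
      and lift: "\<And>t. t \<in> {0..1} \<Longrightarrow> wp L (\<eta> t) = \<gamma> t"
      and e: "\<epsilon> = 1 \<or> \<epsilon> = - 1" "\<omega> \<in> L" and M: "act W \<epsilon> \<omega> M" for \<gamma> \<eta> \<epsilon> \<omega> M
    unfolding monodromy_matrix_def continues_to_def
  proof (intro allI exI conjI)
    fix j
    let ?z1 = "\<epsilon> * z0 + \<omega>"
    have z1: "?z1 \<in> unramified" by (rule unramified_affine[OF e z0])
    have z1w: "wp L ?z1 = wp L z0" by (rule wp_affine[OF e z0L])
    have ends: "\<gamma> 0 = wp L z0" "\<gamma> 1 = wp L z0" using lift[of 0] lift[of 1] \<eta>(3,4) z1w by auto
    have c1: "continues_along (wp L \<circ> \<eta>) (push (W j) z0) (push (W j) ?z1)"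
      using push_continues[OF \<eta>(1,2) hol, of j] unfolding \<eta>(3,4) .
    have c2: "continues_along \<gamma> (push (W j) z0) (push (W j) ?z1)"
    proof -
      obtain F where F: "F 0 = push (W j) z0" "F 1 = push (W j) ?z1"
        "\<And>t. t \<in> {0..1} \<Longrightarrow> F t analytic_on {wp L (\<eta> t)}"
        "\<And>t. t \<in> {0..1} \<Longrightarrow> \<forall>\<^sub>F s in at t within {0..1}. \<forall>\<^sub>F z in nhds (wp L (\<eta> s)). F s z = F t z"
        using c1 unfolding continues_along_def o_def by blast
      show ?thesis unfolding continues_along_def
      proof (intro exI[of _ F] conjI ballI F(1,2))
        fix t :: real assume t: "t \<in> {0..1}"
        show "F t analytic_on {\<gamma> t}" using F(3)[OF t] lift[OF t] by simp
        have "\<forall>\<^sub>F s in at t within {0..1}. s \<in> {0..1}" by (simp add: eventually_at_filter)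
        with F(4)[OF t] show "\<forall>\<^sub>F s in at t within {0..1}. \<forall>\<^sub>F z in nhds (\<gamma> s). F s z = F t z"
        proof eventually_elim
          case (elim s)
          then show ?case using lift[OF elim(2)] by simp
        qed
      qed
    qed
    have pw: "\<forall>\<^sub>F x in nhds (wp L z0). push (W j) z0 x = w j x" for j
    proof -
      have "\<forall>\<^sub>F u in nhds z0. push (W j) z0 (wp L u) = w j (wp L u)"
        using push_eventually[OF z0, of "W j"] eq[of j] by eventually_elim simp
      then show ?thesis using eventually_wp[OF z0] by simp
    qed
    show "continues_along \<gamma> (w j) (push (W j) ?z1)"
      by (rule continues_along_cong[OF \<gamma> c2]) (use pw[of j] ends in simp_all)
    have "filterlim (\<lambda>u. \<epsilon> * u + \<omega>) (nhds ?z1) (nhds z0)"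
      by (intro tendsto_intros filterlim_ident)
    then have "\<forall>\<^sub>F u in nhds z0. push (W j) ?z1 (wp L (\<epsilon> * u + \<omega>)) = W j (\<epsilon> * u + \<omega>)"
      by (rule eventually_compose_filterlim[OF push_eventually[OF z1]])
    with eventually_notin_L[OF z0L] eq[of 1] eq[of 2]
    have "\<forall>\<^sub>F u in nhds z0. (\<Sum>i\<in>UNIV. w i (wp L u) * M $ i $ j) = push (W j) ?z1 (wp L u + 0)"
    proof eventually_elim
      case (elim u)
      have "W j (\<epsilon> * u + \<omega>) = (\<Sum>i\<in>UNIV. W i u * M $ i $ j)" using M elim(1) by (simp add: act_def)
      then show ?case using elim(2-4) wp_affine[OF e elim(1)] by (simp add: sum_2)
    qed
    then have "\<forall>\<^sub>F x in nhds (wp L z0). (\<Sum>i\<in>UNIV. w i x * M $ i $ j) = push (W j) ?z1 (x + 0)"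
      using eventually_wp[OF z0, of "\<lambda>x. (\<Sum>i\<in>UNIV. w i x * M $ i $ j) = push (W j) ?z1 (x + 0)"] by simp
    then show "\<forall>\<^sub>F x in nhds (pathstart \<gamma>). (\<Sum>i\<in>UNIV. w i x * M $ i $ j) = push (W j) ?z1 (x + 0)"
      using ends(1) by (simp add: pathstart_def)
  qed
  show ?thesis
  proof
    show "{M. \<exists>\<gamma>. cycle_in branch_points_free (wp L z0) 0 \<gamma> \<and> monodromy_matrix \<gamma> 0 w M} \<subseteq> full_group W"
    proof clarify
      fix N \<gamma> assume cyc: "cycle_in branch_points_free (wp L z0) 0 \<gamma>" and N: "monodromy_matrix \<gamma> 0 w N"
      have \<gamma>: "path \<gamma>" "path_image \<gamma> \<subseteq> branch_points_free" "pathstart \<gamma> = wp L z0" "pathfinish \<gamma> = pathstart \<gamma> + 0"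
        using cyc by (auto simp: cycle_in_def)
      obtain \<eta> where \<eta>: "path \<eta>" "path_image \<eta> \<subseteq> unramified" "pathstart \<eta> = z0" "\<And>t. t \<in> {0..1} \<Longrightarrow> wp L (\<eta> t) = \<gamma> t"
        by (rule covering_space_lift_path_strong[OF wp_covering z0 \<gamma>(1-3)]) blast
      have "wp L (\<eta> 1) = wp L z0" using \<eta>(4)[of 1] \<gamma>(3,4) by (simp add: pathfinish_def)
      moreover have "\<eta> 1 \<in> unramified" using \<eta>(2) by (auto simp: path_image_def)
      ultimately obtain \<epsilon> \<omega> where e: "\<epsilon> = 1 \<or> \<epsilon> = - 1" "\<omega> \<in> L" "\<eta> 1 = \<epsilon> * z0 + \<omega>"
        using wp_eq_affine[OF z0L unramified_notin] by metis
      obtain M where M: "act W \<epsilon> \<omega> M" using act_exists[OF W e(1,2)] by blast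
      have "\<eta> 0 = z0" using \<eta>(3) by (simp add: pathstart_def)
      from key[OF \<gamma>(1) \<eta>(1,2) this e(3) \<eta>(4) e(1,2) M] have M': "monodromy_matrix \<gamma> 0 w M" by blast
      have "lame_system (pathstart \<gamma>) w" using w \<gamma>(3) by (simp only:)
      from monodromy_matrix_unique[OF \<gamma>(1,4) this N M'] have "N = M" .
      then show "N \<in> full_group W" using M e unfolding full_group_def by blast
    qed
    show "full_group W \<subseteq> {M. \<exists>\<gamma>. cycle_in branch_points_free (wp L z0) 0 \<gamma> \<and> monodromy_matrix \<gamma> 0 w M}"
    proof
      fix M assume "M \<in> full_group W"
      then obtain \<epsilon> \<omega> where e: "\<epsilon> = 1 \<or> \<epsilon> = - 1" "\<omega> \<in> L" and M: "act W \<epsilon> \<omega> M" unfolding full_group_def by blast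
      obtain \<eta> where \<eta>: "path \<eta>" "path_image \<eta> \<subseteq> unramified" "pathstart \<eta> = z0" "pathfinish \<eta> = \<epsilon> * z0 + \<omega>"
        using path_connected_unramified z0 unramified_affine[OF e z0] unfolding path_connected_def by blast
      have \<gamma>: "path (wp L \<circ> \<eta>)"
        by (rule path_continuous_image[OF \<eta>(1) wp_continuous]) (use \<eta>(2) unramified_notin in blast)
      have img: "path_image (wp L \<circ> \<eta>) \<subseteq> branch_points_free"
        using \<eta>(2) wp_image_unramified unfolding path_image_compose by blast
      have "cycle_in branch_points_free (wp L z0) 0 (wp L \<circ> \<eta>)"
        using \<gamma> img \<eta>(3,4) wp_affine[OF e z0L] by (simp add: cycle_in_def pathstart_compose pathfinish_compose)
      moreover have "monodromy_matrix (wp L \<circ> \<eta>) 0 w M"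
        by (rule key[OF \<gamma> \<eta>(1,2) _ _ _ e M]) (use \<eta>(3,4) in \<open>auto simp: pathstart_def pathfinish_def\<close>)
      ultimately show "M \<in> {M. \<exists>\<gamma>. cycle_in branch_points_free (wp L z0) 0 \<gamma> \<and> monodromy_matrix \<gamma> 0 w M}" by blast
    qed
  qed
qed

theorem lame_monodromy_group_exists:
  "\<exists>H. is_lame_monodromy_group n (inv_g2 L, inv_g3 L, Bt) H"
proof -
  \<comment> \<open>Twice this point is a half period and hence off the lattice.\<close>
  let ?z0 = "\<omega>\<^sub>1 / 4"
  have z0: "?z0 \<in> unramified" using half_notin(1) by (simp add: unramified_def)
  have z0L: "?z0 \<notin> L" by (rule unramified_notin[OF z0])
  obtain W where W: "lame_basis W" using lame_basis_exists by blast
  note s = lame_basisD(1)[OF W]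
  note hol = solves_holomorphic[OF s open_compl_L]
  let ?w = "\<lambda>j. push (W j) ?z0"
  have "lame_system (wp L ?z0) ?w"
    unfolding fundamental_system_def
  proof (intro conjI allI impI)
    fix j
    show an: "?w j analytic_on {wp L ?z0}" by (rule push_analytic[OF z0 hol])
    have "\<forall>\<^sub>F u in nhds ?z0. (4 * wp L u ^ 3 - inv_g2 L * wp L u - inv_g3 L) * (deriv ^^ 2) (?w j) (wp L u)
      + (6 * wp L u ^ 2 - inv_g2 L / 2) * deriv (?w j) (wp L u)
      + - (of_nat (n * (n + 1)) * wp L u + Bt) * ?w j (wp L u) = 0"
      using eventually_nhds_nhds[OF push_eventually[OF z0, of "W j"]] eventually_nhds_nhds[OF pull_deriv[OF z0 an]] eventually_notin_L[OF z0L]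
    proof eventually_elim
      case (elim u)
      have u: "u \<in> - L" using elim(3) by simp
      have d: "\<forall>\<^sub>F v in nhds u. deriv (W j) v = deriv (?w j) (wp L v) * wp1 v"
        using eventually_nhds_nhds[OF elim(1)] elim(2)
      proof eventually_elim
        case (elim v)
        have "deriv (\<lambda>v. ?w j (wp L v)) v = deriv (W j) v" by (rule deriv_cong_ev[OF elim(1) refl])
        moreover have "deriv (\<lambda>v. ?w j (wp L v)) v = deriv (?w j) (wp L v) * wp1 v" by (rule DERIV_imp_deriv) (use elim(2) in blast)
        ultimately show ?case by simp
      qed
      have d2: "(deriv (W j) has_field_derivative Q u * W j u) (at u)" by (rule solvesD(2)[OF s open_compl_L u])
      have d3: "((\<lambda>u. deriv (?w j) (wp L u) * wp1 u) has_field_derivative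
      (4 * wp L u ^ 3 - inv_g2 L * wp L u - inv_g3 L) * (deriv ^^ 2) (?w j) (wp L u)
      + (6 * wp L u ^ 2 - inv_g2 L / 2) * deriv (?w j) (wp L u)) (at u)"
        using eventually_nhds_x_imp_x[OF elim(2)] by blast
      have "Q u * W j u = (4 * wp L u ^ 3 - inv_g2 L * wp L u - inv_g3 L) * (deriv ^^ 2) (?w j) (wp L u)
      + (6 * wp L u ^ 2 - inv_g2 L / 2) * deriv (?w j) (wp L u)" by (rule DERIV_unique_ev[OF d2 d3 d])
      then show ?case unfolding eventually_nhds_x_imp_x[OF elim(1)] Q_def by algebra
    qed
    then show "\<forall>\<^sub>F x in nhds (wp L ?z0). (4 * x ^ 3 - inv_g2 L * x - inv_g3 L) * (deriv ^^ 2) (?w j) x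
      + (6 * x ^ 2 - inv_g2 L / 2) * deriv (?w j) x + - (of_nat (n * (n + 1)) * x + Bt) * ?w j x = 0"
      using eventually_wp[OF z0, of "\<lambda>x. (4 * x ^ 3 - inv_g2 L * x - inv_g3 L) * (deriv ^^ 2) (?w j) x
      + (6 * x ^ 2 - inv_g2 L / 2) * deriv (?w j) x + - (of_nat (n * (n + 1)) * x + Bt) * ?w j x = 0"] by blast
  next
    fix k :: "complex ^ 2" assume "\<forall>\<^sub>F x in nhds (wp L ?z0). (\<Sum>j\<in>UNIV. k $ j * ?w j x) = 0"
    then have "\<forall>\<^sub>F u in nhds ?z0. (\<Sum>j\<in>UNIV. k $ j * ?w j (wp L u)) = 0"
      using eventually_wp[OF z0, of "\<lambda>x. (\<Sum>j\<in>UNIV. k $ j * ?w j x) = 0"] by blast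
    with push_eventually[OF z0, of "W 1"] push_eventually[OF z0, of "W 2"]
    have ev: "\<forall>\<^sub>F u in nhds ?z0. W 1 u * k $ 1 + W 2 u * k $ 2 = 0"
      by eventually_elim (simp add: sum_2 mult.commute)
    then show "k = 0" using lame_basis_independent[OF W z0L ev] by (simp add: vec_eq_iff forall_2)
  qed
  moreover have "wp L ?z0 \<in> branch_points_free" using z0 wp_image_unramified by blast
  ultimately show ?thesis unfolding is_lame_monodromy_group_def prod.case Let_def branch_points_free_def by blast
qed

theorem lame_monodromy_group_full:
  assumes H: "is_lame_monodromy_group n (inv_g2 L, inv_g3 L, Bt) H"
  shows "\<exists>W. lame_basis W \<and> H = full_group W"
proof -
  obtain x0 w where x0: "x0 \<in> branch_points_free" and w: "lame_system x0 w"
    and HM: "H = {M. \<exists>\<gamma>. cycle_in branch_points_free x0 0 \<gamma> \<and> monodromy_matrix \<gamma> 0 w M}"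
    using H unfolding is_lame_monodromy_group_def prod.case Let_def branch_points_free_def[symmetric] by blast
  obtain z0 where z0: "z0 \<in> unramified" and x0z: "x0 = wp L z0" using x0 wp_image_unramified by blast
  have z0L: "z0 \<notin> L" by (rule unramified_notin[OF z0])
  define v where "v j u = w j (wp L u)" for j u
  have "\<exists>r>0. solves Q (ball z0 r - L) (v j)" for j
  proof -
    have an: "w j analytic_on {wp L z0}" using w x0z unfolding fundamental_system_def by blast
    have "\<forall>\<^sub>F x in nhds (wp L z0). (4 * x ^ 3 - inv_g2 L * x - inv_g3 L) * (deriv ^^ 2) (w j) x
      + (6 * x ^ 2 - inv_g2 L / 2) * deriv (w j) x + - (of_nat (n * (n + 1)) * x + Bt) * w j x = 0"
      using w x0z unfolding fundamental_system_def by blast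
    then have "\<forall>\<^sub>F u in nhds z0. (4 * wp L u ^ 3 - inv_g2 L * wp L u - inv_g3 L) * (deriv ^^ 2) (w j) (wp L u)
      + (6 * wp L u ^ 2 - inv_g2 L / 2) * deriv (w j) (wp L u) + - (of_nat (n * (n + 1)) * wp L u + Bt) * w j (wp L u) = 0"
      using eventually_wp[OF z0, of "\<lambda>x. (4 * x ^ 3 - inv_g2 L * x - inv_g3 L) * (deriv ^^ 2) (w j) x
      + (6 * x ^ 2 - inv_g2 L / 2) * deriv (w j) x + - (of_nat (n * (n + 1)) * x + Bt) * w j x = 0"] by blast
    with pull_deriv[OF z0 an]
    have "\<forall>\<^sub>F u in nhds z0. (v j has_field_derivative deriv (w j) (wp L u) * wp1 u) (at u) \<and>
       ((\<lambda>u. deriv (w j) (wp L u) * wp1 u) has_field_derivative Q u * v j u) (at u)"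
    proof eventually_elim
      case (elim u)
      have "(4 * wp L u ^ 3 - inv_g2 L * wp L u - inv_g3 L) * (deriv ^^ 2) (w j) (wp L u)
      + (6 * wp L u ^ 2 - inv_g2 L / 2) * deriv (w j) (wp L u) = Q u * v j u"
        using elim(2) unfolding Q_def v_def by algebra
      then show ?case using elim(1) by (simp add: v_def[abs_def])
    qed
    then obtain r where r: "r > 0" "\<And>u. dist u z0 < r \<Longrightarrow> (v j has_field_derivative deriv (w j) (wp L u) * wp1 u) (at u) \<and>
       ((\<lambda>u. deriv (w j) (wp L u) * wp1 u) has_field_derivative Q u * v j u) (at u)"
      unfolding eventually_nhds_metric by blast
    have "solves Q (ball z0 r - L) (v j)"
      by (rule solvesI[where f' = "\<lambda>u. deriv (w j) (wp L u) * wp1 u"]) (use r(2) in \<open>auto simp: dist_commute\<close>)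
    then show ?thesis using r(1) by blast
  qed
  then obtain r where r: "\<And>j. r j > 0" "\<And>j. solves Q (ball z0 (r j) - L) (v j)" by metis
  define r0 where "r0 = min (r 1) (r 2)"
  have r0: "r0 > 0" using r(1) by (simp add: r0_def)
  have vs: "solves Q (ball z0 r0 - L) (v j)" for j
  proof -
    have "ball z0 r0 - L \<subseteq> ball z0 (r j) - L" using exhaust_2[of j] by (auto simp: r0_def)
    then show ?thesis by (rule solves_subset[OF r(2)])
  qed
  have ind: "k = 0" if k: "\<forall>\<^sub>F u in nhds z0. (\<Sum>j\<in>UNIV. k $ j * v j u) = 0" for k :: "complex ^ 2"
  proof -
    have "\<forall>\<^sub>F x in nhds (wp L z0). (\<Sum>j\<in>UNIV. k $ j * w j x) = 0"
      using k eventually_wp[OF z0, of "\<lambda>x. (\<Sum>j\<in>UNIV. k $ j * w j x) = 0"] unfolding v_def by blast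
    then show ?thesis using w x0z unfolding fundamental_system_def by blast
  qed
  obtain W where W: "lame_basis W" "\<And>j. \<forall>\<^sub>F u in nhds z0. W j u = v j u"
    by (rule local_to_global[OF z0L r0 vs ind]) auto
  have eq: "\<forall>\<^sub>F u in nhds z0. w j (wp L u) = W j u" for j
    using W(2)[of j] by eventually_elim (simp add: v_def)
  have "lame_system (wp L z0) w" using w x0z by simp
  from lame_monodromy_set[OF W(1) z0 this eq] show ?thesis using W(1) HM x0z by blast
qed

end

section \<open>Families and their classes\<close>

text \<open>The class of \<open>x\<close> is sent to the class of \<open>f x\<close>, which is well
  defined and injective by \<open>rs\<close>. Classes are formed inside \<open>A0\<close> and
  \<open>B0\<close>, on which the relations are equivalences.\<close>

lemma quotient_eqpoll:
  assumes r: "equiv A0 r" "A \<subseteq> A0" and s: "equiv B0 s" "B \<subseteq> B0" and f: "f ` A = B"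
    and rs: "\<And>x y. x \<in> A \<Longrightarrow> y \<in> A \<Longrightarrow> (x, y) \<in> r \<longleftrightarrow> (f x, f y) \<in> s"
  shows "A // r \<approx> B // s"
proof -
  define g where "g x = r `` {x}" for x
  define h where "h x = s `` {f x}" for x
  have gA: "A // r = g ` A" by (auto simp: quotient_def g_def)
  have hA: "B // s = h ` A" using f by (auto simp: quotient_def h_def)
  have iff: "g x = g y \<longleftrightarrow> h x = h y" if "x \<in> A" "y \<in> A" for x y
  proof -
    have "f x \<in> B0" "f y \<in> B0" "x \<in> A0" "y \<in> A0" using that f s(2) r(2) by blast+
    then show ?thesis unfolding g_def h_def
      using eq_equiv_class_iff[OF r(1)] eq_equiv_class_iff[OF s(1)] rs[OF that] by simp
  qed
  have inv: "inv_into A g X \<in> A \<and> g (inv_into A g X) = X" if "X \<in> g ` A" for X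
    using that by (simp add: inv_into_into f_inv_into_f)
  have "bij_betw (h \<circ> inv_into A g) (g ` A) (h ` A)"
    unfolding bij_betw_def
  proof
    show "inj_on (h \<circ> inv_into A g) (g ` A)"
    proof (rule inj_onI)
      fix X Y assume X: "X \<in> g ` A" and Y: "Y \<in> g ` A" and eq: "(h \<circ> inv_into A g) X = (h \<circ> inv_into A g) Y"
      note X' = inv[OF X] and Y' = inv[OF Y]
      have "g (inv_into A g X) = g (inv_into A g Y)" using iff[OF conjunct1[OF X'] conjunct1[OF Y']] eq by simp
      then show "X = Y" unfolding conjunct2[OF X'] conjunct2[OF Y'] .
    qed
    show "(h \<circ> inv_into A g) ` g ` A = h ` A"
    proof
      show "(h \<circ> inv_into A g) ` g ` A \<subseteq> h ` A" using inv by auto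
      show "h ` A \<subseteq> (h \<circ> inv_into A g) ` g ` A"
      proof
        fix Y assume "Y \<in> h ` A"
        then obtain x where x: "x \<in> A" "Y = h x" by blast
        then have gx: "g x \<in> g ` A" by blast
        note i = inv[OF gx]
        have "h (inv_into A g (g x)) = h x" using iff[OF conjunct1[OF i] x(1)] conjunct2[OF i] by blast
        then show "Y \<in> (h \<circ> inv_into A g) ` g ` A" unfolding x(2) o_def by (intro image_eqI[OF _ gx]) (rule sym)
      qed
    qed
  qed
  then show ?thesis unfolding gA hA eqpoll_def by blast
qed

text \<open>A family with parameters \<open>e\<close> described by coordinates alone, without
  reference to a lattice; \<open>y \<noteq> 0\<close> excludes the points of order two. Each of its
  elements determines \<open>e\<close>.\<close>

definition coords_set :: "nat \<Rightarrow> lame_equation \<Rightarrow> noneven_coords set" where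
  "coords_set n e = {(g2, g3, x, y, T). \<exists>Bt. e = (g2, g3, Bt) \<and> y\<^sup>2 = 4 * x ^ 3 - g2 * x - g3 \<and> y \<noteq> 0 \<and>
     T\<^sup>2 - of_nat (n * (n + 1)) * x = Bt}"

definition scale_lame :: "complex \<Rightarrow> lame_equation \<Rightarrow> lame_equation" where
  "scale_lame \<mu> e = (case e of (g2, g3, Bt) \<Rightarrow> (\<mu> ^ 4 * g2, \<mu> ^ 6 * g3, \<mu>\<^sup>2 * Bt))"

lemma scale_lame_comp: "scale_lame \<mu> (scale_lame \<nu> e) = scale_lame (\<mu> * \<nu>) e"
  by (cases e) (simp add: scale_lame_def power_mult_distrib)

lemma scale_coords_comp: "scale_coords \<mu> (scale_coords \<nu> v) = scale_coords (\<mu> * \<nu>) v"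
  by (cases v) (simp add: scale_coords_def power_mult_distrib)

lemma scale_one: "scale_lame 1 e = e" "scale_coords 1 v = v"
  by (cases e, simp add: scale_lame_def) (cases v, simp add: scale_coords_def)

lemma scale_coords_mem:
  assumes "\<mu> \<noteq> 0" "v \<in> coords_set n e"
  shows "scale_coords \<mu> v \<in> coords_set n (scale_lame \<mu> e)"
proof -
  obtain g2 g3 x y T where v: "v = (g2, g3, x, y, T)" by (metis prod_cases5)
  obtain Bt where e: "e = (g2, g3, Bt)" "y\<^sup>2 = 4 * x ^ 3 - g2 * x - g3" "y \<noteq> 0" "T\<^sup>2 - of_nat (n * (n + 1)) * x = Bt"
    using assms(2) unfolding v coords_set_def by blast
  have "(\<mu> ^ 3 * y)\<^sup>2 = \<mu> ^ 6 * y\<^sup>2" by (simp add: power_mult_distrib)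
  also have "\<dots> = 4 * (\<mu>\<^sup>2 * x) ^ 3 - (\<mu> ^ 4 * g2) * (\<mu>\<^sup>2 * x) - \<mu> ^ 6 * g3"
    unfolding e(2) by algebra
  finally have "(\<mu> ^ 3 * y)\<^sup>2 = 4 * (\<mu>\<^sup>2 * x) ^ 3 - (\<mu> ^ 4 * g2) * (\<mu>\<^sup>2 * x) - \<mu> ^ 6 * g3" .
  moreover have "(\<mu> * T)\<^sup>2 - of_nat (n * (n + 1)) * (\<mu>\<^sup>2 * x) = \<mu>\<^sup>2 * Bt"
    unfolding e(4)[symmetric] by algebra
  ultimately show ?thesis using assms(1) e(3)
    unfolding v e(1) scale_coords_def scale_lame_def coords_set_def prod.case by simp
qed

lemma scale_coords_image:
  assumes "\<mu> \<noteq> 0"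
  shows "scale_coords \<mu> ` coords_set n e = coords_set n (scale_lame \<mu> e)"
proof
  show "scale_coords \<mu> ` coords_set n e \<subseteq> coords_set n (scale_lame \<mu> e)" using scale_coords_mem[OF assms] by blast
  show "coords_set n (scale_lame \<mu> e) \<subseteq> scale_coords \<mu> ` coords_set n e"
  proof
    fix v assume v: "v \<in> coords_set n (scale_lame \<mu> e)"
    have "scale_coords (1 / \<mu>) v \<in> coords_set n (scale_lame (1 / \<mu>) (scale_lame \<mu> e))"
      using scale_coords_mem[OF _ v, of "1 / \<mu>"] assms by simp
    then have "scale_coords (1 / \<mu>) v \<in> coords_set n e" using assms by (simp add: scale_lame_comp scale_one)
    moreover have "scale_coords \<mu> (scale_coords (1 / \<mu>) v) = v" using assms by (simp add: scale_coords_comp scale_one)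
    ultimately show "v \<in> scale_coords \<mu> ` coords_set n e" by (metis image_eqI)
  qed
qed

lemma coords_set_inj:
  assumes "v \<in> coords_set n e" "v \<in> coords_set n e'"
  shows "e = e'"
  using assms unfolding coords_set_def by auto

text \<open>Every point of the affine curve is a value of \<open>wp\<close> and its derivative, by
  \<open>wp_curve_surj\<close>, and the derivative vanishes exactly at the excluded points.\<close>

lemma coords_family:
  assumes "is_lattice L"
  shows "noneven_coords ` noneven_family n L Bt = coords_set n (inv_g2 L, inv_g3 L, Bt)"
    and "noneven_family n L Bt \<noteq> {}"
proof -
  obtain u v where uv: "lattice_basis L u v" using assms unfolding is_lattice_def by blast
  interpret lattice L u v by unfold_locales fact
  show "noneven_coords ` noneven_family n L Bt = coords_set n (inv_g2 L, inv_g3 L, Bt)"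
  proof
    show "noneven_coords ` noneven_family n L Bt \<subseteq> coords_set n (inv_g2 L, inv_g3 L, Bt)"
    proof
      fix c assume "c \<in> noneven_coords ` noneven_family n L Bt"
      then obtain p T where p: "2 * p \<notin> L" "T ^ 2 - of_nat (n * (n + 1)) * wp L p = Bt" "c = noneven_coords (L, p, T)"
        unfolding noneven_family_def by blast
      have pL: "p \<notin> L" using p(1) by (intro unramified_notin) (simp add: unramified_def)
      show "c \<in> coords_set n (inv_g2 L, inv_g3 L, Bt)"
        using p(1,2) wp1_square[OF pL] wp1_eq_0_iff[OF pL] unfolding p(3) noneven_coords_def coords_set_def prod.case deriv_wp[OF pL] by blast
    qed
    show "coords_set n (inv_g2 L, inv_g3 L, Bt) \<subseteq> noneven_coords ` noneven_family n L Bt"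
    proof
      fix c assume "c \<in> coords_set n (inv_g2 L, inv_g3 L, Bt)"
      then obtain x y T where c: "c = (inv_g2 L, inv_g3 L, x, y, T)" "y\<^sup>2 = 4 * x ^ 3 - inv_g2 L * x - inv_g3 L" "y \<noteq> 0"
        "T\<^sup>2 - of_nat (n * (n + 1)) * x = Bt" unfolding coords_set_def by blast
      obtain p where p: "p \<notin> L" "wp L p = x" "wp1 p = y" by (rule wp_curve_surj[OF c(2)])
      have "2 * p \<notin> L" using wp1_eq_0_iff[OF p(1)] p(3) c(3) by simp
      then have "(L, p, T) \<in> noneven_family n L Bt" using c(4) p(2) unfolding noneven_family_def by blast
      moreover have "noneven_coords (L, p, T) = c" unfolding noneven_coords_def prod.case deriv_wp[OF p(1)] c(1) p(2,3) ..
      ultimately show "c \<in> noneven_coords ` noneven_family n L Bt" by (metis image_eqI)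
    qed
  qed
  \<comment> \<open>A quarter period is not of order two, as \<open>u / 2\<close> is off the
    lattice; a square root then provides a matching \<open>T\<close>.\<close>
  have "2 * (u / 4) \<notin> L" using half_notin(1) by simp
  moreover have "csqrt (Bt + of_nat (n * (n + 1)) * wp L (u / 4)) ^ 2 - of_nat (n * (n + 1)) * wp L (u / 4) = Bt" by simp
  ultimately show "noneven_family n L Bt \<noteq> {}" unfolding noneven_family_def by blast
qed

text \<open>The forward direction looks at one member of the nonempty family, the backward direction
  at each member. Every group comes with a basis of its own, and \<open>trans_group_iso\<close>
  reconciles them.\<close>

theorem cyclic_iff_lame_dihedral:
  assumes L: "is_lattice L" and n: "n > 0" and N: "N \<ge> 3"
  shows "has_cyclic_period_monodromy n N (noneven_family n L Bt) \<longleftrightarrow> has_dihedral_monodromy n N (inv_g2 L, inv_g3 L, Bt)"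
proof -
  obtain u v where uv: "lattice_basis L u v" using L unfolding is_lattice_def by blast
  interpret lame L u v n Bt by unfold_locales fact
  have fam: "\<exists>p T. e = (L, p, T) \<and> p \<notin> L \<and> 2 * p \<notin> L \<and> T\<^sup>2 - of_nat (n * (n + 1)) * wp L p = Bt"
    if "e \<in> noneven_family n L Bt" for e
    using that unramified_notin unfolding noneven_family_def unramified_def by blast
  show ?thesis
  proof
    assume cyc: "has_cyclic_period_monodromy n N (noneven_family n L Bt)"
    obtain e where e: "e \<in> noneven_family n L Bt" using coords_family(2)[OF L] by blast
    obtain p T where p: "e = (L, p, T)" "p \<notin> L" "2 * p \<notin> L" "T\<^sup>2 - of_nat (n * (n + 1)) * wp L p = Bt" using fam[OF e] by blast
    obtain H where H: "is_period_monodromy_group n (L, p, T) H" "GL2\<lparr>carrier := H\<rparr> \<cong> integer_mod_group N"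
      using cyc e p(1) unfolding has_cyclic_period_monodromy_def by blast
    obtain W where W: "lame_basis W" "H = trans_group W" using period_monodromy_group_trans[OF p(2-4) n H(1)] by blast
    obtain H' where H': "is_lame_monodromy_group n (inv_g2 L, inv_g3 L, Bt) H'" using lame_monodromy_group_exists by blast
    obtain W' where W': "lame_basis W'" "H' = full_group W'" using lame_monodromy_group_full[OF H'] by blast
    have "GL2\<lparr>carrier := trans_group W'\<rparr> \<cong> integer_mod_group N"
      using iso_trans[OF trans_group_iso[OF W'(1) W(1)]] H(2) W(2) by blast
    then have "GL2\<lparr>carrier := H'\<rparr> \<cong> dihedral_group N" using cyclic_iff_dihedral[OF W'(1) N] W'(2) by blast
    then show "has_dihedral_monodromy n N (inv_g2 L, inv_g3 L, Bt)" using H' unfolding has_dihedral_monodromy_def by blast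
  next
    assume "has_dihedral_monodromy n N (inv_g2 L, inv_g3 L, Bt)"
    then obtain H' where H': "is_lame_monodromy_group n (inv_g2 L, inv_g3 L, Bt) H'" "GL2\<lparr>carrier := H'\<rparr> \<cong> dihedral_group N"
      unfolding has_dihedral_monodromy_def by blast
    obtain W' where W': "lame_basis W'" "H' = full_group W'" using lame_monodromy_group_full[OF H'(1)] by blast
    have tr: "GL2\<lparr>carrier := trans_group W'\<rparr> \<cong> integer_mod_group N" using cyclic_iff_dihedral[OF W'(1) N] H'(2) W'(2) by blast
    show "has_cyclic_period_monodromy n N (noneven_family n L Bt)"
      unfolding has_cyclic_period_monodromy_def
    proof
      fix e assume e: "e \<in> noneven_family n L Bt"
      obtain p T where p: "e = (L, p, T)" "p \<notin> L" "2 * p \<notin> L" "T\<^sup>2 - of_nat (n * (n + 1)) * wp L p = Bt" using fam[OF e] by blast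
      obtain W H where W: "lame_basis W" "H = trans_group W" "is_period_monodromy_group n (L, p, T) H"
        using period_monodromy_group_exists[OF p(2-4) n] by blast
      have "GL2\<lparr>carrier := trans_group W\<rparr> \<cong> integer_mod_group N"
        by (rule iso_trans[OF trans_group_iso[OF W(1) W'(1)] tr])
      then show "\<exists>H. is_period_monodromy_group n e H \<and> GL2\<lparr>carrier := H\<rparr> \<cong> integer_mod_group N" using W(2,3) p(1) by blast
    qed
  qed
qed

text \<open>A family is merely a set of equations; its parameters are recovered from the
  coordinates, uniquely because of \<open>coords_set_inj\<close> and nonemptiness.\<close>

definition family_parameters :: "nat \<Rightarrow> noneven_equation set \<Rightarrow> lame_equation" where
  "family_parameters n F = (THE e. noneven_coords ` F = coords_set n e)"

lemma family_parameters:
  assumes "is_lattice L"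
  shows "family_parameters n (noneven_family n L Bt) = (inv_g2 L, inv_g3 L, Bt)"
  unfolding family_parameters_def
proof (rule the_equality)
  show "noneven_coords ` noneven_family n L Bt = coords_set n (inv_g2 L, inv_g3 L, Bt)" by (rule coords_family(1)[OF assms])
  fix e assume e: "noneven_coords ` noneven_family n L Bt = coords_set n e"
  obtain x where "x \<in> noneven_family n L Bt" using coords_family(2)[OF assms] by blast
  then have "noneven_coords x \<in> coords_set n e" "noneven_coords x \<in> coords_set n (inv_g2 L, inv_g3 L, Bt)"
    using e coords_family(1)[OF assms] by blast+
  then show "e = (inv_g2 L, inv_g3 L, Bt)" by (rule coords_set_inj)
qed

lemma lame_scalar_equiv_iff:
  "(e, e') \<in> lame_scalar_equiv \<longleftrightarrow> e \<in> lame_equations \<and> e' \<in> lame_equations \<and> (\<exists>\<mu>. \<mu> \<noteq> 0 \<and> e' = scale_lame \<mu> e)"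
  by (cases e; cases e') (auto simp: lame_scalar_equiv_def scale_lame_def)

lemma lattice_lame_equation:
  assumes "is_lattice L"
  shows "(inv_g2 L, inv_g3 L, Bt) \<in> lame_equations"
proof -
  obtain u v where uv: "lattice_basis L u v" using assms unfolding is_lattice_def by blast
  interpret lattice L u v by unfold_locales fact
  show ?thesis using discriminant_nz by (simp add: lame_equations_def)
qed

lemma equiv_lame: "equiv lame_equations lame_scalar_equiv"
proof (rule equivI)
  show "lame_scalar_equiv \<subseteq> lame_equations \<times> lame_equations" by (auto simp: lame_scalar_equiv_def)
  show "refl_on lame_equations lame_scalar_equiv"
    by (rule refl_onI) (auto simp: lame_scalar_equiv_iff scale_one intro!: exI[of _ 1])
  show "sym lame_scalar_equiv"
  proof (rule symI)
    fix e e' assume "(e, e') \<in> lame_scalar_equiv"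
    then obtain \<mu> where "e \<in> lame_equations" "e' \<in> lame_equations" "\<mu> \<noteq> 0" "e' = scale_lame \<mu> e" unfolding lame_scalar_equiv_iff by blast
    then show "(e', e) \<in> lame_scalar_equiv" unfolding lame_scalar_equiv_iff
      by (intro conjI exI[of _ "1 / \<mu>"]) (simp_all add: scale_lame_comp scale_one)
  qed
  show "trans lame_scalar_equiv"
  proof (rule transI)
    fix e e' e'' assume "(e, e') \<in> lame_scalar_equiv" "(e', e'') \<in> lame_scalar_equiv"
    then obtain \<mu> \<nu> where "e \<in> lame_equations" "e'' \<in> lame_equations" "\<mu> \<noteq> 0" "\<nu> \<noteq> 0" "e'' = scale_lame \<nu> (scale_lame \<mu> e)" unfolding lame_scalar_equiv_iff by blast
    then show "(e, e'') \<in> lame_scalar_equiv" unfolding lame_scalar_equiv_iff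
      by (intro conjI exI[of _ "\<nu> * \<mu>"]) (simp_all add: scale_lame_comp)
  qed
qed

text \<open>Scaling carries \<open>coords_set n e\<close> onto the set of the scaled parameters, and
  nonempty sets of this kind determine their parameters; so equivalence of the sets is equivalence
  of the parameters.\<close>

lemma family_scalar_equiv_iff:
  assumes F: "F \<in> noneven_families n" "F' \<in> noneven_families n"
  shows "(F, F') \<in> family_scalar_equiv n \<longleftrightarrow> (family_parameters n F, family_parameters n F') \<in> lame_scalar_equiv"
proof -
  obtain L Bt where L: "is_lattice L" "F = noneven_family n L Bt" using F(1) unfolding noneven_families_def by blast
  obtain L' Bt' where L': "is_lattice L'" "F' = noneven_family n L' Bt'" using F(2) unfolding noneven_families_def by blast
  define e e' where "e = (inv_g2 L, inv_g3 L, Bt)" and "e' = (inv_g2 L', inv_g3 L', Bt')"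
  have c: "noneven_coords ` F = coords_set n e" "noneven_coords ` F' = coords_set n e'"
    unfolding L(2) L'(2) e_def e'_def by (rule coords_family(1)[OF L(1)], rule coords_family(1)[OF L'(1)])
  have ne: "coords_set n e' \<noteq> {}" using c(2) coords_family(2)[OF L'(1)] L'(2) by auto
  have k: "family_parameters n F = e" "family_parameters n F' = e'"
    unfolding L(2) L'(2) e_def e'_def by (rule family_parameters[OF L(1)], rule family_parameters[OF L'(1)])
  have m: "e \<in> lame_equations" "e' \<in> lame_equations"
    unfolding e_def e'_def by (rule lattice_lame_equation[OF L(1)], rule lattice_lame_equation[OF L'(1)])
  have "coords_set n e' = scale_coords \<mu> ` coords_set n e \<longleftrightarrow> e' = scale_lame \<mu> e" if "\<mu> \<noteq> 0" for \<mu>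
    unfolding scale_coords_image[OF that] using ne coords_set_inj by blast
  then show ?thesis
    unfolding k lame_scalar_equiv_iff using F m c by (auto simp: family_scalar_equiv_def)
qed

lemma equiv_families: "equiv (noneven_families n) (family_scalar_equiv n)"
proof -
  let ?k = "family_parameters n"
  have mem: "?k F \<in> lame_equations" if F: "F \<in> noneven_families n" for F
  proof -
    obtain L Bt where L: "is_lattice L" "F = noneven_family n L Bt" using F unfolding noneven_families_def by blast
    show ?thesis unfolding L(2) family_parameters[OF L(1)] by (rule lattice_lame_equation[OF L(1)])
  qed
  have fam: "F \<in> noneven_families n \<and> F' \<in> noneven_families n" if "(F, F') \<in> family_scalar_equiv n" for F F'
    using that by (auto simp: family_scalar_equiv_def)
  have s: "refl_on lame_equations lame_scalar_equiv" "sym lame_scalar_equiv" "trans lame_scalar_equiv"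
    using equiv_lame by (auto elim: equivE)
  show ?thesis
  proof (rule equivI)
    show "family_scalar_equiv n \<subseteq> noneven_families n \<times> noneven_families n" using fam by auto
    show "refl_on (noneven_families n) (family_scalar_equiv n)"
    proof (rule refl_onI)
      fix F assume F: "F \<in> noneven_families n"
      show "(F, F) \<in> family_scalar_equiv n"
        unfolding family_scalar_equiv_iff[OF F F] by (rule refl_onD[OF s(1) mem[OF F]])
    qed
    show "sym (family_scalar_equiv n)"
    proof (rule symI)
      fix F F' assume FF: "(F, F') \<in> family_scalar_equiv n"
      have F: "F \<in> noneven_families n" "F' \<in> noneven_families n" using fam[OF FF] by auto
      have "(?k F, ?k F') \<in> lame_scalar_equiv" using FF unfolding family_scalar_equiv_iff[OF F] .
      then have "(?k F', ?k F) \<in> lame_scalar_equiv" by (rule symD[OF s(2)])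
      then show "(F', F) \<in> family_scalar_equiv n" unfolding family_scalar_equiv_iff[OF F(2,1)] .
    qed
    show "trans (family_scalar_equiv n)"
    proof (rule transI)
      fix F F' F'' assume FF: "(F, F') \<in> family_scalar_equiv n" "(F', F'') \<in> family_scalar_equiv n"
      have F: "F \<in> noneven_families n" "F' \<in> noneven_families n" "F'' \<in> noneven_families n" using fam[OF FF(1)] fam[OF FF(2)] by auto
      have "(?k F, ?k F') \<in> lame_scalar_equiv" using FF(1) unfolding family_scalar_equiv_iff[OF F(1,2)] .
      moreover have "(?k F', ?k F'') \<in> lame_scalar_equiv" using FF(2) unfolding family_scalar_equiv_iff[OF F(2,3)] .
      ultimately have "(?k F, ?k F'') \<in> lame_scalar_equiv" by (rule transD[OF s(3)])
      then show "(F, F'') \<in> family_scalar_equiv n" unfolding family_scalar_equiv_iff[OF F(1,3)] .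
    qed
  qed
qed

theorem corollary1p12:
  fixes n N :: nat
  assumes "n > 0" and "N \<ge> 3"
  shows "noneven_classes n N \<approx> lame_classes n N \<and> card (noneven_classes n N) = lame_count n N"
proof -
  let ?A = "{F \<in> noneven_families n. has_cyclic_period_monodromy n N F}"
  let ?B = "{e \<in> lame_equations. has_dihedral_monodromy n N e}"
  have "family_parameters n ` ?A = ?B"
  proof
    show "family_parameters n ` ?A \<subseteq> ?B"
    proof
      fix e assume "e \<in> family_parameters n ` ?A"
      then obtain F where F: "F \<in> noneven_families n" "has_cyclic_period_monodromy n N F" "e = family_parameters n F" by blast
      obtain L Bt where L: "is_lattice L" "F = noneven_family n L Bt" using F(1) unfolding noneven_families_def by blast
      have "e = (inv_g2 L, inv_g3 L, Bt)" unfolding F(3) L(2) by (rule family_parameters[OF L(1)])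
      then show "e \<in> ?B" using lattice_lame_equation[OF L(1)] cyclic_iff_lame_dihedral[OF L(1) assms] F(2) L(2) by blast
    qed
    show "?B \<subseteq> family_parameters n ` ?A"
    proof
      fix e assume e: "e \<in> ?B"
      obtain g2 g3 Bt where e3: "e = (g2, g3, Bt)" by (metis prod_cases3)
      have "g2 ^ 3 - 27 * g3 ^ 2 \<noteq> 0" using e e3 by (simp add: lame_equations_def)
      \<comment> \<open>Uniformization enters here: it makes every algebraic equation the parameter
        of a family.\<close>
      then obtain L where L: "is_lattice L" "inv_g2 L = g2" "inv_g3 L = g3" by (rule lattice_of_invariants)
      have "has_cyclic_period_monodromy n N (noneven_family n L Bt)"
        using cyclic_iff_lame_dihedral[OF L(1) assms] e e3 L(2,3) by simp
      moreover have "noneven_family n L Bt \<in> noneven_families n" using L(1) unfolding noneven_families_def by blast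
      moreover have "family_parameters n (noneven_family n L Bt) = e" unfolding family_parameters[OF L(1)] L(2,3) e3 ..
      ultimately show "e \<in> family_parameters n ` ?A" by (metis (mono_tags, lifting) image_eqI mem_Collect_eq)
    qed
  qed
  \<comment> \<open>Equality of \<open>card\<close> follows from equipollence, which remains
    meaningful for infinite sets, where \<open>card\<close> is 0.\<close>
  then have eq: "noneven_classes n N \<approx> lame_classes n N"
    unfolding noneven_classes_def lame_classes_def
    by (intro quotient_eqpoll[OF equiv_families _ equiv_lame, where f = "family_parameters n"] family_scalar_equiv_iff) auto
  then have "card (noneven_classes n N) = card (lame_classes n N)"
    unfolding eqpoll_def by (auto dest: bij_betw_same_card)
  then show ?thesis using eq by (simp add: lame_count_def)
qed

end
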